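(* Let $X$ be a separable Banach space endowed with a non-degenerate centered Gaussian measure $\mu$, with Cameron--Martin space $H$ and an orthonormal basis $(e_n)_{n\in\mathbb{N}}$ of $H$. Let $s>1$, $s'=\frac{s}{s-1}$, and let $w$ be a function on $X$ with $w>0$ $\mu$-a.e., $w\in W^{1,s}(X,\mu)$ ($w$ being a $(1,s)$-precise version) and $\log w\in W^{2,t}(X,\mu)$ for some $t\ge2s'$. Set $\nu:=w\mu$. Assume that there exists $C\ge0$ such that for every $(\xi_i)_{i\in\mathbb{N}}\in\ell_2$ $$\sum_{i=1}^{+\infty}\sum_{j=1}^{+\infty}\left(\delta_{ij}-\partial_i\partial_j\log w(x)\right)\xi_i\xi_j\le C\sum_{i=1}^{+\infty}\xi_i^2\qquad\mu\text{-a.e.}$$ Then every field $\Phi\in W^{1,2}(X,\nu;H)$ has a divergence $\operatorname{div}_\nu\Phi\in L^2(X,\nu)$, and for every $f\in W^{1,2}(X,\nu)$ the following equality holds: $$\int_X\langle\nabla_Hf(x),\Phi(x)\rangle_H\,d\nu(x)=-\int_Xf(x)\operatorname{div}_\nu\Phi(x)\,d\nu(x).$$ Furthermore, if $\varphi_n=\langle\Phi,e_n\rangle_H$ for every $n\in\mathbb{N}$, then $$\operatorname{div}_\nu\Phi(x)=\sum_{n=1}^{+\infty}\left(\partial_n\varphi_n(x)+\varphi_n(x)\,\partial_n\log w(x)-\varphi_n(x)\hat e_n(x)\right),$$ and $\|\operatorname{div}_\nu\Phi\|_{L^2(X,\nu)}\le\max\{\sqrt C,1\}\,\|\Phi\|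_{W^{1,2}(X,\nu;H)}$.
   Context: $H$ has inner product $\langle\cdot,\cdot\rangle_H$. $X^*_\mu$ is the closure of $X^*$ in $L^2(X,\mu)$; $R_\mu:X^*_\mu\to X$ is defined by $y^*(R_\mu g)=\int_X g\,y^*\,d\mu$ for $y^*\in X^*$; for $h\in H$, $\hat h$ is the unique element of $X^*_\mu$ with $R_\mu\hat h=h$. $\mathscr{FC}_b^\infty(X)$ is the space of functions $f(x)=\varphi(l_1(x),\dots,l_n(x))$ with $n\in\mathbb{N}$, $\varphi\in C_b^\infty(\mathbb{R}^n)$, $l_i\in X^*$. $\nabla_H$ and $\nabla_H^2$ are the gradient and Hessian along $H$; $\partial_if=\langle\nabla_Hf,e_i\rangle_H$, $\partial_i\partial_jf=\langle\nabla_H^2f\,e_j,e_i\rangle_H$; $\mathcal{H}_2$ is the space of Hilbert--Schmidt operators on $H$. $W^{1,p}(X,\mu)$ and $W^{2,p}(X,\mu)$ ($p\ge1$) are the completions of $\mathscr{FC}_b^\infty(X)$ in the norms $\|f\|_{L^p(\mu)}+\|\nabla_H f\|_{L^p(\mu;H)}$ and $\|f\|_{W^{1,p}(X,\mu)}+\|\nabla_H^2f\|_{L^p(\mu;\mathcal{H}_2)}$. For $p\ge\frac{t}{t-s'}$ (in particular $p=2$ when $t\ge2s'$) the operator $\nabla_H:\mathscr{FC}_b^\infty(X)\to L^p(X,\nu;H)$ is closable in $L^p(X,\nu)$; $W^{1,p}(X,\nu)$ is the domain of its closure (still denoted $\nabla_H$) with the graph norm. $W^{1,p}(X,\nu;H)$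 is defined in the same way starting from the linear span of the maps $x\mapsto f(x)h$, $f\in\mathscr{FC}_b^\infty(X)$, $h\in H$, with norm $\|\Phi\|_{L^p(X,\nu;H)}+\|\nabla_H\Phi\|_{L^p(X,\nu;\mathcal{H}_2)}$. Divergence: $\Phi\in L^1(X,\nu;H)$ admits divergence if there is $g\in L^1(X,\nu)$ with $\int_X\langle\nabla_Hf,\Phi\rangle_H\,d\nu=-\int_Xfg\,d\nu$ for every $f\in\mathscr{FC}_b^\infty(X)$; then $g$ is unique and $\operatorname{div}_\nu\Phi:=g$. Precise versions: $L_p$ is the generator in $L^p(X,\mu)$ of the Ornstein--Uhlenbeck semigroup $T(t)f(x)=\int_X f(e^{-t}x+(1-e^{-2t})^{1/2}y)\,d\mu(y)$. For $A$ open, $C_{k,p}(A)=\inf\{\|f\|_{L^p(X,\mu)} : (I-L_p)^{-k/2}f\ge1\ \mu\text{-a.e. in }A\}$; for $B$ Borel, $C_{k,p}(B)=\inf\{C_{k,p}(A): B\subseteq A\text{ open}\}$. A $(k,p)$-precise version of $f\in W^{k,p}(X,\mu)$ is a Borel version $\bar f$ that is $C_{k,p}$-quasicontinuous (for each $\varepsilon>0$ there is an open $A$ with $C_{k,p}(A)\le\varepsilon$ and $\bar f|_{X\setminus A}$ continuous) and satisfies $C_{k,p}(\{|\bar f|>r\})\le\frac1r\|(I-L_p)^{k/2}\bar f\|_{L^p(X,\mu)}$ for all $r>0$. *)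

theory Defs
  imports "HOL-Probability.Probability"
begin

section \<open>Lebesgue spaces\<close>

text \<open>Elements of \<open>L\<^sup>p\<close> are represented by measurable functions; they are only relevant up to
  equality almost everywhere.\<close>

definition Lp_space :: "'a measure \<Rightarrow> real \<Rightarrow> ('a \<Rightarrow> 'b::{banach,second_countable_topology}) set"
  where "Lp_space M p = {f \<in> borel_measurable M. integrable M (\<lambda>x. norm (f x) powr p)}"

definition Lp_norm :: "'a measure \<Rightarrow> real \<Rightarrow> ('a \<Rightarrow> 'b::real_normed_vector) \<Rightarrow> real"
  where "Lp_norm M p f = (\<integral>x. norm (f x) powr p \<partial>M) powr (1 / p)"

text \<open>The nonnegative integral is used because the Bochner integral of a non-integrable function
  is \<open>0\<close>.\<close>

definition Lp_tendsto ::
    "'a measure \<Rightarrow> real \<Rightarrow> (nat \<Rightarrow> 'a \<Rightarrow> 'b::real_normed_vector) \<Rightarrow> ('a \<Rightarrow> 'b) \<Rightarrow> bool"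
  where "Lp_tendsto M p F f \<longleftrightarrow>
    (\<lambda>k. \<integral>\<^sup>+x. ennreal (norm (F k x - f x) powr p) \<partial>M) \<longlonglongrightarrow> 0"


section \<open>Gaussian measures and the Cameron--Martin space\<close>

text \<open>For \<open>l = 0\<close> the image measure is necessarily the Dirac measure at \<open>0\<close>; nondegeneracy
  says that this happens for no other continuous linear functional.\<close>

definition nondegenerate_centered_gaussian :: "'a::{banach,second_countable_topology} measure \<Rightarrow> bool"
  where "nondegenerate_centered_gaussian \<mu> \<longleftrightarrow>
    prob_space \<mu> \<and> sets \<mu> = sets borel \<and>
    (\<forall>l :: 'a \<Rightarrow>\<^sub>L real. l \<noteq> 0 \<longrightarrow>
      (\<exists>\<sigma>>0. distr \<mu> borel (blinfun_apply l) = density lborel (\<lambda>r. ennreal (normal_density 0 \<sigma> r))))"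

definition Xstar_closure :: "'a::{banach,second_countable_topology} measure \<Rightarrow> ('a \<Rightarrow> real) set"
  where "Xstar_closure \<mu> = {g \<in> Lp_space \<mu> 2.
    \<forall>\<epsilon>>0. \<exists>l :: 'a \<Rightarrow>\<^sub>L real. Lp_norm \<mu> 2 (\<lambda>x. g x - blinfun_apply l x) < \<epsilon>}"

definition R_op :: "'a::{banach,second_countable_topology} measure \<Rightarrow> ('a \<Rightarrow> real) \<Rightarrow> 'a"
  where "R_op \<mu> g =
    (THE x. \<forall>l :: 'a \<Rightarrow>\<^sub>L real. blinfun_apply l x = (\<integral>y. g y * blinfun_apply l y \<partial>\<mu>))"

definition cm_space :: "'a::{banach,second_countable_topology} measure \<Rightarrow> 'a set"
  where "cm_space \<mu> = R_op \<mu> ` Xstar_closure \<mu>"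

definition cm_hat :: "'a::{banach,second_countable_topology} measure \<Rightarrow> 'a \<Rightarrow> 'a \<Rightarrow> real"
  where "cm_hat \<mu> h = (SOME g. g \<in> Xstar_closure \<mu> \<and> R_op \<mu> g = h)"

text \<open>The Cameron--Martin space carries a Hilbert space structure that is not the one induced by
  the ambient Banach space. It is represented by a separable Hilbert space type \<open>'h\<close> together
  with the inclusion \<open>\<iota>\<close> of \<open>'h\<close> into the Banach space: a linear bijection onto the set
  \<open>cm_space \<mu>\<close> that transports the inner product of \<open>'h\<close> to the Cameron--Martin one.\<close>

definition cameron_martin ::
    "'a::{banach,second_countable_topology} measure
      \<Rightarrow> ('h::{real_inner,banach,second_countable_topology} \<Rightarrow> 'a) \<Rightarrow> bool"
  where "cameron_martin \<mu> \<iota> \<longleftrightarrow>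
    linear \<iota> \<and> bij_betw \<iota> UNIV (cm_space \<mu>) \<and>
    (\<forall>h k. inner h k = (\<integral>x. cm_hat \<mu> (\<iota> h) x * cm_hat \<mu> (\<iota> k) x \<partial>\<mu>))"

definition orthonormal_basis :: "(nat \<Rightarrow> 'h::real_inner) \<Rightarrow> bool"
  where "orthonormal_basis e \<longleftrightarrow>
    (\<forall>i j. inner (e i) (e j) = (if i = j then 1 else 0)) \<and> closure (span (range e)) = UNIV"


section \<open>Smooth cylindrical functions and derivatives along the Cameron--Martin space\<close>

text \<open>Functions on \<open>\<real>\<^sup>n\<close> are represented by functions of a sequence \<open>nat \<Rightarrow> real\<close> that
  depend on the first \<open>n\<close> entries only. For such functions continuity with respect to the product
  topology is continuity on \<open>\<real>\<^sup>n\<close>. The list \<open>\<alpha>\<close> enumerates the directions of an iterated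
  partial derivative.\<close>

definition partial_deriv :: "nat \<Rightarrow> ((nat \<Rightarrow> real) \<Rightarrow> real) \<Rightarrow> (nat \<Rightarrow> real) \<Rightarrow> real"
  where "partial_deriv i \<phi> v = deriv (\<lambda>r. \<phi> (v(i := r))) (v i)"

definition Cb_infinity :: "nat \<Rightarrow> ((nat \<Rightarrow> real) \<Rightarrow> real) set"
  where "Cb_infinity n = {\<phi>.
    (\<forall>u v. (\<forall>i<n. u i = v i) \<longrightarrow> \<phi> u = \<phi> v) \<and>
    (\<forall>\<alpha>. set \<alpha> \<subseteq> {..<n} \<longrightarrow>
      bounded (range (foldr partial_deriv \<alpha> \<phi>)) \<and>
      continuous_on UNIV (foldr partial_deriv \<alpha> \<phi>) \<and>
      (\<forall>i<n. \<forall>v. (\<lambda>r. foldr partial_deriv \<alpha> \<phi> (v(i := r))) differentiable (at (v i))))}"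

definition FCb :: "('a::real_normed_vector \<Rightarrow> real) set"
  where "FCb = {f. \<exists>n. \<exists>\<phi> \<in> Cb_infinity n. \<exists>l :: nat \<Rightarrow> 'a \<Rightarrow>\<^sub>L real.
    f = (\<lambda>x. \<phi> (\<lambda>i. if i < n then blinfun_apply (l i) x else 0))}"

definition FCb_vec :: "('a::real_normed_vector \<Rightarrow> 'h::real_vector) set"
  where "FCb_vec = {\<Phi>. \<exists>n. \<exists>f :: nat \<Rightarrow> 'a \<Rightarrow> real. \<exists>h :: nat \<Rightarrow> 'h.
    (\<forall>i<n. f i \<in> FCb) \<and> \<Phi> = (\<lambda>x. \<Sum>i<n. f i x *\<^sub>R h i)}"

definition H_grad :: "('h::real_inner \<Rightarrow> 'a::real_vector) \<Rightarrow> ('a \<Rightarrow> real) \<Rightarrow> 'a \<Rightarrow> 'h"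
  where "H_grad \<iota> f x = (THE v. GDERIV (\<lambda>h. f (x + \<iota> h)) 0 :> v)"

definition H_deriv :: "('h::real_inner \<Rightarrow> 'a::real_vector) \<Rightarrow> ('a \<Rightarrow> 'h) \<Rightarrow> 'a \<Rightarrow> 'h \<Rightarrow>\<^sub>L 'h"
  where "H_deriv \<iota> \<Phi> x = (THE T. ((\<lambda>h. \<Phi> (x + \<iota> h)) has_derivative blinfun_apply T) (at 0))"

definition H_hess :: "('h::real_inner \<Rightarrow> 'a::real_vector) \<Rightarrow> ('a \<Rightarrow> real) \<Rightarrow> 'a \<Rightarrow> 'h \<Rightarrow>\<^sub>L 'h"
  where "H_hess \<iota> f = H_deriv \<iota> (H_grad \<iota> f)"


section \<open>Hilbert--Schmidt operators\<close>

text \<open>The parameter \<open>e\<close> is an orthonormal basis; the notions do not depend on its choice.\<close>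

definition hilbert_schmidt :: "(nat \<Rightarrow> 'h) \<Rightarrow> ('h::real_inner \<Rightarrow>\<^sub>L 'h) \<Rightarrow> bool"
  where "hilbert_schmidt e T \<longleftrightarrow> summable (\<lambda>n. (norm (blinfun_apply T (e n)))\<^sup>2)"

definition hs_norm :: "(nat \<Rightarrow> 'h) \<Rightarrow> ('h::real_inner \<Rightarrow>\<^sub>L 'h) \<Rightarrow> real"
  where "hs_norm e T = sqrt (\<Sum>n. (norm (blinfun_apply T (e n)))\<^sup>2)"

text \<open>The Hilbert--Schmidt operators on a separable Hilbert space form a separable Hilbert space in
  which the functionals \<open>T \<mapsto> \<langle>T h, k\<rangle>\<close> are total, so by Pettis' theorem measurability of an
  operator-valued map is measurability of its composition with these functionals.\<close>

definition Lp_HS :: "(nat \<Rightarrow> 'h) \<Rightarrow> 'a measure \<Rightarrow> real \<Rightarrow> ('a \<Rightarrow> 'h::real_inner \<Rightarrow>\<^sub>L 'h) set"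
  where "Lp_HS e M p = {T.
    (\<forall>h k. (\<lambda>x. inner (blinfun_apply (T x) h) k) \<in> borel_measurable M) \<and>
    (AE x in M. hilbert_schmidt e (T x)) \<and>
    integrable M (\<lambda>x. hs_norm e (T x) powr p)}"

definition Lp_HS_norm :: "(nat \<Rightarrow> 'h) \<Rightarrow> 'a measure \<Rightarrow> real \<Rightarrow> ('a \<Rightarrow> 'h::real_inner \<Rightarrow>\<^sub>L 'h) \<Rightarrow> real"
  where "Lp_HS_norm e M p T = Lp_norm M p (\<lambda>x. hs_norm e (T x))"

definition Lp_HS_tendsto ::
    "(nat \<Rightarrow> 'h) \<Rightarrow> 'a measure \<Rightarrow> real \<Rightarrow> (nat \<Rightarrow> 'a \<Rightarrow> 'h::real_inner \<Rightarrow>\<^sub>L 'h) \<Rightarrow> ('a \<Rightarrow> 'h \<Rightarrow>\<^sub>L 'h) \<Rightarrow> bool"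
  where "Lp_HS_tendsto e M p T S \<longleftrightarrow> Lp_tendsto M p (\<lambda>k x. hs_norm e (T k x - S x)) (\<lambda>x. 0)"


section \<open>Sobolev spaces\<close>

text \<open>The Sobolev spaces are described by the graphs of the closures of the derivative operators on
  smooth cylindrical functions. When these operators are closable this gives at once the domain of
  the closure and, as a subspace of \<open>L\<^sup>p\<close>, the completion in the Sobolev norm; the derivatives below
  are then unique up to equality almost everywhere. The measure \<open>M\<close> is the Gaussian measure or the
  weighted one.\<close>

definition has_weak_grad ::
    "('h::{real_inner,banach,second_countable_topology} \<Rightarrow> 'a::{banach,second_countable_topology})
      \<Rightarrow> 'a measure \<Rightarrow> real \<Rightarrow> ('a \<Rightarrow> real) \<Rightarrow> ('a \<Rightarrow> 'h) \<Rightarrow> bool"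
  where "has_weak_grad \<iota> M p f G \<longleftrightarrow>
    f \<in> Lp_space M p \<and> G \<in> Lp_space M p \<and>
    (\<exists>F. (\<forall>k. F k \<in> FCb) \<and> Lp_tendsto M p F f \<and> Lp_tendsto M p (\<lambda>k. H_grad \<iota> (F k)) G)"

definition W1 ::
    "('h::{real_inner,banach,second_countable_topology} \<Rightarrow> 'a::{banach,second_countable_topology})
      \<Rightarrow> 'a measure \<Rightarrow> real \<Rightarrow> ('a \<Rightarrow> real) set"
  where "W1 \<iota> M p = {f. \<exists>G. has_weak_grad \<iota> M p f G}"

definition weak_grad ::
    "('h::{real_inner,banach,second_countable_topology} \<Rightarrow> 'a::{banach,second_countable_topology})
      \<Rightarrow> 'a measure \<Rightarrow> real \<Rightarrow> ('a \<Rightarrow> real) \<Rightarrow> 'a \<Rightarrow> 'h"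
  where "weak_grad \<iota> M p f = (SOME G. has_weak_grad \<iota> M p f G)"

definition has_weak_hess ::
    "('h::{real_inner,banach,second_countable_topology} \<Rightarrow> 'a::{banach,second_countable_topology})
      \<Rightarrow> (nat \<Rightarrow> 'h) \<Rightarrow> 'a measure \<Rightarrow> real \<Rightarrow> ('a \<Rightarrow> real) \<Rightarrow> ('a \<Rightarrow> 'h \<Rightarrow>\<^sub>L 'h) \<Rightarrow> bool"
  where "has_weak_hess \<iota> e M p f S \<longleftrightarrow>
    f \<in> Lp_space M p \<and> S \<in> Lp_HS e M p \<and>
    (\<exists>F G. (\<forall>k. F k \<in> FCb) \<and> G \<in> Lp_space M p \<and> Lp_tendsto M p F f \<and>
      Lp_tendsto M p (\<lambda>k. H_grad \<iota> (F k)) G \<and> Lp_HS_tendsto e M p (\<lambda>k. H_hess \<iota> (F k)) S)"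

definition W2 ::
    "('h::{real_inner,banach,second_countable_topology} \<Rightarrow> 'a::{banach,second_countable_topology})
      \<Rightarrow> (nat \<Rightarrow> 'h) \<Rightarrow> 'a measure \<Rightarrow> real \<Rightarrow> ('a \<Rightarrow> real) set"
  where "W2 \<iota> e M p = {f. \<exists>S. has_weak_hess \<iota> e M p f S}"

definition weak_hess ::
    "('h::{real_inner,banach,second_countable_topology} \<Rightarrow> 'a::{banach,second_countable_topology})
      \<Rightarrow> (nat \<Rightarrow> 'h) \<Rightarrow> 'a measure \<Rightarrow> real \<Rightarrow> ('a \<Rightarrow> real) \<Rightarrow> 'a \<Rightarrow> 'h \<Rightarrow>\<^sub>L 'h"
  where "weak_hess \<iota> e M p f = (SOME S. has_weak_hess \<iota> e M p f S)"

definition has_weak_deriv ::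
    "('h::{real_inner,banach,second_countable_topology} \<Rightarrow> 'a::{banach,second_countable_topology})
      \<Rightarrow> (nat \<Rightarrow> 'h) \<Rightarrow> 'a measure \<Rightarrow> real \<Rightarrow> ('a \<Rightarrow> 'h) \<Rightarrow> ('a \<Rightarrow> 'h \<Rightarrow>\<^sub>L 'h) \<Rightarrow> bool"
  where "has_weak_deriv \<iota> e M p \<Phi> S \<longleftrightarrow>
    \<Phi> \<in> Lp_space M p \<and> S \<in> Lp_HS e M p \<and>
    (\<exists>F. (\<forall>k. F k \<in> FCb_vec) \<and> Lp_tendsto M p F \<Phi> \<and> Lp_HS_tendsto e M p (\<lambda>k. H_deriv \<iota> (F k)) S)"

definition W1_vec ::
    "('h::{real_inner,banach,second_countable_topology} \<Rightarrow> 'a::{banach,second_countable_topology})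
      \<Rightarrow> (nat \<Rightarrow> 'h) \<Rightarrow> 'a measure \<Rightarrow> real \<Rightarrow> ('a \<Rightarrow> 'h) set"
  where "W1_vec \<iota> e M p = {\<Phi>. \<exists>S. has_weak_deriv \<iota> e M p \<Phi> S}"

definition weak_deriv ::
    "('h::{real_inner,banach,second_countable_topology} \<Rightarrow> 'a::{banach,second_countable_topology})
      \<Rightarrow> (nat \<Rightarrow> 'h) \<Rightarrow> 'a measure \<Rightarrow> real \<Rightarrow> ('a \<Rightarrow> 'h) \<Rightarrow> 'a \<Rightarrow> 'h \<Rightarrow>\<^sub>L 'h"
  where "weak_deriv \<iota> e M p \<Phi> = (SOME S. has_weak_deriv \<iota> e M p \<Phi> S)"

definition W1_vec_norm ::
    "('h::{real_inner,banach,second_countable_topology} \<Rightarrow> 'a::{banach,second_countable_topology})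
      \<Rightarrow> (nat \<Rightarrow> 'h) \<Rightarrow> 'a measure \<Rightarrow> real \<Rightarrow> ('a \<Rightarrow> 'h) \<Rightarrow> real"
  where "W1_vec_norm \<iota> e M p \<Phi> = Lp_norm M p \<Phi> + Lp_HS_norm e M p (weak_deriv \<iota> e M p \<Phi>)"


section \<open>Divergence\<close>

definition has_divergence ::
    "('h::{real_inner,banach,second_countable_topology} \<Rightarrow> 'a::{banach,second_countable_topology})
      \<Rightarrow> 'a measure \<Rightarrow> ('a \<Rightarrow> 'h) \<Rightarrow> ('a \<Rightarrow> real) \<Rightarrow> bool"
  where "has_divergence \<iota> M \<Phi> g \<longleftrightarrow>
    \<Phi> \<in> Lp_space M 1 \<and> g \<in> Lp_space M 1 \<and>
    (\<forall>f\<in>FCb. (\<integral>x. inner (H_grad \<iota> f x) (\<Phi> x) \<partial>M) = - (\<integral>x. f x * g x \<partial>M))"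

definition divergence ::
    "('h::{real_inner,banach,second_countable_topology} \<Rightarrow> 'a::{banach,second_countable_topology})
      \<Rightarrow> 'a measure \<Rightarrow> ('a \<Rightarrow> 'h) \<Rightarrow> 'a \<Rightarrow> real"
  where "divergence \<iota> M \<Phi> = (SOME g. has_divergence \<iota> M \<Phi> g)"


section \<open>Capacities and precise versions\<close>

definition ou_semigroup ::
    "'a::{banach,second_countable_topology} measure \<Rightarrow> real \<Rightarrow> ('a \<Rightarrow> real) \<Rightarrow> 'a \<Rightarrow> real"
  where "ou_semigroup \<mu> t f x = (\<integral>y. f (exp (- t) *\<^sub>R x + sqrt (1 - exp (- 2 * t)) *\<^sub>R y) \<partial>\<mu>)"

text \<open>Let \<open>L\<close> be the generator of the Ornstein--Uhlenbeck semigroup \<open>T\<close> in \<open>L\<^sup>p\<close>. The operator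
  \<open>L - I\<close> generates the exponentially stable semigroup \<open>exp (- t) T(t)\<close>, and the negative fractional
  powers of \<open>I - L\<close> are by definition
  \<open>(I - L)\<^sup>-\<^sup>\<alpha> f = 1 / \<Gamma>(\<alpha>) \<integral>\<^sub>0\<^sup>\<infinity> t\<^sup>\<alpha>\<^sup>-\<^sup>1 exp (- t) T(t) f dt\<close>; here \<open>\<alpha> = k / 2\<close>.\<close>

definition bessel_potential ::
    "'a::{banach,second_countable_topology} measure \<Rightarrow> nat \<Rightarrow> ('a \<Rightarrow> real) \<Rightarrow> 'a \<Rightarrow> real"
  where "bessel_potential \<mu> k f x =
    (LBINT t:{0<..}. t powr (real k / 2 - 1) * exp (- t) * ou_semigroup \<mu> t f x) / Gamma (real k / 2)"

definition capacity_open ::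
    "'a::{banach,second_countable_topology} measure \<Rightarrow> nat \<Rightarrow> real \<Rightarrow> 'a set \<Rightarrow> ennreal"
  where "capacity_open \<mu> k p A =
    (INF f \<in> {f \<in> Lp_space \<mu> p. AE x in \<mu>. x \<in> A \<longrightarrow> 1 \<le> bessel_potential \<mu> k f x}.
      ennreal (Lp_norm \<mu> p f))"

definition capacity ::
    "'a::{banach,second_countable_topology} measure \<Rightarrow> nat \<Rightarrow> real \<Rightarrow> 'a set \<Rightarrow> ennreal"
  where "capacity \<mu> k p B = (INF A \<in> {A. open A \<and> B \<subseteq> A}. capacity_open \<mu> k p A)"

definition quasicontinuous ::
    "'a::{banach,second_countable_topology} measure \<Rightarrow> nat \<Rightarrow> real \<Rightarrow> ('a \<Rightarrow> real) \<Rightarrow> bool"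
  where "quasicontinuous \<mu> k p f \<longleftrightarrow>
    (\<forall>\<epsilon>>0. \<exists>A. open A \<and> capacity_open \<mu> k p A \<le> ennreal \<epsilon> \<and> continuous_on (- A) f)"

text \<open>\<open>precise \<mu> k p f\<close> says that the function \<open>f\<close> is a precise version of its own equivalence
  class. The function \<open>g\<close> is \<open>(I - L)\<^sup>k\<^sup>/\<^sup>2 f\<close>, this operator being the inverse of \<open>(I - L)\<^sup>-\<^sup>k\<^sup>/\<^sup>2\<close>.\<close>

definition precise ::
    "'a::{banach,second_countable_topology} measure \<Rightarrow> nat \<Rightarrow> real \<Rightarrow> ('a \<Rightarrow> real) \<Rightarrow> bool"
  where "precise \<mu> k p f \<longleftrightarrow>
    f \<in> borel_measurable borel \<and> quasicontinuous \<mu> k p f \<and>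
    (\<exists>g \<in> Lp_space \<mu> p. (AE x in \<mu>. f x = bessel_potential \<mu> k g x) \<and>
      (\<forall>r>0. capacity \<mu> k p {x. \<bar>f x\<bar> > r} \<le> ennreal (Lp_norm \<mu> p g / r)))"

end

theory Submission
  imports Defs
begin

text \<open>Write \<open>\<beta>\<^sub>h = \<langle>\<nabla>log w, h\<rangle> - hat h\<close> for the logarithmic derivative of \<open>\<nu>\<close> along \<open>h\<close> and \<open>\<delta>\<^sub>h f = \<partial>\<^sub>h f + f \<beta>\<^sub>h\<close>,
  so that the field \<open>f h\<close> has divergence \<open>\<delta>\<^sub>h f\<close>. Since \<open>\<partial>\<^sub>k \<beta>\<^sub>h = \<langle>D\<^sup>2log w k, h\<rangle> - \<langle>h, k\<rangle>\<close>, integrating by parts twice gives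
  \<open>\<integral> \<delta>\<^sub>h f \<delta>\<^sub>k g d\<nu> = \<integral> \<partial>\<^sub>k f \<partial>\<^sub>h g + f g (\<langle>h, k\<rangle> - \<langle>D\<^sup>2log w k, h\<rangle>) d\<nu>\<close>. Summed over the terms of a cylindrical
  field \<open>\<Phi>\<close>, the right-hand side is \<open>\<integral> tr ((D\<Phi>)\<^sup>2) + \<langle>(I - D\<^sup>2log w) \<Phi>, \<Phi>\<rangle> d\<nu> \<le> \<parallel>D\<Phi>\<parallel>\<^sup>2 + C \<parallel>\<Phi>\<parallel>\<^sup>2\<close>. Density of
  the cylindrical fields extends this bound, and the series is the divergence of the projections of
  \<open>\<Phi>\<close> onto the spans of \<open>e\<^sub>0, \<dots>, e\<^sub>N\<close>. Identities between integrable functions are tested against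
  the plane waves \<open>cos (l x + b)\<close>, which replaces finite-dimensional reductions.\<close>

section \<open>The Hahn--Banach theorem in a normed space\<close>

text \<open>The exponent 2s' embeds L^t(\<mu>) into L^2(\<nu>): w lies in L^s(\<mu>), so a^2 w is
  integrable for a in L^(2s')(\<mu>). The gradient and Hessian of ln w are therefore handled as
  L^2(\<nu>) limits. The main obstacle is that the logarithmic derivative is neither bounded nor
  continuous in general, so \<open>delta h f\<close> cannot be differentiated classically; its
  derivative is taken in the sense of distributions, a relation closed in L^2(\<nu>), and is reached
  by approximating ln w and the Gaussian functionals separately. A second obstacle is that weak
  gradients and divergences are chosen from existential statements, so identities for them pass
  through almost-everywhere uniqueness, which rests on injectivity of the Fourier transform. The
  gradients of w and ln w are compared although exp is unbounded by composing with arctan. In the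
  final bound the constant 1 pays for the trace term and C for the Hessian term. Hahn-Banach enters
  because Cameron-Martin vectors are known only through the values of functionals on them.\<close>

definition sublinear :: "('a::real_vector \<Rightarrow> real) \<Rightarrow> bool" where
  "sublinear q \<longleftrightarrow> (\<forall>x y. q (x + y) \<le> q x + q y) \<and> (\<forall>c\<ge>0. \<forall>x. q (c *\<^sub>R x) = c * q x)"

text \<open>Applying the assumed inequality to \<open>c *\<^sub>R x\<close> with factor
  \<open>inverse c\<close> gives its converse. For functionals built as infima, as below, only this
  one direction is immediate.\<close>

lemma sublinearI:
  assumes "\<And>x y. q (x + y) \<le> q x + q y" "q 0 = 0" "\<And>c x. c > 0 \<Longrightarrow> c * q x \<le> q (c *\<^sub>R x)"
  shows "sublinear q"
proof -
  have "q (c *\<^sub>R x) = c * q x" if "c \<ge> 0" for c x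
  proof (cases "c = 0")
    case False
    with that have c: "c > 0" by simp
    have "inverse c * q (c *\<^sub>R x) \<le> q (inverse c *\<^sub>R (c *\<^sub>R x))"
      using assms(3)[of "inverse c" "c *\<^sub>R x"] c by simp
    then have "q (c *\<^sub>R x) \<le> c * q x"
      using c by (simp add: field_simps)
    with assms(3)[OF c, of x] show ?thesis by simp
  qed (simp add: assms(2))
  then show ?thesis using assms(1) by (auto simp: sublinear_def)
qed

lemma sublinearD:
  assumes "sublinear q"
  shows "q (x + y) \<le> q x + q y" "c \<ge> 0 \<Longrightarrow> q (c *\<^sub>R x) = c * q x" "q 0 = 0" "- q (- x) \<le> q x"
proof -
  show *: "q (x + y) \<le> q x + q y" "c \<ge> 0 \<Longrightarrow> q (c *\<^sub>R x) = c * q x" for c x y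
    using assms by (auto simp: sublinear_def)
  show 0: "q 0 = 0" using *(2)[of 0 0] by simp
  show "- q (- x) \<le> q x" using *(1)[of x "- x"] 0 by simp
qed

text \<open>The largest sublinear functional below \<open>q\<close> whose value at
  \<open>- y\<close> is at most \<open>- q y\<close>.\<close>

definition sublinear_shift :: "('a::real_vector \<Rightarrow> real) \<Rightarrow> 'a \<Rightarrow> 'a \<Rightarrow> real" where
  "sublinear_shift q y x = (INF t\<in>{0..}. q (x + t *\<^sub>R y) - t * q y)"

text \<open>Subadditivity bounds the set under the infimum from below by \<open>- q (- x)\<close>.
  The parameters \<open>t\<close> add when arguments add and rescale when arguments are scaled,
  which makes the infimum sublinear again.\<close>

lemma sublinear_shift:
  assumes q: "sublinear q"
  shows sublinear_shift_lower: "t \<ge> 0 \<Longrightarrow> sublinear_shift q y x \<le> q (x + t *\<^sub>R y) - t * q y"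
    and "sublinear_shift q y x \<le> q x"
    and "sublinear (sublinear_shift q y)"
proof -
  have "- q (- x) \<le> q (x + t *\<^sub>R y) - t * q y" if "t \<ge> 0" for t x
    using sublinearD(1)[OF q, of "x + t *\<^sub>R y" "- x"] sublinearD(2)[OF q that, of y] by simp
  then have bdd: "bdd_below ((\<lambda>t. q (x + t *\<^sub>R y) - t * q y) ` {0..})" for x
    by (intro bdd_belowI[of _ "- q (- x)"]) auto
  show low: "sublinear_shift q y x \<le> q (x + t *\<^sub>R y) - t * q y" if "t \<ge> 0" for t x
    unfolding sublinear_shift_def using that by (intro cINF_lower[OF bdd]) auto
  show "sublinear_shift q y x \<le> q x" using low[of 0 x] by simp
  have ge: "b \<le> sublinear_shift q y x" if "\<And>t. t \<ge> 0 \<Longrightarrow> b \<le> q (x + t *\<^sub>R y) - t * q y" for b x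
    unfolding sublinear_shift_def using that by (intro cINF_greatest) auto
  show "sublinear (sublinear_shift q y)"
  proof (rule sublinearI)
    fix x z
    have "sublinear_shift q y (x + z) - (q (z + t2 *\<^sub>R y) - t2 * q y) \<le> sublinear_shift q y x"
      if t2: "t2 \<ge> 0" for t2
    proof (rule ge)
      fix t1 :: real assume t1: "t1 \<ge> 0"
      have "sublinear_shift q y (x + z) \<le> q ((x + z) + (t1 + t2) *\<^sub>R y) - (t1 + t2) * q y"
        using t1 t2 by (intro low) auto
      also have "(x + z) + (t1 + t2) *\<^sub>R y = (x + t1 *\<^sub>R y) + (z + t2 *\<^sub>R y)"
        by (simp add: algebra_simps)
      also have "q \<dots> \<le> q (x + t1 *\<^sub>R y) + q (z + t2 *\<^sub>R y)"
        by (rule sublinearD(1)[OF q])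
      finally show "sublinear_shift q y (x + z) - (q (z + t2 *\<^sub>R y) - t2 * q y) \<le> q (x + t1 *\<^sub>R y) - t1 * q y"
        by (simp add: algebra_simps)
    qed
    then have "sublinear_shift q y (x + z) - sublinear_shift q y x \<le> sublinear_shift q y z"
      by (intro ge) (simp add: algebra_simps)
    then show "sublinear_shift q y (x + z) \<le> sublinear_shift q y x + sublinear_shift q y z" by simp
  next
    have "0 \<le> sublinear_shift q y 0"
      by (intro ge) (simp add: sublinearD(2)[OF q])
    with low[of 0 0] show "sublinear_shift q y 0 = 0" by (simp add: sublinearD(3)[OF q])
  next
    fix c :: real and x assume c: "c > 0"
    show "c * sublinear_shift q y x \<le> sublinear_shift q y (c *\<^sub>R x)"
    proof (rule ge)
      fix t :: real assume t: "t \<ge> 0"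
      have "q (c *\<^sub>R x + t *\<^sub>R y) = q (c *\<^sub>R (x + (t / c) *\<^sub>R y))"
        using c by (simp add: algebra_simps)
      also have "\<dots> = c * q (x + (t / c) *\<^sub>R y)"
        using c by (intro sublinearD(2)[OF q]) simp
      finally have "q (c *\<^sub>R x + t *\<^sub>R y) - t * q y = c * (q (x + (t / c) *\<^sub>R y) - (t / c) * q y)"
        using c by (simp add: algebra_simps)
      also have "\<dots> \<ge> c * sublinear_shift q y x"
        using c t by (intro mult_left_mono low) auto
      finally show "c * sublinear_shift q y x \<le> q (c *\<^sub>R x + t *\<^sub>R y) - t * q y" by simp
    qed
  qed
qed

text \<open>A minimal \<open>q\<close> equals all its shifts. Evaluating a shift at t = 1 gives the
  superadditivity that sublinearity leaves open.\<close>

lemma minimal_sublinear_linear: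
  assumes q: "sublinear q" and minimal: "\<And>r. sublinear r \<Longrightarrow> (\<And>x. r x \<le> q x) \<Longrightarrow> r = q"
  shows "linear q"
proof -
  have "sublinear_shift q y = q" for y
    by (rule minimal) (use sublinear_shift[OF q] in auto)
  then have "q x \<le> q (x + y) - q y" for x y
    using sublinear_shift_lower[OF q, of 1 y x] by simp
  then have add: "q (x + y) = q x + q y" for x y
    using sublinearD(1)[OF q, of x y] by (smt (verit))
  have neg: "q (- x) = - q x" for x
    using add[of x "- x"] sublinearD(3)[OF q] by simp
  have "q (c *\<^sub>R x) = c * q x" for c x
  proof (cases "c \<ge> 0")
    case False
    then have "q ((- c) *\<^sub>R (- x)) = (- c) * q (- x)" by (intro sublinearD(2)[OF q]) auto
    then show ?thesis using neg by simp
  qed (rule sublinearD(2)[OF q])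
  then show ?thesis using add by (intro linearI) auto
qed

lemma sublinear_dominates_linear:
  assumes p: "sublinear p"
  obtains f where "linear f" "\<And>x. f x \<le> p x"
proof -
  define A where "A = {q. sublinear q \<and> (\<forall>x. q x \<le> p x)}"
  \<comment> \<open>The order is reversed: Zorn's lemma yields maximal elements, and the element
    wanted is pointwise minimal.\<close>
  define P where "P = (\<lambda>f g :: 'a \<Rightarrow> real. \<forall>x. g x \<le> f x)"
  have "partial_order_on A (relation_of P A)"
    by (rule partial_order_on_relation_ofI) (auto simp: P_def intro: order_trans intro!: ext antisym)
  then have "\<exists>m\<in>A. \<forall>a\<in>A. P m a \<longrightarrow> a = m"
  proof (rule predicate_Zorn)
    fix C assume "C \<in> Chains (relation_of P A)"
    then have CA: "C \<subseteq> A" and chain: "\<And>f g. f \<in> C \<Longrightarrow> g \<in> C \<Longrightarrow> (\<forall>x. g x \<le> f x) \<or> (\<forall>x. f x \<le> g x)"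
      by (auto simp: Chains_def relation_of_def P_def)
    show "\<exists>u\<in>A. \<forall>a\<in>C. P a u"
    proof (cases "C = {}")
      case True
      then show ?thesis using p by (auto simp: A_def)
    next
      case False
      define u where "u = (\<lambda>x. INF q\<in>C. q x)"
      have subl: "sublinear q" "q x \<le> p x" if "q \<in> C" for q x using that CA by (auto simp: A_def)
      have bdd: "bdd_below ((\<lambda>q. q x) ` C)" for x
      proof (rule bdd_belowI2)
        fix q assume "q \<in> C"
        then show "- p (- x) \<le> q x"
          using sublinearD(4)[OF subl(1), of q x] subl(2)[of q "- x"] by linarith
      qed
      have low: "u x \<le> q x" if "q \<in> C" for q x
        unfolding u_def by (rule cINF_lower[OF bdd that])
      have ge: "b \<le> u x" if "\<And>q. q \<in> C \<Longrightarrow> b \<le> q x" for b x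
        unfolding u_def using False that by (intro cINF_greatest) auto
      have "sublinear u"
      proof (rule sublinearI)
        fix x y
        \<comment> \<open>Of two members of a chain one lies below the other; its own subadditivity
          gives the mixed estimate.\<close>
        have "u (x + y) \<le> q1 x + q2 y" if "q1 \<in> C" "q2 \<in> C" for q1 q2
          using chain[OF that] low[OF that(1), of "x + y"] low[OF that(2), of "x + y"]
            sublinearD(1)[OF subl(1)[OF that(1)], of x y] sublinearD(1)[OF subl(1)[OF that(2)], of x y]
          by (smt (verit))
        then have "u (x + y) - q2 y \<le> u x" if "q2 \<in> C" for q2
          using that by (intro ge) (simp add: algebra_simps)
        then have "u (x + y) - u x \<le> u y"
          by (intro ge) (simp add: algebra_simps)
        then show "u (x + y) \<le> u x + u y" by simp
      next
        have "\<And>q. q \<in> C \<Longrightarrow> q 0 = 0" using subl(1) sublinearD(3) by blast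
        then show "u 0 = 0" using False low[of _ 0] ge[of 0 0] by (metis antisym ex_in_conv order_refl)
      next
        fix c :: real and x assume "c > 0"
        then show "c * u x \<le> u (c *\<^sub>R x)"
          using low by (intro ge) (auto simp: sublinearD(2)[OF subl(1)] intro!: mult_left_mono)
      qed
      moreover have "u x \<le> p x" for x
        using False low subl(2) by (meson ex_in_conv order_trans)
      ultimately show ?thesis using low by (intro bexI[of _ u]) (auto simp: A_def P_def)
    qed
  qed
  then obtain m where m: "m \<in> A" "\<And>a. a \<in> A \<Longrightarrow> P m a \<Longrightarrow> a = m" by blast
  have "linear m"
  proof (rule minimal_sublinear_linear)
    show "sublinear m" using m by (simp add: A_def)
    show "r = m" if "sublinear r" "\<And>x. r x \<le> m x" for r
    proof (rule m(2))
      have "\<And>x. m x \<le> p x" using m(1) by (simp add: A_def)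
      then show "r \<in> A" using that order_trans by (fastforce simp: A_def)
      show "P m r" using that(2) by (simp add: P_def)
    qed
  qed
  then show ?thesis using m(1) that by (auto simp: A_def)
qed

text \<open>Instead of extending a functional from the line through \<open>x0\<close>, dominate one
  by the shift of the norm along \<open>x0\<close>: this forces its value at \<open>- x0\<close>
  down to \<open>- norm x0\<close>, and the norm bounds it from the other side.\<close>

theorem norming_functional:
  fixes x0 :: "'a::real_normed_vector"
  obtains l :: "'a \<Rightarrow>\<^sub>L real" where "norm l \<le> 1" "blinfun_apply l x0 = norm x0"
proof -
  have n: "sublinear (norm :: 'a \<Rightarrow> real)"
    by (simp add: sublinear_def norm_triangle_ineq)
  define p where "p = sublinear_shift norm x0"
  obtain f where f: "linear f" "\<And>x. f x \<le> p x"
    using sublinear_dominates_linear sublinear_shift(3)[OF n] unfolding p_def by blast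
  have fn: "f x \<le> norm x" for x
    using f(2) sublinear_shift(2)[OF n] order_trans unfolding p_def by blast
  have "p (- x0) \<le> - norm x0"
    using sublinear_shift_lower[OF n, of 1 x0 "- x0"] by (simp add: p_def)
  then have "f (- x0) \<le> - norm x0" using f(2) order_trans by blast
  then have fx: "f x0 = norm x0" using fn[of x0] linear_neg[OF f(1), of x0] by simp
  have abs: "\<bar>f x\<bar> \<le> norm x" for x
    using fn[of x] fn[of "- x"] linear_neg[OF f(1), of x] by (simp add: abs_le_iff)
  have bl: "bounded_linear f"
    using f(1) abs by (intro bounded_linear_intro[where K=1]) (auto simp: linear_add linear_scale)
  show ?thesis
  proof (rule that)
    show "norm (Blinfun f) \<le> 1"
      using abs by (intro norm_blinfun_bound) (auto simp: bounded_linear_Blinfun_apply[OF bl])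
    show "blinfun_apply (Blinfun f) x0 = norm x0"
      by (simp add: bounded_linear_Blinfun_apply[OF bl] fx)
  qed
qed

lemma functionals_separate:
  fixes x y :: "'a::real_normed_vector"
  assumes "\<And>l :: 'a \<Rightarrow>\<^sub>L real. blinfun_apply l x = blinfun_apply l y"
  shows "x = y"
  using norming_functional[of "x - y"] assms by (metis blinfun.diff_right diff_self norm_eq_zero right_minus_eq)

section \<open>Trigonometric polynomials on a Banach space\<close>

text \<open>The phase \<open>b\<close> covers sines as well as cosines, so the product-to-sum
  formula keeps the class closed under multiplication without complex exponentials;
  \<open>l = 0\<close> gives the constants.\<close>

inductive trig_poly :: "('a::real_normed_vector \<Rightarrow> real) \<Rightarrow> bool" where
  base: "trig_poly (\<lambda>x. c * cos (blinfun_apply l x + b))"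
| add: "trig_poly f \<Longrightarrow> trig_poly g \<Longrightarrow> trig_poly (\<lambda>x. f x + g x)"

lemma trig_poly_const: "trig_poly (\<lambda>x. c)"
  using trig_poly.base[of c 0 0] by simp

lemma trig_poly_mult:
  assumes "trig_poly f" "trig_poly g"
  shows "trig_poly (\<lambda>x. f x * g x)"
  using assms
proof (induction f rule: trig_poly.induct)
  case (base c l b)
  from base show ?case
  proof (induction g rule: trig_poly.induct)
    case (base c' l' b')
    have eq: "(\<lambda>x. c * cos (blinfun_apply l x + b) * (c' * cos (blinfun_apply l' x + b'))) =
      (\<lambda>x. c * c' / 2 * cos (blinfun_apply (l - l') x + (b - b'))
         + c * c' / 2 * cos (blinfun_apply (l + l') x + (b + b')))"
    proof
      fix x
      have "cos (blinfun_apply l x + b) * cos (blinfun_apply l' x + b') =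
        (cos (blinfun_apply (l - l') x + (b - b')) + cos (blinfun_apply (l + l') x + (b + b'))) / 2"
        by (simp add: cos_times_cos blinfun.diff_left blinfun.add_left add_diff_eq diff_diff_add add.commute add.left_commute)
      then show "c * cos (blinfun_apply l x + b) * (c' * cos (blinfun_apply l' x + b')) =
         c * c' / 2 * cos (blinfun_apply (l - l') x + (b - b'))
         + c * c' / 2 * cos (blinfun_apply (l + l') x + (b + b'))"
        by (simp add: field_simps)
    qed
    show ?case unfolding eq by (rule trig_poly.add[OF trig_poly.base trig_poly.base])
  next
    case (add f g)
    then show ?case using trig_poly.add by (simp add: distrib_left)
  qed
next
  case (add f f')
  then show ?case using trig_poly.add by (simp add: distrib_right)
qed

lemma trig_poly_continuous: "trig_poly f \<Longrightarrow> continuous_on S f"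
  by (induction f rule: trig_poly.induct) (auto intro!: continuous_intros)

lemma trig_poly_bounded: "trig_poly f \<Longrightarrow> \<exists>B. \<forall>x. \<bar>f x\<bar> \<le> B"
proof (induction f rule: trig_poly.induct)
  case (base c l b)
  then show ?case by (intro exI[of _ "\<bar>c\<bar>"]) (auto simp: abs_mult mult_left_le)
next
  case (add f g)
  then obtain A B where "\<forall>x. \<bar>f x\<bar> \<le> A" "\<forall>x. \<bar>g x\<bar> \<le> B" by auto
  then have "\<bar>f x + g x\<bar> \<le> A + B" for x
    by (meson abs_triangle_ineq add_mono order_trans)
  then show ?case by blast
qed

lemma trig_poly_compose_polynomial:
  fixes p :: "real \<Rightarrow> real"
  assumes "real_polynomial_function p" "trig_poly f"
  shows "trig_poly (\<lambda>x. p (f x))"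
  using assms(1)
proof (induction p rule: real_polynomial_function.induct)
  case (linear h)
  then obtain c where "h = (\<lambda>r. r * c)" using real_bounded_linear by blast
  then show ?case using trig_poly_mult[OF assms(2) trig_poly_const[of c]] by simp
qed (use trig_poly_const trig_poly_mult trig_poly.add in auto)

text \<open>Stone-Weierstrass controls the approximant only on \<open>K\<close>. Dominated
  convergence also needs a bound on the whole space, which is recovered by composing with a
  polynomial that approximates truncation.\<close>

lemma trig_poly_approx_compact:
  fixes f :: "'a::real_normed_vector \<Rightarrow> real"
  assumes K: "compact K" and f: "continuous_on K f" and B: "\<And>x. \<bar>f x\<bar> \<le> B" and e: "e > 0"
  obtains p where "trig_poly p" "\<And>x. x \<in> K \<Longrightarrow> \<bar>f x - p x\<bar> < e" "\<And>x. \<bar>p x\<bar> \<le> B + e"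
proof -
  have B0: "B \<ge> 0" using B[of undefined] by linarith
  interpret function_ring_on "Collect trig_poly" K
  proof
    fix x y :: 'a assume "x \<noteq> y"
    then obtain l :: "'a \<Rightarrow>\<^sub>L real" where l: "blinfun_apply l x \<noteq> blinfun_apply l y"
      using functionals_separate by metis
    define d where "d = blinfun_apply l y - blinfun_apply l x"
    \<comment> \<open>Rescaling makes the two values differ by pi, so a cosine with phase fixed at
      \<open>x\<close> takes the values 1 and -1.\<close>
    define m where "m = (pi / d) *\<^sub>R l"
    have d: "d \<noteq> 0" using l by (simp add: d_def)
    have "blinfun_apply m y - blinfun_apply m x = pi / d * d"
      by (simp add: m_def blinfun.scaleR_left d_def right_diff_distrib)
    then have "blinfun_apply m y + - blinfun_apply m x = pi" using d by simp
    then have "1 * cos (blinfun_apply m x + - blinfun_apply m x) \<noteq> 1 * cos (blinfun_apply m y + - blinfun_apply m x)"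
      by simp
    moreover have "trig_poly (\<lambda>z. 1 * cos (blinfun_apply m z + - blinfun_apply m x))"
      by (rule trig_poly.base)
    ultimately show "\<exists>f\<in>Collect trig_poly. f x \<noteq> f y"
      by (intro bexI[of _ "\<lambda>z. 1 * cos (blinfun_apply m z + - blinfun_apply m x)"] CollectI)
  qed (use K trig_poly_continuous trig_poly.add trig_poly_mult trig_poly_const in auto)
  obtain p0 where p0: "trig_poly p0" "\<And>x. x \<in> K \<Longrightarrow> \<bar>f x - p0 x\<bar> < e/2"
    using Stone_Weierstrass_basic[OF f, of "e/2"] e by auto
  obtain M where M: "\<And>x. \<bar>p0 x\<bar> \<le> M" using trig_poly_bounded[OF p0(1)] by blast
  \<comment> \<open>\<open>p0\<close> has values in the bounded interval from -M to M, so one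
    polynomial close to \<open>clamp\<close> there controls the composition at every point, not only
    on \<open>K\<close>.\<close>
  define clamp where "clamp = (\<lambda>r. max (- B) (min B r))"
  have "continuous_on {- M..M} clamp" unfolding clamp_def by (intro continuous_intros)
  then obtain g where g: "real_polynomial_function g" "\<And>r. r \<in> {- M..M} \<Longrightarrow> \<bar>clamp r - g r\<bar> < e/2"
    using Stone_Weierstrass_real_polynomial_function[of "{- M..M}" clamp "e/2"] e by auto
  show ?thesis
  proof (rule that)
    show "trig_poly (\<lambda>x. g (p0 x))" by (rule trig_poly_compose_polynomial[OF g(1) p0(1)])
    have g': "\<bar>clamp (p0 x) - g (p0 x)\<bar> < e/2" for x
      using M[of x] by (intro g(2)) (auto simp: abs_le_iff)
    show "\<bar>f x - g (p0 x)\<bar> < e" if "x \<in> K" for x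
    proof -
      have "\<bar>f x - clamp (p0 x)\<bar> \<le> \<bar>f x - p0 x\<bar>"
        using B[of x] unfolding clamp_def by linarith
      then show ?thesis using p0(2)[OF that] g'[of x] by linarith
    qed
    show "\<bar>g (p0 x)\<bar> \<le> B + e" for x
    proof -
      have "\<bar>clamp (p0 x)\<bar> \<le> B" using B0 unfolding clamp_def by linarith
      then show ?thesis using g'[of x] e by linarith
    qed
  qed
qed

lemma trig_poly_approx_sequence:
  fixes f :: "'a::real_normed_vector \<Rightarrow> real"
  assumes K: "\<And>n. compact (K n)" "incseq K" and f: "continuous_on UNIV f" and B: "\<And>x. \<bar>f x\<bar> \<le> B"
  obtains p where "\<And>n. trig_poly (p n)" "\<And>n x. \<bar>p n x\<bar> \<le> B + 1"
    "\<And>x. x \<in> (\<Union>n. K n) \<Longrightarrow> (\<lambda>n. p n x) \<longlonglongrightarrow> f x"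
proof -
  have "\<exists>p. trig_poly p \<and> (\<forall>x\<in>K n. \<bar>f x - p x\<bar> < 1 / real (Suc n)) \<and> (\<forall>x. \<bar>p x\<bar> \<le> B + 1 / real (Suc n))" for n
  proof -
    have c: "continuous_on (K n) f" and "1 / real (Suc n) > 0" using continuous_on_subset[OF f] by auto
    then show ?thesis using trig_poly_approx_compact[OF K(1)[of n] c B] by metis
  qed
  then obtain p where p: "\<And>n. trig_poly (p n)" "\<And>n x. x \<in> K n \<Longrightarrow> \<bar>f x - p n x\<bar> < 1 / real (Suc n)"
    "\<And>n x. \<bar>p n x\<bar> \<le> B + 1 / real (Suc n)"
    by metis
  show ?thesis
  proof (rule that[OF p(1)])
    show "\<bar>p n x\<bar> \<le> B + 1" for n x
      by (rule order_trans[OF p(3)]) simp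
    fix x assume "x \<in> (\<Union>n. K n)"
    then obtain N where "x \<in> K N" by auto
    then have *: "x \<in> K n" if "n \<ge> N" for n using K(2) that by (auto simp: incseq_def)
    have "(\<lambda>n. p n x - f x) \<longlonglongrightarrow> 0"
    proof (rule tendsto_0_le[where K=1])
      show "(\<lambda>n. 1 / real (Suc n)) \<longlonglongrightarrow> 0" by (rule LIMSEQ_Suc[OF lim_1_over_n])
      show "\<forall>\<^sub>F n in sequentially. norm (p n x - f x) \<le> norm (1 / real (Suc n)) * 1"
        using eventually_ge_at_top[of N] by eventually_elim (use p(2)[OF *] in \<open>fastforce simp: abs_minus_commute\<close>)
    qed
    then show "(\<lambda>n. p n x) \<longlonglongrightarrow> f x" by (simp add: LIM_zero_iff)
  qed
qed

text \<open>Inner regularity by compact sets makes a finite Borel measure on a complete separable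
  metric space tight; finite unions of the compact sets make them increase.\<close>

lemma AE_in_sigma_compact:
  fixes M :: "'a::{complete_space,second_countable_topology} measure"
  assumes fin: "finite_measure M" and M: "sets M = sets borel"
  obtains K :: "nat \<Rightarrow> 'a set" where "\<And>n. compact (K n)" "incseq K" "AE x in M. x \<in> (\<Union>n. K n)"
proof -
  interpret finite_measure M by (rule fin)
  have sp: "space M = UNIV" using sets_eq_imp_space_eq[OF M] by simp
  have "\<exists>K. compact K \<and> measure M UNIV - 1 / real (Suc n) < measure M K" for n
  proof (rule ccontr)
    assume neg: "\<not> ?thesis"
    have "emeasure M UNIV = (SUP K \<in> {K. K \<subseteq> UNIV \<and> compact K}. emeasure M K)"
      using inner_regular[OF M, of UNIV] by (simp add: emeasure_finite)
    also have "\<dots> \<le> ennreal (measure M UNIV - 1 / real (Suc n))"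
    proof (rule SUP_least)
      fix K :: "'a set" assume "K \<in> {K. K \<subseteq> UNIV \<and> compact K}"
      then have "measure M K \<le> measure M UNIV - 1 / real (Suc n)" using neg by auto
      then show "emeasure M K \<le> ennreal (measure M UNIV - 1 / real (Suc n))"
        by (simp add: emeasure_eq_measure ennreal_leI)
    qed
    finally have "ennreal (measure M UNIV) \<le> ennreal (measure M UNIV - 1 / real (Suc n))"
      by (simp add: emeasure_eq_measure)
    moreover have pos: "1 / real (Suc n) > 0" by simp
    \<comment> \<open>\<open>ennreal\<close> sends negative numbers to 0, so the inequality is
      contradictory only for positive total mass. In the null case the empty set has the required
      measure.\<close>
    ultimately have "measure M UNIV = 0" using measure_nonneg[of M UNIV]
      unfolding ennreal_le_iff2 by linarith
    then have "compact ({} :: 'a set) \<and> measure M UNIV - 1 / real (Suc n) < measure M {}" using pos by simp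
    then show False using neg by blast
  qed
  then obtain K0 where K0: "\<And>n. compact (K0 n)" "\<And>n. measure M UNIV - 1 / real (Suc n) < measure M (K0 n)"
    by metis
  define K where "K n = (\<Union>i\<le>n. K0 i)" for n
  have K: "compact (K n)" for n unfolding K_def using K0(1) by (intro compact_UN) auto
  have inc: "incseq K" by (auto simp: K_def incseq_def intro: order_trans)
  have sK: "K0 n \<in> sets M" "(\<Union>n. K n) \<in> sets M" for n
    using K0(1) K by (auto simp: M intro!: borel_compact sets.countable_UN)
  have "measure M UNIV - 1 / real (Suc n) \<le> measure M (\<Union>n. K n)" for n
    using K0(2)[of n] finite_measure_mono[of "K0 n" "\<Union>n. K n"] sK by (force simp: K_def)
  moreover have "(\<lambda>n. measure M UNIV - 1 / real (Suc n)) \<longlonglongrightarrow> measure M UNIV - 0"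
    by (intro tendsto_diff tendsto_const LIMSEQ_Suc[OF lim_1_over_n])
  ultimately have "measure M UNIV \<le> measure M (\<Union>n. K n)"
    by (intro LIMSEQ_le_const2[of "\<lambda>n. measure M UNIV - 1 / real (Suc n)"]) auto
  then have "measure M (space M) = measure M (\<Union>n. K n)"
    using finite_measure_mono[of "\<Union>n. K n" "space M"] sK sp by (metis antisym sets.top subset_UNIV)
  then have "measure M (space M - (\<Union>n. K n)) = 0"
    using finite_measure_compl[OF sK(2)] by simp
  then have "AE x in M. x \<in> (\<Union>n. K n)"
    using sK(2) by (intro AE_I[where N="space M - (\<Union>n. K n)"]) (auto simp: emeasure_eq_measure)
  then show ?thesis using that K inc by blast
qed

text \<open>The Fourier transform of the signed measure \<open>G M\<close> determines \<open>G\<close>: tightness of \<open>M\<close> lets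
  Stone--Weierstrass replace trigonometric polynomials by bounded continuous functions.\<close>

lemma AE_zero_of_trig:
  fixes M :: "'a::{banach,second_countable_topology} measure" and G :: "'a \<Rightarrow> real"
  assumes fin: "finite_measure M" and M: "sets M = sets borel" and G: "integrable M G"
    and 0: "\<And>l b. (\<integral>x. G x * cos (blinfun_apply l x + b) \<partial>M) = 0"
  shows "AE x in M. G x = 0"
proof -
  interpret finite_measure M by (rule fin)
  have [measurable]: "G \<in> borel_measurable M" using G by auto
  have cont: "f \<in> borel_measurable M" if "continuous_on UNIV f" for f :: "'a \<Rightarrow> real"
    using borel_measurable_continuous_onI[OF that] unfolding measurable_cong_sets[OF M refl] .
  have int: "integrable M (\<lambda>x. G x * f x)" if "f \<in> borel_measurable M" "\<And>x. \<bar>f x\<bar> \<le> B" for f B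
  proof (rule Bochner_Integration.integrable_bound[OF integrable_mult_left[OF integrable_norm[OF G], of B]])
    show "AE x in M. norm (G x * f x) \<le> norm (norm (G x) * B)"
      using order_trans[OF that(2) abs_ge_self] by (intro AE_I2) (simp add: abs_mult mult_left_mono)
  qed (use that(1) in measurable)
  have trig: "(\<integral>x. G x * p x \<partial>M) = 0" if "trig_poly p" for p
    using that
  proof (induction p rule: trig_poly.induct)
    case (base c l b)
    have "(\<integral>x. G x * (c * cos (blinfun_apply l x + b)) \<partial>M) = c * (\<integral>x. G x * cos (blinfun_apply l x + b) \<partial>M)"
      by (subst integral_mult_right_zero[symmetric]) (simp add: ac_simps)
    then show ?case using 0 by simp
  next
    case (add f g)
    then have "integrable M (\<lambda>x. G x * f x)" "integrable M (\<lambda>x. G x * g x)"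
      using trig_poly_bounded trig_poly_continuous cont int by metis+
    then show ?case using add by (simp add: distrib_left)
  qed
  obtain K where K: "\<And>n. compact (K n)" "incseq K" "AE x in M. x \<in> (\<Union>n. K n)"
    using AE_in_sigma_compact[OF fin M] by blast
  have bcont: "(\<integral>x. G x * f x \<partial>M) = 0" if f: "continuous_on UNIV f" "\<And>x. \<bar>f x\<bar> \<le> B" for f B
  proof -
    obtain p where p: "\<And>n. trig_poly (p n)" "\<And>n x. \<bar>p n x\<bar> \<le> B + 1"
      "\<And>x. x \<in> (\<Union>n. K n) \<Longrightarrow> (\<lambda>n. p n x) \<longlonglongrightarrow> f x"
      using trig_poly_approx_sequence[OF K(1,2) f] by blast
    have [measurable]: "p n \<in> borel_measurable M" "f \<in> borel_measurable M" for n
      using cont f(1) p(1) trig_poly_continuous by blast+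
    have "(\<lambda>n. \<integral>x. G x * p n x \<partial>M) \<longlonglongrightarrow> (\<integral>x. G x * f x \<partial>M)"
    proof (rule integral_dominated_convergence)
      show "integrable M (\<lambda>x. norm (G x) * (B + 1))" using G by auto
      show "AE x in M. (\<lambda>n. G x * p n x) \<longlonglongrightarrow> G x * f x"
        using K(3) by eventually_elim (intro tendsto_mult_left p(3))
      show "AE x in M. norm (G x * p n x) \<le> norm (G x) * (B + 1)" for n
        using p(2) by (auto simp: abs_mult intro!: mult_left_mono)
    qed measurable
    then show ?thesis by (simp add: trig[OF p(1)] LIMSEQ_const_iff)
  qed
  have closed: "(\<integral>x. G x * indicator F x \<partial>M) = 0" if F: "closed F" for F
  proof (cases "F = {}")
    case False
    \<comment> \<open>Continuous functions decreasing to the indicator of \<open>F\<close>;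
      closedness of \<open>F\<close> makes the distance positive off \<open>F\<close>.\<close>
    define f where "f n x = max 0 (1 - real n * infdist x F)" for n x
    have fc: "continuous_on UNIV (f n)" for n unfolding f_def by (intro continuous_intros)
    have fb: "\<bar>f n x\<bar> \<le> 1" for n x by (auto simp: f_def infdist_nonneg)
    have [measurable]: "f n \<in> borel_measurable M" for n using cont fc by blast
    have Fs: "F \<in> sets M" using F M by auto
    note this[measurable]
    have lim: "(\<lambda>n. f n x) \<longlonglongrightarrow> indicator F x" for x
    proof (cases "x \<in> F")
      case True then show ?thesis using infdist_zero[of x F] by (simp add: f_def)
    next
      case False
      then have pos: "infdist x F > 0" using in_closed_iff_infdist_zero[OF F \<open>F \<noteq> {}\<close>] infdist_nonneg[of x F] by (metis less_eq_real_def)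
      obtain N where N: "real N * infdist x F > 1" using pos reals_Archimedean3 by blast
      have "f n x = 0" if "n \<ge> N" for n
      proof -
        have "real N * infdist x F \<le> real n * infdist x F" using that pos by (intro mult_right_mono) auto
        then show ?thesis using N by (simp add: f_def)
      qed
      then have "\<forall>\<^sub>F n in sequentially. f n x = indicator F x" using eventually_ge_at_top[of N]
        by (elim eventually_mono) (simp add: False)
      then show ?thesis by (rule tendsto_eventually)
    qed
    have "(\<lambda>n. \<integral>x. G x * f n x \<partial>M) \<longlonglongrightarrow> (\<integral>x. G x * indicator F x \<partial>M)"
    proof (rule integral_dominated_convergence)
      show "integrable M (\<lambda>x. norm (G x))" using G by auto
      show "AE x in M. norm (G x * f n x) \<le> norm (G x)" for n
        using fb by (auto simp: abs_mult intro!: mult_left_le)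
    qed (auto intro!: tendsto_mult_left lim)
    then show ?thesis by (simp add: bcont[OF fc fb] LIMSEQ_const_iff)
  qed simp
  have sp: "space M = UNIV" using sets_eq_imp_space_eq[OF M] by simp
  \<comment> \<open>Closed sets are stable under intersection and generate the Borel sets, so a
    Dynkin class argument passes from closed sets to all measurable sets.\<close>
  have Int: "Int_stable (Collect closed :: 'a set set)" by (auto simp: Int_stable_def)
  have closed_Pow: "Collect closed \<subseteq> Pow (UNIV :: 'a set)" by auto
  show ?thesis
  proof (rule density_zero[OF G])
    fix A assume "A \<in> sets M"
    then have "A \<in> sigma_sets UNIV (Collect closed)" by (simp add: M borel_eq_closed)
    with Int closed_Pow have "(\<integral>x. G x * indicator A x \<partial>M) = 0"
    proof (induction A rule: sigma_sets_induct_disjoint)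
      case (compl A)
      then have A: "A \<in> sets M" by (simp add: M borel_eq_closed)
      have "(\<integral>x. G x * indicator (UNIV - A) x \<partial>M) = (\<integral>x. G x * indicator UNIV x - G x * indicator A x \<partial>M)"
        by (intro Bochner_Integration.integral_cong) (auto simp: indicator_def)
      also have "\<dots> = (\<integral>x. G x * indicator UNIV x \<partial>M) - (\<integral>x. G x * indicator A x \<partial>M)"
        using A borel_measurable_indicator[OF A] borel_measurable_indicator[of UNIV M]
        by (intro Bochner_Integration.integral_diff int[where B=1]) (auto simp: sp[symmetric])
      finally show ?case using closed[of UNIV] compl by simp
    next
      case (union A)
      have A: "A i \<in> sets M" for i using union(2) by (auto simp: M borel_eq_closed)
      have "(LINT x:(\<Union>i. A i)|M. G x) = (\<Sum>i. (LINT x:(A i)|M. G x))"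
      proof (rule lebesgue_integral_countable_add)
        show "A i \<inter> A j = {}" if "i \<noteq> j" for i j using union(1) that by (auto simp: disjoint_family_on_def)
        show "set_integrable M (\<Union>i. A i) G" unfolding set_integrable_def using A G
          by (intro integrable_mult_indicator) auto
      qed (use A in auto)
      then show ?case using union(3) by (simp add: set_lebesgue_integral_def mult.commute)
    qed (auto intro: closed)
    then show "(LINT x:A|M. G x) = 0" by (simp add: set_lebesgue_integral_def mult.commute)
  qed
qed

section \<open>Integration tools\<close>

text \<open>The Lipschitz bound dominates the difference quotients. The set \<open>S\<close> allows
  a one-sided derivative, which is what integration over translates in {0..r} with r nonnegative
  provides later.\<close>

lemma has_real_derivative_integral:
  fixes F :: "real \<Rightarrow> 'a \<Rightarrow> real"
  assumes F: "\<And>r. integrable M (F r)" and F': "F' \<in> borel_measurable M" and B: "integrable M B"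
    and deriv: "\<And>x. ((\<lambda>r. F r x) has_real_derivative F' x) (at 0 within S)"
    and bound: "\<And>r x. r \<in> S \<Longrightarrow> \<bar>F r x - F 0 x\<bar> \<le> \<bar>r\<bar> * B x"
  shows "((\<lambda>r. \<integral>x. F r x \<partial>M) has_real_derivative (\<integral>x. F' x \<partial>M)) (at 0 within S)"
  unfolding has_field_derivative_iff tendsto_at_iff_sequentially
proof (intro allI impI)
  fix X :: "nat \<Rightarrow> real" assume X: "\<forall>i. X i \<in> S - {0}" "X \<longlonglongrightarrow> 0"
  have [measurable]: "F r \<in> borel_measurable M" for r using F by blast
  note F'[measurable]
  have "(\<lambda>n. \<integral>x. (F (X n) x - F 0 x) / X n \<partial>M) \<longlonglongrightarrow> (\<integral>x. F' x \<partial>M)"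
  proof (rule integral_dominated_convergence[where w=B])
    show "AE x in M. (\<lambda>n. (F (X n) x - F 0 x) / X n) \<longlonglongrightarrow> F' x"
      using deriv X unfolding has_field_derivative_iff tendsto_at_iff_sequentially comp_def by auto
    show "AE x in M. norm ((F (X n) x - F 0 x) / X n) \<le> B x" for n
      using bound[of "X n"] X(1) by (intro AE_I2) (auto simp: abs_divide divide_le_eq mult.commute)
  qed (use B in \<open>auto simp: measurable\<close>)
  then show "((\<lambda>y. ((\<integral>x. F y x \<partial>M) - (\<integral>x. F 0 x \<partial>M)) / (y - 0)) \<circ> X) \<longlonglongrightarrow> (\<integral>x. F' x \<partial>M)"
    using F by (simp add: comp_def Bochner_Integration.integral_diff)
qed

lemma integrable_of_norm_le:
  fixes f :: "'a \<Rightarrow> 'b::{banach,second_countable_topology}"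
  assumes "integrable M g" "f \<in> borel_measurable M" "\<And>x. norm (f x) \<le> g x"
  shows "integrable M f"
  by (rule Bochner_Integration.integrable_bound[OF assms(1,2)])
    (use assms(3) in \<open>auto intro!: AE_I2 order_trans[OF assms(3) abs_ge_self]\<close>)

lemma abs_mult_le_squares: "\<bar>a * b\<bar> \<le> a\<^sup>2 + (b::real)\<^sup>2"
proof -
  have "2 * (\<bar>a\<bar> * \<bar>b\<bar>) \<le> \<bar>a\<bar>\<^sup>2 + \<bar>b\<bar>\<^sup>2" by (metis mult.assoc sum_squares_bound)
  moreover have "0 \<le> \<bar>a\<bar> * \<bar>b\<bar>" by simp
  ultimately show ?thesis unfolding abs_mult power2_abs by linarith
qed

lemma integrable_mult_squares:
  fixes f g :: "'a \<Rightarrow> real"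
  assumes [measurable]: "f \<in> borel_measurable M" "g \<in> borel_measurable M"
    and "integrable M (\<lambda>x. (f x)\<^sup>2)" "integrable M (\<lambda>x. (g x)\<^sup>2)"
  shows "integrable M (\<lambda>x. f x * g x)"
  by (rule integrable_of_norm_le[where g="\<lambda>x. (f x)\<^sup>2 + (g x)\<^sup>2"])
    (use assms abs_mult_le_squares in auto)

lemma integrable_add_squares:
  fixes f g :: "'a \<Rightarrow> real"
  assumes [measurable]: "f \<in> borel_measurable M" "g \<in> borel_measurable M"
    and "integrable M (\<lambda>x. (f x)\<^sup>2)" "integrable M (\<lambda>x. (g x)\<^sup>2)"
  shows "integrable M (\<lambda>x. (f x + g x)\<^sup>2)" "integrable M (\<lambda>x. (f x - g x)\<^sup>2)"
  using integrable_mult_squares[OF assms] assms(3,4)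
  by (auto simp: power2_sum power2_diff mult.assoc)

lemma integral_Cauchy_Schwarz:
  fixes f g :: "'a \<Rightarrow> real"
  assumes [measurable]: "f \<in> borel_measurable M" "g \<in> borel_measurable M"
    and f: "integrable M (\<lambda>x. (f x)\<^sup>2)" and g: "integrable M (\<lambda>x. (g x)\<^sup>2)"
  shows "(\<integral>x. f x * g x \<partial>M)\<^sup>2 \<le> (\<integral>x. (f x)\<^sup>2 \<partial>M) * (\<integral>x. (g x)\<^sup>2 \<partial>M)"
proof -
  note fg = integrable_mult_squares[OF assms]
  have *: "0 \<le> (\<integral>x. (f x)\<^sup>2 \<partial>M) - 2 * t * (\<integral>x. f x * g x \<partial>M) + t\<^sup>2 * (\<integral>x. (g x)\<^sup>2 \<partial>M)" for t
  proof -
    have "0 \<le> (\<integral>x. (f x - t * g x)\<^sup>2 \<partial>M)" by simp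
    also have "(\<lambda>x. (f x - t * g x)\<^sup>2) = (\<lambda>x. (f x)\<^sup>2 - 2 * t * (f x * g x) + t\<^sup>2 * (g x)\<^sup>2)"
      by (auto simp: power2_diff power_mult_distrib algebra_simps)
    finally show ?thesis using f g fg by simp
  qed
  show ?thesis
  proof (cases "(\<integral>x. (g x)\<^sup>2 \<partial>M) = 0")
    case True
    then have "AE x in M. (g x)\<^sup>2 = 0" using g by (simp add: integral_nonneg_eq_0_iff_AE)
    then have "AE x in M. f x * g x = 0" by eventually_elim simp
    then have "(\<integral>x. f x * g x \<partial>M) = 0" by (simp add: integral_eq_zero_AE)
    then show ?thesis using True by simp
  next
    case False
    moreover have "0 \<le> (\<integral>x. (g x)\<^sup>2 \<partial>M)" by simp
    ultimately have pos: "(\<integral>x. (g x)\<^sup>2 \<partial>M) > 0" by linarith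
    show ?thesis using *[of "(\<integral>x. f x * g x \<partial>M) / (\<integral>x. (g x)\<^sup>2 \<partial>M)"] pos
      by (simp add: field_simps power2_eq_square)
  qed
qed

text \<open>Fatou's lemma. It bounds the limit without presupposing its integrability, and is the
  way integrability of limits is obtained below.\<close>

lemma nn_integral_le_of_AE_tendsto:
  fixes u :: "nat \<Rightarrow> 'a \<Rightarrow> real"
  assumes [measurable]: "\<And>n. u n \<in> borel_measurable M"
    and lim: "AE x in M. (\<lambda>n. u n x) \<longlonglongrightarrow> v x"
    and le: "\<forall>\<^sub>F n in sequentially. (\<integral>\<^sup>+x. ennreal (u n x) \<partial>M) \<le> C"
  shows "(\<integral>\<^sup>+x. ennreal (v x) \<partial>M) \<le> C"
proof -
  have "(\<integral>\<^sup>+x. ennreal (v x) \<partial>M) = (\<integral>\<^sup>+x. liminf (\<lambda>n. ennreal (u n x)) \<partial>M)"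
    using lim by (intro nn_integral_cong_AE, eventually_elim)
      (auto intro!: lim_imp_Liminf[symmetric] tendsto_ennrealI)
  also have "\<dots> \<le> liminf (\<lambda>n. \<integral>\<^sup>+x. ennreal (u n x) \<partial>M)"
    by (rule nn_integral_liminf) measurable
  also have "\<dots> \<le> C" using le by (intro Liminf_le) auto
  finally show ?thesis .
qed

lemma AE_subseq_of_nn_integral:
  fixes u :: "nat \<Rightarrow> 'a \<Rightarrow> real"
  assumes [measurable]: "\<And>n. u n \<in> borel_measurable M" and p: "p > 0"
    and lim: "(\<lambda>n. \<integral>\<^sup>+x. ennreal (\<bar>u n x\<bar> powr p) \<partial>M) \<longlonglongrightarrow> 0"
  obtains r where "strict_mono r" "AE x in M. (\<lambda>n. u (r n) x) \<longlonglongrightarrow> 0"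
proof -
  have "\<forall>\<^sub>F n in sequentially. (\<integral>\<^sup>+x. ennreal (\<bar>u n x\<bar> powr p) \<partial>M) < 1"
    using order_tendstoD(2)[OF lim] by simp
  then obtain N where N: "\<And>n. n \<ge> N \<Longrightarrow> (\<integral>\<^sup>+x. ennreal (\<bar>u n x\<bar> powr p) \<partial>M) < 1"
    by (auto simp: eventually_sequentially)
  \<comment> \<open>The first \<open>N\<close> terms are dropped because their integrals may be
    infinite; the remaining terms are integrable and converge in L^1.\<close>
  define v where "v n x = \<bar>u (n + N) x\<bar> powr p" for n x
  have [measurable]: "v n \<in> borel_measurable M" for n unfolding v_def by measurable
  have fin: "(\<integral>\<^sup>+x. ennreal (v n x) \<partial>M) < 1" for n using N[of "n + N"] by (simp add: v_def)
  have int: "integrable M (v n)" for n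
    using fin[of n] by (intro integrableI_nonneg) (auto simp: v_def intro: less_trans)
  have "(\<lambda>n. \<integral>\<^sup>+x. ennreal (v n x) \<partial>M) \<longlonglongrightarrow> 0"
    unfolding v_def by (rule LIMSEQ_ignore_initial_segment[OF lim])
  moreover have "(\<integral>\<^sup>+x. ennreal (v n x) \<partial>M) = ennreal (\<integral>x. v n x \<partial>M)" for n
    by (intro nn_integral_eq_integral int) (auto simp: v_def)
  moreover have v0: "v n x \<ge> 0" for n x by (simp add: v_def)
  ultimately have "(\<lambda>n. \<integral>x. v n x \<partial>M) \<longlonglongrightarrow> 0"
    by (simp add: ennreal_0[symmetric] del: ennreal_0)
  then have "(\<lambda>n. \<integral>x. norm (v n x) \<partial>M) \<longlonglongrightarrow> 0" using v0 by simp
  then obtain r where r: "strict_mono r" "AE x in M. (\<lambda>n. v (r n) x) \<longlonglongrightarrow> 0"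
    using tendsto_L1_AE_subseq[of M v] int by auto
  show ?thesis
  proof (rule that[of "\<lambda>n. r n + N"])
    show "strict_mono (\<lambda>n. r n + N)" using r(1) by (simp add: strict_mono_def)
    show "AE x in M. (\<lambda>n. u (r n + N) x) \<longlonglongrightarrow> 0" using r(2)
    proof eventually_elim
      case (elim x)
      then have "(\<lambda>n. (v (r n) x) powr (1/p)) \<longlonglongrightarrow> 0 powr (1/p)"
        using p by (intro tendsto_powr'[OF _ tendsto_const]) (auto simp: v_def)
      then have "(\<lambda>n. \<bar>u (r n + N) x\<bar>) \<longlonglongrightarrow> 0"
        using p by (simp add: v_def powr_powr)
      then show ?case by (rule tendsto_rabs_zero_cancel)
    qed
  qed
qed

section \<open>Gaussian functionals\<close>

locale gaussian =
  fixes \<mu> :: "'a::{banach,second_countable_topology} measure"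
  assumes gauss: "nondegenerate_centered_gaussian \<mu>"
begin

lemma prob: "prob_space \<mu>" and sets_mu: "sets \<mu> = sets borel"
  using gauss by (auto simp: nondegenerate_centered_gaussian_def)

sublocale prob_space \<mu> by (rule prob)

lemma space_mu [simp]: "space \<mu> = UNIV"
  using sets_eq_imp_space_eq[OF sets_mu] by simp

lemma measurable_mu_iff: "f \<in> measurable \<mu> N \<longleftrightarrow> f \<in> measurable borel N"
  using measurable_cong_sets[OF sets_mu refl] by blast

lemma continuous_measurable: "continuous_on UNIV f \<Longrightarrow> f \<in> borel_measurable \<mu>"
  by (simp add: measurable_mu_iff borel_measurable_continuous_onI)

lemma blinfun_measurable [measurable]: "blinfun_apply l \<in> borel_measurable \<mu>"
  by (intro continuous_measurable continuous_intros)

definition var :: "('a \<Rightarrow>\<^sub>L real) \<Rightarrow> real" where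
  "var l = (\<integral>x. (blinfun_apply l x)\<^sup>2 \<partial>\<mu>)"

definition cov :: "('a \<Rightarrow>\<^sub>L real) \<Rightarrow> ('a \<Rightarrow>\<^sub>L real) \<Rightarrow> real" where
  "cov l m = (\<integral>x. blinfun_apply l x * blinfun_apply m x \<partial>\<mu>)"

lemma var_nonneg: "var l \<ge> 0" by (simp add: var_def)

lemma gaussian_law:
  assumes "l \<noteq> 0"
  obtains \<sigma> where "\<sigma> > 0" "distributed \<mu> lborel (blinfun_apply l) (normal_density 0 \<sigma>)"
proof -
  obtain \<sigma> where \<sigma>: "\<sigma> > 0" "distr \<mu> borel (blinfun_apply l) = density lborel (\<lambda>r. ennreal (normal_density 0 \<sigma> r))"
    using gauss assms by (auto simp: nondegenerate_centered_gaussian_def)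
  have "distr \<mu> lborel (blinfun_apply l) = distr \<mu> borel (blinfun_apply l)"
    by (rule distr_cong) auto
  then show ?thesis using that \<sigma> by (auto simp: distributed_def)
qed

text \<open>The zero functional has a Dirac law and is treated apart. The even moments matter
  because they are fixed multiples of powers of the variance: for functionals, L^2 estimates become
  L^(2m) estimates.\<close>

lemma gaussian_moments:
  fixes l :: "'a \<Rightarrow>\<^sub>L real"
  shows integrable_power: "integrable \<mu> (\<lambda>x. (blinfun_apply l x) ^ k)"
    and even_moment: "(\<integral>x. (blinfun_apply l x) ^ (2 * m) \<partial>\<mu>) = fact (2 * m) / (2 ^ m * fact m) * var l ^ m"
    and integral_cos: "(\<integral>x. cos (blinfun_apply l x + b) \<partial>\<mu>) = cos b * exp (- var l / 2)"
proof (atomize (full), cases "l = 0")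
  case True
  then show "integrable \<mu> (\<lambda>x. (blinfun_apply l x) ^ k) \<and>
    (\<integral>x. (blinfun_apply l x) ^ (2 * m) \<partial>\<mu>) = fact (2 * m) / (2 ^ m * fact m) * var l ^ m \<and>
    (\<integral>x. cos (blinfun_apply l x + b) \<partial>\<mu>) = cos b * exp (- var l / 2)"
    by (cases m) (auto simp: var_def prob_space[simplified])
next
  case False
  then obtain \<sigma> where \<sigma>: "\<sigma> > 0" and D: "distributed \<mu> lborel (blinfun_apply l) (normal_density 0 \<sigma>)"
    by (rule gaussian_law)
  have int: "integrable \<mu> (\<lambda>x. (blinfun_apply l x) ^ k)" for k
    using distributed_integrable[OF D, of "\<lambda>y. y ^ k"] integrable_normal_moment[OF \<sigma>, of 0 k] by simp
  have mom: "(\<integral>x. (blinfun_apply l x) ^ (2 * m) \<partial>\<mu>) = fact (2 * m) / ((2 / \<sigma>\<^sup>2) ^ m * fact m)" for m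
    using distributed_integral[OF D, of "\<lambda>y. y ^ (2 * m)"] integral_normal_moment_even[OF \<sigma>, of 0 m] by simp
  have var: "var l = \<sigma>\<^sup>2" using mom[of 1] \<sigma> by (simp add: var_def)
  have "distributed \<mu> lborel (\<lambda>x. (blinfun_apply l x - 0) / \<sigma>) std_normal_density"
    using normal_standard_normal_convert[OF \<sigma>, of "blinfun_apply l" 0] D by simp
  then have "distr \<mu> lborel (\<lambda>x. blinfun_apply l x / \<sigma>) = density lborel std_normal_density"
    by (simp add: distributed_def)
  moreover have "distr \<mu> lborel (\<lambda>x. blinfun_apply l x / \<sigma>) = distr \<mu> borel (\<lambda>x. blinfun_apply l x / \<sigma>)"
    by (rule distr_cong) auto
  \<comment> \<open>The characteristic function of \<open>l\<close> divided by \<sigma>, evaluated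
    at \<sigma>, is that of \<open>l\<close> at 1.\<close>
  ultimately have "char (distr \<mu> borel (\<lambda>x. blinfun_apply l x / \<sigma>)) \<sigma> = of_real (exp (- (\<sigma>\<^sup>2) / 2))"
    using char_std_normal_distribution by simp
  then have *: "(\<integral>x. iexp (blinfun_apply l x) \<partial>\<mu>) = of_real (exp (- (\<sigma>\<^sup>2) / 2))"
    unfolding char_def using \<sigma> by (subst (asm) integral_distr) auto
  have ie: "integrable \<mu> (\<lambda>x. iexp (blinfun_apply l x))"
    by (rule integrable_const_bound[of _ 1]) auto
  have c: "(\<integral>x. cos (blinfun_apply l x) \<partial>\<mu>) = exp (- (\<sigma>\<^sup>2) / 2)"
    using integral_Re[OF ie] * by (simp add: Re_exp)
  have s: "(\<integral>x. sin (blinfun_apply l x) \<partial>\<mu>) = 0"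
    using integral_Im[OF ie] * by (simp add: Im_exp)
  have "integrable \<mu> (\<lambda>x. cos (blinfun_apply l x))" "integrable \<mu> (\<lambda>x. sin (blinfun_apply l x))"
    by (rule integrable_const_bound[of _ 1]; auto)+
  then have "(\<integral>x. cos (blinfun_apply l x + b) \<partial>\<mu>) = cos b * exp (- var l / 2)"
    by (simp add: cos_add c s var)
  then show "integrable \<mu> (\<lambda>x. (blinfun_apply l x) ^ k) \<and>
    (\<integral>x. (blinfun_apply l x) ^ (2 * m) \<partial>\<mu>) = fact (2 * m) / (2 ^ m * fact m) * var l ^ m \<and>
    (\<integral>x. cos (blinfun_apply l x + b) \<partial>\<mu>) = cos b * exp (- var l / 2)"
    using int mom by (simp add: var power_divide)
qed

lemma integrable_square: "integrable \<mu> (\<lambda>x. (blinfun_apply (l :: 'a \<Rightarrow>\<^sub>L real) x)\<^sup>2)"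
  by (rule integrable_power)

lemma var_add_scaled: "var (l + s *\<^sub>R m) = var l + 2 * s * cov l m + s\<^sup>2 * var m"
proof -
  have "(\<lambda>x. (blinfun_apply (l + s *\<^sub>R m) x)\<^sup>2) = (\<lambda>x. (blinfun_apply l x)\<^sup>2
      + 2 * s * (blinfun_apply l x * blinfun_apply m x) + s\<^sup>2 * (blinfun_apply m x)\<^sup>2)"
    by (auto simp: blinfun.add_left blinfun.scaleR_left power2_sum power_mult_distrib algebra_simps)
  moreover have "integrable \<mu> (\<lambda>x. blinfun_apply l x * blinfun_apply m x)"
    by (rule integrable_mult_squares) (auto intro: integrable_square)
  ultimately show ?thesis using integrable_square[of l] integrable_square[of m]
    by (simp add: var_def cov_def)
qed

text \<open>Gaussian integration by parts for plane waves: differentiate the characteristic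
  functional at \<open>l\<close> in the direction \<open>m\<close>.\<close>

lemma integral_functional_cos:
  "(\<integral>x. blinfun_apply m x * cos (blinfun_apply l x + b) \<partial>\<mu>) = - cov l m * sin b * exp (- var l / 2)"
proof -
  \<comment> \<open>The phase shift by pi/2 turns the cosine into a sine, whose derivative in
    \<open>s\<close> at 0 is the integrand sought, while \<open>integral_cos\<close> still computes
    the integral.\<close>
  define F where "F s x = cos (blinfun_apply (l + s *\<^sub>R m) x + (b - pi / 2))" for s x
  have F: "F s x = sin (blinfun_apply l x + s * blinfun_apply m x + b)" for s x
  proof -
    have "cos (y - pi / 2) = sin y" for y :: real by (simp add: cos_diff)
    from this[of "blinfun_apply l x + s * blinfun_apply m x + b"] show ?thesis
      by (simp add: F_def blinfun.add_left blinfun.scaleR_left add_diff_eq)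
  qed
  have int: "integrable \<mu> (F s)" for s
    unfolding F_def by (rule integrable_const_bound[of _ 1]) auto
  have iB: "integrable \<mu> (\<lambda>x. \<bar>blinfun_apply m x\<bar>)"
    using integrable_power[of m 1] by simp
  have "((\<lambda>r. \<integral>x. F r x \<partial>\<mu>) has_real_derivative
      (\<integral>x. blinfun_apply m x * cos (blinfun_apply l x + b) \<partial>\<mu>)) (at 0 within UNIV)"
  proof (rule has_real_derivative_integral[OF int _ iB])
    show "((\<lambda>r. F r x) has_real_derivative blinfun_apply m x * cos (blinfun_apply l x + b)) (at 0)" for x
      unfolding F by (auto intro!: derivative_eq_intros)
    show "\<bar>F r x - F 0 x\<bar> \<le> \<bar>r\<bar> * \<bar>blinfun_apply m x\<bar>" for r x
    proof -
      have "\<bar>F r x - F 0 x\<bar> = \<bar>2 * sin (r * blinfun_apply m x / 2) * cos ((2 * blinfun_apply l x + r * blinfun_apply m x + 2 * b) / 2)\<bar>"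
        unfolding F sin_diff_sin by (simp add: algebra_simps)
      also have "\<dots> \<le> \<bar>2 * sin (r * blinfun_apply m x / 2)\<bar> * 1"
        unfolding abs_mult by (intro mult_left_mono) auto
      also have "\<dots> \<le> 2 * \<bar>r * blinfun_apply m x / 2\<bar>"
        using abs_sin_x_le_abs_x[of "r * blinfun_apply m x / 2"] by (simp add: abs_mult)
      finally show ?thesis by (simp add: abs_mult)
    qed
  qed auto
  moreover have "(\<lambda>r. \<integral>x. F r x \<partial>\<mu>) = (\<lambda>r. sin b * exp (- (var l + 2 * r * cov l m + r\<^sup>2 * var m) / 2))"
    unfolding F_def by (simp add: integral_cos var_add_scaled cos_diff)
  moreover have "((\<lambda>r. sin b * exp (- (var l + 2 * r * cov l m + r\<^sup>2 * var m) / 2)) has_real_derivative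
      - cov l m * sin b * exp (- var l / 2)) (at 0)"
    by (auto intro!: derivative_eq_intros)
  ultimately show ?thesis using DERIV_unique by fastforce
qed

lemma cos_ge_parabola: "1 - y\<^sup>2 / 2 \<le> cos (y::real)"
proof -
  have "\<bar>sin (y / 2)\<bar>\<^sup>2 \<le> \<bar>y / 2\<bar>\<^sup>2" by (intro power_mono abs_sin_x_le_abs_x) auto
  then show ?thesis using cos_double_sin[of "y / 2"] by (simp add: power_divide)
qed

text \<open>Bounded variances on the unit ball need only \<open>\<mu>(ball 0 R) \<ge> 7/8\<close> for some \<open>R\<close>, not Fernique's theorem.\<close>

lemma var_bounded:
  obtains K where "K \<ge> 0" "\<And>l. norm l \<le> 1 \<Longrightarrow> var l \<le> K"
proof -
  have "(\<lambda>n. measure \<mu> (cball 0 (real n))) \<longlonglongrightarrow> measure \<mu> (\<Union>n. cball 0 (real n))"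
    by (rule finite_Lim_measure_incseq) (auto simp: sets_mu incseq_def)
  moreover have "(\<Union>n. cball (0::'a) (real n)) = UNIV"
    using real_arch_simple by auto
  ultimately have "(\<lambda>n. measure \<mu> (cball 0 (real n))) \<longlonglongrightarrow> 1" using prob_space by simp
  then have "\<forall>\<^sub>F n in sequentially. measure \<mu> (cball 0 (real n)) > 7 / 8"
    by (rule order_tendstoD(1)) simp
  then obtain n0 where n0: "\<And>n. n \<ge> n0 \<Longrightarrow> measure \<mu> (cball 0 (real n)) > 7 / 8"
    by (auto simp: eventually_sequentially)
  define R where "R = real (Suc n0)"
  have R: "R > 0" and P: "measure \<mu> (cball 0 R) > 7 / 8" using n0[of "Suc n0"] by (auto simp: R_def)
  have B: "cball 0 R \<in> sets \<mu>" by (simp add: sets_mu)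
  show ?thesis
  proof (rule that[of "R\<^sup>2 * (2 * ln 4)"])
    fix l :: "'a \<Rightarrow>\<^sub>L real" assume l: "norm l \<le> 1"
    define m where "m = (1 / R) *\<^sub>R l"
    \<comment> \<open>On the ball the scaled functional is at most 1 in absolute value, so its
      cosine is at least 1/2; elsewhere it is at least -1. Integration gives more than 7/8 times 3/2
      minus 1, that is 5/16, which exceeds the 1/4 used below.\<close>
    have "indicator (cball 0 R) x * (3/2) - 1 \<le> cos (blinfun_apply m x + 0)" for x
    proof (cases "x \<in> cball 0 R")
      case True
      have "\<bar>blinfun_apply l x\<bar> \<le> R"
        using norm_blinfun[of l x] l True mult_mono[of "norm l" 1 "norm x" R] by auto
      then have "\<bar>blinfun_apply m x\<bar> \<le> 1"
        using R by (simp add: m_def blinfun.scaleR_left abs_mult)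
      then have "(blinfun_apply m x)\<^sup>2 \<le> 1" by (simp add: abs_square_le_1)
      then show ?thesis using True cos_ge_parabola[of "blinfun_apply m x"] by simp
    qed simp
    then have "(\<integral>x. indicator (cball 0 R) x * (3/2) - 1 \<partial>\<mu>) \<le> (\<integral>x. cos (blinfun_apply m x + 0) \<partial>\<mu>)"
      using B by (intro integral_mono integrable_const_bound[of _ 1] Bochner_Integration.integrable_diff
          integrable_mult_left integrable_real_indicator) (auto simp: emeasure_eq_measure)
    also have "\<dots> = exp (- var m / 2)" using integral_cos[of m 0] by simp
    finally have "measure \<mu> (cball 0 R) * (3/2) - 1 \<le> exp (- var m / 2)"
      using B prob_space by (subst (asm) Bochner_Integration.integral_diff) (auto simp: emeasure_eq_measure)
    then have "1 / 4 \<le> exp (- var m / 2)" using P by simp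
    then have "ln (1 / 4) \<le> ln (exp (- var m / 2))" by (subst ln_le_cancel_iff) auto
    then have "ln (1 / 4) \<le> - var m / 2" by simp
    then have "var m \<le> 2 * ln 4" by (simp add: ln_div)
    moreover have "var m = var l / R\<^sup>2"
      by (simp add: var_def m_def blinfun.scaleR_left power_divide)
    ultimately show "var l \<le> R\<^sup>2 * (2 * ln 4)" using R by (simp add: field_simps)
  qed auto
qed

lemma Lp_space_2_iff: "g \<in> Lp_space M 2 \<longleftrightarrow> g \<in> borel_measurable M \<and> integrable M (\<lambda>x. (norm (g x))\<^sup>2)"
  by (simp add: Lp_space_def)

lemma integrable_of_square:
  fixes g :: "'a \<Rightarrow> real"
  assumes [measurable]: "g \<in> borel_measurable \<mu>" and "integrable \<mu> (\<lambda>x. (g x)\<^sup>2)"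
  shows "integrable \<mu> g"
  using integrable_mult_squares[OF assms(1) borel_measurable_const[of 1] assms(2)] by simp

text \<open>The Pettis integral of \<open>g(y) y\<close> is the norm limit of the Bochner integrals over balls: the tails
  are small uniformly over the unit ball of the dual because the variances are bounded there.\<close>

lemma pettis_integral_exists:
  fixes g :: "'a \<Rightarrow> real"
  assumes [measurable]: "g \<in> borel_measurable \<mu>" and g2: "integrable \<mu> (\<lambda>x. (g x)\<^sup>2)"
  obtains x where "\<And>l :: 'a \<Rightarrow>\<^sub>L real. blinfun_apply l x = (\<integral>y. g y * blinfun_apply l y \<partial>\<mu>)"
proof -
  obtain K where K: "K \<ge> 0" "\<And>l. norm l \<le> 1 \<Longrightarrow> var l \<le> K" using var_bounded by blast
  note g1 = integrable_of_square[OF assms]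
  define g' where "g' n y = indicator (cball 0 (real n)) y * g y" for n y
  have [measurable]: "cball 0 r \<in> sets \<mu>" for r :: real by (simp add: sets_mu)
  have [measurable]: "g' n \<in> borel_measurable \<mu>" for n unfolding g'_def by measurable
  have [measurable]: "(\<lambda>y. y) \<in> borel_measurable \<mu>" by (simp add: measurable_mu_iff)
  have g'2: "integrable \<mu> (\<lambda>y. (g' n y)\<^sup>2)" for n
    by (rule integrable_of_norm_le[OF g2]) (auto simp: g'_def indicator_def)
  define X where "X n = (\<integral>y. g' n y *\<^sub>R y \<partial>\<mu>)" for n
  have intX: "integrable \<mu> (\<lambda>y. g' n y *\<^sub>R y)" for n
  proof (rule integrable_of_norm_le)
    show "integrable \<mu> (\<lambda>y. \<bar>g y\<bar> * real n)" using g1 by auto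
    show "norm (g' n y *\<^sub>R y) \<le> \<bar>g y\<bar> * real n" for y
      by (auto simp: g'_def indicator_def intro: mult_left_mono)
  qed measurable
  have lX: "blinfun_apply l (X n) = (\<integral>y. g' n y * blinfun_apply l y \<partial>\<mu>)" for l :: "'a \<Rightarrow>\<^sub>L real" and n
    unfolding X_def using integral_bounded_linear[OF blinfun.bounded_linear_right[of l] intX[of n]]
    by (simp add: blinfun.scaleR_right)
  have lim: "(\<lambda>n. \<integral>y. (g' n y - g y)\<^sup>2 \<partial>\<mu>) \<longlonglongrightarrow> (\<integral>y. 0 \<partial>\<mu>)"
  proof (rule integral_dominated_convergence[OF _ _ g2])
    have "(\<lambda>n. (g' n y - g y)\<^sup>2) \<longlonglongrightarrow> 0" for y
    proof -
      obtain N where "norm y \<le> real N" using real_arch_simple by blast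
      then have "\<forall>\<^sub>F n in sequentially. (g' n y - g y)\<^sup>2 = 0"
        using eventually_ge_at_top[of N] by (elim eventually_mono) (auto simp: g'_def indicator_def)
      then show ?thesis by (rule tendsto_eventually)
    qed
    then show "AE y in \<mu>. (\<lambda>n. (g' n y - g y)\<^sup>2) \<longlonglongrightarrow> 0" by simp
    show "AE y in \<mu>. norm ((g' n y - g y)\<^sup>2) \<le> (g y)\<^sup>2" for n by (auto simp: g'_def indicator_def)
  qed measurable
  have bound: "(blinfun_apply l (X n) - (\<integral>y. g y * blinfun_apply l y \<partial>\<mu>))\<^sup>2 \<le> (\<integral>y. (g' n y - g y)\<^sup>2 \<partial>\<mu>) * K"
    if "norm l \<le> 1" for l :: "'a \<Rightarrow>\<^sub>L real" and n
  proof -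
    have "blinfun_apply l (X n) - (\<integral>y. g y * blinfun_apply l y \<partial>\<mu>) = (\<integral>y. (g' n y - g y) * blinfun_apply l y \<partial>\<mu>)"
      unfolding lX left_diff_distrib
      by (subst Bochner_Integration.integral_diff) (auto intro!: integrable_mult_squares g2 g'2 integrable_square)
    then have "(blinfun_apply l (X n) - (\<integral>y. g y * blinfun_apply l y \<partial>\<mu>))\<^sup>2 \<le> (\<integral>y. (g' n y - g y)\<^sup>2 \<partial>\<mu>) * var l"
      unfolding var_def by (simp, intro integral_Cauchy_Schwarz)
        (auto intro!: integrable_add_squares g2 g'2 integrable_square)
    also have "\<dots> \<le> (\<integral>y. (g' n y - g y)\<^sup>2 \<partial>\<mu>) * K" by (intro mult_left_mono K that) auto
    finally show ?thesis .
  qed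
  define d where "d n = sqrt ((\<integral>y. (g' n y - g y)\<^sup>2 \<partial>\<mu>) * K)" for n
  have "(\<lambda>n. sqrt ((\<integral>y. (g' n y - g y)\<^sup>2 \<partial>\<mu>) * K)) \<longlonglongrightarrow> sqrt (0 * K)"
    using lim by (intro tendsto_intros) simp
  then have d: "d \<longlonglongrightarrow> 0" by (simp add: d_def[abs_def])
  have bound': "\<bar>blinfun_apply l (X n) - (\<integral>y. g y * blinfun_apply l y \<partial>\<mu>)\<bar> \<le> d n"
    if "norm l \<le> 1" for l :: "'a \<Rightarrow>\<^sub>L real" and n
    unfolding d_def using real_sqrt_le_mono[OF bound[OF that, of n]] by simp
  have XX: "norm (X m - X n) \<le> d m + d n" for m n
  proof -
    \<comment> \<open>A norming functional converts the uniform estimate over the unit ball of the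
      dual into a norm estimate.\<close>
    obtain l :: "'a \<Rightarrow>\<^sub>L real" where l: "norm l \<le> 1" "blinfun_apply l (X m - X n) = norm (X m - X n)"
      by (rule norming_functional)
    then show ?thesis using bound'[OF l(1), of m] bound'[OF l(1), of n] by (simp add: blinfun.diff_right)
  qed
  have "Cauchy X"
  proof (rule CauchyI)
    fix e :: real assume "e > 0"
    then have "\<forall>\<^sub>F n in sequentially. d n < e / 2" using order_tendstoD(2)[OF d, of "e/2"] by simp
    then obtain N where "\<And>n. n \<ge> N \<Longrightarrow> d n < e / 2" by (auto simp: eventually_sequentially)
    then show "\<exists>M. \<forall>m\<ge>M. \<forall>n\<ge>M. norm (X m - X n) < e" using XX by (intro exI[of _ N]) (smt (verit) field_sum_of_halves)
  qed
  then obtain x where x: "X \<longlonglongrightarrow> x" using Cauchy_convergent_iff convergent_def by blast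
  show ?thesis
  proof (rule that[of x])
    fix l :: "'a \<Rightarrow>\<^sub>L real"
    \<comment> \<open>The estimate is available for functionals of norm at most 1; adding 1 keeps
      the divisor positive when \<open>l\<close> is zero.\<close>
    define c where "c = norm l + 1"
    have c: "c > 0" by (simp add: c_def add_nonneg_pos)
    define m where "m = (1 / c) *\<^sub>R l"
    have "norm m \<le> 1" using c by (simp add: m_def c_def field_simps)
    then have "(\<lambda>n. blinfun_apply m (X n) - (\<integral>y. g y * blinfun_apply m y \<partial>\<mu>)) \<longlonglongrightarrow> 0"
      using bound' by (intro tendsto_0_le[OF d, where K=1] always_eventually) (auto intro: order_trans[OF _ abs_ge_self])
    then have "(\<lambda>n. blinfun_apply m (X n)) \<longlonglongrightarrow> (\<integral>y. g y * blinfun_apply m y \<partial>\<mu>)" by (simp add: LIM_zero_iff)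
    moreover have "(\<lambda>n. blinfun_apply m (X n)) \<longlonglongrightarrow> blinfun_apply m x" by (intro tendsto_intros x)
    ultimately have "blinfun_apply m x = (\<integral>y. g y * blinfun_apply m y \<partial>\<mu>)" using LIMSEQ_unique by blast
    then show "blinfun_apply l x = (\<integral>y. g y * blinfun_apply l y \<partial>\<mu>)"
      using c by (simp add: m_def blinfun.scaleR_left)
  qed
qed

lemma Xstar_closureD:
  assumes "g \<in> Xstar_closure \<mu>"
  shows "g \<in> borel_measurable \<mu>" "integrable \<mu> (\<lambda>x. (g x)\<^sup>2)"
    "\<exists>L. (\<lambda>n. \<integral>x. (g x - blinfun_apply (L n) x)\<^sup>2 \<partial>\<mu>) \<longlonglongrightarrow> 0"
proof -
  show g: "g \<in> borel_measurable \<mu>" "integrable \<mu> (\<lambda>x. (g x)\<^sup>2)"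
    using assms by (auto simp: Xstar_closure_def Lp_space_2_iff)
  have "\<exists>l :: 'a \<Rightarrow>\<^sub>L real. Lp_norm \<mu> 2 (\<lambda>x. g x - blinfun_apply l x) < 1 / real (Suc n)" for n
    using assms by (auto simp: Xstar_closure_def)
  then obtain L :: "nat \<Rightarrow> 'a \<Rightarrow>\<^sub>L real" where L: "\<And>n. Lp_norm \<mu> 2 (\<lambda>x. g x - blinfun_apply (L n) x) < 1 / real (Suc n)"
    by metis
  have "sqrt (\<integral>x. (g x - blinfun_apply (L n) x)\<^sup>2 \<partial>\<mu>) \<le> 1 / real (Suc n)" for n
    using L[of n] by (simp add: Lp_norm_def powr_half_sqrt)
  then have "(\<lambda>n. sqrt (\<integral>x. (g x - blinfun_apply (L n) x)\<^sup>2 \<partial>\<mu>)) \<longlonglongrightarrow> 0"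
    by (intro tendsto_sandwich[OF _ _ tendsto_const LIMSEQ_Suc[OF lim_1_over_n]]) (auto intro!: always_eventually)
  from tendsto_power[OF this, of 2]
  show "\<exists>L. (\<lambda>n. \<integral>x. (g x - blinfun_apply (L n) x)\<^sup>2 \<partial>\<mu>) \<longlonglongrightarrow> 0" by auto
qed

lemma functional_in_Xstar_closure: "blinfun_apply l \<in> Xstar_closure \<mu>"
proof -
  have "Lp_norm \<mu> 2 (\<lambda>x. blinfun_apply l x - blinfun_apply l x) = 0" by (simp add: Lp_norm_def)
  then show ?thesis using integrable_square[of l]
    by (auto simp: Xstar_closure_def Lp_space_2_iff intro!: exI[of _ l])
qed

lemma R_op_apply:
  assumes "g \<in> Xstar_closure \<mu>"
  shows "blinfun_apply l (R_op \<mu> g) = (\<integral>y. g y * blinfun_apply l y \<partial>\<mu>)"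
proof -
  obtain x where x: "\<And>l :: 'a \<Rightarrow>\<^sub>L real. blinfun_apply l x = (\<integral>y. g y * blinfun_apply l y \<partial>\<mu>)"
    using pettis_integral_exists[OF Xstar_closureD(1,2)[OF assms]] by blast
  have "R_op \<mu> g = x" unfolding R_op_def using x by (intro the_equality) (auto intro: functionals_separate)
  then show ?thesis using x by simp
qed

text \<open>The difference of \<open>g\<close> and the functional is orthogonal to every functional
  and is an L^2 limit of functionals, hence zero.\<close>

lemma R_op_inj:
  assumes g: "g \<in> Xstar_closure \<mu>" and h: "blinfun_apply m = h" and eq: "R_op \<mu> g = R_op \<mu> h"
  shows "AE x in \<mu>. g x = h x"
proof -
  note [measurable] = Xstar_closureD(1)[OF g]
  obtain L where L: "(\<lambda>n. \<integral>x. (g x - blinfun_apply (L n) x)\<^sup>2 \<partial>\<mu>) \<longlonglongrightarrow> 0"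
    using Xstar_closureD(3)[OF g] by blast
  define f where "f x = g x - blinfun_apply m x" for x
  have [measurable]: "f \<in> borel_measurable \<mu>" unfolding f_def by measurable
  have f2: "integrable \<mu> (\<lambda>x. (f x)\<^sup>2)" unfolding f_def
    by (rule integrable_add_squares) (auto intro: Xstar_closureD(2)[OF g] integrable_square)
  have orth: "(\<integral>x. f x * blinfun_apply l x \<partial>\<mu>) = 0" for l
  proof -
    have "(\<integral>x. f x * blinfun_apply l x \<partial>\<mu>) = blinfun_apply l (R_op \<mu> g) - blinfun_apply l (R_op \<mu> h)"
      unfolding f_def left_diff_distrib R_op_apply[OF g] h[symmetric] R_op_apply[OF functional_in_Xstar_closure]
      by (intro Bochner_Integration.integral_diff integrable_mult_squares)
        (auto intro: Xstar_closureD(2)[OF g] integrable_square)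
    then show ?thesis using eq by simp
  qed
  \<comment> \<open>Pythagoras: \<open>g\<close> minus \<open>L n\<close> differs from
    \<open>f\<close> by a functional, to which \<open>f\<close> is orthogonal, so removing it can
    only decrease the norm.\<close>
  have "(\<integral>x. (f x)\<^sup>2 \<partial>\<mu>) \<le> (\<integral>x. (g x - blinfun_apply (L n) x)\<^sup>2 \<partial>\<mu>)" for n
  proof -
    define l where "l = L n - m"
    have "(\<lambda>x. (g x - blinfun_apply (L n) x)\<^sup>2) = (\<lambda>x. (f x)\<^sup>2 - 2 * (f x * blinfun_apply l x) + (blinfun_apply l x)\<^sup>2)"
      by (auto simp: f_def l_def blinfun.diff_left power2_eq_square algebra_simps)
    then have "(\<integral>x. (g x - blinfun_apply (L n) x)\<^sup>2 \<partial>\<mu>) = (\<integral>x. (f x)\<^sup>2 \<partial>\<mu>) - 2 * (\<integral>x. f x * blinfun_apply l x \<partial>\<mu>) + var l"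
      using f2 integrable_square[of l] integrable_mult_squares[OF _ _ f2 integrable_square[of l]]
      by (simp add: var_def)
    then show ?thesis using orth[of l] var_nonneg[of l] by simp
  qed
  then have "(\<integral>x. (f x)\<^sup>2 \<partial>\<mu>) \<le> 0" by (intro LIMSEQ_le_const[OF L]) auto
  then have "(\<integral>x. (f x)\<^sup>2 \<partial>\<mu>) = 0" by (simp add: antisym)
  then have "AE x in \<mu>. (f x)\<^sup>2 = 0" using f2 by (simp add: integral_nonneg_eq_0_iff_AE)
  then show ?thesis by eventually_elim (simp add: f_def h[symmetric])
qed

end

section \<open>The Cameron--Martin space and integration by parts\<close>

lemma integral_product_tendsto:
  fixes f g :: "'a \<Rightarrow> real"
  assumes [measurable]: "f \<in> borel_measurable M" "g \<in> borel_measurable M" "\<And>n. F n \<in> borel_measurable M"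
    and 2: "integrable M (\<lambda>x. (f x)\<^sup>2)" "integrable M (\<lambda>x. (g x)\<^sup>2)" "\<And>n. integrable M (\<lambda>x. (F n x)\<^sup>2)"
    and lim: "(\<lambda>n. \<integral>x. (f x - F n x)\<^sup>2 \<partial>M) \<longlonglongrightarrow> 0"
  shows "(\<lambda>n. \<integral>x. F n x * g x \<partial>M) \<longlonglongrightarrow> (\<integral>x. f x * g x \<partial>M)"
proof -
  define d where "d n = sqrt ((\<integral>x. (f x - F n x)\<^sup>2 \<partial>M) * (\<integral>x. (g x)\<^sup>2 \<partial>M))" for n
  have "(\<lambda>n. sqrt ((\<integral>x. (f x - F n x)\<^sup>2 \<partial>M) * (\<integral>x. (g x)\<^sup>2 \<partial>M))) \<longlonglongrightarrow> sqrt (0 * (\<integral>x. (g x)\<^sup>2 \<partial>M))"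
    by (intro tendsto_intros lim)
  then have d: "d \<longlonglongrightarrow> 0" by (simp add: d_def[abs_def])
  have "\<bar>(\<integral>x. F n x * g x \<partial>M) - (\<integral>x. f x * g x \<partial>M)\<bar> \<le> d n" for n
  proof -
    have "(\<integral>x. f x * g x \<partial>M) - (\<integral>x. F n x * g x \<partial>M) = (\<integral>x. (f x - F n x) * g x \<partial>M)"
      unfolding left_diff_distrib
      by (intro Bochner_Integration.integral_diff[symmetric] integrable_mult_squares 2) measurable
    moreover have "(\<integral>x. (f x - F n x) * g x \<partial>M)\<^sup>2 \<le> (\<integral>x. (f x - F n x)\<^sup>2 \<partial>M) * (\<integral>x. (g x)\<^sup>2 \<partial>M)"
      by (intro integral_Cauchy_Schwarz integrable_add_squares 2) measurable
    ultimately have "sqrt (((\<integral>x. f x * g x \<partial>M) - (\<integral>x. F n x * g x \<partial>M))\<^sup>2) \<le> d n"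
      unfolding d_def by (intro real_sqrt_le_mono) simp
    then show ?thesis by (simp add: abs_minus_commute)
  qed
  then have "(\<lambda>n. (\<integral>x. F n x * g x \<partial>M) - (\<integral>x. f x * g x \<partial>M)) \<longlonglongrightarrow> 0"
    by (intro tendsto_0_le[OF d, where K=1] always_eventually) (auto intro: order_trans[OF _ abs_ge_self])
  then show ?thesis by (simp add: LIM_zero_iff)
qed

locale cameron_martin_space = gaussian \<mu>
  for \<mu> :: "'a::{banach,second_countable_topology} measure" +
  fixes \<iota> :: "'h::{real_inner,banach,second_countable_topology} \<Rightarrow> 'a"
    and e :: "nat \<Rightarrow> 'h"
  assumes cm: "cameron_martin \<mu> \<iota>" and onb: "orthonormal_basis e"
begin

definition hat :: "'h \<Rightarrow> 'a \<Rightarrow> real" where "hat k = cm_hat \<mu> (\<iota> k)"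

lemma linear_iota: "linear \<iota>" using cm by (simp add: cameron_martin_def)

lemma hat_mem: "hat k \<in> Xstar_closure \<mu>" and R_op_hat: "R_op \<mu> (hat k) = \<iota> k"
proof -
  have "\<iota> k \<in> cm_space \<mu>" using cm by (auto simp: cameron_martin_def bij_betw_def)
  then have "\<exists>g. g \<in> Xstar_closure \<mu> \<and> R_op \<mu> g = \<iota> k" by (auto simp: cm_space_def)
  from someI_ex[OF this] show "hat k \<in> Xstar_closure \<mu>" "R_op \<mu> (hat k) = \<iota> k"
    unfolding hat_def cm_hat_def by auto
qed

lemma hat_measurable [measurable]: "hat k \<in> borel_measurable \<mu>"
  and hat_square: "integrable \<mu> (\<lambda>x. (hat k x)\<^sup>2)"
  and hat_approx: "\<exists>L. (\<lambda>n. \<integral>x. (hat k x - blinfun_apply (L n) x)\<^sup>2 \<partial>\<mu>) \<longlonglongrightarrow> 0"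
  using Xstar_closureD[OF hat_mem] by auto

lemma hat_integrable: "integrable \<mu> (hat k)"
  by (rule integrable_of_square[OF hat_measurable hat_square])

lemma apply_iota: "blinfun_apply l (\<iota> k) = (\<integral>x. hat k x * blinfun_apply l x \<partial>\<mu>)"
  using R_op_apply[OF hat_mem[of k], of l] by (simp add: R_op_hat)

lemma inner_hat: "inner h k = (\<integral>x. hat h x * hat k x \<partial>\<mu>)"
  using cm by (simp add: cameron_martin_def hat_def)

text \<open>The representer is the Cameron-Martin vector of \<open>l\<close>, whose
  \<open>hat\<close> is \<open>l\<close> itself by injectivity of \<open>R_op\<close>. As
  \<open>cameron_martin\<close> asks only linearity of \<open>\<iota>\<close>, this supplies the
  continuity of \<open>l\<close> along H that makes cylindrical functions differentiable
  there.\<close>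

lemma functional_representer:
  obtains a where "\<And>h. blinfun_apply l (\<iota> h) = inner a h"
proof -
  have "R_op \<mu> (blinfun_apply l) \<in> range \<iota>"
    using cm functional_in_Xstar_closure[of l] by (auto simp: cameron_martin_def bij_betw_def cm_space_def)
  then obtain a where a: "\<iota> a = R_op \<mu> (blinfun_apply l)" by auto
  have *: "AE x in \<mu>. hat a x = blinfun_apply l x"
    by (rule R_op_inj[OF hat_mem refl]) (simp add: R_op_hat a)
  show ?thesis
  proof (rule that[of a])
    fix h
    have "blinfun_apply l (\<iota> h) = (\<integral>x. hat h x * hat a x \<partial>\<mu>)"
      unfolding apply_iota by (intro integral_cong_AE) (use * in auto)
    then show "blinfun_apply l (\<iota> h) = inner a h" by (simp add: inner_hat mult.commute)
  qed
qed

text \<open>For Gaussian functionals the 2m-th moment is a multiple of the m-th power of the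
  variance, so a sequence that is Cauchy in L^2 is Cauchy in L^(2m). Fatou along an almost surely
  convergent subsequence replaces one index by the limit \<open>hat k\<close>.\<close>

lemma hat_moment_tendsto:
  assumes L: "(\<lambda>n. \<integral>x. (hat k x - blinfun_apply (L n) x)\<^sup>2 \<partial>\<mu>) \<longlonglongrightarrow> 0" and m: "m \<ge> 1"
  shows "(\<lambda>n. \<integral>\<^sup>+x. ennreal ((hat k x - blinfun_apply (L n) x) ^ (2 * m)) \<partial>\<mu>) \<longlonglongrightarrow> 0"
proof (rule order_tendstoI)
  define c :: real where "c = fact (2 * m) / (2 ^ m * fact m)"
  have c: "c > 0" by (simp add: c_def)
  have int: "integrable \<mu> (\<lambda>x. (hat k x - blinfun_apply (L n) x)\<^sup>2)" for n
    by (intro integrable_add_squares hat_square integrable_square) measurable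
  have "(\<integral>\<^sup>+x. ennreal (\<bar>hat k x - blinfun_apply (L n) x\<bar> powr 2) \<partial>\<mu>) = ennreal (\<integral>x. (hat k x - blinfun_apply (L n) x)\<^sup>2 \<partial>\<mu>)" for n
    using nn_integral_eq_integral[OF int[of n]] by simp
  moreover have "(\<lambda>n. ennreal (\<integral>x. (hat k x - blinfun_apply (L n) x)\<^sup>2 \<partial>\<mu>)) \<longlonglongrightarrow> ennreal 0"
    by (intro tendsto_ennrealI L)
  ultimately have "(\<lambda>n. \<integral>\<^sup>+x. ennreal (\<bar>hat k x - blinfun_apply (L n) x\<bar> powr 2) \<partial>\<mu>) \<longlonglongrightarrow> 0" by simp
  then obtain r where r: "strict_mono r" "AE x in \<mu>. (\<lambda>n. hat k x - blinfun_apply (L (r n)) x) \<longlonglongrightarrow> 0"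
    by (rule AE_subseq_of_nn_integral[rotated 2]) auto
  fix \<epsilon> :: ennreal assume "0 < \<epsilon>"
  then obtain \<epsilon>1 where \<epsilon>1: "0 < \<epsilon>1" "\<epsilon>1 < \<epsilon>" using dense by blast
  define \<epsilon>' where "\<epsilon>' = enn2real \<epsilon>1"
  have "\<epsilon>1 < top" using \<epsilon>1(2) by (meson less_le_trans top_greatest)
  then have \<epsilon>': "\<epsilon>' > 0" "ennreal \<epsilon>' < \<epsilon>"
    using \<epsilon>1 by (auto simp: \<epsilon>'_def enn2real_positive_iff)
  \<comment> \<open>The minimum with 1 gives \<delta>^m at most \<delta> for m at least 1, and the
    second entry makes \<open>c\<close> times that at most \<epsilon>'.\<close>
  define \<delta> where "\<delta> = min 1 (\<epsilon>' / c)"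
  have \<delta>: "\<delta> > 0" "\<delta> \<le> 1" using c \<epsilon>' by (auto simp: \<delta>_def)
  have "\<delta> ^ m \<le> \<delta>" using \<delta> m by (metis less_imp_le power_decreasing power_one_right)
  then have "c * \<delta> ^ m \<le> c * (\<epsilon>' / c)" using c by (intro mult_left_mono) (auto simp: \<delta>_def)
  then have c\<delta>: "c * \<delta> ^ m \<le> \<epsilon>'" using c by simp
  have "\<forall>\<^sub>F n in sequentially. (\<integral>x. (hat k x - blinfun_apply (L n) x)\<^sup>2 \<partial>\<mu>) < \<delta> / 4"
    using \<delta> by (intro order_tendstoD(2)[OF L]) simp
  then obtain N where N: "\<And>n. n \<ge> N \<Longrightarrow> (\<integral>x. (hat k x - blinfun_apply (L n) x)\<^sup>2 \<partial>\<mu>) < \<delta> / 4"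
    by (auto simp: eventually_sequentially)
  \<comment> \<open>Each distance to \<open>hat k\<close> contributes less than \<delta>/4, doubled
    by the elementary bound on the square of a sum.\<close>
  have var: "var (L n - L j) \<le> \<delta>" if "n \<ge> N" "j \<ge> N" for n j
  proof -
    have "var (L n - L j) \<le> (\<integral>x. 2 * (hat k x - blinfun_apply (L n) x)\<^sup>2 + 2 * (hat k x - blinfun_apply (L j) x)\<^sup>2 \<partial>\<mu>)"
      unfolding var_def
    proof (intro integral_mono integrable_square Bochner_Integration.integrable_add integrable_mult_right int)
      fix x
      have "(b - a)\<^sup>2 \<le> 2 * a\<^sup>2 + 2 * b\<^sup>2" for a b :: real using zero_le_power2[of "a + b"]
        by (simp add: power2_eq_square algebra_simps)
      from this[of "hat k x - blinfun_apply (L j) x" "hat k x - blinfun_apply (L n) x"]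
      have "(blinfun_apply (L n) x - blinfun_apply (L j) x)\<^sup>2 \<le> 2 * (hat k x - blinfun_apply (L n) x)\<^sup>2 + 2 * (hat k x - blinfun_apply (L j) x)\<^sup>2"
        by (simp add: power2_commute)
      then show "(blinfun_apply (L n - L j) x)\<^sup>2 \<le> 2 * (hat k x - blinfun_apply (L n) x)\<^sup>2 + 2 * (hat k x - blinfun_apply (L j) x)\<^sup>2"
        by (simp add: blinfun.diff_left)
    qed
    also have "\<dots> \<le> \<delta>" using N[OF that(1)] N[OF that(2)] int by simp
    finally show ?thesis .
  qed
  have bound: "(\<integral>\<^sup>+x. ennreal ((hat k x - blinfun_apply (L n) x) ^ (2 * m)) \<partial>\<mu>) \<le> ennreal \<epsilon>'" if n: "n \<ge> N" for n
  proof (rule nn_integral_le_of_AE_tendsto)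
    show "(\<lambda>x. (blinfun_apply (L (r j)) x - blinfun_apply (L n) x) ^ (2 * m)) \<in> borel_measurable \<mu>" for j by measurable
    show "AE x in \<mu>. (\<lambda>j. (blinfun_apply (L (r j)) x - blinfun_apply (L n) x) ^ (2 * m)) \<longlonglongrightarrow> (hat k x - blinfun_apply (L n) x) ^ (2 * m)"
      using r(2)
    proof eventually_elim
      case (elim x)
      have "(\<lambda>j. hat k x - (hat k x - blinfun_apply (L (r j)) x)) \<longlonglongrightarrow> hat k x - 0" by (intro tendsto_intros elim)
      then show ?case by (intro tendsto_intros) simp
    qed
    show "\<forall>\<^sub>F j in sequentially. (\<integral>\<^sup>+x. ennreal ((blinfun_apply (L (r j)) x - blinfun_apply (L n) x) ^ (2 * m)) \<partial>\<mu>) \<le> ennreal \<epsilon>'"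
      using eventually_ge_at_top[of N]
    proof eventually_elim
      case (elim j)
      then have j: "r j \<ge> N" using seq_suble[OF r(1), of j] by linarith
      have "(\<integral>\<^sup>+x. ennreal ((blinfun_apply (L (r j)) x - blinfun_apply (L n) x) ^ (2 * m)) \<partial>\<mu>)
         = ennreal (c * var (L (r j) - L n) ^ m)"
        using nn_integral_eq_integral[OF integrable_power[of "L (r j) - L n" "2 * m"]] even_moment[of "L (r j) - L n" m]
        by (simp add: blinfun.diff_left c_def zero_le_even_power)
      also have "\<dots> \<le> ennreal (c * \<delta> ^ m)"
        using c var[OF j n] var_nonneg by (intro ennreal_leI mult_left_mono power_mono) auto
      also have "\<dots> \<le> ennreal \<epsilon>'" using c\<delta> by (rule ennreal_leI)
      finally show ?case .
    qed
  qed
  show "\<forall>\<^sub>F n in sequentially. (\<integral>\<^sup>+x. ennreal ((hat k x - blinfun_apply (L n) x) ^ (2 * m)) \<partial>\<mu>) < \<epsilon>"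
    using eventually_ge_at_top[of N] by eventually_elim (use bound \<epsilon>'(2) le_less_trans in blast)
qed simp

text \<open>One functional at finite L^(2m) distance from \<open>hat k\<close> is enough, because
  functionals have all moments.\<close>

lemma hat_power_integrable: "integrable \<mu> (\<lambda>x. (hat k x) ^ (2 * m))"
proof (cases "m = 0")
  case False
  obtain L where L: "(\<lambda>n. \<integral>x. (hat k x - blinfun_apply (L n) x)\<^sup>2 \<partial>\<mu>) \<longlonglongrightarrow> 0"
    using hat_approx by blast
  have "\<forall>\<^sub>F n in sequentially. (\<integral>\<^sup>+x. ennreal ((hat k x - blinfun_apply (L n) x) ^ (2 * m)) \<partial>\<mu>) < 1"
    using False by (intro order_tendstoD(2)[OF hat_moment_tendsto[OF L]]) auto
  then obtain n where n: "(\<integral>\<^sup>+x. ennreal ((hat k x - blinfun_apply (L n) x) ^ (2 * m)) \<partial>\<mu>) < 1"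
    by (auto simp: eventually_sequentially)
  have 1: "integrable \<mu> (\<lambda>x. (hat k x - blinfun_apply (L n) x) ^ (2 * m))"
    using n by (intro integrableI_nonneg) (auto simp: zero_le_even_power intro: less_trans)
  show ?thesis
  proof (rule integrable_of_norm_le)
    show "integrable \<mu> (\<lambda>x. 2 ^ (2 * m) * ((hat k x - blinfun_apply (L n) x) ^ (2 * m) + (blinfun_apply (L n) x) ^ (2 * m)))"
      using 1 integrable_power[of "L n" "2 * m"] by auto
    have *: "(a + b) ^ (2 * m) \<le> 2 ^ (2 * m) * (a ^ (2 * m) + b ^ (2 * m))" for a b :: real
    proof -
      have "\<bar>a + b\<bar> \<le> 2 * max \<bar>a\<bar> \<bar>b\<bar>" by linarith
      then have "\<bar>a + b\<bar> ^ (2 * m) \<le> (2 * max \<bar>a\<bar> \<bar>b\<bar>) ^ (2 * m)" by (rule power_mono) simp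
      also have "\<dots> \<le> 2 ^ (2 * m) * (\<bar>a\<bar> ^ (2 * m) + \<bar>b\<bar> ^ (2 * m))"
        unfolding power_mult_distrib by (intro mult_left_mono) (auto simp: max_def)
      finally show ?thesis by (simp add: power_even_abs)
    qed
    show "norm (hat k x ^ (2 * m)) \<le> 2 ^ (2 * m) * ((hat k x - blinfun_apply (L n) x) ^ (2 * m) + (blinfun_apply (L n) x) ^ (2 * m))" for x
      using *[of "hat k x - blinfun_apply (L n) x" "blinfun_apply (L n) x"] by (simp add: zero_le_even_power)
  qed measurable
qed simp

text \<open>Passage to the limit in the formula for functionals: the covariances with
  \<open>l\<close> converge to the pairing of \<open>hat k\<close> with \<open>l\<close>, which is
  the value of \<open>l\<close> at \<open>\<iota> k\<close>.\<close>

lemma integral_hat_cos: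
  "(\<integral>x. hat k x * cos (blinfun_apply l x + b) \<partial>\<mu>) = - blinfun_apply l (\<iota> k) * sin b * exp (- var l / 2)"
proof -
  obtain L where L: "(\<lambda>n. \<integral>x. (hat k x - blinfun_apply (L n) x)\<^sup>2 \<partial>\<mu>) \<longlonglongrightarrow> 0"
    using hat_approx by blast
  have "integrable \<mu> (\<lambda>x. (cos (blinfun_apply l x + b))\<^sup>2)"
    by (rule integrable_const_bound[of _ 1]) (auto simp: abs_square_le_1)
  then have "(\<lambda>n. \<integral>x. blinfun_apply (L n) x * cos (blinfun_apply l x + b) \<partial>\<mu>) \<longlonglongrightarrow> (\<integral>x. hat k x * cos (blinfun_apply l x + b) \<partial>\<mu>)"
    by (intro integral_product_tendsto L hat_square integrable_square) measurable
  then have 1: "(\<lambda>n. - cov l (L n) * sin b * exp (- var l / 2)) \<longlonglongrightarrow> (\<integral>x. hat k x * cos (blinfun_apply l x + b) \<partial>\<mu>)"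
    by (simp add: integral_functional_cos)
  have "(\<lambda>n. \<integral>x. blinfun_apply (L n) x * blinfun_apply l x \<partial>\<mu>) \<longlonglongrightarrow> (\<integral>x. hat k x * blinfun_apply l x \<partial>\<mu>)"
    by (intro integral_product_tendsto L hat_square integrable_square) measurable
  then have "(\<lambda>n. cov l (L n)) \<longlonglongrightarrow> blinfun_apply l (\<iota> k)" by (simp add: cov_def apply_iota mult.commute)
  then have "(\<lambda>n. - cov l (L n) * sin b * exp (- var l / 2)) \<longlonglongrightarrow> - blinfun_apply l (\<iota> k) * sin b * exp (- var l / 2)"
    by (intro tendsto_intros)
  with 1 show ?thesis using LIMSEQ_unique by blast
qed

text \<open>Test functions differentiable in the single direction \<open>k\<close>. The class
  contains the cylindrical functions, and also their compositions with bounded smooth functions and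
  rescaled sines of functionals, which occur later as truncations.\<close>

definition admissible :: "'h \<Rightarrow> ('a \<Rightarrow> real) \<Rightarrow> ('a \<Rightarrow> real) \<Rightarrow> bool" where
  "admissible k f f' \<longleftrightarrow> continuous_on UNIV f \<and> continuous_on UNIV f' \<and>
    (\<exists>B. \<forall>x. \<bar>f x\<bar> \<le> B) \<and> (\<exists>B. \<forall>x. \<bar>f' x\<bar> \<le> B) \<and>
    (\<forall>x. ((\<lambda>r. f (x + r *\<^sub>R \<iota> k)) has_real_derivative f' x) (at 0))"

lemma translate_continuous:
  assumes f: "continuous_on UNIV (f :: 'a \<Rightarrow> real)"
  shows "continuous_on S (\<lambda>x. f (x + r *\<^sub>R v))" "continuous_on T (\<lambda>r. f (x + r *\<^sub>R v))"
  by (rule continuous_on_compose2[OF f]; auto intro!: continuous_intros)+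

lemma bounded_integrable:
  assumes "f \<in> borel_measurable \<mu>" "\<And>x. \<bar>f x\<bar> \<le> B"
  shows "integrable \<mu> f" "integrable \<mu> (\<lambda>x. hat k x * f x)"
proof -
  show "integrable \<mu> f" by (rule integrable_const_bound[of _ B]) (use assms in auto)
  show "integrable \<mu> (\<lambda>x. hat k x * f x)"
    by (rule integrable_of_norm_le[where g="\<lambda>x. \<bar>hat k x\<bar> * B"])
      (use assms hat_integrable[of k] in \<open>auto simp: abs_mult intro!: mult_left_mono\<close>)
qed

text \<open>Translation along \<open>\<iota> k\<close> only shifts the phase of a plane wave, so
  both integrals are explicit and the claim is the fundamental theorem of calculus for a
  cosine.\<close>

lemma trig_translate_has_integral:
  assumes "trig_poly p" "r \<ge> 0"
  shows "((\<lambda>s. \<integral>x. hat k x * p (x + s *\<^sub>R \<iota> k) \<partial>\<mu>) has_integral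
    (\<integral>x. p (x + r *\<^sub>R \<iota> k) \<partial>\<mu>) - (\<integral>x. p x \<partial>\<mu>)) {0..r}"
  using assms(1)
proof (induction p rule: trig_poly.induct)
  case (base c l b)
  define d where "d = blinfun_apply l (\<iota> k)"
  have *: "c * cos (blinfun_apply l (x + s *\<^sub>R \<iota> k) + b) = c * cos (blinfun_apply l x + (b + s * d))" for x s
    by (simp add: blinfun.add_right blinfun.scaleR_right d_def algebra_simps)
  have hat: "(\<integral>x. hat k x * (c * cos (blinfun_apply l x + (b + s * d))) \<partial>\<mu>) = c * (- d * sin (b + s * d) * exp (- var l / 2))" for s
  proof -
    have "(\<integral>x. hat k x * (c * cos (blinfun_apply l x + (b + s * d))) \<partial>\<mu>) = (\<integral>x. c * (hat k x * cos (blinfun_apply l x + (b + s * d))) \<partial>\<mu>)"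
      by (intro Bochner_Integration.integral_cong) auto
    then show ?thesis using integral_hat_cos[of k l "b + s * d"] by (simp add: d_def)
  qed
  have "((\<lambda>s. c * (- d * sin (b + s * d) * exp (- var l / 2))) has_integral
    c * (cos (b + r * d) * exp (- var l / 2)) - c * (cos (b + 0 * d) * exp (- var l / 2))) {0..r}"
    by (rule fundamental_theorem_of_calculus[OF assms(2)])
      (auto intro!: derivative_eq_intros simp: has_real_derivative_iff_has_vector_derivative[symmetric])
  then show ?case unfolding * hat using integral_cos[of l "b + r * d"] integral_cos[of l "b"] by simp
next
  case (add f g)
  have 1: "integrable \<mu> (\<lambda>x. q (x + s *\<^sub>R \<iota> k))" "integrable \<mu> (\<lambda>x. hat k x * q (x + s *\<^sub>R \<iota> k))" if "trig_poly q" for q s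
    using trig_poly_bounded[OF that] bounded_integrable[OF continuous_measurable[OF translate_continuous(1)[OF trig_poly_continuous[OF that]]]]
    by blast+
  show ?case
    using has_integral_add[OF add.IH] 1[OF add.hyps(1)] 1[OF add.hyps(2)]
      1(1)[OF add.hyps(1), of 0] 1(1)[OF add.hyps(2), of 0]
    by (simp add: distrib_left algebra_simps)
qed

text \<open>Integrated form of the Cameron--Martin formula. Both sides are controlled by the laws of the
  translates \<open>x + s k\<close>, \<open>s \<in> [0,r]\<close>, which are uniformly tight.\<close>

lemma translate_has_integral:
  assumes f: "continuous_on UNIV f" "\<And>x. \<bar>f x\<bar> \<le> B" and r: "r \<ge> 0"
  shows "((\<lambda>s. \<integral>x. hat k x * f (x + s *\<^sub>R \<iota> k) \<partial>\<mu>) has_integral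
    (\<integral>x. f (x + r *\<^sub>R \<iota> k) \<partial>\<mu>) - (\<integral>x. f x \<partial>\<mu>)) {0..r}"
proof -
  obtain K where K: "\<And>n. compact (K n)" "incseq K" "AE x in \<mu>. x \<in> (\<Union>n. K n)"
    using AE_in_sigma_compact[OF finite_measure_axioms sets_mu] by blast
  \<comment> \<open>The segments of translates starting in \<open>K n\<close> sweep out a compact
    set, so a single sequence of trigonometric polynomials converges at every translate at
    once.\<close>
  define K' where "K' n = (\<lambda>(x, s). x + s *\<^sub>R \<iota> k) ` (K n \<times> {0..r})" for n
  have "compact (K' n)" for n unfolding K'_def
    by (intro compact_continuous_image compact_Times K) (auto simp: case_prod_beta intro!: continuous_intros)
  moreover have "incseq K'" using K(2) by (fastforce simp: K'_def incseq_def)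
  ultimately obtain p where p: "\<And>n. trig_poly (p n)" "\<And>n x. \<bar>p n x\<bar> \<le> B + 1"
      "\<And>x. x \<in> (\<Union>n. K' n) \<Longrightarrow> (\<lambda>n. p n x) \<longlonglongrightarrow> f x"
    using trig_poly_approx_sequence[OF _ _ f, of K'] by blast
  have lim: "AE x in \<mu>. \<forall>s\<in>{0..r}. (\<lambda>n. p n (x + s *\<^sub>R \<iota> k)) \<longlonglongrightarrow> f (x + s *\<^sub>R \<iota> k)"
    using K(3)
  proof eventually_elim
    case (elim x)
    then obtain n where "x \<in> K n" by auto
    then have "x + s *\<^sub>R \<iota> k \<in> K' n" if "s \<in> {0..r}" for s
      unfolding K'_def using that by (intro image_eqI[of _ _ "(x, s)"]) auto
    then show ?case by (intro ballI p(3)) blast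
  qed
  have [measurable]: "(\<lambda>x. p n (x + s *\<^sub>R \<iota> k)) \<in> borel_measurable \<mu>" "(\<lambda>x. f (x + s *\<^sub>R \<iota> k)) \<in> borel_measurable \<mu>" for n s
    by (intro continuous_measurable translate_continuous trig_poly_continuous p f)+
  have l1: "(\<lambda>n. \<integral>x. p n (x + s *\<^sub>R \<iota> k) \<partial>\<mu>) \<longlonglongrightarrow> (\<integral>x. f (x + s *\<^sub>R \<iota> k) \<partial>\<mu>)" if "s \<in> {0..r}" for s
    by (rule integral_dominated_convergence[where w="\<lambda>_. B + 1"]) (use lim that p(2) in auto)
  have l2: "(\<lambda>n. \<integral>x. hat k x * p n (x + s *\<^sub>R \<iota> k) \<partial>\<mu>) \<longlonglongrightarrow> (\<integral>x. hat k x * f (x + s *\<^sub>R \<iota> k) \<partial>\<mu>)" if "s \<in> {0..r}" for s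
    by (rule integral_dominated_convergence[where w="\<lambda>x. \<bar>hat k x\<bar> * (B + 1)"])
      (use lim that p(2) hat_integrable[of k] in \<open>auto simp: abs_mult intro!: mult_left_mono tendsto_mult_left\<close>)
  have bd: "norm (\<integral>x. hat k x * p n (x + s *\<^sub>R \<iota> k) \<partial>\<mu>) \<le> (\<integral>x. \<bar>hat k x\<bar> * (B + 1) \<partial>\<mu>)" for n s
  proof (rule order_trans[OF Bochner_Integration.integral_norm_bound integral_mono])
    show "integrable \<mu> (\<lambda>x. norm (hat k x * p n (x + s *\<^sub>R \<iota> k)))"
      by (rule integrable_norm[OF bounded_integrable(2)[OF _ p(2)]]) measurable
  qed (use p(2) hat_integrable[of k] in \<open>auto simp: abs_mult intro!: mult_left_mono\<close>)
  note hi = trig_translate_has_integral[OF p(1) r, of k]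
  \<comment> \<open>Dominated convergence for the gauge integral also delivers integrability of the
    limit in \<open>s\<close>.\<close>
  have D: "(\<lambda>s. \<integral>x. hat k x * f (x + s *\<^sub>R \<iota> k) \<partial>\<mu>) integrable_on {0..r} \<and>
    (\<lambda>n. integral {0..r} (\<lambda>s. \<integral>x. hat k x * p n (x + s *\<^sub>R \<iota> k) \<partial>\<mu>)) \<longlonglongrightarrow>
    integral {0..r} (\<lambda>s. \<integral>x. hat k x * f (x + s *\<^sub>R \<iota> k) \<partial>\<mu>)"
    using dominated_convergence[of "\<lambda>n s. \<integral>x. hat k x * p n (x + s *\<^sub>R \<iota> k) \<partial>\<mu>" "{0..r}" "\<lambda>_. \<integral>x. \<bar>hat k x\<bar> * (B + 1) \<partial>\<mu>"
       "\<lambda>s. \<integral>x. hat k x * f (x + s *\<^sub>R \<iota> k) \<partial>\<mu>"] hi l2 bd by (auto simp: has_integral_integrable)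
  have "(\<lambda>n. integral {0..r} (\<lambda>s. \<integral>x. hat k x * p n (x + s *\<^sub>R \<iota> k) \<partial>\<mu>)) \<longlonglongrightarrow>
    (\<integral>x. f (x + r *\<^sub>R \<iota> k) \<partial>\<mu>) - (\<integral>x. f x \<partial>\<mu>)"
    unfolding integral_unique[OF hi] using l1[of r] l1[of 0] r by (intro tendsto_diff) auto
  then have "integral {0..r} (\<lambda>s. \<integral>x. hat k x * f (x + s *\<^sub>R \<iota> k) \<partial>\<mu>) = (\<integral>x. f (x + r *\<^sub>R \<iota> k) \<partial>\<mu>) - (\<integral>x. f x \<partial>\<mu>)"
    using D LIMSEQ_unique by blast
  then show ?thesis using integrable_integral[OF conjunct1[OF D]] by simp
qed

lemma admissible_deriv:
  assumes "admissible k f f'"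
  shows "((\<lambda>r. f (x + r *\<^sub>R \<iota> k)) has_real_derivative f' (x + r *\<^sub>R \<iota> k)) (at r)"
proof -
  have "((\<lambda>s. f ((x + r *\<^sub>R \<iota> k) + s *\<^sub>R \<iota> k)) has_real_derivative f' (x + r *\<^sub>R \<iota> k)) (at 0)"
    using assms unfolding admissible_def by blast
  then have "((\<lambda>s. f (x + (r + s) *\<^sub>R \<iota> k)) has_real_derivative f' (x + r *\<^sub>R \<iota> k)) (at 0)"
    by (simp add: scaleR_add_left add.assoc)
  then show ?thesis using DERIV_at_within_shift[of "\<lambda>s. f (x + s *\<^sub>R \<iota> k)" _ r 0 UNIV] by (simp add: add.commute)
qed

text \<open>The right derivative at 0 of the integral of the translated function is computed twice:
  under the integral sign, and by the fundamental theorem from the integrated Cameron-Martin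
  formula, whose integrand \<open>G\<close> is continuous.\<close>

theorem gaussian_integration_by_parts:
  assumes f: "admissible k f f'"
  shows "(\<integral>x. f' x \<partial>\<mu>) = (\<integral>x. f x * hat k x \<partial>\<mu>)"
proof -
  obtain B B' where cont: "continuous_on UNIV f" "continuous_on UNIV f'" and B: "\<And>x. \<bar>f x\<bar> \<le> B" "\<And>x. \<bar>f' x\<bar> \<le> B'"
    using f unfolding admissible_def by blast
  have m: "(\<lambda>x. f (x + s *\<^sub>R \<iota> k)) \<in> borel_measurable \<mu>" "f' \<in> borel_measurable \<mu>" "f \<in> borel_measurable \<mu>" for s
    by (intro continuous_measurable translate_continuous cont)+
  note [measurable] = m
  define G where "G s = (\<integral>x. hat k x * f (x + s *\<^sub>R \<iota> k) \<partial>\<mu>)" for s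
  have 1: "((\<lambda>r. \<integral>x. f (x + r *\<^sub>R \<iota> k) \<partial>\<mu>) has_real_derivative (\<integral>x. f' x \<partial>\<mu>)) (at 0 within {0..1})"
  proof (rule has_real_derivative_integral[where B="\<lambda>_. B'"])
    show "integrable \<mu> (\<lambda>x. f (x + r *\<^sub>R \<iota> k))" for r by (rule bounded_integrable[OF m(1) B(1)])
    show "((\<lambda>r. f (x + r *\<^sub>R \<iota> k)) has_real_derivative f' x) (at 0 within {0..1})" for x
      using f unfolding admissible_def by (auto intro: has_field_derivative_at_within)
    show "\<bar>f (x + r *\<^sub>R \<iota> k) - f (x + 0 *\<^sub>R \<iota> k)\<bar> \<le> \<bar>r\<bar> * B'" for r x
      using field_differentiable_bound[of UNIV "\<lambda>r. f (x + r *\<^sub>R \<iota> k)" "\<lambda>r. f' (x + r *\<^sub>R \<iota> k)" B' 0 r]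
        admissible_deriv[OF f] B(2) by (simp add: mult.commute norm_minus_commute abs_minus_commute)
  qed (use m in auto)
  have "continuous_on {0..1} G"
    unfolding G_def
  proof (rule continuous_on_sequentiallyI)
    fix u :: "nat \<Rightarrow> real" and a assume u: "u \<longlonglongrightarrow> a"
    show "(\<lambda>n. \<integral>x. hat k x * f (x + u n *\<^sub>R \<iota> k) \<partial>\<mu>) \<longlonglongrightarrow> (\<integral>x. hat k x * f (x + a *\<^sub>R \<iota> k) \<partial>\<mu>)"
    proof (rule integral_dominated_convergence[where w="\<lambda>x. \<bar>hat k x\<bar> * B"])
      show "AE x in \<mu>. (\<lambda>n. hat k x * f (x + u n *\<^sub>R \<iota> k)) \<longlonglongrightarrow> hat k x * f (x + a *\<^sub>R \<iota> k)"
        by (intro AE_I2 tendsto_mult_left continuous_on_tendsto_compose[OF cont(1)] tendsto_intros u) auto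
    qed (use B hat_integrable[of k] in \<open>auto simp: abs_mult intro!: mult_left_mono\<close>)
  qed
  then have A: "((\<lambda>r. integral {0..r} G) has_real_derivative G 0) (at 0 within {0..1})"
    by (rule integral_has_real_derivative) simp
  have I: "integral {0..r} G = (\<integral>x. f (x + r *\<^sub>R \<iota> k) \<partial>\<mu>) - (\<integral>x. f x \<partial>\<mu>)" if "r \<in> {0..1}" for r
    unfolding G_def using translate_has_integral[OF cont(1) B(1), of r k] that by (intro integral_unique) auto
  have "((\<lambda>r. (\<integral>x. f (x + r *\<^sub>R \<iota> k) \<partial>\<mu>) - (\<integral>x. f x \<partial>\<mu>)) has_real_derivative G 0) (at 0 within {0..1})"
    by (rule has_field_derivative_transform_within[OF A zero_less_one]) (auto simp: I)
  then have "((\<lambda>r. \<integral>x. f (x + r *\<^sub>R \<iota> k) \<partial>\<mu>) has_real_derivative G 0) (at 0 within {0..1})"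
    using DERIV_add[OF _ DERIV_const[of "\<integral>x. f x \<partial>\<mu>"]] by fastforce
  with 1 have "(\<integral>x. f' x \<partial>\<mu>) = G 0"
    unfolding has_field_derivative_iff by (rule tendsto_unique[rotated]) (simp add: at_within_Icc_at_right)
  then show ?thesis by (simp add: G_def mult.commute)
qed

end

section \<open>Smooth cylindrical functions\<close>

lemma Cb_infinity_cong: "\<phi> \<in> Cb_infinity n \<Longrightarrow> (\<And>i. i < n \<Longrightarrow> u i = v i) \<Longrightarrow> \<phi> u = \<phi> v"
  by (auto simp: Cb_infinity_def)

lemma Cb_infinity_bounded: "\<phi> \<in> Cb_infinity n \<Longrightarrow> \<exists>B. \<forall>v. \<bar>\<phi> v\<bar> \<le> B"
  unfolding Cb_infinity_def by (auto dest!: spec[of _ "[]"] simp: bounded_iff) blast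

lemma Cb_infinity_continuous: "\<phi> \<in> Cb_infinity n \<Longrightarrow> continuous_on UNIV \<phi>"
  unfolding Cb_infinity_def by (auto dest!: spec[of _ "[]"])

lemma partial_deriv_trivial:
  assumes "\<phi> \<in> Cb_infinity n" "\<not> i < n"
  shows "\<phi> (v(i := r)) = \<phi> v" "partial_deriv i \<phi> = (\<lambda>_. 0)"
proof -
  show "\<phi> (v(i := r)) = \<phi> v" for v r using assms by (intro Cb_infinity_cong[OF assms(1)]) auto
  then show "partial_deriv i \<phi> = (\<lambda>_. 0)" by (intro ext) (simp add: partial_deriv_def)
qed

lemma Cb_infinity_DERIV:
  assumes "\<phi> \<in> Cb_infinity n"
  shows "((\<lambda>r. \<phi> (v(i := r))) has_real_derivative partial_deriv i \<phi> (v(i := r))) (at r)"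
proof (cases "i < n")
  case True
  have "\<forall>v. (\<lambda>s. \<phi> (v(i := s))) differentiable (at (v i))"
    using assms True unfolding Cb_infinity_def by (auto dest!: spec[of _ "[]"])
  from spec[OF this, of "v(i := r)"] have "(\<lambda>s. \<phi> (v(i := s))) differentiable (at r)" by simp
  then show ?thesis by (simp add: partial_deriv_def DERIV_deriv_iff_real_differentiable)
next
  case False
  then show ?thesis by (simp only: partial_deriv_trivial[OF assms False] DERIV_const)
qed

text \<open>An invariant class \<open>G\<close> that contains all iterated partial derivatives
  reduces the condition on every list of directions to one check on members of
  \<open>G\<close>.\<close>

lemma Cb_infinityI:
  assumes cong: "\<And>u v. (\<And>i. i < n \<Longrightarrow> u i = v i) \<Longrightarrow> \<phi> u = \<phi> v"
    and fold: "\<And>\<alpha>. set \<alpha> \<subseteq> {..<n} \<Longrightarrow> foldr partial_deriv \<alpha> \<phi> \<in> G"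
    and G: "\<And>\<psi>. \<psi> \<in> G \<Longrightarrow> (\<exists>B. \<forall>v. \<bar>\<psi> v\<bar> \<le> B) \<and> continuous_on UNIV \<psi> \<and>
      (\<forall>i v. \<exists>D. ((\<lambda>r. \<psi> (v(i := r))) has_real_derivative D) (at (v i)))"
  shows "\<phi> \<in> Cb_infinity n"
  unfolding Cb_infinity_def
proof (intro CollectI conjI allI impI)
  fix \<alpha> assume "set \<alpha> \<subseteq> {..<n}"
  from G[OF fold[OF this]]
  have 1: "\<exists>B. \<forall>v. \<bar>foldr partial_deriv \<alpha> \<phi> v\<bar> \<le> B" "continuous_on UNIV (foldr partial_deriv \<alpha> \<phi>)"
    "\<And>i v. \<exists>D. ((\<lambda>r. foldr partial_deriv \<alpha> \<phi> (v(i := r))) has_real_derivative D) (at (v i))"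
    by auto
  show "bounded (range (foldr partial_deriv \<alpha> \<phi>))" using 1(1) by (auto simp: bounded_iff)
  show "continuous_on UNIV (foldr partial_deriv \<alpha> \<phi>)" by (rule 1(2))
  show "(\<lambda>r. foldr partial_deriv \<alpha> \<phi> (v(i := r))) differentiable (at (v i))" for i v
    using 1(3)[where v=v and i=i] by (auto simp: real_differentiable_def)
next
  fix u v :: "nat \<Rightarrow> real" assume "\<forall>i<n. u i = v i"
  then show "\<phi> u = \<phi> v" by (intro cong) blast
qed

lemma Cb_infinity_properties:
  assumes "\<psi> \<in> Cb_infinity n"
  shows "(\<exists>B. \<forall>v. \<bar>\<psi> v\<bar> \<le> B) \<and> continuous_on UNIV \<psi> \<and>
      (\<forall>i v. \<exists>D. ((\<lambda>r. \<psi> (v(i := r))) has_real_derivative D) (at (v i)))"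
proof -
  have "((\<lambda>r. \<psi> (v(i := r))) has_real_derivative partial_deriv i \<psi> (v(i := v i))) (at (v i))" for v i
    by (rule Cb_infinity_DERIV[OF assms])
  then show ?thesis using Cb_infinity_bounded[OF assms] Cb_infinity_continuous[OF assms] by blast
qed

lemma partial_deriv_const: "partial_deriv i (\<lambda>_. c) = (\<lambda>_. 0)"
  by (auto simp: partial_deriv_def)

lemma Cb_infinity_const: "(\<lambda>_. c) \<in> Cb_infinity n"
proof (rule Cb_infinityI[where G="range (\<lambda>c _. c)"])
  show "foldr partial_deriv \<alpha> (\<lambda>_. c) \<in> range (\<lambda>c _. c)" for \<alpha>
    by (induction \<alpha>) (auto simp: partial_deriv_const)
  fix \<psi> :: "(nat \<Rightarrow> real) \<Rightarrow> real" assume "\<psi> \<in> range (\<lambda>c _. c)"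
  then obtain c where c: "\<psi> = (\<lambda>_. c)" by auto
  have "((\<lambda>r. \<psi> (v(i := r))) has_real_derivative 0) (at (v i))" for i v unfolding c by simp
  moreover have "\<exists>B. \<forall>v. \<bar>\<psi> v\<bar> \<le> B" unfolding c by blast
  moreover have "continuous_on UNIV \<psi>" unfolding c by simp
  ultimately show "(\<exists>B. \<forall>v. \<bar>\<psi> v\<bar> \<le> B) \<and> continuous_on UNIV \<psi> \<and>
      (\<forall>i v. \<exists>D. ((\<lambda>r. \<psi> (v(i := r))) has_real_derivative D) (at (v i)))" by blast
qed simp

lemma Cb_infinity_partial_deriv:
  assumes \<phi>: "\<phi> \<in> Cb_infinity n"
  shows "partial_deriv i \<phi> \<in> Cb_infinity n"
proof (cases "i < n")
  case True
  have *: "foldr partial_deriv \<alpha> (partial_deriv i \<phi>) = foldr partial_deriv (\<alpha> @ [i]) \<phi>" for \<alpha> by simp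
  have uv: "partial_deriv i \<phi> u = partial_deriv i \<phi> v" if uv: "\<forall>i<n. u i = v i" for u v
  proof -
    have "(\<lambda>r. \<phi> (u(i := r))) = (\<lambda>r. \<phi> (v(i := r)))"
      using uv by (intro ext Cb_infinity_cong[OF \<phi>]) auto
    then show ?thesis using uv True by (simp add: partial_deriv_def)
  qed
  have "set (\<alpha> @ [i]) \<subseteq> {..<n}" if "set \<alpha> \<subseteq> {..<n}" for \<alpha> using that True by auto
  then have P: "bounded (range (foldr partial_deriv (\<alpha> @ [i]) \<phi>)) \<and>
      continuous_on UNIV (foldr partial_deriv (\<alpha> @ [i]) \<phi>) \<and>
      (\<forall>j<n. \<forall>v. (\<lambda>r. foldr partial_deriv (\<alpha> @ [i]) \<phi> (v(j := r))) differentiable (at (v j)))"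
    if "set \<alpha> \<subseteq> {..<n}" for \<alpha>
    using \<phi> that unfolding Cb_infinity_def by blast
  show ?thesis unfolding Cb_infinity_def mem_Collect_eq *
    by (rule conjI; intro allI impI; (erule uv | erule P))
qed (simp add: partial_deriv_trivial[OF \<phi>] Cb_infinity_const)

lemma Cb_infinity_mono:
  assumes \<phi>: "\<phi> \<in> Cb_infinity n" and nm: "n \<le> m"
  shows "\<phi> \<in> Cb_infinity m"
proof (rule Cb_infinityI[OF _ _ Cb_infinity_properties])
  show "foldr partial_deriv \<alpha> \<phi> \<in> Cb_infinity n" for \<alpha>
    by (induction \<alpha>) (auto simp: \<phi> Cb_infinity_partial_deriv)
  show "\<phi> u = \<phi> v" if "\<And>i. i < m \<Longrightarrow> u i = v i" for u v
    by (rule Cb_infinity_cong[OF \<phi>], rule that) (use nm in simp)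
qed

lemma Cb_infinity_linear_combination:
  assumes \<phi>: "\<phi> \<in> Cb_infinity n" and \<psi>: "\<psi> \<in> Cb_infinity n"
  shows "(\<lambda>v. a * \<phi> v + b * \<psi> v) \<in> Cb_infinity n"
proof (rule Cb_infinityI)
  define G where "G = {\<lambda>v. a * \<phi> v + b * \<psi> v | \<phi> \<psi>. \<phi> \<in> Cb_infinity n \<and> \<psi> \<in> Cb_infinity n}"
  have der: "((\<lambda>r. a * \<phi> (v(i := r)) + b * \<psi> (v(i := r))) has_real_derivative
      a * partial_deriv i \<phi> v + b * partial_deriv i \<psi> v) (at (v i))"
    if "\<phi> \<in> Cb_infinity n" "\<psi> \<in> Cb_infinity n" for \<phi> \<psi> i v
    using Cb_infinity_DERIV[OF that(1), of v i "v i"] Cb_infinity_DERIV[OF that(2), of v i "v i"]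
    by (auto intro!: derivative_eq_intros)
  have pd: "partial_deriv i \<zeta> \<in> G" if "\<zeta> \<in> G" for i \<zeta>
  proof -
    obtain \<phi> \<psi> where *: "\<zeta> = (\<lambda>v. a * \<phi> v + b * \<psi> v)" "\<phi> \<in> Cb_infinity n" "\<psi> \<in> Cb_infinity n"
      using \<open>\<zeta> \<in> G\<close> by (auto simp: G_def)
    have "partial_deriv i \<zeta> = (\<lambda>v. a * partial_deriv i \<phi> v + b * partial_deriv i \<psi> v)"
      unfolding *(1) partial_deriv_def[of i "\<lambda>v. a * \<phi> v + b * \<psi> v"] using DERIV_imp_deriv[OF der[OF *(2,3)]] by blast
    then show ?thesis using Cb_infinity_partial_deriv[OF *(2)] Cb_infinity_partial_deriv[OF *(3)] by (auto simp: G_def)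
  qed
  show "foldr partial_deriv \<alpha> (\<lambda>v. a * \<phi> v + b * \<psi> v) \<in> G" for \<alpha>
    by (induction \<alpha>) (use \<phi> \<psi> pd in \<open>auto simp: G_def\<close>)
  fix \<zeta> assume "\<zeta> \<in> G"
  then obtain \<phi> \<psi> where *: "\<zeta> = (\<lambda>v. a * \<phi> v + b * \<psi> v)" "\<phi> \<in> Cb_infinity n" "\<psi> \<in> Cb_infinity n"
    by (auto simp: G_def)
  obtain A B where AB: "\<And>v. \<bar>\<phi> v\<bar> \<le> A" "\<And>v. \<bar>\<psi> v\<bar> \<le> B"
    using Cb_infinity_bounded[OF *(2)] Cb_infinity_bounded[OF *(3)] by blast
  have "\<bar>\<zeta> v\<bar> \<le> \<bar>a\<bar> * A + \<bar>b\<bar> * B" for v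
    unfolding *(1) by (rule order_trans[OF abs_triangle_ineq]) (auto simp: abs_mult intro!: add_mono mult_left_mono AB)
  moreover have "continuous_on UNIV \<zeta>"
    unfolding *(1) by (intro continuous_intros Cb_infinity_continuous[OF *(2)] Cb_infinity_continuous[OF *(3)])
  moreover have "\<exists>D. ((\<lambda>r. \<zeta> (v(i := r))) has_real_derivative D) (at (v i))" for i v
    unfolding *(1) by (rule exI, rule der[OF *(2,3)])
  ultimately show "(\<exists>B. \<forall>v. \<bar>\<zeta> v\<bar> \<le> B) \<and> continuous_on UNIV \<zeta> \<and>
      (\<forall>i v. \<exists>D. ((\<lambda>r. \<zeta> (v(i := r))) has_real_derivative D) (at (v i)))" by blast
next
  show "a * \<phi> u + b * \<psi> u = a * \<phi> v + b * \<psi> v" if "\<And>i. i < n \<Longrightarrow> u i = v i" for u v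
    using Cb_infinity_cong[OF \<phi>, of u v] Cb_infinity_cong[OF \<psi>, of u v] that by simp
qed

text \<open>Places the variables of a second function behind those of the first, so that two
  cylindrical functions over different functionals can be combined.\<close>

lemma Cb_infinity_shift:
  assumes \<phi>: "\<phi> \<in> Cb_infinity n"
  shows "(\<lambda>v. \<phi> (\<lambda>i. v (i + k))) \<in> Cb_infinity (n + k)"
proof (rule Cb_infinityI)
  define G where "G = (\<lambda>\<psi> v. \<psi> (\<lambda>i. v (i + k)) :: real) ` Cb_infinity n"
  have upd: "(\<lambda>i. (v(j := r)) (i + k)) = (if k \<le> j then (\<lambda>i. v (i + k))(j - k := r) else (\<lambda>i. v (i + k)))"
    for v :: "nat \<Rightarrow> real" and j r by (auto simp: fun_eq_iff)
  have pd: "partial_deriv j \<zeta> \<in> G" if "\<zeta> \<in> G" for j \<zeta>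
  proof -
    obtain \<psi> where \<psi>: "\<psi> \<in> Cb_infinity n" "\<zeta> = (\<lambda>v. \<psi> (\<lambda>i. v (i + k)))" using \<open>\<zeta> \<in> G\<close> by (auto simp: G_def)
    define \<eta> where "\<eta> = (if k \<le> j then partial_deriv (j - k) \<psi> else (\<lambda>_. 0))"
    have "partial_deriv j \<zeta> v = \<eta> (\<lambda>i. v (i + k))" for v
      unfolding \<psi>(2) partial_deriv_def upd \<eta>_def by (cases "k \<le> j") (simp_all add: partial_deriv_def)
    moreover have "\<eta> \<in> Cb_infinity n"
      by (simp add: \<eta>_def Cb_infinity_partial_deriv[OF \<psi>(1)] Cb_infinity_const)
    ultimately show ?thesis unfolding G_def by (intro image_eqI[of _ _ \<eta>] ext)
  qed
  show "foldr partial_deriv \<alpha> (\<lambda>v. \<phi> (\<lambda>i. v (i + k))) \<in> G" for \<alpha>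
    by (induction \<alpha>) (use \<phi> pd in \<open>auto simp: G_def\<close>)
  fix \<zeta> assume "\<zeta> \<in> G"
  then obtain \<psi> where \<psi>: "\<psi> \<in> Cb_infinity n" "\<zeta> = (\<lambda>v. \<psi> (\<lambda>i. v (i + k)))" by (auto simp: G_def)
  note P = Cb_infinity_properties[OF \<psi>(1)]
  have "continuous_on UNIV \<zeta>" unfolding \<psi>(2)
    by (rule continuous_on_compose2[OF Cb_infinity_continuous[OF \<psi>(1)]]) (auto intro!: continuous_intros)
  moreover have "\<exists>D. ((\<lambda>r. \<zeta> (v(j := r))) has_real_derivative D) (at (v j))" for j v
  proof (cases "k \<le> j")
    case True
    show ?thesis unfolding \<psi>(2) upd if_P[OF True] by (rule exI, rule Cb_infinity_DERIV[OF \<psi>(1)])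
  qed (auto simp: \<psi>(2) upd intro!: exI[of _ 0])
  ultimately show "(\<exists>B. \<forall>v. \<bar>\<zeta> v\<bar> \<le> B) \<and> continuous_on UNIV \<zeta> \<and>
      (\<forall>i v. \<exists>D. ((\<lambda>r. \<zeta> (v(i := r))) has_real_derivative D) (at (v i)))"
    using P by (auto simp: \<psi>(2))
next
  show "\<phi> (\<lambda>i. u (i + k)) = \<phi> (\<lambda>i. v (i + k))" if "\<And>i. i < n + k \<Longrightarrow> u i = v i" for u v
    by (rule Cb_infinity_cong[OF \<phi>], rule that) simp
qed

section \<open>Smooth cylindrical functions on the Banach space\<close>

lemma FCbI: "\<phi> \<in> Cb_infinity n \<Longrightarrow> (\<lambda>x. \<phi> (\<lambda>i. if i < n then blinfun_apply (l i) x else 0)) \<in> FCb"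
  unfolding FCb_def by blast

lemma FCbE:
  assumes "f \<in> FCb"
  obtains n \<phi> l where "\<phi> \<in> Cb_infinity n" "f = (\<lambda>x. \<phi> (\<lambda>i. if i < n then blinfun_apply (l i) x else 0))"
  using assms unfolding FCb_def mem_Collect_eq by (elim exE bexE) (rule that)

lemma FCb_linear_combination:
  assumes "f \<in> FCb" "g \<in> FCb"
  shows "(\<lambda>x. a * f x + b * g x) \<in> FCb"
proof -
  obtain n \<phi> l where f: "\<phi> \<in> Cb_infinity n" "f = (\<lambda>x. \<phi> (\<lambda>i. if i < n then blinfun_apply (l i) x else 0))"
    by (rule FCbE[OF assms(1)])
  obtain m \<psi> k where g: "\<psi> \<in> Cb_infinity m" "g = (\<lambda>x. \<psi> (\<lambda>i. if i < m then blinfun_apply (k i) x else 0))"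
    by (rule FCbE[OF assms(2)])
  define \<zeta> where "\<zeta> v = a * \<phi> v + b * \<psi> (\<lambda>i. v (i + n))" for v
  define u where "u i = (if i < n then l i else k (i - n))" for i
  have "\<zeta> \<in> Cb_infinity (m + n)"
    unfolding \<zeta>_def[abs_def] using f(1) g(1)
    by (intro Cb_infinity_linear_combination Cb_infinity_shift) (auto intro: Cb_infinity_mono)
  from FCbI[OF this, of u]
  have A: "(\<lambda>x. \<zeta> (\<lambda>i. if i < m + n then blinfun_apply (u i) x else 0)) \<in> FCb" .
  have B: "\<zeta> (\<lambda>i. if i < m + n then blinfun_apply (u i) x else 0) = a * f x + b * g x" for x
  proof -
    have "\<phi> (\<lambda>i. if i < m + n then blinfun_apply (u i) x else 0) = f x"
      unfolding f(2) by (rule Cb_infinity_cong[OF f(1)]) (simp add: u_def)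
    moreover have "\<psi> (\<lambda>i. if i + n < m + n then blinfun_apply (u (i + n)) x else 0) = g x"
      unfolding g(2) by (rule Cb_infinity_cong[OF g(1)]) (simp add: u_def)
    ultimately show ?thesis by (simp add: \<zeta>_def)
  qed
  show ?thesis using A unfolding B .
qed

lemma FCb_const: "(\<lambda>_. c) \<in> FCb"
  using FCbI[of "\<lambda>_. c" 0] by (simp add: Cb_infinity_const)

lemma FCb_sum:
  assumes "\<And>i. i < (n::nat) \<Longrightarrow> f i \<in> FCb"
  shows "(\<lambda>x. \<Sum>i<n. f i x * c i) \<in> FCb"
  using assms
proof (induction n)
  case (Suc n)
  have "(\<lambda>x. \<Sum>i<n. f i x * c i) \<in> FCb" by (rule Suc.IH, rule Suc.prems) simp
  moreover have "f n \<in> FCb" by (rule Suc.prems) simp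
  ultimately have "(\<lambda>x. 1 * (\<Sum>i<n. f i x * c i) + c n * f n x) \<in> FCb"
    by (rule FCb_linear_combination)
  then show ?case by (simp add: mult.commute)
qed (simp add: FCb_const)

text \<open>Differentiating adds pi/2 to the phase, so cosines with arbitrary phase form an
  invariant class. This puts the plane waves among the test functions and links \<open>FCb\<close>
  to the uniqueness result \<open>AE_zero_of_trig\<close>.\<close>

lemma FCb_cos: "(\<lambda>x. cos (blinfun_apply l x + b)) \<in> FCb"
proof -
  have pd: "partial_deriv 0 (\<lambda>v. cos (v 0 + b)) = (\<lambda>v. cos (v 0 + (b + pi / 2)))" for b
  proof
    fix v :: "nat \<Rightarrow> real"
    have "((\<lambda>r. cos (r + b)) has_real_derivative - sin (v 0 + b)) (at (v 0))"
      by (auto intro!: derivative_eq_intros)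
    moreover have "- sin (v 0 + b) = cos (v 0 + (b + pi / 2))"
      using cos_add[of "v 0 + b" "pi / 2"] by (simp add: add.assoc)
    ultimately show "partial_deriv 0 (\<lambda>v. cos (v 0 + b)) v = cos (v 0 + (b + pi / 2))"
      by (simp add: partial_deriv_def DERIV_imp_deriv)
  qed
  have "(\<lambda>v :: nat \<Rightarrow> real. cos (v 0 + b)) \<in> Cb_infinity 1"
  proof (rule Cb_infinityI)
    define G where "G = range (\<lambda>b (v :: nat \<Rightarrow> real). cos (v 0 + b))"
    show "foldr partial_deriv \<alpha> (\<lambda>v. cos (v 0 + b)) \<in> G" if "set \<alpha> \<subseteq> {..<1}" for \<alpha>
      using that by (induction \<alpha>) (auto simp: G_def pd)
    fix \<psi> assume "\<psi> \<in> G"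
    then obtain b where b: "\<psi> = (\<lambda>v. cos (v 0 + b))" by (auto simp: G_def)
    have "continuous_on UNIV \<psi>" unfolding b by (intro continuous_intros) simp
    moreover have "\<exists>D. ((\<lambda>r. \<psi> (v(i := r))) has_real_derivative D) (at (v i))" for i v
      unfolding b by (cases "i = 0") (auto intro!: exI derivative_eq_intros)
    moreover have "\<exists>B. \<forall>v. \<bar>\<psi> v\<bar> \<le> B" unfolding b by (intro exI[of _ 1]) simp
    ultimately show "(\<exists>B. \<forall>v. \<bar>\<psi> v\<bar> \<le> B) \<and> continuous_on UNIV \<psi> \<and>
      (\<forall>i v. \<exists>D. ((\<lambda>r. \<psi> (v(i := r))) has_real_derivative D) (at (v i)))" by blast
  qed simp
  from FCbI[OF this, of "\<lambda>_. l"] show ?thesis by simp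
qed

lemma continuous_on_cylinder:
  fixes l :: "nat \<Rightarrow> 'a::real_normed_vector \<Rightarrow>\<^sub>L real"
  assumes "continuous_on UNIV \<phi>"
  shows "continuous_on UNIV (\<lambda>x. \<phi> (\<lambda>i. if i < n then blinfun_apply (l i) x else 0) :: real)"
proof (rule continuous_on_compose2[OF assms])
  show "continuous_on UNIV (\<lambda>x i. if i < n then blinfun_apply (l i) x else 0)"
  proof (rule continuous_on_coordinatewise_then_product)
    show "continuous_on UNIV (\<lambda>x. if i < n then blinfun_apply (l i) x else 0)" for i
      by (cases "i < n") (auto intro!: continuous_intros)
  qed
qed simp

lemma FCb_continuous: "f \<in> FCb \<Longrightarrow> continuous_on UNIV f"
  by (elim FCbE) (auto intro!: continuous_on_cylinder Cb_infinity_continuous)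

lemma FCb_bounded: "f \<in> FCb \<Longrightarrow> \<exists>B. \<forall>x. \<bar>f x\<bar> \<le> B"
proof (elim FCbE)
  fix n :: nat and \<phi> and l :: "nat \<Rightarrow> 'a \<Rightarrow>\<^sub>L real"
  assume \<phi>: "\<phi> \<in> Cb_infinity n" and f: "f = (\<lambda>x. \<phi> (\<lambda>i. if i < n then blinfun_apply (l i) x else 0))"
  obtain B where B: "\<forall>v. \<bar>\<phi> v\<bar> \<le> B" using Cb_infinity_bounded[OF \<phi>] by blast
  show "\<exists>B. \<forall>x. \<bar>f x\<bar> \<le> B" unfolding f by (intro exI[of _ B] allI B[rule_format])
qed

text \<open>A function with continuous partial derivatives is differentiable, along the affine
  map \<open>h \<mapsto> v + (\<langle>a\<^sub>i, h\<rangle>)\<^sub>i\<close>: change one coordinate after the other.\<close>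

lemma Cb_infinity_has_derivative:
  fixes a :: "nat \<Rightarrow> 'h::real_inner"
  assumes \<phi>: "\<phi> \<in> Cb_infinity n"
  shows "((\<lambda>h. \<phi> (\<lambda>i. v i + (if i < m then inner (a i) h else 0))) has_derivative
    (\<lambda>h. \<Sum>i<m. partial_deriv i \<phi> v * inner (a i) h)) (at 0)"
proof (induction m)
  case (Suc m)
  define F where "F m h = \<phi> (\<lambda>i. v i + (if i < m then inner (a i) h else 0))" for m h
  \<comment> \<open>The point in which the first \<open>m\<close> coordinates have already moved by
    the full increment and coordinate \<open>m\<close> has moved by \<theta>; \<open>P\<close> is
    the partial derivative there.\<close>
  define W where "W = (\<lambda>(h, \<theta>) i. v i + (if i < m then inner (a i) h else if i = m then \<theta> else 0))"
  define P where "P = (\<lambda>p. partial_deriv m \<phi> (W p))"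
  have W: "continuous_on UNIV W"
  proof (rule continuous_on_coordinatewise_then_product)
    fix i
    consider "i < m" | "i = m" | "i > m" by linarith
    then show "continuous_on UNIV (\<lambda>p. W p i)"
      by cases (auto simp: W_def case_prod_beta intro!: continuous_intros)
  qed
  have P: "continuous_on UNIV P" unfolding P_def
    by (rule continuous_on_compose2[OF Cb_infinity_continuous[OF Cb_infinity_partial_deriv[OF \<phi>]] W]) simp
  have "\<exists>\<theta>. \<bar>\<theta>\<bar> \<le> \<bar>inner (a m) h\<bar> \<and> F (Suc m) h - F m h = P (h, \<theta>) * inner (a m) h" for h
  proof -
    define g where "g r = \<phi> ((W (h, 0))(m := v m + r))" for r
    have upd: "(W (h, 0))(m := v m + r) = W (h, r)" for r by (auto simp: W_def)
    have der: "(g has_real_derivative P (h, r)) (at r)" for r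
    proof -
      have "((\<lambda>s. \<phi> ((W (h, 0))(m := s))) has_real_derivative P (h, r)) (at (v m + r))"
        using Cb_infinity_DERIV[OF \<phi>, of "W (h, 0)" m "v m + r"] unfolding upd P_def .
      then show ?thesis unfolding g_def
        using DERIV_at_within_shift[of "\<lambda>s. \<phi> ((W (h, 0))(m := s))" "P (h, r)" "v m" r UNIV] by simp
    qed
    have F: "F m h = g 0" "F (Suc m) h = g (inner (a m) h)"
      by (auto simp: F_def g_def W_def fun_eq_iff intro!: arg_cong[where f=\<phi>])
    let ?t = "inner (a m) h"
    \<comment> \<open>The mean value theorem wants an increasing interval, hence the split by the
      sign of the increment.\<close>
    consider "?t = 0" | "0 < ?t" | "?t < 0" by linarith
    then show ?thesis
    proof cases
      case 1 then show ?thesis using F by (intro exI[of _ 0]) simp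
    next
      case 2
      then obtain z where "0 < z" "z < ?t" "g ?t - g 0 = (?t - 0) * P (h, z)"
        using MVT2[of 0 ?t g "\<lambda>r. P (h, r)"] der by blast
      then show ?thesis using F by (intro exI[of _ z]) (auto simp: mult.commute)
    next
      case 3
      then obtain z where "?t < z" "z < 0" "g 0 - g ?t = (0 - ?t) * P (h, z)"
        using MVT2[of ?t 0 g "\<lambda>r. P (h, r)"] der by blast
      then show ?thesis using F by (intro exI[of _ z]) (auto simp: algebra_simps)
    qed
  qed
  then obtain \<theta> where \<theta>: "\<And>h. \<bar>\<theta> h\<bar> \<le> \<bar>inner (a m) h\<bar>" "\<And>h. F (Suc m) h - F m h = P (h, \<theta> h) * inner (a m) h"
    by metis
  have P0: "P (0, 0) = partial_deriv m \<phi> v" by (auto simp: P_def W_def intro!: arg_cong[where f="partial_deriv m \<phi>"])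
  have "((\<lambda>h. F (Suc m) h - F m h) has_derivative (\<lambda>h. partial_deriv m \<phi> v * inner (a m) h)) (at 0)"
  proof (rule has_derivativeI_sandwich[where e=1 and H="\<lambda>h. \<bar>P (h, \<theta> h) - P (0, 0)\<bar> * norm (a m)"])
    have "(\<lambda>h. \<bar>inner (a m) h\<bar>) \<midarrow>0\<rightarrow> \<bar>inner (a m) 0\<bar>" by (intro tendsto_intros)
    then have "\<theta> \<midarrow>0\<rightarrow> 0" by (intro tendsto_0_le[where K=1 and g=\<theta>]) (use \<theta>(1) in auto)
    then have "(\<lambda>h. P (h, \<theta> h)) \<midarrow>0\<rightarrow> P (0, 0)"
      by (intro continuous_on_tendsto_compose[OF P] tendsto_Pair tendsto_ident_at) auto
    then have "(\<lambda>h. \<bar>P (h, \<theta> h) - P (0, 0)\<bar> * norm (a m)) \<midarrow>0\<rightarrow> \<bar>P (0, 0) - P (0, 0)\<bar> * norm (a m)"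
      by (intro tendsto_intros)
    then show "(\<lambda>h. \<bar>P (h, \<theta> h) - P (0, 0)\<bar> * norm (a m)) \<midarrow>0\<rightarrow> 0" by simp
    show "bounded_linear (\<lambda>h. partial_deriv m \<phi> v * inner (a m) h)"
      by (intro bounded_linear_const_mult bounded_linear_inner_right)
    fix h :: 'h assume "h \<noteq> 0"
    have F0: "F (Suc m) 0 = F m 0" by (simp add: F_def cong: if_cong)
    have "\<bar>F (Suc m) h - F m h - partial_deriv m \<phi> v * inner (a m) h\<bar> = \<bar>P (h, \<theta> h) - P (0, 0)\<bar> * \<bar>inner (a m) h\<bar>"
      unfolding \<theta>(2) P0[symmetric] by (simp add: left_diff_distrib[symmetric] abs_mult)
    also have "\<dots> \<le> \<bar>P (h, \<theta> h) - P (0, 0)\<bar> * (norm (a m) * norm h)"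
      by (intro mult_left_mono Cauchy_Schwarz_ineq2) auto
    finally show "norm (F (Suc m) h - F m h - (F (Suc m) 0 - F m 0) - partial_deriv m \<phi> v * inner (a m) (h - 0)) / norm (h - 0)
      \<le> \<bar>P (h, \<theta> h) - P (0, 0)\<bar> * norm (a m)"
      using \<open>h \<noteq> 0\<close> by (simp add: F0 divide_le_eq mult.assoc)
  qed auto
  from has_derivative_add[OF Suc.IH this[unfolded F_def]] show ?case by simp
qed simp

section \<open>Derivatives of cylindrical functions along the Cameron-Martin space\<close>

context cameron_martin_space
begin

lemma H_grad_eq:
  assumes "GDERIV (\<lambda>h. f (x + \<iota> h)) 0 :> v"
  shows "H_grad \<iota> f x = v"
  unfolding H_grad_def
proof (rule the_equality)
  show "GDERIV (\<lambda>h. f (x + \<iota> h)) 0 :> v" by (rule assms)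
  fix u assume "GDERIV (\<lambda>h. f (x + \<iota> h)) 0 :> u"
  then have "(\<lambda>h. inner h u) = (\<lambda>h. inner h v)"
    using assms unfolding gderiv_def by (rule has_derivative_unique)
  then have "inner (u - v) u = inner (u - v) v" by (rule fun_cong)
  then have "inner (u - v) (u - v) = 0" by (simp add: inner_diff_right)
  then show "u = v" by simp
qed

lemma H_deriv_eq:
  assumes "((\<lambda>h. \<Phi> (x + \<iota> h)) has_derivative blinfun_apply T) (at 0)"
  shows "H_deriv \<iota> \<Phi> x = T"
  unfolding H_deriv_def
proof (rule the_equality)
  show "((\<lambda>h. \<Phi> (x + \<iota> h)) has_derivative blinfun_apply T) (at 0)" by (rule assms)
  fix S assume "((\<lambda>h. \<Phi> (x + \<iota> h)) has_derivative blinfun_apply S) (at 0)"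
  then have "blinfun_apply S = blinfun_apply T" using assms by (rule has_derivative_unique)
  then show "S = T" by (simp add: blinfun_apply_inject)
qed

text \<open>By the chain rule the gradient combines the representers of the functionals, with the
  partial derivatives as cylindrical coefficients. It is thus again a cylindrical field, and
  Hessians reduce to derivatives of such fields.\<close>

lemma FCb_gradient_form:
  assumes "f \<in> FCb"
  obtains n :: nat and g a where "\<forall>i<n. g i \<in> FCb" "H_grad \<iota> f = (\<lambda>x. \<Sum>i<n. g i x *\<^sub>R a i)"
    "\<forall>x. GDERIV (\<lambda>h. f (x + \<iota> h)) 0 :> H_grad \<iota> f x"
proof -
  obtain n \<phi> l where f: "\<phi> \<in> Cb_infinity n" "f = (\<lambda>x. \<phi> (\<lambda>i. if i < n then blinfun_apply (l i) x else 0))"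
    by (rule FCbE[OF assms])
  have "\<exists>a. \<forall>h. blinfun_apply (l i) (\<iota> h) = inner a h" for i
    by (rule functional_representer[of "l i"]) blast
  then have "\<forall>i. \<exists>a. \<forall>h. blinfun_apply (l i) (\<iota> h) = inner a h" by blast
  from choice[OF this] obtain a where a: "\<And>i h. blinfun_apply (l i) (\<iota> h) = inner (a i) h" by auto
  define g where "g i = (\<lambda>x. partial_deriv i \<phi> (\<lambda>i. if i < n then blinfun_apply (l i) x else 0))" for i
  have grad: "GDERIV (\<lambda>h. f (x + \<iota> h)) 0 :> (\<Sum>i<n. g i x *\<^sub>R a i)" for x
  proof -
    have "(\<lambda>h. f (x + \<iota> h)) = (\<lambda>h. \<phi> (\<lambda>i. (if i < n then blinfun_apply (l i) x else 0) + (if i < n then inner (a i) h else 0)))"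
      by (auto simp: f(2) blinfun.add_right a fun_eq_iff intro!: arg_cong[where f=\<phi>])
    moreover have "(\<lambda>h. inner h (\<Sum>i<n. g i x *\<^sub>R a i)) =
      (\<lambda>h. \<Sum>i<n. partial_deriv i \<phi> (\<lambda>i. if i < n then blinfun_apply (l i) x else 0) * inner (a i) h)"
      by (auto simp: inner_sum_right g_def inner_commute)
    ultimately show ?thesis unfolding gderiv_def using Cb_infinity_has_derivative[OF f(1)] by simp
  qed
  have "g i \<in> FCb" for i unfolding g_def by (rule FCbI[OF Cb_infinity_partial_deriv[OF f(1)]])
  then have G: "\<forall>i<n. g i \<in> FCb" by blast
  have H: "H_grad \<iota> f = (\<lambda>x. \<Sum>i<n. g i x *\<^sub>R a i)" by (rule ext, rule H_grad_eq, rule grad)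
  have D: "\<forall>x. GDERIV (\<lambda>h. f (x + \<iota> h)) 0 :> H_grad \<iota> f x" unfolding H using grad by blast
  show ?thesis by (rule that[OF G H D])
qed

lemma FCb_gderiv:
  assumes "f \<in> FCb"
  shows "GDERIV (\<lambda>h. f (x + \<iota> h)) 0 :> H_grad \<iota> f x"
proof -
  obtain n :: nat and g a where "\<forall>i<n. g i \<in> FCb" "H_grad \<iota> f = (\<lambda>x. \<Sum>i<n. g i x *\<^sub>R a i)"
    and g: "\<forall>x. GDERIV (\<lambda>h. f (x + \<iota> h)) 0 :> H_grad \<iota> f x"
    by (rule FCb_gradient_form[OF assms])
  show ?thesis by (rule spec[OF g])
qed

lemma FCb_vecI: "\<forall>i<(n::nat). f i \<in> FCb \<Longrightarrow> (\<lambda>x. \<Sum>i<n. f i x *\<^sub>R h i) \<in> FCb_vec"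
  unfolding FCb_vec_def mem_Collect_eq
  by (rule exI[of _ n], rule exI[of _ f], rule exI[of _ h], rule conjI, assumption, rule refl)

lemma H_grad_in_FCb_vec:
  assumes "f \<in> FCb"
  shows "H_grad \<iota> f \<in> FCb_vec"
proof -
  obtain n :: nat and g a where g: "\<forall>i<n. g i \<in> FCb" "H_grad \<iota> f = (\<lambda>x. \<Sum>i<n. g i x *\<^sub>R a i)"
    by (rule FCb_gradient_form[OF assms])
  show ?thesis unfolding g(2) by (rule FCb_vecI[OF g(1)])
qed

definition dH :: "'h \<Rightarrow> ('a \<Rightarrow> real) \<Rightarrow> 'a \<Rightarrow> real" where
  "dH k f x = inner (H_grad \<iota> f x) k"

lemma FCb_vecE:
  assumes "\<Phi> \<in> FCb_vec"
  obtains n f h where "\<forall>i<(n::nat). f i \<in> FCb" "\<Phi> = (\<lambda>x. \<Sum>i<n. f i x *\<^sub>R h i)"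
  using assms unfolding FCb_vec_def mem_Collect_eq by (elim exE conjE) (rule that)

lemma FCb_vec_component:
  fixes h :: "'b::real_inner"
  assumes "\<Phi> \<in> FCb_vec"
  shows "(\<lambda>x. inner (\<Phi> x) h) \<in> FCb"
proof -
  obtain n f a where f: "\<forall>i<(n::nat). f i \<in> FCb" "\<Phi> = (\<lambda>x. \<Sum>i<n. f i x *\<^sub>R a i)"
    by (rule FCb_vecE[OF assms])
  have "(\<lambda>x. \<Sum>i<n. f i x * inner (a i) h) \<in> FCb" by (rule FCb_sum) (simp add: f(1))
  then show ?thesis by (simp add: f(2) inner_sum_left)
qed

lemma FCb_vec_continuous:
  assumes "\<Phi> \<in> FCb_vec"
  shows "continuous_on UNIV (\<Phi> :: 'a \<Rightarrow> 'h)"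
proof -
  obtain n f h where f: "\<forall>i<(n::nat). f i \<in> FCb" "\<Phi> = (\<lambda>x. \<Sum>i<n. f i x *\<^sub>R h i)"
    by (rule FCb_vecE[OF assms])
  show ?thesis unfolding f(2)
    by (intro continuous_on_sum continuous_on_scaleR continuous_on_const FCb_continuous) (simp add: f(1))
qed

lemma FCb_vec_bounded: "\<Phi> \<in> FCb_vec \<Longrightarrow> \<exists>B. \<forall>x. norm (\<Phi> x :: 'h) \<le> B"
proof (elim FCb_vecE)
  fix n f and h :: "nat \<Rightarrow> 'h" assume f: "\<forall>i<(n::nat). f i \<in> FCb" "\<Phi> = (\<lambda>x. \<Sum>i<n. f i x *\<^sub>R h i)"
  have "\<forall>i\<in>{..<n}. \<exists>B. \<forall>x. \<bar>f i x\<bar> \<le> B" by (intro ballI FCb_bounded) (simp add: f(1))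
  from bchoice[OF this] obtain B where B: "\<And>i x. i < n \<Longrightarrow> \<bar>f i x\<bar> \<le> B i" by auto
  have "norm (\<Phi> x) \<le> (\<Sum>i<n. B i * norm (h i))" for x
    unfolding f(2) by (rule order_trans[OF norm_sum]) (auto intro!: sum_mono mult_right_mono B)
  then show "\<exists>B. \<forall>x. norm (\<Phi> x) \<le> B" by blast
qed

lemma dH_FCb: "f \<in> FCb \<Longrightarrow> dH k f \<in> FCb"
  unfolding dH_def[abs_def] by (intro FCb_vec_component H_grad_in_FCb_vec)

lemma FCb_admissible:
  assumes f: "f \<in> FCb"
  shows "admissible k f (dH k f)"
  unfolding admissible_def
proof (intro conjI allI)
  fix x
  have "((\<lambda>h. f (x + \<iota> h)) has_derivative (\<lambda>h. inner h (H_grad \<iota> f x))) (at (0 *\<^sub>R k))"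
    using FCb_gderiv[OF f, of x] by (simp add: gderiv_def)
  moreover have "((\<lambda>r. r *\<^sub>R k) has_derivative (\<lambda>r. r *\<^sub>R k)) (at 0)"
    by (auto intro!: derivative_eq_intros)
  ultimately have "((\<lambda>r. f (x + \<iota> (r *\<^sub>R k))) has_derivative (\<lambda>r. inner (r *\<^sub>R k) (H_grad \<iota> f x))) (at 0)"
    using has_derivative_compose[of "\<lambda>r. r *\<^sub>R k" "\<lambda>r. r *\<^sub>R k" 0 UNIV "\<lambda>h. f (x + \<iota> h)"] by blast
  moreover have "(\<lambda>r. inner (r *\<^sub>R k) (H_grad \<iota> f x)) = times (dH k f x)"
    by (auto simp: dH_def inner_commute)
  ultimately show "((\<lambda>r. f (x + r *\<^sub>R \<iota> k)) has_real_derivative dH k f x) (at 0)"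
    by (simp add: has_field_derivative_def linear_scale[OF linear_iota])
qed (use f dH_FCb FCb_continuous FCb_bounded in blast)+

text \<open>The mean value theorem used twice, once in each direction. The left-hand side is
  symmetric in \<open>h\<close> and \<open>k\<close>, which is the classical route to equality of
  mixed derivatives.\<close>

lemma double_difference:
  assumes f: "admissible h f f1" "admissible k f1 f12" and t: "t > 0"
  obtains \<xi> \<eta> where "0 < \<xi>" "\<xi> < t" "0 < \<eta>" "\<eta> < t"
    "f (x + t *\<^sub>R \<iota> h + t *\<^sub>R \<iota> k) - f (x + t *\<^sub>R \<iota> h) - f (x + t *\<^sub>R \<iota> k) + f x =
     t * t * f12 (x + \<xi> *\<^sub>R \<iota> h + \<eta> *\<^sub>R \<iota> k)"
proof -
  define g where "g r = f (x + t *\<^sub>R \<iota> k + r *\<^sub>R \<iota> h) - f (x + r *\<^sub>R \<iota> h)" for r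
  have "(g has_real_derivative f1 (x + t *\<^sub>R \<iota> k + r *\<^sub>R \<iota> h) - f1 (x + r *\<^sub>R \<iota> h)) (at r)" for r
    unfolding g_def by (intro derivative_intros admissible_deriv[OF f(1)])
  then obtain \<xi> where \<xi>: "0 < \<xi>" "\<xi> < t"
    "g t - g 0 = (t - 0) * (f1 (x + t *\<^sub>R \<iota> k + \<xi> *\<^sub>R \<iota> h) - f1 (x + \<xi> *\<^sub>R \<iota> h))"
    using MVT2[of 0 t g "\<lambda>r. f1 (x + t *\<^sub>R \<iota> k + r *\<^sub>R \<iota> h) - f1 (x + r *\<^sub>R \<iota> h)"] t by blast
  obtain \<eta> where \<eta>: "0 < \<eta>" "\<eta> < t"
    "f1 (x + \<xi> *\<^sub>R \<iota> h + t *\<^sub>R \<iota> k) - f1 (x + \<xi> *\<^sub>R \<iota> h + 0 *\<^sub>R \<iota> k) = (t - 0) * f12 (x + \<xi> *\<^sub>R \<iota> h + \<eta> *\<^sub>R \<iota> k)"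
    using MVT2[of 0 t "\<lambda>r. f1 (x + \<xi> *\<^sub>R \<iota> h + r *\<^sub>R \<iota> k)" "\<lambda>r. f12 (x + \<xi> *\<^sub>R \<iota> h + r *\<^sub>R \<iota> k)"]
      t admissible_deriv[OF f(2)] by blast
  show ?thesis
    using \<xi>(3) \<eta>(3) by (intro that[OF \<xi>(1,2) \<eta>(1,2)]) (simp add: g_def algebra_simps)
qed

text \<open>Both orders express the same second difference, so the mixed derivatives agree at two
  points close to \<open>x\<close>; steps tending to 0 and continuity give agreement at
  \<open>x\<close>.\<close>

lemma admissible_mixed_derivatives:
  assumes "admissible h f f1" "admissible k f1 f12" "admissible k f f2" "admissible h f2 f21"
  shows "f12 x = f21 x"
proof -
  have "\<exists>\<xi> \<eta> \<xi>' \<eta>'. 0 < \<xi> \<and> \<xi> < t \<and> 0 < \<eta> \<and> \<eta> < t \<and> 0 < \<xi>' \<and> \<xi>' < t \<and> 0 < \<eta>' \<and> \<eta>' < t \<and>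
    f12 (x + \<xi> *\<^sub>R \<iota> h + \<eta> *\<^sub>R \<iota> k) = f21 (x + \<xi>' *\<^sub>R \<iota> k + \<eta>' *\<^sub>R \<iota> h)" if t: "t > 0" for t
  proof -
    obtain \<xi> \<eta> where 1: "0 < \<xi>" "\<xi> < t" "0 < \<eta>" "\<eta> < t"
      "f (x + t *\<^sub>R \<iota> h + t *\<^sub>R \<iota> k) - f (x + t *\<^sub>R \<iota> h) - f (x + t *\<^sub>R \<iota> k) + f x =
       t * t * f12 (x + \<xi> *\<^sub>R \<iota> h + \<eta> *\<^sub>R \<iota> k)" using double_difference[OF assms(1,2) t] by blast
    obtain \<xi>' \<eta>' where 2: "0 < \<xi>'" "\<xi>' < t" "0 < \<eta>'" "\<eta>' < t"
      "f (x + t *\<^sub>R \<iota> k + t *\<^sub>R \<iota> h) - f (x + t *\<^sub>R \<iota> k) - f (x + t *\<^sub>R \<iota> h) + f x =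
       t * t * f21 (x + \<xi>' *\<^sub>R \<iota> k + \<eta>' *\<^sub>R \<iota> h)" using double_difference[OF assms(3,4) t] by blast
    have *: "x + t *\<^sub>R \<iota> h + t *\<^sub>R \<iota> k = x + t *\<^sub>R \<iota> k + t *\<^sub>R \<iota> h" by (simp add: add_ac)
    have "t * t * f12 (x + \<xi> *\<^sub>R \<iota> h + \<eta> *\<^sub>R \<iota> k) = t * t * f21 (x + \<xi>' *\<^sub>R \<iota> k + \<eta>' *\<^sub>R \<iota> h)"
      using 1(5)[unfolded *] 2(5) by linarith
    then show ?thesis using 1(1-4) 2(1-4) t by (intro exI[of _ \<xi>] exI[of _ \<eta>] exI[of _ \<xi>'] exI[of _ \<eta>']) auto
  qed
  from this[of "1 / real (Suc n)" for n]
  obtain \<xi> \<eta> \<xi>' \<eta>' where *: "\<And>n. 0 < \<xi> n \<and> \<xi> n < 1 / real (Suc n) \<and> 0 < \<eta> n \<and> \<eta> n < 1 / real (Suc n) \<and>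
     0 < \<xi>' n \<and> \<xi>' n < 1 / real (Suc n) \<and> 0 < \<eta>' n \<and> \<eta>' n < 1 / real (Suc n) \<and>
     f12 (x + \<xi> n *\<^sub>R \<iota> h + \<eta> n *\<^sub>R \<iota> k) = f21 (x + \<xi>' n *\<^sub>R \<iota> k + \<eta>' n *\<^sub>R \<iota> h)"
    by (simp del: of_nat_Suc) metis
  have 0: "u \<longlonglongrightarrow> 0" if "\<And>n. 0 < u n \<and> u n < 1 / real (Suc n)" for u :: "nat \<Rightarrow> real"
    by (rule tendsto_sandwich[OF _ _ tendsto_const LIMSEQ_Suc[OF lim_1_over_n]])
      (use that in \<open>auto intro!: always_eventually less_imp_le\<close>)
  have c: "continuous_on UNIV f12" "continuous_on UNIV f21" using assms by (auto simp: admissible_def)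
  have "(\<lambda>n. f12 (x + \<xi> n *\<^sub>R \<iota> h + \<eta> n *\<^sub>R \<iota> k)) \<longlonglongrightarrow> f12 (x + 0 *\<^sub>R \<iota> h + 0 *\<^sub>R \<iota> k)"
    by (intro continuous_on_tendsto_compose[OF c(1)] tendsto_intros 0) (use * in auto)
  moreover have "(\<lambda>n. f21 (x + \<xi>' n *\<^sub>R \<iota> k + \<eta>' n *\<^sub>R \<iota> h)) \<longlonglongrightarrow> f21 (x + 0 *\<^sub>R \<iota> k + 0 *\<^sub>R \<iota> h)"
    by (intro continuous_on_tendsto_compose[OF c(2)] tendsto_intros 0) (use * in auto)
  ultimately show ?thesis using * LIMSEQ_unique by simp
qed

lemma dH_commute: "f \<in> FCb \<Longrightarrow> dH h (dH k f) = dH k (dH h f)"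
  using admissible_mixed_derivatives[of k f "dH k f" h "dH h (dH k f)" "dH h f" "dH k (dH h f)"]
  by (auto intro: FCb_admissible dH_FCb)

text \<open>The derivative has finite rank: it is the sum of the tensors of \<open>a i\<close> with
  the gradients of \<open>f i\<close>. This form later gives the Hilbert-Schmidt property and the
  trace.\<close>

lemma FCb_vec_H_deriv:
  assumes f: "\<And>i. i < (n::nat) \<Longrightarrow> f i \<in> FCb" and \<Phi>: "\<Phi> = (\<lambda>x. \<Sum>i<n. f i x *\<^sub>R (a i :: 'h))"
  shows "((\<lambda>h. \<Phi> (x + \<iota> h)) has_derivative blinfun_apply (H_deriv \<iota> \<Phi> x)) (at 0)"
    and "blinfun_apply (H_deriv \<iota> \<Phi> x) k = (\<Sum>i<n. dH k (f i) x *\<^sub>R a i)"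
proof -
  define T where "T k = (\<Sum>i<n. inner k (H_grad \<iota> (f i) x) *\<^sub>R a i)" for k
  have T: "((\<lambda>h. \<Phi> (x + \<iota> h)) has_derivative T) (at 0)"
    unfolding \<Phi> T_def
  proof (rule has_derivative_sum)
    fix i assume "i \<in> {..<n}"
    then have "((\<lambda>h. f i (x + \<iota> h)) has_derivative (\<lambda>h. inner h (H_grad \<iota> (f i) x))) (at 0)"
      using FCb_gderiv[OF f, of i x] by (simp add: gderiv_def)
    then show "((\<lambda>h. f i (x + \<iota> h) *\<^sub>R a i) has_derivative (\<lambda>h. inner h (H_grad \<iota> (f i) x) *\<^sub>R a i)) (at 0)"
      by (auto intro!: derivative_eq_intros)
  qed
  have bl: "bounded_linear T" by (rule has_derivative_bounded_linear[OF T])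
  then have "H_deriv \<iota> \<Phi> x = Blinfun T"
    using T by (intro H_deriv_eq) (simp add: bounded_linear_Blinfun_apply)
  then have *: "blinfun_apply (H_deriv \<iota> \<Phi> x) = T" by (simp add: bounded_linear_Blinfun_apply[OF bl])
  show "((\<lambda>h. \<Phi> (x + \<iota> h)) has_derivative blinfun_apply (H_deriv \<iota> \<Phi> x)) (at 0)" using T * by simp
  show "blinfun_apply (H_deriv \<iota> \<Phi> x) k = (\<Sum>i<n. dH k (f i) x *\<^sub>R a i)"
    by (simp add: * T_def dH_def inner_commute)
qed

lemma FCb_vec_has_derivative:
  assumes "\<Phi> \<in> FCb_vec"
  shows "((\<lambda>h. \<Phi> (x + \<iota> h)) has_derivative blinfun_apply (H_deriv \<iota> \<Phi> x)) (at (0 :: 'h))"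
proof -
  obtain n f a where f: "\<forall>i<(n::nat). f i \<in> FCb" "\<Phi> = (\<lambda>x. \<Sum>i<n. f i x *\<^sub>R a i)"
    by (rule FCb_vecE[OF assms])
  show ?thesis by (rule FCb_vec_H_deriv(1)[OF f(1)[rule_format] f(2)])
qed

lemma inner_H_deriv:
  assumes "\<Phi> \<in> FCb_vec"
  shows "inner (blinfun_apply (H_deriv \<iota> \<Phi> x) k) h = dH k (\<lambda>x. inner (\<Phi> x) h) x"
proof -
  have "((\<lambda>k. inner (\<Phi> (x + \<iota> k)) h) has_derivative (\<lambda>k. inner (blinfun_apply (H_deriv \<iota> \<Phi> x) k) h)) (at 0)"
    using FCb_vec_has_derivative[OF assms, of x] by (auto intro!: derivative_eq_intros)
  moreover have "((\<lambda>k. inner (\<Phi> (x + \<iota> k)) h) has_derivative (\<lambda>k. inner k (H_grad \<iota> (\<lambda>x. inner (\<Phi> x) h) x))) (at 0)"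
    using FCb_gderiv[OF FCb_vec_component[OF assms], of x h] by (simp add: gderiv_def)
  ultimately have "(\<lambda>k. inner (blinfun_apply (H_deriv \<iota> \<Phi> x) k) h) = (\<lambda>k. inner k (H_grad \<iota> (\<lambda>x. inner (\<Phi> x) h) x))"
    by (rule has_derivative_unique)
  then show ?thesis by (metis dH_def inner_commute)
qed

lemma H_hess_inner:
  "f \<in> FCb \<Longrightarrow> inner (blinfun_apply (H_hess \<iota> f x) k) h = dH k (dH h f) x"
  unfolding H_hess_def using inner_H_deriv[OF H_grad_in_FCb_vec] by (simp add: dH_def[abs_def])

lemma FCb_vec_blinfun:
  fixes Q :: "'h \<Rightarrow>\<^sub>L 'h"
  assumes "\<Phi> \<in> FCb_vec"
  shows "(\<lambda>x. blinfun_apply Q (\<Phi> x)) \<in> FCb_vec"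
    and "H_deriv \<iota> (\<lambda>x. blinfun_apply Q (\<Phi> x)) x = Q o\<^sub>L H_deriv \<iota> \<Phi> x"
proof -
  obtain n f a where f: "\<forall>i<(n::nat). f i \<in> FCb" "\<Phi> = (\<lambda>x. \<Sum>i<n. f i x *\<^sub>R a i)"
    by (rule FCb_vecE[OF assms])
  have "(\<lambda>x. \<Sum>i<n. f i x *\<^sub>R blinfun_apply Q (a i)) \<in> FCb_vec" by (rule FCb_vecI[OF f(1)])
  then show "(\<lambda>x. blinfun_apply Q (\<Phi> x)) \<in> FCb_vec"
    by (simp add: f(2) blinfun.sum_right blinfun.scaleR_right)
  have "((\<lambda>h. blinfun_apply Q (\<Phi> (x + \<iota> h))) has_derivative (\<lambda>h. blinfun_apply Q (blinfun_apply (H_deriv \<iota> \<Phi> x) h))) (at 0)"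
    using FCb_vec_has_derivative[OF assms, of x] by (auto intro!: derivative_eq_intros)
  moreover have "blinfun_apply (Q o\<^sub>L H_deriv \<iota> \<Phi> x) = (\<lambda>h. blinfun_apply Q (blinfun_apply (H_deriv \<iota> \<Phi> x) h))"
    by (rule ext) simp
  ultimately show "H_deriv \<iota> (\<lambda>x. blinfun_apply Q (\<Phi> x)) x = Q o\<^sub>L H_deriv \<iota> \<Phi> x"
    by (intro H_deriv_eq) (simp only:)
qed

lemma FCb_vec_diff:
  fixes \<Phi> \<Psi> :: "'a \<Rightarrow> 'h"
  assumes "\<Phi> \<in> FCb_vec" "\<Psi> \<in> FCb_vec"
  shows "(\<lambda>x. \<Phi> x - \<Psi> x) \<in> FCb_vec"
    and "H_deriv \<iota> (\<lambda>x. \<Phi> x - \<Psi> x) x = H_deriv \<iota> \<Phi> x - H_deriv \<iota> \<Psi> x"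
proof -
  obtain n f a where f: "\<forall>i<(n::nat). f i \<in> FCb" "\<Phi> = (\<lambda>x. \<Sum>i<n. f i x *\<^sub>R a i)"
    by (rule FCb_vecE[OF assms(1)])
  obtain m g b where g: "\<forall>i<(m::nat). g i \<in> FCb" "\<Psi> = (\<lambda>x. \<Sum>i<m. g i x *\<^sub>R b i)"
    by (rule FCb_vecE[OF assms(2)])
  have split: "(\<Sum>i<n + m. u i) = (\<Sum>i<n. u i) + (\<Sum>i<m. u (n + i))" for u :: "nat \<Rightarrow> 'h"
    by (induction m) (auto simp: add.assoc)
  have "(\<lambda>x. \<Sum>i<n + m. (if i < n then f i else g (i - n)) x *\<^sub>R (if i < n then a i else - b (i - n))) \<in> FCb_vec"
    by (rule FCb_vecI) (use f(1) g(1) in auto)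
  moreover have "(\<Sum>i<n + m. (if i < n then f i else g (i - n)) x *\<^sub>R (if i < n then a i else - b (i - n))) = \<Phi> x - \<Psi> x" for x
    by (simp add: f(2) g(2) split sum_negf)
  ultimately show "(\<lambda>x. \<Phi> x - \<Psi> x) \<in> FCb_vec" by (simp only:)
  have "((\<lambda>h. \<Phi> (x + \<iota> h) - \<Psi> (x + \<iota> h)) has_derivative (\<lambda>h. blinfun_apply (H_deriv \<iota> \<Phi> x) h - blinfun_apply (H_deriv \<iota> \<Psi> x) h)) (at 0)"
    by (intro derivative_intros FCb_vec_has_derivative assms)
  moreover have "blinfun_apply (H_deriv \<iota> \<Phi> x - H_deriv \<iota> \<Psi> x)
      = (\<lambda>h. blinfun_apply (H_deriv \<iota> \<Phi> x) h - blinfun_apply (H_deriv \<iota> \<Psi> x) h)"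
    by (rule ext) (simp add: blinfun.diff_left)
  ultimately show "H_deriv \<iota> (\<lambda>x. \<Phi> x - \<Psi> x) x = H_deriv \<iota> \<Phi> x - H_deriv \<iota> \<Psi> x"
    by (intro H_deriv_eq) (simp only:)
qed

end

section \<open>Convergence in Lebesgue spaces\<close>

text \<open>Stands in for Hoelder's inequality and uniform integrability: a fixed integrable
  function carries an arbitrarily small factor, and the large constant multiplies a sequence that
  tends to 0 in mean.\<close>

lemma nn_integral_tendsto_0_of_domination:
  fixes a b :: "nat \<Rightarrow> 'a \<Rightarrow> real" and h :: "'a \<Rightarrow> real"
  assumes [measurable]: "\<And>k. a k \<in> borel_measurable M" "h \<in> borel_measurable M"
    and nonneg: "\<And>k x. a k x \<ge> 0" "\<And>x. h x \<ge> 0"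
    and h: "integrable M h"
    and lim: "(\<lambda>k. \<integral>\<^sup>+x. ennreal (a k x) \<partial>M) \<longlonglongrightarrow> 0"
    and dom: "\<And>\<delta>. \<delta> > 0 \<Longrightarrow> \<exists>c\<ge>0. \<forall>k. AE x in M. b k x \<le> \<delta> * h x + c * a k x"
  shows "(\<lambda>k. \<integral>\<^sup>+x. ennreal (b k x) \<partial>M) \<longlonglongrightarrow> 0"
proof (rule order_tendstoI)
  define H where "H = (\<integral>x. h x \<partial>M)"
  have H: "H \<ge> 0" unfolding H_def by (simp add: nonneg)
  fix \<epsilon> :: ennreal assume "0 < \<epsilon>"
  then obtain \<epsilon>1 where \<epsilon>1: "0 < \<epsilon>1" "\<epsilon>1 < \<epsilon>" using dense by blast
  define \<epsilon>' where "\<epsilon>' = enn2real \<epsilon>1"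
  have "\<epsilon>1 < top" using \<epsilon>1(2) by (meson less_le_trans top_greatest)
  then have \<epsilon>': "\<epsilon>' > 0" "ennreal \<epsilon>' < \<epsilon>"
    using \<epsilon>1 by (auto simp: \<epsilon>'_def enn2real_positive_iff)
  \<comment> \<open>The added 1 avoids division by zero when \<open>h\<close> has integral
    0.\<close>
  define \<delta> where "\<delta> = \<epsilon>' / (2 * (H + 1))"
  have \<delta>: "\<delta> > 0" using \<epsilon>' H by (simp add: \<delta>_def)
  have "\<delta> * H \<le> \<delta> * (H + 1)" using \<delta> by simp
  also have "\<dots> = \<epsilon>' / 2" using H by (simp add: \<delta>_def field_simps)
  finally have \<delta>H: "\<delta> * H \<le> \<epsilon>' / 2" .
  obtain c where c: "c \<ge> 0" "\<And>k. AE x in M. b k x \<le> \<delta> * h x + c * a k x" using dom[OF \<delta>] by blast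
  have "(\<lambda>k. ennreal c * (\<integral>\<^sup>+x. ennreal (a k x) \<partial>M)) \<longlonglongrightarrow> ennreal c * 0"
    by (rule tendsto_mult_ennreal[OF tendsto_const lim]) auto
  then have "\<forall>\<^sub>F k in sequentially. ennreal c * (\<integral>\<^sup>+x. ennreal (a k x) \<partial>M) < ennreal (\<epsilon>' / 2)"
    using \<epsilon>' by (intro order_tendstoD(2)) auto
  then show "\<forall>\<^sub>F k in sequentially. (\<integral>\<^sup>+x. ennreal (b k x) \<partial>M) < \<epsilon>"
  proof eventually_elim
    case (elim k)
    have "(\<integral>\<^sup>+x. ennreal (b k x) \<partial>M) \<le> (\<integral>\<^sup>+x. ennreal \<delta> * ennreal (h x) + ennreal c * ennreal (a k x) \<partial>M)"
    proof (rule nn_integral_mono_AE)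
      show "AE x in M. ennreal (b k x) \<le> ennreal \<delta> * ennreal (h x) + ennreal c * ennreal (a k x)"
        using c(2)[of k]
      proof eventually_elim
        case (elim x)
        then have "ennreal (b k x) \<le> ennreal (\<delta> * h x + c * a k x)" by (rule ennreal_leI)
        then show ?case using \<delta> c nonneg by (simp add: ennreal_plus ennreal_mult)
      qed
    qed
    also have "\<dots> = ennreal \<delta> * (\<integral>\<^sup>+x. ennreal (h x) \<partial>M) + ennreal c * (\<integral>\<^sup>+x. ennreal (a k x) \<partial>M)"
      by (subst nn_integral_add; (subst nn_integral_cmult)?; (subst nn_integral_cmult)?; measurable)
    also have "ennreal \<delta> * (\<integral>\<^sup>+x. ennreal (h x) \<partial>M) = ennreal (\<delta> * H)"
      using nn_integral_eq_integral[OF h] nonneg \<delta> H by (simp add: H_def ennreal_mult)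
    also have "\<dots> + ennreal c * (\<integral>\<^sup>+x. ennreal (a k x) \<partial>M) \<le> ennreal (\<epsilon>' / 2) + ennreal (\<epsilon>' / 2)"
      using elim by (intro add_mono ennreal_leI \<delta>H less_imp_le)
    also have "\<dots> = ennreal \<epsilon>'" using \<epsilon>' by (simp add: ennreal_plus[symmetric] del: ennreal_plus)
    finally show ?case using \<epsilon>'(2) by simp
  qed
qed simp

text \<open>Below the threshold \<open>a0\<close> the left side is at most \<delta>; above it the
  power with the larger exponent wins, at the cost of the factor
  \<open>a0 powr (q - t)\<close>.\<close>

lemma powr_domination:
  fixes q t \<delta> K :: real
  assumes q: "0 < q" "q \<le> t" and \<delta>: "\<delta> > 0" and K: "K \<ge> 0"
  shows "\<exists>c\<ge>0. \<forall>a\<ge>0. K * a powr q \<le> \<delta> + c * a powr t"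
proof -
  define a0 where "a0 = (\<delta> / (K + 1)) powr (1 / q)"
  have a0: "a0 > 0" using \<delta> K by (simp add: a0_def)
  define c where "c = K * a0 powr (q - t)"
  have "K * a powr q \<le> \<delta> + c * a powr t" if a: "a \<ge> 0" for a
  proof (cases "a \<le> a0")
    case True
    have "K * a powr q \<le> K * a0 powr q" using a True q K by (intro mult_left_mono powr_mono2) auto
    also have "a0 powr q = \<delta> / (K + 1)" using q \<delta> K by (simp add: a0_def powr_powr)
    also have "K * (\<delta> / (K + 1)) \<le> \<delta>" using \<delta> K by (simp add: field_simps)
    finally have "K * a powr q \<le> \<delta>" .
    moreover have "0 \<le> c * a powr t" using K by (simp add: c_def)
    ultimately show ?thesis by linarith
  next
    case False
    then have "a powr q = a powr (q - t) * a powr t" by (simp add: powr_add[symmetric])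
    also have "\<dots> \<le> a0 powr (q - t) * a powr t"
      using False a0 q by (intro mult_right_mono powr_mono2') auto
    finally have "K * a powr q \<le> c * a powr t" using K by (simp add: c_def mult.assoc mult_left_mono)
    then show ?thesis using \<delta> by linarith
  qed
  moreover have "c \<ge> 0" using K by (simp add: c_def)
  ultimately show ?thesis by blast
qed

text \<open>Hoelder's inequality enters only through this pointwise form of Young's inequality.\<close>

lemma product_domination:
  fixes p q r :: real
  assumes s: "s > 1" and q: "s / (s - 1) * r \<le> p" "r > 0" and \<delta>: "\<delta> > 0"
  shows "\<exists>c\<ge>0. \<forall>a\<ge>0. \<forall>b\<ge>0. a powr r * b \<le> \<delta> * (1 + b powr s) + c * a powr p"
proof -
  define s' where "s' = s / (s - 1)"
  have s': "s' > 1" "1 / s' + 1 / s = 1" using s by (auto simp: s'_def field_simps)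
  \<comment> \<open>The weight in Young's inequality is chosen with \<eta>^s = \<delta>, so that the
    power of \<open>b\<close> receives exactly the prescribed small coefficient.\<close>
  define \<eta> where "\<eta> = \<delta> powr (1 / s)"
  have \<eta>: "\<eta> > 0" "\<eta> powr s = \<delta>" using \<delta> s by (auto simp: \<eta>_def powr_powr)
  obtain c where c: "c \<ge> 0" "\<And>a. a \<ge> 0 \<Longrightarrow> \<eta> powr (- s') * a powr (s' * r) \<le> \<delta> + c * a powr p"
    using powr_domination[of "s' * r" p \<delta> "\<eta> powr (- s')"] q[folded s'_def] s' \<delta> by auto
  have "a powr r * b \<le> \<delta> * (1 + b powr s) + c * a powr p" if a: "a \<ge> 0" and b: "b \<ge> 0" for a b
  proof -
    have "a powr r * b = (a powr r / \<eta>) * (\<eta> * b)" using \<eta> by simp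
    also have "\<dots> \<le> (a powr r / \<eta>) powr s' / s' + (\<eta> * b) powr s / s"
      using a b \<eta> s s' by (intro Youngs_inequality) auto
    also have "\<dots> \<le> (a powr r / \<eta>) powr s' + (\<eta> * b) powr s"
      using s s' by (intro add_mono) (auto simp: divide_le_eq mult_le_cancel_left1)
    also have "(a powr r / \<eta>) powr s' = \<eta> powr (- s') * a powr (s' * r)"
      using a \<eta> by (simp add: powr_divide powr_powr powr_minus field_simps)
    also have "(\<eta> * b) powr s = \<delta> * b powr s" using \<eta> b by (simp add: powr_mult)
    finally show ?thesis using c(2)[OF a] by (simp add: algebra_simps)
  qed
  then show ?thesis using c(1) by blast
qed

section \<open>Square integrability and limits in L^2\<close>

definition sq_int :: "'a measure \<Rightarrow> ('a \<Rightarrow> real) \<Rightarrow> bool" where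
  "sq_int M f \<longleftrightarrow> f \<in> borel_measurable M \<and> integrable M (\<lambda>x. (f x)\<^sup>2)"

text \<open>The Bochner integral is safe here because square integrability of all functions is part
  of the predicate.\<close>

definition L2_lim :: "'a measure \<Rightarrow> (nat \<Rightarrow> 'a \<Rightarrow> real) \<Rightarrow> ('a \<Rightarrow> real) \<Rightarrow> bool" where
  "L2_lim M F f \<longleftrightarrow> (\<forall>n. sq_int M (F n)) \<and> sq_int M f \<and> (\<lambda>n. \<integral>x. (F n x - f x)\<^sup>2 \<partial>M) \<longlonglongrightarrow> 0"

lemma sq_int_measurable [measurable_dest]: "sq_int M f \<Longrightarrow> f \<in> borel_measurable M"
  by (simp add: sq_int_def)

lemma sq_int_Lp_space: "sq_int M f \<longleftrightarrow> f \<in> Lp_space M 2"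
  by (simp add: sq_int_def Lp_space_def)

lemma sq_int_add: "sq_int M f \<Longrightarrow> sq_int M g \<Longrightarrow> sq_int M (\<lambda>x. f x + g x)"
  and sq_int_diff: "sq_int M f \<Longrightarrow> sq_int M g \<Longrightarrow> sq_int M (\<lambda>x. f x - g x)"
  by (auto simp: sq_int_def intro: integrable_add_squares)

lemma sq_int_product: "sq_int M f \<Longrightarrow> sq_int M g \<Longrightarrow> integrable M (\<lambda>x. f x * g x)"
  by (auto simp: sq_int_def intro: integrable_mult_squares)

lemma sq_int_bounded_mult:
  assumes f: "sq_int M f" and [measurable]: "g \<in> borel_measurable M" and g: "\<And>x. \<bar>g x\<bar> \<le> B"
  shows "sq_int M (\<lambda>x. g x * f x)"
proof -
  note [measurable] = sq_int_measurable[OF f]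
  have "integrable M (\<lambda>x. (g x * f x)\<^sup>2)"
  proof (rule integrable_of_norm_le)
    show "integrable M (\<lambda>x. B\<^sup>2 * (f x)\<^sup>2)" using f by (simp add: sq_int_def)
    show "norm ((g x * f x)\<^sup>2) \<le> B\<^sup>2 * (f x)\<^sup>2" for x
      using power_mono[OF g abs_ge_zero, of x 2] by (simp add: power_mult_distrib mult_right_mono)
  qed measurable
  then show ?thesis by (simp add: sq_int_def)
qed

lemma sq_int_cmult: "sq_int M f \<Longrightarrow> sq_int M (\<lambda>x. c * f x)"
  using sq_int_bounded_mult[of M f "\<lambda>_. c" "\<bar>c\<bar>"] by simp

lemma sq_int_zero: "sq_int M (\<lambda>x. 0)" by (simp add: sq_int_def)

lemma sq_int_sum: "(\<And>i. i \<in> I \<Longrightarrow> sq_int M (f i)) \<Longrightarrow> sq_int M (\<lambda>x. \<Sum>i\<in>I. f i x)"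
  by (induction I rule: infinite_finite_induct) (auto intro: sq_int_add sq_int_zero)

lemma sq_int_bounded:
  assumes "finite_measure M" "f \<in> borel_measurable M" "\<And>x. \<bar>f x\<bar> \<le> B"
  shows "sq_int M f"
proof -
  interpret finite_measure M by fact
  have "sq_int M (\<lambda>_. 1)" by (simp add: sq_int_def)
  from sq_int_bounded_mult[OF this assms(2,3)] show ?thesis by simp
qed

lemma sq_int_integrable:
  assumes "finite_measure M" "sq_int M f" shows "integrable M f"
  using sq_int_product[OF assms(2) sq_int_bounded[OF assms(1), of "\<lambda>_. 1" 1]] by simp

lemma L2_limD:
  assumes "L2_lim M F f"
  shows "sq_int M (F n)" "sq_int M f" "(\<lambda>n. \<integral>x. (F n x - f x)\<^sup>2 \<partial>M) \<longlonglongrightarrow> 0"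
  using assms by (auto simp: L2_lim_def)

lemma L2_limI_dominated:
  assumes F: "\<And>n. sq_int M (F n)" and f: "sq_int M f"
    and G: "\<And>n. integrable M (G n)" "(\<lambda>n. \<integral>x. G n x \<partial>M) \<longlonglongrightarrow> 0"
    and le: "\<And>n x. (F n x - f x)\<^sup>2 \<le> G n x"
  shows "L2_lim M F f"
  unfolding L2_lim_def
proof (intro conjI allI F f tendsto_sandwich[OF _ _ tendsto_const G(2)] always_eventually)
  show "(\<integral>x. (F n x - f x)\<^sup>2 \<partial>M) \<le> (\<integral>x. G n x \<partial>M)" for n
    using sq_int_diff[OF F f] by (intro integral_mono G le) (auto simp: sq_int_def)
qed auto

lemma L2_lim_add:
  assumes "L2_lim M F f" "L2_lim M G g"
  shows "L2_lim M (\<lambda>n x. F n x + G n x) (\<lambda>x. f x + g x)"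
proof (rule L2_limI_dominated[where G="\<lambda>n x. 2 * (F n x - f x)\<^sup>2 + 2 * (G n x - g x)\<^sup>2"])
  note d = sq_int_diff[OF L2_limD(1,2)[OF assms(1)]] sq_int_diff[OF L2_limD(1,2)[OF assms(2)]]
  show "integrable M (\<lambda>x. 2 * (F n x - f x)\<^sup>2 + 2 * (G n x - g x)\<^sup>2)" for n
    using d[of n] by (auto simp: sq_int_def)
  have "(\<lambda>n. 2 * (\<integral>x. (F n x - f x)\<^sup>2 \<partial>M) + 2 * (\<integral>x. (G n x - g x)\<^sup>2 \<partial>M)) \<longlonglongrightarrow> 2 * 0 + 2 * 0"
    by (intro tendsto_intros L2_limD(3) assms)
  then show "(\<lambda>n. \<integral>x. 2 * (F n x - f x)\<^sup>2 + 2 * (G n x - g x)\<^sup>2 \<partial>M) \<longlonglongrightarrow> 0"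
    using d by (simp add: sq_int_def)
  have *: "(a + b - (c + d))\<^sup>2 \<le> 2 * (a - c)\<^sup>2 + 2 * (b - d)\<^sup>2" for a b c d :: real
    using zero_le_power2[of "(a - c) - (b - d)"] by (simp add: power2_eq_square algebra_simps)
  show "(F n x + G n x - (f x + g x))\<^sup>2 \<le> 2 * (F n x - f x)\<^sup>2 + 2 * (G n x - g x)\<^sup>2" for n x
    by (rule *)
qed (use assms in \<open>auto intro: sq_int_add L2_limD\<close>)

lemma L2_lim_mult:
  assumes F: "L2_lim M F f" and [measurable]: "g \<in> borel_measurable M" and g: "\<And>x. \<bar>g x\<bar> \<le> B"
  shows "L2_lim M (\<lambda>n x. g x * F n x) (\<lambda>x. g x * f x)"
proof (rule L2_limI_dominated[where G="\<lambda>n x. B\<^sup>2 * (F n x - f x)\<^sup>2"])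
  note d = sq_int_diff[OF L2_limD(1,2)[OF F]]
  show "integrable M (\<lambda>x. B\<^sup>2 * (F n x - f x)\<^sup>2)" for n using d[of n] by (auto simp: sq_int_def)
  have "(\<lambda>n. B\<^sup>2 * (\<integral>x. (F n x - f x)\<^sup>2 \<partial>M)) \<longlonglongrightarrow> B\<^sup>2 * 0"
    by (intro tendsto_intros L2_limD(3) F)
  then show "(\<lambda>n. \<integral>x. B\<^sup>2 * (F n x - f x)\<^sup>2 \<partial>M) \<longlonglongrightarrow> 0" using d by (simp add: sq_int_def)
  show "(g x * F n x - g x * f x)\<^sup>2 \<le> B\<^sup>2 * (F n x - f x)\<^sup>2" for n x
    using power_mono[OF g abs_ge_zero, of x 2]
    by (simp add: right_diff_distrib[symmetric] power_mult_distrib mult_right_mono)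
qed (use F g in \<open>auto intro!: sq_int_bounded_mult L2_limD[OF F]\<close>)

lemma L2_lim_cmult: "L2_lim M F f \<Longrightarrow> L2_lim M (\<lambda>n x. c * F n x) (\<lambda>x. c * f x)"
  using L2_lim_mult[of M F f "\<lambda>_. c" "\<bar>c\<bar>"] by simp

lemma L2_lim_integral_product:
  assumes "L2_lim M F f" "sq_int M g"
  shows "(\<lambda>n. \<integral>x. F n x * g x \<partial>M) \<longlonglongrightarrow> (\<integral>x. f x * g x \<partial>M)"
  using assms unfolding L2_lim_def sq_int_def
  by (intro integral_product_tendsto) (auto simp: power2_commute)

lemma L2_lim_norm:
  assumes F: "L2_lim M F f"
  shows "(\<lambda>n. \<integral>x. (F n x)\<^sup>2 \<partial>M) \<longlonglongrightarrow> (\<integral>x. (f x)\<^sup>2 \<partial>M)"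
proof -
  note s = L2_limD(1,2)[OF F]
  have "(\<lambda>n. (\<integral>x. (F n x - f x)\<^sup>2 \<partial>M) + 2 * (\<integral>x. F n x * f x \<partial>M) - (\<integral>x. f x * f x \<partial>M)) \<longlonglongrightarrow>
      0 + 2 * (\<integral>x. f x * f x \<partial>M) - (\<integral>x. f x * f x \<partial>M)"
    by (intro tendsto_intros L2_limD(3)[OF F] L2_lim_integral_product[OF F s(2)])
  moreover have "(\<integral>x. (F n x)\<^sup>2 \<partial>M) = (\<integral>x. (F n x - f x)\<^sup>2 \<partial>M) + 2 * (\<integral>x. F n x * f x \<partial>M) - (\<integral>x. f x * f x \<partial>M)" for n
  proof -
    have "(\<lambda>x. (F n x - f x)\<^sup>2) = (\<lambda>x. (F n x)\<^sup>2 - 2 * (F n x * f x) + f x * f x)"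
      by (auto simp: power2_eq_square algebra_simps)
    then show ?thesis using s sq_int_product[OF s] sq_int_product[OF s(2) s(2)] by (simp add: sq_int_def)
  qed
  ultimately show ?thesis by (simp add: power2_eq_square)
qed

text \<open>The Riesz-Fischer argument: a fast subsequence converges almost everywhere, and Fatou
  identifies its pointwise limit as the limit in mean of the whole sequence.\<close>

lemma L2_complete:
  fixes F :: "nat \<Rightarrow> 'a \<Rightarrow> real"
  assumes F: "\<And>n. sq_int M (F n)"
    and Cauchy: "\<And>\<epsilon>. \<epsilon> > 0 \<Longrightarrow> \<exists>N. \<forall>m\<ge>N. \<forall>n\<ge>N. (\<integral>x. (F m x - F n x)\<^sup>2 \<partial>M) < \<epsilon>"
  obtains f where "L2_lim M F f"
proof -
  note [measurable] = sq_int_measurable[OF F]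
  have nn: "(\<integral>\<^sup>+x. ennreal ((F m x - F n x)\<^sup>2) \<partial>M) = ennreal (\<integral>x. (F m x - F n x)\<^sup>2 \<partial>M)" for m n
    using sq_int_diff[OF F F, of m n] by (intro nn_integral_eq_integral) (auto simp: sq_int_def)
  have "\<exists>N. \<forall>m\<ge>N. \<forall>n\<ge>N. (\<integral>x. (F m x - F n x)\<^sup>2 \<partial>M) < (1/4) ^ j" for j :: nat
    using Cauchy[of "(1/4) ^ j"] by simp
  then obtain N where N: "\<And>j m n. m \<ge> N j \<Longrightarrow> n \<ge> N j \<Longrightarrow> (\<integral>x. (F m x - F n x)\<^sup>2 \<partial>M) < (1/4) ^ j"
    by metis
  \<comment> \<open>The sum makes \<open>r\<close> monotone and at least \<open>N j\<close>; the
    summand \<open>j\<close> makes it tend to infinity, as the use of Fatou below requires.\<close>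
  define r where "r j = j + (\<Sum>i\<le>j. N i)" for j
  have r: "r j \<ge> N j" "r j \<ge> j" "r j \<le> r (Suc j)" for j
    using member_le_sum[of j "{..j}" N] by (auto simp: r_def)
  define \<Delta> where "\<Delta> j x = F (r (Suc j)) x - F (r j) x" for j x
  have [measurable]: "\<Delta> j \<in> borel_measurable M" for j unfolding \<Delta>_def by measurable
  have \<Delta>: "(\<integral>\<^sup>+x. ennreal (2 ^ j * (\<Delta> j x)\<^sup>2) \<partial>M) \<le> ennreal ((1/2) ^ j)" for j
  proof -
    have "(\<integral>\<^sup>+x. ennreal (2 ^ j * (\<Delta> j x)\<^sup>2) \<partial>M) = ennreal (2 ^ j) * (\<integral>\<^sup>+x. ennreal ((\<Delta> j x)\<^sup>2) \<partial>M)"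
      by (subst nn_integral_cmult[symmetric]) (auto simp: ennreal_mult)
    also have "\<dots> \<le> ennreal (2 ^ j) * ennreal ((1/4) ^ j)"
      unfolding \<Delta>_def nn using N[of j "r (Suc j)" "r j"] r[of j] by (intro mult_left_mono ennreal_leI) auto
    also have "\<dots> = ennreal ((1/2) ^ j)"
      by (subst ennreal_mult[symmetric]) (auto simp: power_mult_distrib[symmetric])
    finally show ?thesis .
  qed
  have "(\<integral>\<^sup>+x. (\<Sum>j. ennreal (2 ^ j * (\<Delta> j x)\<^sup>2)) \<partial>M) = (\<Sum>j. \<integral>\<^sup>+x. ennreal (2 ^ j * (\<Delta> j x)\<^sup>2) \<partial>M)"
    by (rule nn_integral_suminf) measurable
  also have "\<dots> \<le> (\<Sum>j. ennreal ((1/2) ^ j))" by (intro suminf_le \<Delta> summableI)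
  also have "\<dots> < \<infinity>" by (subst suminf_ennreal2) (auto intro: summable_geometric)
  finally have "AE x in M. (\<Sum>j. ennreal (2 ^ j * (\<Delta> j x)\<^sup>2)) \<noteq> \<infinity>"
    by (intro nn_integral_PInf_AE) auto
  then have conv: "AE x in M. convergent (\<lambda>j. F (r j) x)"
  proof eventually_elim
    case (elim x)
    then have sm: "summable (\<lambda>j. 2 ^ j * (\<Delta> j x)\<^sup>2)" by (intro summable_suminf_not_top) auto
    \<comment> \<open>The weighted squares are summable, and a difference exceeding 2^(-j) is at
      most 2^j times its square, so the differences are dominated by two summable series.\<close>
    have "summable (\<lambda>j. \<Delta> j x)"
    proof (rule summable_comparison_test')
      show "summable (\<lambda>j. (1/2) ^ j + 2 ^ j * (\<Delta> j x)\<^sup>2)" by (intro summable_add sm summable_geometric) simp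
      show "norm (\<Delta> j x) \<le> (1/2) ^ j + 2 ^ j * (\<Delta> j x)\<^sup>2" if "j \<ge> 0" for j
      proof (cases "\<bar>\<Delta> j x\<bar> \<le> (1/2) ^ j")
        case False
        then have "1 \<le> 2 ^ j * \<bar>\<Delta> j x\<bar>" by (simp add: power_divide field_simps)
        then have "\<bar>\<Delta> j x\<bar> * 1 \<le> \<bar>\<Delta> j x\<bar> * (2 ^ j * \<bar>\<Delta> j x\<bar>)" by (intro mult_left_mono) auto
        also have "\<dots> = 2 ^ j * (\<Delta> j x)\<^sup>2" by (simp add: power2_eq_square ac_simps)
        finally show ?thesis by (simp add: add_increasing)
      qed (simp add: add_increasing2)
    qed
    then have "convergent (\<lambda>n. \<Sum>j<n. \<Delta> j x)" by (simp add: summable_iff_convergent)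
    moreover have "(\<Sum>j<n. \<Delta> j x) = F (r n) x - F (r 0) x" for n
      unfolding \<Delta>_def by (rule sum_lessThan_telescope)
    ultimately have "convergent (\<lambda>n. F (r n) x - F (r 0) x)" by simp
    then show ?case by (simp add: convergent_diff_const_right_iff)
  qed
  define f where "f x = lim (\<lambda>j. F (r j) x)" for x
  have [measurable]: "f \<in> borel_measurable M" unfolding f_def by measurable
  have lim: "AE x in M. (\<lambda>j. F (r j) x) \<longlonglongrightarrow> f x"
    using conv by eventually_elim (simp add: f_def convergent_LIMSEQ_iff)
  have bound: "(\<integral>\<^sup>+x. ennreal ((F n x - f x)\<^sup>2) \<partial>M) \<le> ennreal ((1/4) ^ j)" if n: "n \<ge> N j" for n j
  proof (rule nn_integral_le_of_AE_tendsto)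
    show "AE x in M. (\<lambda>i. (F n x - F (r i) x)\<^sup>2) \<longlonglongrightarrow> (F n x - f x)\<^sup>2"
      using lim by eventually_elim (intro tendsto_intros)
    show "\<forall>\<^sub>F i in sequentially. (\<integral>\<^sup>+x. ennreal ((F n x - F (r i) x)\<^sup>2) \<partial>M) \<le> ennreal ((1/4) ^ j)"
      using eventually_ge_at_top[of "N j"]
    proof eventually_elim
      case (elim i)
      then have "r i \<ge> N j" using r(2)[of i] by linarith
      then show ?case unfolding nn using N[OF n] by (intro ennreal_leI less_imp_le)
    qed
  qed measurable
  have d: "sq_int M (\<lambda>x. F n x - f x)" if n: "n \<ge> N j" for n j
    unfolding sq_int_def
    by (intro conjI integrableI_nonneg) (use le_less_trans[OF bound[OF n]] in auto)
  have f: "sq_int M f"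
    using sq_int_diff[OF F d[of "N 0" "N 0"]] d[of 0 "N 0"] sq_int_diff[OF F[of "N 0"] d[of 0 "N 0"]] by simp
  have "(\<lambda>n. \<integral>x. (F n x - f x)\<^sup>2 \<partial>M) \<longlonglongrightarrow> 0"
  proof (rule order_tendstoI)
    fix \<epsilon> :: real assume "\<epsilon> > 0"
    then obtain j :: nat where j: "(1/4) ^ j < \<epsilon>" using real_arch_pow_inv[of \<epsilon> "1/4"] by auto
    show "\<forall>\<^sub>F n in sequentially. (\<integral>x. (F n x - f x)\<^sup>2 \<partial>M) < \<epsilon>"
      using eventually_ge_at_top[of "N j"]
    proof eventually_elim
      case (elim n)
      have "ennreal (\<integral>x. (F n x - f x)\<^sup>2 \<partial>M) \<le> ennreal ((1/4) ^ j)"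
        using bound[OF elim] d[OF elim] by (subst nn_integral_eq_integral[symmetric]) (auto simp: sq_int_def)
      then show ?case using j by (subst (asm) ennreal_le_iff) auto
    qed
  next
    show "\<forall>\<^sub>F n in sequentially. a < (\<integral>x. (F n x - f x)\<^sup>2 \<partial>M)" if "a < 0" for a
      by (intro always_eventually allI less_le_trans[OF that]) simp
  qed
  then show ?thesis using that F f by (auto simp: L2_lim_def)
qed

lemma L2_lim_of_nn_integral:
  assumes F: "\<And>n. sq_int M (F n)" and f: "sq_int M f"
    and lim: "(\<lambda>n. \<integral>\<^sup>+x. ennreal ((F n x - f x)\<^sup>2) \<partial>M) \<longlonglongrightarrow> 0"
  shows "L2_lim M F f"
proof -
  have "(\<integral>\<^sup>+x. ennreal ((F n x - f x)\<^sup>2) \<partial>M) = ennreal (\<integral>x. (F n x - f x)\<^sup>2 \<partial>M)" for n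
    using sq_int_diff[OF F f, of n] by (intro nn_integral_eq_integral) (auto simp: sq_int_def)
  then have "(\<lambda>n. ennreal (\<integral>x. (F n x - f x)\<^sup>2 \<partial>M)) \<longlonglongrightarrow> ennreal 0" using lim by simp
  then have "(\<lambda>n. \<integral>x. (F n x - f x)\<^sup>2 \<partial>M) \<longlonglongrightarrow> 0"
    by (subst (asm) tendsto_ennreal_iff) auto
  then show ?thesis using F f by (simp add: L2_lim_def)
qed

lemma Lp_tendsto_imp_L2_lim:
  fixes F :: "nat \<Rightarrow> 'a \<Rightarrow> real"
  assumes "\<And>n. sq_int M (F n)" "sq_int M f" "Lp_tendsto M 2 F f"
  shows "L2_lim M F f"
  using assms by (intro L2_lim_of_nn_integral) (auto simp: Lp_tendsto_def)

text \<open>The two sequences may take values in different spaces: it transfers convergence of a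
  Hilbert-Schmidt norm to components and gradients.\<close>

lemma Lp_tendsto_mono:
  fixes F :: "nat \<Rightarrow> 'a \<Rightarrow> 'b::real_normed_vector" and G :: "nat \<Rightarrow> 'a \<Rightarrow> 'c::real_normed_vector"
  assumes F: "Lp_tendsto M p F f" and p: "p > 0"
    and [measurable]: "\<And>n. (\<lambda>x. norm (F n x - f x)) \<in> borel_measurable M"
    and le: "\<And>n. AE x in M. norm (G n x - g x) \<le> c * norm (F n x - f x)" and c: "c \<ge> 0"
  shows "Lp_tendsto M p G g"
proof -
  have "(\<lambda>n. ennreal (c powr p) * (\<integral>\<^sup>+x. ennreal (norm (F n x - f x) powr p) \<partial>M)) \<longlonglongrightarrow> ennreal (c powr p) * 0"
    using F unfolding Lp_tendsto_def by (intro tendsto_mult_ennreal[OF tendsto_const]) auto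
  then have 0: "(\<lambda>n. ennreal (c powr p) * (\<integral>\<^sup>+x. ennreal (norm (F n x - f x) powr p) \<partial>M)) \<longlonglongrightarrow> 0" by simp
  have *: "(\<integral>\<^sup>+x. ennreal (norm (G n x - g x) powr p) \<partial>M) \<le>
    ennreal (c powr p) * (\<integral>\<^sup>+x. ennreal (norm (F n x - f x) powr p) \<partial>M)" for n
  proof -
    have "(\<integral>\<^sup>+x. ennreal (norm (G n x - g x) powr p) \<partial>M) \<le> (\<integral>\<^sup>+x. ennreal (c powr p) * ennreal (norm (F n x - f x) powr p) \<partial>M)"
    proof (rule nn_integral_mono_AE)
      show "AE x in M. ennreal (norm (G n x - g x) powr p) \<le> ennreal (c powr p) * ennreal (norm (F n x - f x) powr p)"
        using le[of n]
      proof eventually_elim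
        case (elim x)
        have "norm (G n x - g x) powr p \<le> (c * norm (F n x - f x)) powr p" using elim p by (intro powr_mono2) auto
        then show ?case using c by (simp add: powr_mult ennreal_mult[symmetric] ennreal_leI)
      qed
    qed
    also have "\<dots> = ennreal (c powr p) * (\<integral>\<^sup>+x. ennreal (norm (F n x - f x) powr p) \<partial>M)"
      by (rule nn_integral_cmult) measurable
    finally show ?thesis .
  qed
  show ?thesis unfolding Lp_tendsto_def
    by (rule tendsto_sandwich[OF _ _ tendsto_const 0]) (auto intro!: always_eventually *)
qed

lemma Lp_tendsto_inner:
  fixes F :: "nat \<Rightarrow> 'a \<Rightarrow> 'b::{real_inner,second_countable_topology}"
  assumes "Lp_tendsto M p F f" "p > 0"
    and [measurable]: "\<And>n. F n \<in> borel_measurable M" "f \<in> borel_measurable M"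
  shows "Lp_tendsto M p (\<lambda>n x. inner (F n x) h) (\<lambda>x. inner (f x) h)"
proof (rule Lp_tendsto_mono[OF assms(1,2), where c="norm h"])
  show "AE x in M. norm (inner (F n x) h - inner (f x) h) \<le> norm h * norm (F n x - f x)" for n
    using Cauchy_Schwarz_ineq2[of "F n x - f x" h for x]
    by (intro AE_I2) (simp add: inner_diff_left[symmetric] mult.commute)
qed auto

lemma Lp_space_inner:
  fixes f :: "'a \<Rightarrow> 'b::{real_inner,banach,second_countable_topology}"
  assumes "f \<in> Lp_space M p" "p > 0"
  shows "(\<lambda>x. inner (f x) h) \<in> Lp_space M p"
proof -
  have [measurable]: "f \<in> borel_measurable M" using assms by (simp add: Lp_space_def)
  have "integrable M (\<lambda>x. norm (inner (f x) h) powr p)"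
  proof (rule integrable_of_norm_le)
    show "integrable M (\<lambda>x. norm h powr p * norm (f x) powr p)" using assms by (simp add: Lp_space_def)
    fix x
    have "\<bar>inner (f x) h\<bar> powr p \<le> (norm h * norm (f x)) powr p"
      using Cauchy_Schwarz_ineq2[of "f x" h] assms(2) by (intro powr_mono2) (auto simp: mult.commute)
    then show "norm (norm (inner (f x) h) powr p) \<le> norm h powr p * norm (f x) powr p"
      by (simp add: powr_mult)
  qed measurable
  then show ?thesis by (simp add: Lp_space_def)
qed

section \<open>Logarithmic gradients and integration by parts for the weighted measure\<close>

lemma Lp_space_measurable: "f \<in> Lp_space M p \<Longrightarrow> f \<in> borel_measurable M"
  by (simp add: Lp_space_def)

text \<open>The conjugate of the conjugate is \<open>p\<close> again; needed because
  \<open>product_domination\<close> is parametrized by the exponent of its second factor.\<close>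

lemma conjugate_exponent:
  fixes p :: real
  assumes "p > 1"
  shows "p / (p - 1) > 1" "(p / (p - 1)) / (p / (p - 1) - 1) = p"
  using assms by (auto simp: field_simps)

lemma Lp_product_integrable:
  fixes f g :: "'a \<Rightarrow> real"
  assumes "finite_measure M" and p: "p > 1" and f: "f \<in> Lp_space M p" and g: "g \<in> Lp_space M (p / (p - 1))"
  shows "integrable M (\<lambda>x. f x * g x)"
proof -
  interpret finite_measure M by fact
  note [measurable] = Lp_space_measurable[OF f] Lp_space_measurable[OF g]
  obtain c where c: "c \<ge> 0" "\<And>a b. a \<ge> 0 \<Longrightarrow> b \<ge> 0 \<Longrightarrow> a powr 1 * b \<le> 1 * (1 + b powr (p / (p - 1))) + c * a powr p"
    using product_domination[OF conjugate_exponent(1)[OF p], of 1 p 1] conjugate_exponent(2)[OF p] by auto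
  show ?thesis
  proof (rule integrable_of_norm_le)
    show "integrable M (\<lambda>x. 1 * (1 + \<bar>g x\<bar> powr (p / (p - 1))) + c * \<bar>f x\<bar> powr p)"
      using f g by (auto simp: Lp_space_def)
    show "norm (f x * g x) \<le> 1 * (1 + \<bar>g x\<bar> powr (p / (p - 1))) + c * \<bar>f x\<bar> powr p" for x
      using c(2)[of "\<bar>f x\<bar>" "\<bar>g x\<bar>"] by (simp add: abs_mult)
  qed measurable
qed

lemma Lp_product_tendsto_norm:
  fixes F :: "nat \<Rightarrow> 'a \<Rightarrow> real"
  assumes "finite_measure M" and p: "p > 1" and g: "g \<in> Lp_space M (p / (p - 1))"
    and [measurable]: "\<And>k. F k \<in> borel_measurable M" "f \<in> borel_measurable M"
    and lim: "Lp_tendsto M p F f"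
  shows "(\<lambda>k. \<integral>\<^sup>+x. ennreal (norm (F k x * g x - f x * g x)) \<partial>M) \<longlonglongrightarrow> 0"
proof (rule nn_integral_tendsto_0_of_domination[where a="\<lambda>k x. \<bar>F k x - f x\<bar> powr p" and h="\<lambda>x. 1 + \<bar>g x\<bar> powr (p / (p - 1))"])
  interpret finite_measure M by fact
  note [measurable] = Lp_space_measurable[OF g]
  show "integrable M (\<lambda>x. 1 + \<bar>g x\<bar> powr (p / (p - 1)))" using g by (auto simp: Lp_space_def)
  show "(\<lambda>k. \<integral>\<^sup>+x. ennreal (\<bar>F k x - f x\<bar> powr p) \<partial>M) \<longlonglongrightarrow> 0"
    using lim by (simp add: Lp_tendsto_def)
  show "\<exists>c\<ge>0. \<forall>k. AE x in M. norm (F k x * g x - f x * g x) \<le> \<delta> * (1 + \<bar>g x\<bar> powr (p / (p - 1))) + c * \<bar>F k x - f x\<bar> powr p"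
    if d: "\<delta> > 0" for \<delta>
  proof -
    obtain c where c: "c \<ge> 0" "\<And>a b. a \<ge> 0 \<Longrightarrow> b \<ge> 0 \<Longrightarrow> a powr 1 * b \<le> \<delta> * (1 + b powr (p / (p - 1))) + c * a powr p"
      using product_domination[OF conjugate_exponent(1)[OF p], of 1 p \<delta>] conjugate_exponent(2)[OF p] d by auto
    have "norm (F k x * g x - f x * g x) \<le> \<delta> * (1 + \<bar>g x\<bar> powr (p / (p - 1))) + c * \<bar>F k x - f x\<bar> powr p" for k x
      using c(2)[of "\<bar>F k x - f x\<bar>" "\<bar>g x\<bar>"] by (simp add: left_diff_distrib[symmetric] abs_mult)
    then show ?thesis using c(1) by blast
  qed
qed (use Lp_space_measurable[OF g] in measurable)

lemma Lp_product_tendsto: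
  fixes F :: "nat \<Rightarrow> 'a \<Rightarrow> real"
  assumes "finite_measure M" "p > 1" "g \<in> Lp_space M (p / (p - 1))"
    and F: "\<And>k. F k \<in> Lp_space M p" and f: "f \<in> Lp_space M p" and "Lp_tendsto M p F f"
  shows "(\<lambda>k. \<integral>x. F k x * g x \<partial>M) \<longlonglongrightarrow> (\<integral>x. f x * g x \<partial>M)"
  using Lp_product_tendsto_norm[OF assms(1-3) Lp_space_measurable[OF F] Lp_space_measurable[OF f] assms(6)]
    Lp_product_integrable[OF assms(1,2) F assms(3)] Lp_product_integrable[OF assms(1,2) f assms(3)]
  by (intro tendsto_L1_int)

lemma bounded_Lp_space:
  fixes f :: "'a \<Rightarrow> 'b::{banach,second_countable_topology}"
  assumes "finite_measure M" "f \<in> borel_measurable M" "\<And>x. norm (f x) \<le> B" "p > 0"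
  shows "f \<in> Lp_space M p"
proof -
  interpret finite_measure M by fact
  have "integrable M (\<lambda>x. norm (f x) powr p)"
    by (rule integrable_const_bound[of _ "B powr p"]) (use assms in \<open>auto intro!: AE_I2 powr_mono2\<close>)
  then show ?thesis using assms by (simp add: Lp_space_def)
qed

lemma Lp_space_bounded_mult:
  fixes f :: "'a \<Rightarrow> real"
  assumes f: "f \<in> Lp_space M p" and [measurable]: "g \<in> borel_measurable M" and g: "\<And>x. \<bar>g x\<bar> \<le> B" and p: "p > 0"
  shows "(\<lambda>x. g x * f x) \<in> Lp_space M p"
proof -
  note [measurable] = Lp_space_measurable[OF f]
  have "integrable M (\<lambda>x. norm (g x * f x) powr p)"
  proof (rule integrable_of_norm_le)
    show "integrable M (\<lambda>x. B powr p * norm (f x) powr p)" using f by (simp add: Lp_space_def)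
    fix x
    have "\<bar>g x\<bar> powr p * \<bar>f x\<bar> powr p \<le> B powr p * \<bar>f x\<bar> powr p" using g p by (intro mult_right_mono powr_mono2) auto
    then show "norm (norm (g x * f x) powr p) \<le> B powr p * norm (f x) powr p" by (simp add: abs_mult powr_mult)
  qed measurable
  then show ?thesis by (simp add: Lp_space_def)
qed

context cameron_martin_space
begin

lemma fin_mu: "finite_measure \<mu>" by (rule finite_measure_axioms)

lemma admissible_mult:
  assumes "admissible k f f'" "admissible k g g'"
  shows "admissible k (\<lambda>x. f x * g x) (\<lambda>x. f' x * g x + f x * g' x)"
proof -
  obtain A A' B B' where b: "\<And>x. \<bar>f x\<bar> \<le> A" "\<And>x. \<bar>f' x\<bar> \<le> A'" "\<And>x. \<bar>g x\<bar> \<le> B" "\<And>x. \<bar>g' x\<bar> \<le> B'"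
    using assms unfolding admissible_def by blast
  have m: "\<bar>a * c\<bar> \<le> M * N" if "\<bar>a\<bar> \<le> M" "\<bar>c\<bar> \<le> N" for a c M N :: real
    using that by (auto simp: abs_mult intro!: mult_mono)
  have "\<bar>f x * g x\<bar> \<le> A * B" "\<bar>f' x * g x + f x * g' x\<bar> \<le> A' * B + A * B'" for x
    using m[OF b(1) b(3)] m[OF b(2) b(3)] m[OF b(1) b(4)] by (auto intro: order_trans[OF abs_triangle_ineq add_mono])
  moreover have "((\<lambda>r. f (x + r *\<^sub>R \<iota> k) * g (x + r *\<^sub>R \<iota> k)) has_real_derivative f' x * g x + f x * g' x) (at 0)" for x
  proof -
    have "((\<lambda>r. f (x + r *\<^sub>R \<iota> k)) has_real_derivative f' x) (at 0)" "((\<lambda>r. g (x + r *\<^sub>R \<iota> k)) has_real_derivative g' x) (at 0)"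
      using assms unfolding admissible_def by blast+
    from DERIV_mult[OF this] show ?thesis by (simp add: algebra_simps)
  qed
  moreover have "continuous_on UNIV (\<lambda>x. f x * g x)" "continuous_on UNIV (\<lambda>x. f' x * g x + f x * g' x)"
    using assms unfolding admissible_def by (auto intro!: continuous_intros)
  ultimately show ?thesis unfolding admissible_def by blast
qed

lemma admissible_compose:
  fixes \<theta> \<theta>' :: "real \<Rightarrow> real"
  assumes f: "admissible k f f'" and \<theta>: "\<And>r. (\<theta> has_real_derivative \<theta>' r) (at r)" "continuous_on UNIV \<theta>'"
    and B: "\<And>r. \<bar>\<theta> r\<bar> \<le> B" "\<And>r. \<bar>\<theta>' r\<bar> \<le> B'"
  shows "admissible k (\<lambda>x. \<theta> (f x)) (\<lambda>x. \<theta>' (f x) * f' x)"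
proof -
  obtain A' where A': "\<And>x. \<bar>f' x\<bar> \<le> A'" using f unfolding admissible_def by blast
  have fc: "continuous_on UNIV f" "continuous_on UNIV f'" using f by (auto simp: admissible_def)
  have "\<bar>\<theta>' (f x) * f' x\<bar> \<le> B' * A'" for x
    unfolding abs_mult using B(2) A' by (intro mult_mono) (auto intro: order_trans[OF abs_ge_zero])
  moreover have "continuous_on UNIV \<theta>" using \<theta>(1) by (meson DERIV_isCont continuous_at_imp_continuous_on)
  then have "continuous_on UNIV (\<lambda>x. \<theta> (f x))" by (rule continuous_on_compose2[OF _ fc(1)]) simp
  moreover have "continuous_on UNIV (\<lambda>x. \<theta>' (f x) * f' x)"
    by (intro continuous_on_mult fc continuous_on_compose2[OF \<theta>(2) fc(1)]) simp
  moreover have "((\<lambda>r. \<theta> (f (x + r *\<^sub>R \<iota> k))) has_real_derivative \<theta>' (f x) * f' x) (at 0)" for x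
  proof -
    have "((\<lambda>r. f (x + r *\<^sub>R \<iota> k)) has_real_derivative f' x) (at 0)" using f unfolding admissible_def by blast
    from DERIV_chain2[OF _ this, of \<theta> "\<theta>' (f x)"] show ?thesis using \<theta>(1) by simp
  qed
  ultimately show ?thesis unfolding admissible_def using B(1) by blast
qed

lemma admissible_facts:
  assumes "admissible k f f'"
  shows "f \<in> borel_measurable \<mu>" "f' \<in> borel_measurable \<mu>" "\<exists>B. \<forall>x. \<bar>f x\<bar> \<le> B" "\<exists>B. \<forall>x. \<bar>f' x\<bar> \<le> B"
  using assms by (auto simp: admissible_def intro: continuous_measurable)

lemma admissible_cos:
  "admissible k (\<lambda>x. cos (blinfun_apply l x + b)) (dH k (\<lambda>x. cos (blinfun_apply l x + b)))"
  by (intro FCb_admissible FCb_cos)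

lemma FCb_measurable: "f \<in> FCb \<Longrightarrow> f \<in> borel_measurable \<mu>"
  by (intro continuous_measurable FCb_continuous)

lemma FCb_Lp:
  assumes "f \<in> FCb" "p > 0"
  shows "f \<in> Lp_space \<mu> p"
proof -
  obtain B where "\<forall>x. \<bar>f x\<bar> \<le> B" using FCb_bounded[OF assms(1)] by blast
  then show ?thesis using assms(2) FCb_measurable[OF assms(1)]
    by (intro bounded_Lp_space[OF fin_mu, where B=B]) auto
qed

lemma FCb_vec_measurable: "\<Phi> \<in> FCb_vec \<Longrightarrow> (\<Phi> :: 'a \<Rightarrow> 'h) \<in> borel_measurable \<mu>"
  by (simp add: measurable_mu_iff borel_measurable_continuous_onI FCb_vec_continuous)

text \<open>A real exponent is dominated by an even integer exponent up to the constant 1, and even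
  moments are finite.\<close>

lemma hat_Lp: "p > 0 \<Longrightarrow> hat k \<in> Lp_space \<mu> p"
proof -
  assume p: "p > 0"
  obtain m :: nat where m: "p \<le> real m" using real_arch_simple by blast
  have "integrable \<mu> (\<lambda>x. norm (hat k x) powr p)"
  proof (rule integrable_of_norm_le)
    show "integrable \<mu> (\<lambda>x. 1 + hat k x ^ (2 * m))" using hat_power_integrable by auto
    show "norm (norm (hat k x) powr p) \<le> 1 + hat k x ^ (2 * m)" for x
    proof (cases "\<bar>hat k x\<bar> \<le> 1")
      case True
      then have "\<bar>hat k x\<bar> powr p \<le> 1" using p by (intro powr_le1) auto
      then show ?thesis by (simp add: zero_le_even_power add_increasing2)
    next
      case False
      then have "\<bar>hat k x\<bar> powr p \<le> \<bar>hat k x\<bar> powr real (2 * m)" using m by (intro powr_mono) auto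
      also have "\<dots> = \<bar>hat k x\<bar> ^ (2 * m)" using False by (intro powr_realpow) auto
      finally show ?thesis by (simp add: power_even_abs)
    qed
  qed measurable
  then show ?thesis by (simp add: Lp_space_def)
qed

text \<open>Weak form of the chain rule: pass to the limit along a subsequence converging almost
  everywhere. Boundedness of \<open>\<theta>\<close> and \<open>\<theta>'\<close> makes all limits dominated.\<close>

lemma weak_chain_rule:
  fixes \<theta> \<theta>' :: "real \<Rightarrow> real"
  assumes vG: "has_weak_grad \<iota> \<mu> p v G" and p: "p > 1" and f: "admissible h f f'"
    and \<theta>: "\<And>r. (\<theta> has_real_derivative \<theta>' r) (at r)" "continuous_on UNIV \<theta>'"
    and B: "\<And>r. \<bar>\<theta> r\<bar> \<le> B" "\<And>r. \<bar>\<theta>' r\<bar> \<le> B'"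
  shows "integrable \<mu> (\<lambda>x. f x * (\<theta>' (v x) * inner (G x) h))"
    and "(\<integral>x. f' x * \<theta> (v x) \<partial>\<mu>) + (\<integral>x. f x * (\<theta>' (v x) * inner (G x) h) \<partial>\<mu>) = (\<integral>x. f x * \<theta> (v x) * hat h x \<partial>\<mu>)"
proof -
  obtain F where vm: "v \<in> Lp_space \<mu> p" "G \<in> Lp_space \<mu> p" and F: "\<And>k. F k \<in> FCb" "Lp_tendsto \<mu> p F v"
    "Lp_tendsto \<mu> p (\<lambda>k. H_grad \<iota> (F k)) G"
    using vG by (auto simp: has_weak_grad_def)
  obtain C C' where C: "\<And>x. \<bar>f x\<bar> \<le> C" "\<And>x. \<bar>f' x\<bar> \<le> C'" using admissible_facts[OF f] by metis
  note mG = FCb_vec_measurable[OF H_grad_in_FCb_vec[OF F(1)]]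
  have \<theta>c: "continuous_on UNIV \<theta>" using \<theta>(1) by (meson DERIV_isCont continuous_at_imp_continuous_on)
  have [measurable]: "\<theta> \<in> borel_measurable borel" "\<theta>' \<in> borel_measurable borel"
    using \<theta>c \<theta>(2) by (auto intro: borel_measurable_continuous_onI)
  note [measurable] = Lp_space_measurable[OF vm(1)] Lp_space_measurable[OF vm(2)] admissible_facts(1,2)[OF f]
    FCb_measurable[OF F(1)] mG FCb_measurable[OF dH_FCb[OF F(1)]]
  have "(\<lambda>n. \<integral>\<^sup>+x. ennreal (\<bar>F n x - v x\<bar> powr p) \<partial>\<mu>) \<longlonglongrightarrow> 0"
    using F(2) by (simp add: Lp_tendsto_def)
  then obtain r where r: "strict_mono r" "AE x in \<mu>. (\<lambda>n. F (r n) x - v x) \<longlonglongrightarrow> 0"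
    by (rule AE_subseq_of_nn_integral[rotated 2]) (use p in auto)
  have rl: "AE x in \<mu>. (\<lambda>n. F (r n) x) \<longlonglongrightarrow> v x" using r(2) by eventually_elim (simp add: LIM_zero_iff)
  define g where "g x = inner (G x) h" for x
  have g: "g \<in> Lp_space \<mu> p" unfolding g_def using p by (intro Lp_space_inner vm) simp
  note [measurable] = Lp_space_measurable[OF g]
  \<comment> \<open>Pairing with the constant 1 is the embedding of L^p into L^1 over a finite
    measure.\<close>
  have one: "(\<lambda>_. 1 :: real) \<in> Lp_space \<mu> (p / (p - 1))"
    using conjugate_exponent(1)[OF p] by (intro bounded_Lp_space[OF fin_mu]) auto
  have g1: "integrable \<mu> g" using Lp_product_integrable[OF fin_mu p g one] by simp
  have fb: "\<bar>f x * \<theta>' y\<bar> \<le> C * B'" for x y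
    unfolding abs_mult by (intro mult_mono C B) (auto intro: order_trans[OF abs_ge_zero C(1)])
  have fb': "\<bar>f x * (\<theta>' y * z)\<bar> \<le> C * B' * \<bar>z\<bar>" for x y z
    using mult_right_mono[OF fb[of x y], of "\<bar>z\<bar>"] by (simp add: abs_mult mult.assoc)
  show int: "integrable \<mu> (\<lambda>x. f x * (\<theta>' (v x) * inner (G x) h))"
    by (rule integrable_of_norm_le[where g="\<lambda>x. C * B' * \<bar>g x\<bar>"]) (use g1 fb' in \<open>auto simp: g_def[symmetric]\<close>)
  have dHlp: "dH h (F n) \<in> Lp_space \<mu> p" for n
    using p by (intro FCb_Lp dH_FCb F) simp
  have dH1: "integrable \<mu> (dH h (F n))" for n using Lp_product_integrable[OF fin_mu p dHlp one] by simp
  have "Lp_tendsto \<mu> p (\<lambda>k. dH h (F k)) g"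
    unfolding dH_def g_def using p by (intro Lp_tendsto_inner F) auto
  from Lp_product_tendsto_norm[OF fin_mu p one _ _ this]
  have "(\<lambda>k. \<integral>\<^sup>+x. ennreal (norm (dH h (F k) x - g x)) \<partial>\<mu>) \<longlonglongrightarrow> 0" by simp
  then have "(\<lambda>k. ennreal (\<integral>x. norm (dH h (F k) x - g x) \<partial>\<mu>)) \<longlonglongrightarrow> ennreal 0"
    using nn_integral_eq_integral[OF integrable_norm[OF Bochner_Integration.integrable_diff[OF dH1 g1]]] by simp
  then have n1: "(\<lambda>k. \<integral>x. norm (dH h (F k) x - g x) \<partial>\<mu>) \<longlonglongrightarrow> 0" by (subst (asm) tendsto_ennreal_iff) auto
  have "(\<lambda>k. C * B' * (\<integral>x. norm (dH h (F (r k)) x - g x) \<partial>\<mu>)) \<longlonglongrightarrow> C * B' * 0"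
    using LIMSEQ_subseq_LIMSEQ[OF n1 r(1)] by (intro tendsto_mult_left) (simp add: comp_def)
  then have n1': "(\<lambda>k. C * B' * (\<integral>x. norm (dH h (F (r k)) x - g x) \<partial>\<mu>)) \<longlonglongrightarrow> 0" by simp
  have i1: "integrable \<mu> (\<lambda>x. f x * (\<theta>' (F k x) * z x))" if "integrable \<mu> z" for z k
  proof -
    have [measurable]: "z \<in> borel_measurable \<mu>" using that by blast
    show ?thesis by (rule integrable_of_norm_le[where g="\<lambda>x. C * B' * \<bar>z x\<bar>"]) (use that fb' in auto)
  qed
  have l1: "(\<lambda>k. \<integral>x. f' x * \<theta> (F (r k) x) \<partial>\<mu>) \<longlonglongrightarrow> (\<integral>x. f' x * \<theta> (v x) \<partial>\<mu>)"
  proof (rule integral_dominated_convergence[where w="\<lambda>_. C' * B"])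
    show "AE x in \<mu>. (\<lambda>k. f' x * \<theta> (F (r k) x)) \<longlonglongrightarrow> f' x * \<theta> (v x)"
      using rl by eventually_elim (auto intro!: tendsto_mult_left continuous_on_tendsto_compose[OF \<theta>c])
    show "AE x in \<mu>. norm (f' x * \<theta> (F (r k) x)) \<le> C' * B" for k
      unfolding real_norm_def abs_mult by (intro AE_I2 mult_mono C B) (auto intro: order_trans[OF abs_ge_zero C(2)])
  qed auto
  have l2: "(\<lambda>k. \<integral>x. f x * \<theta> (F (r k) x) * hat h x \<partial>\<mu>) \<longlonglongrightarrow> (\<integral>x. f x * \<theta> (v x) * hat h x \<partial>\<mu>)"
  proof (rule integral_dominated_convergence[where w="\<lambda>x. C * B * \<bar>hat h x\<bar>"])
    show "AE x in \<mu>. (\<lambda>k. f x * \<theta> (F (r k) x) * hat h x) \<longlonglongrightarrow> f x * \<theta> (v x) * hat h x"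
      using rl by eventually_elim (auto intro!: tendsto_mult_left tendsto_mult_right continuous_on_tendsto_compose[OF \<theta>c])
    show "AE x in \<mu>. norm (f x * \<theta> (F (r k) x) * hat h x) \<le> C * B * \<bar>hat h x\<bar>" for k
      unfolding real_norm_def abs_mult
      by (intro AE_I2 mult_right_mono mult_mono C B) (auto intro: order_trans[OF abs_ge_zero C(1)])
  qed (use hat_integrable in auto)
  have l3: "(\<lambda>k. \<integral>x. f x * (\<theta>' (F (r k) x) * g x) \<partial>\<mu>) \<longlonglongrightarrow> (\<integral>x. f x * (\<theta>' (v x) * g x) \<partial>\<mu>)"
  proof (rule integral_dominated_convergence[where w="\<lambda>x. C * B' * \<bar>g x\<bar>"])
    show "AE x in \<mu>. (\<lambda>k. f x * (\<theta>' (F (r k) x) * g x)) \<longlonglongrightarrow> f x * (\<theta>' (v x) * g x)"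
      using rl by eventually_elim (auto intro!: tendsto_mult_left tendsto_mult_right continuous_on_tendsto_compose[OF \<theta>(2)])
  qed (use g1 fb' in auto)
  \<comment> \<open>The integrand is a boundedly almost everywhere convergent factor times an L^1
    convergent one. Replacing the second factor by its limit costs at most \<open>C * B'\<close>
    times its L^1 distance, and the first factor is treated by \<open>l3\<close>.\<close>
  have "(\<lambda>k. (\<integral>x. f x * (\<theta>' (F (r k) x) * dH h (F (r k)) x) \<partial>\<mu>) - (\<integral>x. f x * (\<theta>' (F (r k) x) * g x) \<partial>\<mu>)) \<longlonglongrightarrow> 0"
  proof (rule tendsto_0_le[OF n1', where K=1], intro always_eventually allI)
    fix k
    have "norm ((\<integral>x. f x * (\<theta>' (F (r k) x) * dH h (F (r k)) x) \<partial>\<mu>) - (\<integral>x. f x * (\<theta>' (F (r k) x) * g x) \<partial>\<mu>))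
       = norm (\<integral>x. f x * (\<theta>' (F (r k) x) * (dH h (F (r k)) x - g x)) \<partial>\<mu>)"
      using i1[OF dH1, of "r k" "r k"] i1[OF g1, of "r k"] by (simp add: right_diff_distrib)
    also have "\<dots> \<le> (\<integral>x. norm (f x * (\<theta>' (F (r k) x) * (dH h (F (r k)) x - g x))) \<partial>\<mu>)"
      by (rule Bochner_Integration.integral_norm_bound)
    also have "\<dots> \<le> (\<integral>x. C * B' * norm (dH h (F (r k)) x - g x) \<partial>\<mu>)"
      using dH1[of "r k"] g1 fb'
      by (intro integral_mono integrable_norm i1 integrable_mult_right) auto
    also have "\<dots> \<le> norm (C * B' * (\<integral>x. norm (dH h (F (r k)) x - g x) \<partial>\<mu>)) * 1" by simp
    finally show "norm ((\<integral>x. f x * (\<theta>' (F (r k) x) * dH h (F (r k)) x) \<partial>\<mu>) - (\<integral>x. f x * (\<theta>' (F (r k) x) * g x) \<partial>\<mu>))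
      \<le> norm (C * B' * (\<integral>x. norm (dH h (F (r k)) x - g x) \<partial>\<mu>)) * 1" .
  qed
  from tendsto_add[OF this l3]
  have l3': "(\<lambda>k. \<integral>x. f x * (\<theta>' (F (r k) x) * dH h (F (r k)) x) \<partial>\<mu>) \<longlonglongrightarrow> (\<integral>x. f x * (\<theta>' (v x) * g x) \<partial>\<mu>)" by simp
  have "(\<integral>x. f' x * \<theta> (F k x) \<partial>\<mu>) + (\<integral>x. f x * (\<theta>' (F k x) * dH h (F k) x) \<partial>\<mu>) = (\<integral>x. f x * \<theta> (F k x) * hat h x \<partial>\<mu>)" for k
  proof -
    note ad = admissible_compose[OF FCb_admissible[OF F(1), of h k] \<theta> B]
    have "integrable \<mu> (\<lambda>x. f' x * \<theta> (F k x))"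
      by (rule integrable_const_bound[of _ "C' * B"])
        (auto intro!: AE_I2 mult_mono C B order_trans[OF abs_ge_zero C(2)] simp: abs_mult)
    then show ?thesis
      using gaussian_integration_by_parts[OF admissible_mult[OF f ad]] i1[OF dH1, of k k] by simp
  qed
  then have "(\<lambda>k. (\<integral>x. f' x * \<theta> (F (r k) x) \<partial>\<mu>) + (\<integral>x. f x * (\<theta>' (F (r k) x) * dH h (F (r k)) x) \<partial>\<mu>)) \<longlonglongrightarrow> (\<integral>x. f x * \<theta> (v x) * hat h x \<partial>\<mu>)"
    using l2 by simp
  moreover have "(\<lambda>k. (\<integral>x. f' x * \<theta> (F (r k) x) \<partial>\<mu>) + (\<integral>x. f x * (\<theta>' (F (r k) x) * dH h (F (r k)) x) \<partial>\<mu>))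
    \<longlonglongrightarrow> (\<integral>x. f' x * \<theta> (v x) \<partial>\<mu>) + (\<integral>x. f x * (\<theta>' (v x) * inner (G x) h) \<partial>\<mu>)"
    using tendsto_add[OF l1 l3'] by (simp add: g_def)
  ultimately show "(\<integral>x. f' x * \<theta> (v x) \<partial>\<mu>) + (\<integral>x. f x * (\<theta>' (v x) * inner (G x) h) \<partial>\<mu>) = (\<integral>x. f x * \<theta> (v x) * hat h x \<partial>\<mu>)"
    using LIMSEQ_unique by blast
qed

text \<open>The function \<open>v\<close> may be unbounded: the test function is bounded and
  \<open>hat h\<close> lies in every L^q, so all pairings are continuous in \<open>v\<close> and its
  gradient.\<close>

lemma weak_integration_by_parts:
  assumes vG: "has_weak_grad \<iota> \<mu> p v G" and p: "p > 1" and f: "admissible h f f'"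
  shows "(\<integral>x. v x * f' x \<partial>\<mu>) + (\<integral>x. inner (G x) h * f x \<partial>\<mu>) = (\<integral>x. v x * (f x * hat h x) \<partial>\<mu>)"
proof -
  obtain F where vm: "v \<in> Lp_space \<mu> p" "G \<in> Lp_space \<mu> p" and F: "\<And>k. F k \<in> FCb" "Lp_tendsto \<mu> p F v"
    "Lp_tendsto \<mu> p (\<lambda>k. H_grad \<iota> (F k)) G"
    using vG by (auto simp: has_weak_grad_def)
  obtain C C' where C: "\<And>x. \<bar>f x\<bar> \<le> C" "\<And>x. \<bar>f' x\<bar> \<le> C'" using admissible_facts[OF f] by metis
  have p': "p / (p - 1) > 0" using conjugate_exponent(1)[OF p] by simp
  note [measurable] = admissible_facts(1,2)[OF f]
  have f': "f \<in> Lp_space \<mu> (p / (p - 1))" "f' \<in> Lp_space \<mu> (p / (p - 1))" "(\<lambda>x. f x * hat h x) \<in> Lp_space \<mu> (p / (p - 1))"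
    using C p' by (auto intro!: bounded_Lp_space[OF fin_mu] Lp_space_bounded_mult[OF hat_Lp[OF p'] _ C(1) p'])
  have Fp: "F k \<in> Lp_space \<mu> p" "dH h (F k) \<in> Lp_space \<mu> p" for k
    using p by (intro FCb_Lp dH_FCb F; simp)+
  have dHl: "Lp_tendsto \<mu> p (\<lambda>k. dH h (F k)) (\<lambda>x. inner (G x) h)"
    unfolding dH_def using p
    by (intro Lp_tendsto_inner F FCb_vec_measurable H_grad_in_FCb_vec Lp_space_measurable[OF vm(2)]) simp
  have Gh: "(\<lambda>x. inner (G x) h) \<in> Lp_space \<mu> p" using p by (intro Lp_space_inner vm) simp
  have "(\<lambda>k. (\<integral>x. F k x * f' x \<partial>\<mu>) + (\<integral>x. dH h (F k) x * f x \<partial>\<mu>)) \<longlonglongrightarrow> (\<integral>x. v x * f' x \<partial>\<mu>) + (\<integral>x. inner (G x) h * f x \<partial>\<mu>)"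
    by (intro tendsto_add Lp_product_tendsto[OF fin_mu p] f' Fp vm F dHl Gh)
  moreover have "(\<lambda>k. \<integral>x. F k x * (f x * hat h x) \<partial>\<mu>) \<longlonglongrightarrow> (\<integral>x. v x * (f x * hat h x) \<partial>\<mu>)"
    by (intro Lp_product_tendsto[OF fin_mu p] f' Fp vm F)
  moreover have "(\<integral>x. F k x * f' x \<partial>\<mu>) + (\<integral>x. dH h (F k) x * f x \<partial>\<mu>) = (\<integral>x. F k x * (f x * hat h x) \<partial>\<mu>)" for k
    using gaussian_integration_by_parts[OF admissible_mult[OF FCb_admissible[OF F(1)] f], of k]
      Lp_product_integrable[OF fin_mu p Fp(1) f'(2)] Lp_product_integrable[OF fin_mu p Fp(2) f'(1)]
    by (simp add: mult.assoc)
  ultimately show ?thesis using LIMSEQ_unique by simp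
qed

end

section \<open>The weighted measure and its comparison with the Gaussian one\<close>

locale weighted_space = cameron_martin_space \<mu> \<iota> e
  for \<mu> :: "'a::{banach,second_countable_topology} measure"
    and \<iota> :: "'h::{real_inner,banach,second_countable_topology} \<Rightarrow> 'a" and e +
  fixes w :: "'a \<Rightarrow> real" and s t :: real
  assumes s: "s > 1" and w_pos: "AE x in \<mu>. w x > 0" and w_W1: "w \<in> W1 \<iota> \<mu> s"
    and t: "t \<ge> 2 * (s / (s - 1))" and lnw_W2: "(\<lambda>x. ln (w x)) \<in> W2 \<iota> e \<mu> t"
begin

definition \<nu> :: "'a measure" where "\<nu> = density \<mu> (\<lambda>x. ennreal (w x))"

lemma t_gt: "t > 2" using t conjugate_exponent(1)[OF s] by linarith

lemma w_Lp: "w \<in> Lp_space \<mu> s"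
  using w_W1 by (auto simp: W1_def has_weak_grad_def)

lemma w_measurable [measurable]: "w \<in> borel_measurable \<mu>"
  by (rule Lp_space_measurable[OF w_Lp])

lemma sets_nu [simp, measurable_cong]: "sets \<nu> = sets \<mu>" by (simp add: \<nu>_def)
lemma space_nu [simp]: "space \<nu> = UNIV" by (simp add: \<nu>_def)

lemma measurable_nu: "f \<in> measurable \<mu> N \<Longrightarrow> f \<in> measurable \<nu> N"
  using measurable_cong_sets[OF sets_nu refl] by blast

lemma measurable_nu_iff: "f \<in> measurable \<nu> N \<longleftrightarrow> f \<in> measurable \<mu> N"
  using measurable_cong_sets[OF sets_nu refl] by blast

text \<open>Positivity of the density makes the two measures mutually absolutely continuous, so
  almost-everywhere statements move freely between them.\<close>

lemma AE_nu: "(AE x in \<nu>. P x) \<longleftrightarrow> (AE x in \<mu>. P x)"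
proof -
  have "(AE x in \<nu>. P x) \<longleftrightarrow> (AE x in \<mu>. 0 < w x \<longrightarrow> P x)"
    unfolding \<nu>_def by (subst AE_density) auto
  also have "\<dots> \<longleftrightarrow> (AE x in \<mu>. P x)"
    by (intro iffI) (use w_pos in \<open>auto elim: AE_mp intro: AE_mp[OF w_pos]\<close>)
  finally show ?thesis .
qed

lemma integral_nu: "f \<in> borel_measurable \<mu> \<Longrightarrow> (\<integral>x. f x \<partial>\<nu>) = (\<integral>x. w x * f x \<partial>\<mu>)" for f :: "'a \<Rightarrow> real"
  unfolding \<nu>_def using w_pos by (subst integral_density) (auto elim: eventually_mono)

lemma integrable_nu: "f \<in> borel_measurable \<mu> \<Longrightarrow> integrable \<nu> f \<longleftrightarrow> integrable \<mu> (\<lambda>x. w x * f x)" for f :: "'a \<Rightarrow> real"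
  unfolding \<nu>_def using w_pos by (subst integrable_density) (auto elim: eventually_mono)

lemma nn_integral_nu:
  fixes f :: "'a \<Rightarrow> real"
  assumes [measurable]: "f \<in> borel_measurable \<mu>"
  shows "(\<integral>\<^sup>+x. ennreal (f x) \<partial>\<nu>) = (\<integral>\<^sup>+x. ennreal (w x * f x) \<partial>\<mu>)"
proof -
  have "(\<integral>\<^sup>+x. ennreal (f x) \<partial>\<nu>) = (\<integral>\<^sup>+x. ennreal (w x) * ennreal (f x) \<partial>\<mu>)"
    unfolding \<nu>_def by (rule nn_integral_density) measurable
  also have "\<dots> = (\<integral>\<^sup>+x. ennreal (w x * f x) \<partial>\<mu>)"
    using w_pos by (intro nn_integral_cong_AE, eventually_elim) (simp add: ennreal_mult'[symmetric])
  finally show ?thesis .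
qed

lemma weight_integrable: "integrable \<mu> (\<lambda>x. 1 + \<bar>w x\<bar> powr s)"
  using w_Lp by (auto simp: Lp_space_def)

lemma fin_nu: "finite_measure \<nu>"
proof -
  have "(\<lambda>_. 1 :: real) \<in> Lp_space \<mu> (s / (s - 1))"
    using conjugate_exponent(1)[OF s] by (intro bounded_Lp_space[OF fin_mu]) auto
  from Lp_product_integrable[OF fin_mu s w_Lp this] have "integrable \<mu> w" by simp
  then have "integrable \<nu> (\<lambda>_. 1 :: real)" by (simp add: integrable_nu)
  then have "emeasure \<nu> (space \<nu>) \<noteq> \<infinity>"
    by (auto simp: integrable_iff_bounded)
  then show ?thesis by (intro finite_measureI) simp
qed

text \<open>This is where 2s' comes from: the square is conjugate to \<open>w\<close> in L^s exactly
  when the function itself lies in L^(2s').\<close>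

lemma weight_domination:
  assumes p: "p \<ge> 2 * (s / (s - 1))" and \<delta>: "\<delta> > 0"
  obtains c where "c \<ge> 0" "\<And>a x. w x > 0 \<Longrightarrow> w x * a\<^sup>2 \<le> \<delta> * (1 + \<bar>w x\<bar> powr s) + c * \<bar>a\<bar> powr p"
proof -
  have "s / (s - 1) * 2 \<le> p" using p by (simp add: mult.commute)
  from product_domination[OF s this _ \<delta>]
  obtain c where c: "c \<ge> 0" "\<And>a b. a \<ge> 0 \<Longrightarrow> b \<ge> 0 \<Longrightarrow> a powr 2 * b \<le> \<delta> * (1 + b powr s) + c * a powr p" by auto
  show ?thesis
  proof (rule that[OF c(1)])
    fix a x assume "w x > 0"
    then show "w x * a\<^sup>2 \<le> \<delta> * (1 + \<bar>w x\<bar> powr s) + c * \<bar>a\<bar> powr p"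
      using c(2)[of "\<bar>a\<bar>" "w x"] by (simp add: mult.commute)
  qed
qed

lemma sq_int_nu:
  assumes p: "p \<ge> 2 * (s / (s - 1))" and f: "f \<in> Lp_space \<mu> p"
  shows "sq_int \<nu> f"
proof -
  note [measurable] = Lp_space_measurable[OF f]
  obtain c where c: "c \<ge> 0" "\<And>a x. w x > 0 \<Longrightarrow> w x * a\<^sup>2 \<le> 1 * (1 + \<bar>w x\<bar> powr s) + c * \<bar>a\<bar> powr p"
    using weight_domination[OF p, of 1] by auto
  have "integrable \<mu> (\<lambda>x. w x * (f x)\<^sup>2)"
  proof (rule Bochner_Integration.integrable_bound)
    show "integrable \<mu> (\<lambda>x. 1 * (1 + \<bar>w x\<bar> powr s) + c * \<bar>f x\<bar> powr p)"
      using weight_integrable f by (auto simp: Lp_space_def)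
    show "AE x in \<mu>. norm (w x * (f x)\<^sup>2) \<le> norm (1 * (1 + \<bar>w x\<bar> powr s) + c * \<bar>f x\<bar> powr p)"
      using w_pos
    proof eventually_elim
      case (elim x)
      then show ?case using c(2)[of x "f x"] by simp
    qed
  qed measurable
  then show ?thesis by (simp add: sq_int_def integrable_nu measurable_nu_iff)
qed

lemma nu_square_tendsto:
  assumes p: "p \<ge> 2 * (s / (s - 1))" and [measurable]: "\<And>k. a k \<in> borel_measurable \<mu>"
    and lim: "(\<lambda>k. \<integral>\<^sup>+x. ennreal (\<bar>a k x\<bar> powr p) \<partial>\<mu>) \<longlonglongrightarrow> 0"
  shows "(\<lambda>k. \<integral>\<^sup>+x. ennreal ((a k x)\<^sup>2) \<partial>\<nu>) \<longlonglongrightarrow> 0"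
proof -
  have "(\<lambda>k. \<integral>\<^sup>+x. ennreal (w x * (a k x)\<^sup>2) \<partial>\<mu>) \<longlonglongrightarrow> 0"
  proof (rule nn_integral_tendsto_0_of_domination[OF _ _ _ _ weight_integrable lim])
    fix \<delta> :: real assume "\<delta> > 0"
    from weight_domination[OF p this]
    obtain c where c: "c \<ge> 0" "\<And>a x. w x > 0 \<Longrightarrow> w x * a\<^sup>2 \<le> \<delta> * (1 + \<bar>w x\<bar> powr s) + c * \<bar>a\<bar> powr p" by blast
    have "AE x in \<mu>. w x * (a k x)\<^sup>2 \<le> \<delta> * (1 + \<bar>w x\<bar> powr s) + c * \<bar>a k x\<bar> powr p" for k
      using w_pos by eventually_elim (rule c(2))
    then show "\<exists>c\<ge>0. \<forall>k. AE x in \<mu>. w x * (a k x)\<^sup>2 \<le> \<delta> * (1 + \<bar>w x\<bar> powr s) + c * \<bar>a k x\<bar> powr p"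
      using c(1) by blast
  qed auto
  then show ?thesis by (simp add: nn_integral_nu)
qed

lemma L2_lim_nu:
  assumes p: "p \<ge> 2 * (s / (s - 1))" and F: "\<And>k. F k \<in> Lp_space \<mu> p" "f \<in> Lp_space \<mu> p" "Lp_tendsto \<mu> p F f"
  shows "L2_lim \<nu> F f"
proof (rule L2_lim_of_nn_integral[OF sq_int_nu[OF p F(1)] sq_int_nu[OF p F(2)]])
  note [measurable] = Lp_space_measurable[OF F(1)] Lp_space_measurable[OF F(2)]
  show "(\<lambda>n. \<integral>\<^sup>+x. ennreal ((F n x - f x)\<^sup>2) \<partial>\<nu>) \<longlonglongrightarrow> 0"
    using F(3) by (intro nu_square_tendsto[OF p]) (auto simp: Lp_tendsto_def)
qed

lemma hat_sq_int: "sq_int \<nu> (hat k)"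
  by (rule sq_int_nu[OF order_refl hat_Lp]) (use conjugate_exponent(1)[OF s] in simp)

text \<open>Any even integer above 2s' serves as intermediate exponent. Convergence of the same
  sequence in L^2(\<mu>) is kept in the conclusion because it determines the limit of the values at
  Cameron-Martin vectors.\<close>

lemma functional_L2_lim_hat:
  obtains L where "L2_lim \<nu> (\<lambda>n. blinfun_apply (L n)) (hat k)"
    "(\<lambda>n. \<integral>x. (hat k x - blinfun_apply (L n) x)\<^sup>2 \<partial>\<mu>) \<longlonglongrightarrow> 0"
proof -
  obtain L where L: "(\<lambda>n. \<integral>x. (hat k x - blinfun_apply (L n) x)\<^sup>2 \<partial>\<mu>) \<longlonglongrightarrow> 0"
    using hat_approx by blast
  obtain m0 :: nat where m0: "2 * (s / (s - 1)) \<le> real m0" using real_arch_simple by blast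
  define m where "m = max 1 m0"
  have m: "m \<ge> 1" "2 * (s / (s - 1)) \<le> real (2 * m)" using m0 by (auto simp: m_def)
  have pw: "\<bar>x\<bar> powr real (2 * m) = x ^ (2 * m)" for x :: real
  proof (cases "x = 0")
    case False
    then have "\<bar>x\<bar> powr real (2 * m) = \<bar>x\<bar> ^ (2 * m)" by (intro powr_realpow) auto
    then show ?thesis by (simp add: power_even_abs)
  qed (use m in simp)
  have "L2_lim \<nu> (\<lambda>n. blinfun_apply (L n)) (hat k)"
  proof (rule L2_lim_nu[OF m(2)])
    show "blinfun_apply (L n) \<in> Lp_space \<mu> (real (2 * m))" for n
      unfolding Lp_space_def real_norm_def pw using integrable_power[of "L n" "2 * m"] by auto
    show "hat k \<in> Lp_space \<mu> (real (2 * m))" using m by (intro hat_Lp) simp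
    show "Lp_tendsto \<mu> (real (2 * m)) (\<lambda>n. blinfun_apply (L n)) (hat k)"
    proof -
      have "(blinfun_apply (L n) x - hat k x) ^ (2 * m) = (hat k x - blinfun_apply (L n) x) ^ (2 * m)" for n x
        by (simp add: power_mult power2_commute)
      then show ?thesis using hat_moment_tendsto[OF L m(1)] unfolding Lp_tendsto_def real_norm_def pw by (simp only:)
    qed
  qed
  then show ?thesis using L that by blast
qed

section \<open>Gradient and Hessian of ln w\<close>

definition hess :: "'a \<Rightarrow> 'h \<Rightarrow>\<^sub>L 'h" where "hess = weak_hess \<iota> e \<mu> t (\<lambda>x. ln (w x))"

text \<open>The gradient hidden in the existential statement behind \<open>hess\<close>. Choosing it
  together with \<open>hess\<close> provides one approximating sequence for both; it is matched with
  \<open>weak_grad\<close> only afterwards, by uniqueness.\<close>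

definition grad_ln :: "'a \<Rightarrow> 'h" where
  "grad_ln = (SOME G. G \<in> Lp_space \<mu> t \<and> (\<exists>F. (\<forall>k. F k \<in> FCb) \<and> Lp_tendsto \<mu> t F (\<lambda>x. ln (w x)) \<and>
    Lp_tendsto \<mu> t (\<lambda>k. H_grad \<iota> (F k)) G \<and> Lp_HS_tendsto e \<mu> t (\<lambda>k. H_hess \<iota> (F k)) hess))"

lemma ln_approx:
  shows "hess \<in> Lp_HS e \<mu> t" "(\<lambda>x. ln (w x)) \<in> Lp_space \<mu> t" "grad_ln \<in> Lp_space \<mu> t"
    "\<exists>F. (\<forall>k. F k \<in> FCb) \<and> Lp_tendsto \<mu> t F (\<lambda>x. ln (w x)) \<and>
      Lp_tendsto \<mu> t (\<lambda>k. H_grad \<iota> (F k)) grad_ln \<and> Lp_HS_tendsto e \<mu> t (\<lambda>k. H_hess \<iota> (F k)) hess"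
proof -
  have "\<exists>S. has_weak_hess \<iota> e \<mu> t (\<lambda>x. ln (w x)) S" using lnw_W2 by (simp add: W2_def)
  from someI_ex[OF this] have h: "has_weak_hess \<iota> e \<mu> t (\<lambda>x. ln (w x)) hess"
    by (simp add: hess_def weak_hess_def)
  then show "hess \<in> Lp_HS e \<mu> t" "(\<lambda>x. ln (w x)) \<in> Lp_space \<mu> t" by (auto simp: has_weak_hess_def)
  from h have "\<exists>G. G \<in> Lp_space \<mu> t \<and> (\<exists>F. (\<forall>k. F k \<in> FCb) \<and> Lp_tendsto \<mu> t F (\<lambda>x. ln (w x)) \<and>
    Lp_tendsto \<mu> t (\<lambda>k. H_grad \<iota> (F k)) G \<and> Lp_HS_tendsto e \<mu> t (\<lambda>k. H_hess \<iota> (F k)) hess)"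
    unfolding has_weak_hess_def by blast
  from someI_ex[OF this] show "grad_ln \<in> Lp_space \<mu> t"
    "\<exists>F. (\<forall>k. F k \<in> FCb) \<and> Lp_tendsto \<mu> t F (\<lambda>x. ln (w x)) \<and>
      Lp_tendsto \<mu> t (\<lambda>k. H_grad \<iota> (F k)) grad_ln \<and> Lp_HS_tendsto e \<mu> t (\<lambda>k. H_hess \<iota> (F k)) hess"
    unfolding grad_ln_def by blast+
qed

lemma grad_ln_weak_grad: "has_weak_grad \<iota> \<mu> t (\<lambda>x. ln (w x)) grad_ln"
  using ln_approx unfolding has_weak_grad_def by blast

definition \<beta> :: "'h \<Rightarrow> 'a \<Rightarrow> real" where
  "\<beta> h x = inner (grad_ln x) h - hat h x"

lemma grad_ln_sq_int: "sq_int \<nu> (\<lambda>x. inner (grad_ln x) h)"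
  using t t_gt by (intro sq_int_nu[where p=t] Lp_space_inner ln_approx) auto

lemma beta_sq_int: "sq_int \<nu> (\<beta> h)"
  unfolding \<beta>_def[abs_def] by (intro sq_int_diff grad_ln_sq_int hat_sq_int)

text \<open>The weak chain rule for arctan gives both gradients, weighted by the derivative of
  arctan, the same pairing with all plane waves. The weight never vanishes and can be
  cancelled.\<close>

lemma grad_ln_unique:
  assumes G: "has_weak_grad \<iota> \<mu> t (\<lambda>x. ln (w x)) G"
  shows "AE x in \<mu>. inner (G x) h = inner (grad_ln x) h"
proof -
  have der: "(arctan has_real_derivative inverse (1 + r\<^sup>2)) (at r)" for r by (rule DERIV_arctan)
  have cont: "continuous_on UNIV (\<lambda>r :: real. inverse (1 + r\<^sup>2))"
    by (intro continuous_intros) (auto simp: add_nonneg_eq_0_iff)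
  have bd: "\<bar>arctan r\<bar> \<le> pi / 2" "\<bar>inverse (1 + r\<^sup>2)\<bar> \<le> 1" for r :: real
    using arctan_bounded[of r] by (auto simp: abs_le_iff inverse_eq_divide divide_le_eq add_pos_nonneg)
  have t1: "t > 1" using t_gt by simp
  define D where "D x = inverse (1 + (ln (w x))\<^sup>2) * inner (G x) h - inverse (1 + (ln (w x))\<^sup>2) * inner (grad_ln x) h" for x
  note c1 = weak_chain_rule[OF G t1 _ der cont bd]
  note c2 = weak_chain_rule[OF grad_ln_weak_grad t1 _ der cont bd]
  have one: "admissible h (\<lambda>x. cos (blinfun_apply 0 x + 0)) (dH h (\<lambda>x. cos (blinfun_apply 0 x + 0)))"
    by (rule admissible_cos)
  have "AE x in \<mu>. D x = 0"
  proof (rule AE_zero_of_trig[OF fin_mu sets_mu])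
    show "integrable \<mu> D" unfolding D_def
      using Bochner_Integration.integrable_diff[OF c1(1)[OF one] c2(1)[OF one]] by simp
    fix l b
    note a = admissible_cos[of h l b]
    show "(\<integral>x. D x * cos (blinfun_apply l x + b) \<partial>\<mu>) = 0"
      using Bochner_Integration.integral_diff[OF c1(1)[OF a] c2(1)[OF a]] c1(2)[OF a] c2(2)[OF a]
      by (simp add: D_def algebra_simps)
  qed
  then show ?thesis
  proof eventually_elim
    case (elim x)
    have "1 + (ln (w x))\<^sup>2 \<noteq> 0" by (metis add_nonneg_eq_0_iff zero_le_power2 zero_le_one zero_neq_one)
    then show ?case using elim by (simp add: D_def)
  qed
qed

lemma weak_grad_ln: "AE x in \<mu>. inner (weak_grad \<iota> \<mu> t (\<lambda>x. ln (w x)) x) h = inner (grad_ln x) h"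
proof (rule grad_ln_unique)
  show "has_weak_grad \<iota> \<mu> t (\<lambda>x. ln (w x)) (weak_grad \<iota> \<mu> t (\<lambda>x. ln (w x)))"
    unfolding weak_grad_def
    by (rule someI[of "has_weak_grad \<iota> \<mu> t (\<lambda>x. ln (w x))", OF grad_ln_weak_grad])
qed

text \<open>\<open>\<nabla>w = w \<nabla>(ln w)\<close>: compare the weak derivatives of \<open>arctan w = arctan (exp (ln w))\<close>.\<close>

lemma grad_w:
  assumes G: "has_weak_grad \<iota> \<mu> s w G"
  shows "AE x in \<mu>. inner (G x) h = w x * inner (grad_ln x) h"
proof -
  have der: "(arctan has_real_derivative inverse (1 + r\<^sup>2)) (at r)" for r by (rule DERIV_arctan)
  have cont: "continuous_on UNIV (\<lambda>r :: real. inverse (1 + r\<^sup>2))"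
    by (intro continuous_intros) (auto simp: add_nonneg_eq_0_iff)
  have bd: "\<bar>arctan r\<bar> \<le> pi / 2" "\<bar>inverse (1 + r\<^sup>2)\<bar> \<le> 1" for r :: real
    using arctan_bounded[of r] by (auto simp: abs_le_iff inverse_eq_divide divide_le_eq add_pos_nonneg)
  have der': "((\<lambda>r. arctan (exp r)) has_real_derivative inverse (1 + (exp r)\<^sup>2) * exp r) (at r)" for r :: real
    by (auto intro!: derivative_eq_intros)
  have cont': "continuous_on UNIV (\<lambda>r :: real. inverse (1 + (exp r)\<^sup>2) * exp r)"
    by (intro continuous_intros) (auto simp: add_nonneg_eq_0_iff)
  \<comment> \<open>The exponential is unbounded, but arctan after exp has bounded values and a
    bounded derivative, so the weak chain rule applies to ln w.\<close>
  have bd': "\<bar>arctan (exp r)\<bar> \<le> pi / 2" "\<bar>inverse (1 + (exp r)\<^sup>2) * exp r\<bar> \<le> 1" for r :: real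
  proof -
    have "2 * exp r \<le> 1 + (exp r)\<^sup>2" using sum_squares_bound[of 1 "exp r"] by simp
    then have "exp r \<le> 1 + (exp r)\<^sup>2" using exp_gt_zero[of r] by linarith
    then show "\<bar>inverse (1 + (exp r)\<^sup>2) * exp r\<bar> \<le> 1"
      by (simp add: abs_mult inverse_eq_divide divide_le_eq add_pos_nonneg)
  qed (rule bd(1))
  have t1: "t > 1" using t_gt by simp
  note c1 = weak_chain_rule[OF G s _ der cont bd]
  note c2 = weak_chain_rule[OF grad_ln_weak_grad t1 _ der' cont' bd']
  define D where "D x = inverse (1 + (w x)\<^sup>2) * inner (G x) h - inverse (1 + (exp (ln (w x)))\<^sup>2) * exp (ln (w x)) * inner (grad_ln x) h" for x
  have one: "admissible h (\<lambda>x. cos (blinfun_apply 0 x + 0)) (dH h (\<lambda>x. cos (blinfun_apply 0 x + 0)))"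
    by (rule admissible_cos)
  have "AE x in \<mu>. D x = 0"
  proof (rule AE_zero_of_trig[OF fin_mu sets_mu])
    show "integrable \<mu> D" unfolding D_def
      using Bochner_Integration.integrable_diff[OF c1(1)[OF one] c2(1)[OF one]] by simp
    fix l b
    note a = admissible_cos[of h l b]
    note [measurable] = admissible_facts(1,2)[OF a]
    \<comment> \<open>The logarithm inverts the exponential only where \<open>w\<close> is positive,
      hence equality of integrals rather than of functions.\<close>
    have "(\<integral>x. dH h (\<lambda>x. cos (blinfun_apply l x + b)) x * arctan (exp (ln (w x))) \<partial>\<mu>)
        = (\<integral>x. dH h (\<lambda>x. cos (blinfun_apply l x + b)) x * arctan (w x) \<partial>\<mu>)"
      "(\<integral>x. cos (blinfun_apply l x + b) * arctan (exp (ln (w x))) * hat h x \<partial>\<mu>)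
        = (\<integral>x. cos (blinfun_apply l x + b) * arctan (w x) * hat h x \<partial>\<mu>)"
      using w_pos by (auto intro!: integral_cong_AE elim: eventually_mono)
    then show "(\<integral>x. D x * cos (blinfun_apply l x + b) \<partial>\<mu>) = 0"
      using Bochner_Integration.integral_diff[OF c1(1)[OF a] c2(1)[OF a]] c1(2)[OF a] c2(2)[OF a]
      by (simp add: D_def algebra_simps)
  qed
  then show ?thesis using w_pos
  proof eventually_elim
    case (elim x)
    have "1 + (w x)\<^sup>2 \<noteq> 0" by (metis add_nonneg_eq_0_iff zero_le_power2 zero_le_one zero_neq_one)
    then show ?case using elim by (simp add: D_def)
  qed
qed

lemma admissible_nu:
  assumes "admissible h f f'"
  shows "sq_int \<nu> f" "sq_int \<nu> f'" "f \<in> borel_measurable \<nu>" "f' \<in> borel_measurable \<nu>"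
  using admissible_facts[OF assms] by (auto intro!: sq_int_bounded[OF fin_nu] simp: measurable_nu_iff)

text \<open>The Gaussian formula is applied to \<open>w\<close> against \<open>f\<close>, and the
  gradient of \<open>w\<close> is then written as \<open>w\<close> times the gradient of ln w; the
  two remaining terms assemble into the logarithmic derivative.\<close>

theorem weighted_integration_by_parts:
  assumes f: "admissible h f f'"
  shows "(\<integral>x. f' x \<partial>\<nu>) = - (\<integral>x. f x * \<beta> h x \<partial>\<nu>)"
proof -
  obtain G where G: "has_weak_grad \<iota> \<mu> s w G" using w_W1 by (auto simp: W1_def)
  note [measurable] = admissible_facts(1,2)[OF f] Lp_space_measurable[OF ln_approx(3)]
  have Gm [measurable]: "G \<in> borel_measurable \<mu>" using G by (auto simp: has_weak_grad_def Lp_space_def)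
  note fnu = admissible_nu(1)[OF f]
  have i1: "integrable \<mu> (\<lambda>x. w x * (f x * inner (grad_ln x) h))"
    using sq_int_product[OF fnu grad_ln_sq_int[of h]] by (subst (asm) integrable_nu) auto
  have i2: "integrable \<mu> (\<lambda>x. w x * (f x * hat h x))"
    using sq_int_product[OF fnu hat_sq_int[of h]] by (subst (asm) integrable_nu) auto
  have "(\<integral>x. f' x \<partial>\<nu>) + (\<integral>x. inner (G x) h * f x \<partial>\<mu>) = (\<integral>x. w x * (f x * hat h x) \<partial>\<mu>)"
    using weak_integration_by_parts[OF G s f] by (simp add: integral_nu)
  moreover have "(\<integral>x. inner (G x) h * f x \<partial>\<mu>) = (\<integral>x. w x * (f x * inner (grad_ln x) h) \<partial>\<mu>)"
    using grad_w[OF G, of h] by (intro integral_cong_AE) (auto elim!: eventually_mono)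
  moreover have "(\<integral>x. f x * \<beta> h x \<partial>\<nu>) = (\<integral>x. w x * (f x * inner (grad_ln x) h) \<partial>\<mu>) - (\<integral>x. w x * (f x * hat h x) \<partial>\<mu>)"
    using i1 i2 by (subst integral_nu) (auto simp: \<beta>_def[abs_def] right_diff_distrib)
  ultimately show ?thesis by simp
qed

lemma weighted_W12_integration_by_parts:
  assumes vG: "has_weak_grad \<iota> \<nu> 2 v G" and f: "admissible h f f'"
  shows "sq_int \<nu> v" "sq_int \<nu> (\<lambda>x. inner (G x) h)"
    and "(\<integral>x. v x * f' x \<partial>\<nu>) + (\<integral>x. inner (G x) h * f x \<partial>\<nu>) = - (\<integral>x. v x * (f x * \<beta> h x) \<partial>\<nu>)"
proof -
  obtain F where vm: "v \<in> Lp_space \<nu> 2" "G \<in> Lp_space \<nu> 2" and F: "\<And>k. F k \<in> FCb" "Lp_tendsto \<nu> 2 F v"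
    "Lp_tendsto \<nu> 2 (\<lambda>k. H_grad \<iota> (F k)) G"
    using vG by (auto simp: has_weak_grad_def)
  note [measurable] = admissible_facts(1,2)[OF f]
  obtain C where C: "\<And>x. \<bar>f x\<bar> \<le> C" using admissible_facts[OF f] by metis
  show v: "sq_int \<nu> v" and g: "sq_int \<nu> (\<lambda>x. inner (G x) h)"
    using vm by (auto simp: sq_int_Lp_space intro: Lp_space_inner)
  note Fs = admissible_nu(1,2)[OF FCb_admissible[OF F(1), of h]]
  have l1: "L2_lim \<nu> F v" by (rule Lp_tendsto_imp_L2_lim[OF Fs(1) v F(2)])
  have "Lp_tendsto \<nu> 2 (\<lambda>k. dH h (F k)) (\<lambda>x. inner (G x) h)"
    unfolding dH_def
    by (intro Lp_tendsto_inner F measurable_nu FCb_vec_measurable H_grad_in_FCb_vec Lp_space_measurable[OF vm(2)]) simp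
  then have l2: "L2_lim \<nu> (\<lambda>k. dH h (F k)) (\<lambda>x. inner (G x) h)" by (rule Lp_tendsto_imp_L2_lim[OF Fs(2) g])
  have fb: "sq_int \<nu> (\<lambda>x. f x * \<beta> h x)" by (rule sq_int_bounded_mult[OF beta_sq_int _ C]) (simp add: measurable_nu_iff)
  have "(\<lambda>k. (\<integral>x. F k x * f' x \<partial>\<nu>) + (\<integral>x. dH h (F k) x * f x \<partial>\<nu>)) \<longlonglongrightarrow> (\<integral>x. v x * f' x \<partial>\<nu>) + (\<integral>x. inner (G x) h * f x \<partial>\<nu>)"
    by (intro tendsto_add L2_lim_integral_product l1 l2 admissible_nu[OF f])
  moreover have "(\<lambda>k. - (\<integral>x. F k x * (f x * \<beta> h x) \<partial>\<nu>)) \<longlonglongrightarrow> - (\<integral>x. v x * (f x * \<beta> h x) \<partial>\<nu>)"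
    by (intro tendsto_minus L2_lim_integral_product l1 fb)
  moreover have "(\<integral>x. F k x * f' x \<partial>\<nu>) + (\<integral>x. dH h (F k) x * f x \<partial>\<nu>) = - (\<integral>x. F k x * (f x * \<beta> h x) \<partial>\<nu>)" for k
    using weighted_integration_by_parts[OF admissible_mult[OF FCb_admissible[OF F(1)] f], of k]
      sq_int_product[OF Fs(1) admissible_nu(2)[OF f]] sq_int_product[OF Fs(2) admissible_nu(1)[OF f]]
    by (simp add: mult.assoc)
  ultimately show "(\<integral>x. v x * f' x \<partial>\<nu>) + (\<integral>x. inner (G x) h * f x \<partial>\<nu>) = - (\<integral>x. v x * (f x * \<beta> h x) \<partial>\<nu>)"
    using LIMSEQ_unique by simp
qed

end

section \<open>Orthonormal expansions and Hilbert--Schmidt operators\<close>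

locale orthonormal =
  fixes e :: "nat \<Rightarrow> 'h::{real_inner,banach,second_countable_topology}"
  assumes onb: "orthonormal_basis e"
begin

lemma inner_basis: "inner (e i) (e j) = (if i = j then 1 else 0)"
  using onb by (simp add: orthonormal_basis_def)

definition proj :: "nat \<Rightarrow> 'h \<Rightarrow> 'h" where
  "proj N v = (\<Sum>n<N. inner v (e n) *\<^sub>R e n)"

lemma inner_proj: "inner (proj N v) (e m) = (if m < N then inner v (e m) else 0)"
  by (simp add: proj_def inner_sum_left inner_basis if_distrib sum.delta cong: if_cong)

lemma proj_diff: "proj N (u - v) = proj N u - proj N v"
  by (simp add: proj_def inner_diff_left scaleR_left_diff_distrib sum_subtractf)

lemma norm_proj: "(norm (proj N v))\<^sup>2 = (\<Sum>n<N. (inner v (e n))\<^sup>2)"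
  unfolding power2_norm_eq_inner proj_def[of N v]
  by (subst inner_sum_right) (simp add: inner_proj[unfolded proj_def] power2_eq_square)

lemma norm_diff_proj: "(norm (v - proj N v))\<^sup>2 = (norm v)\<^sup>2 - (norm (proj N v))\<^sup>2"
proof -
  have "inner v (proj N v) = (norm (proj N v))\<^sup>2"
    unfolding norm_proj by (simp add: proj_def inner_sum_right power2_eq_square)
  then show ?thesis by (simp add: power2_norm_eq_inner inner_diff_left inner_diff_right inner_commute)
qed

lemma norm_proj_le: "norm (proj N v) \<le> norm v"
proof -
  have "0 \<le> (norm (v - proj N v))\<^sup>2" by simp
  then have "(norm (proj N v))\<^sup>2 \<le> (norm v)\<^sup>2" unfolding norm_diff_proj by simp
  then show ?thesis by (rule power2_le_imp_le) simp
qed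

lemma norm_diff_proj_le: "norm (v - proj N v) \<le> norm v"
proof -
  have "(norm (v - proj N v))\<^sup>2 \<le> (norm v)\<^sup>2" unfolding norm_diff_proj by simp
  then show ?thesis by (rule power2_le_imp_le) simp
qed

text \<open>A finite combination of basis vectors is reproduced exactly as soon as \<open>N\<close>
  passes every index involved.\<close>

lemma proj_span:
  assumes "u \<in> span (range e)"
  shows "\<exists>N0. \<forall>N\<ge>N0. proj N u = u"
  using assms
proof (induction rule: span_induct_alt)
  case base
  then show ?case by (simp add: proj_def)
next
  case (step c x y)
  then obtain m N0 where m: "x = e m" and N0: "\<forall>N\<ge>N0. proj N y = y" by auto
  have "proj N (c *\<^sub>R x + y) = c *\<^sub>R x + y" if N: "N \<ge> max N0 (Suc m)" for N
  proof -
    have "proj N (e m) = (\<Sum>n<N. if m = n then e n else 0)"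
      by (simp add: proj_def inner_basis if_distrib[where f="\<lambda>r. r *\<^sub>R _"] cong: if_cong)
    also have "\<dots> = e m" using N by (simp add: sum.delta)
    finally have "proj N (e m) = e m" .
    moreover have "proj N (c *\<^sub>R x + y) = c *\<^sub>R proj N x + proj N y"
      by (simp add: proj_def inner_add_left scaleR_left_distrib sum.distrib scaleR_sum_right)
    ultimately show ?thesis using N0 N m by simp
  qed
  then show ?case by blast
qed

text \<open>The complementary projections are contractions, and they eventually vanish on each
  vector of the dense span.\<close>

lemma proj_tendsto: "(\<lambda>N. proj N v) \<longlonglongrightarrow> v"
proof (rule LIMSEQ_I)
  fix r :: real assume r: "r > 0"
  have "v \<in> closure (span (range e))" using onb by (simp add: orthonormal_basis_def)
  then obtain u where u: "u \<in> span (range e)" "dist u v < r / 2"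
    using r closure_approachable[of v "span (range e)"] by (meson half_gt_zero)
  obtain N0 where N0: "\<forall>N\<ge>N0. proj N u = u" using proj_span[OF u(1)] by blast
  have "norm (proj N v - v) < r" if "N \<ge> N0" for N
  proof -
    have "proj N v - v = proj N (v - u) - (v - u)" using N0 that by (simp add: proj_diff)
    also have "norm \<dots> \<le> norm (v - u)" using norm_diff_proj_le[of "v - u" N] by (simp add: norm_minus_commute)
    finally show ?thesis using u(2) r by (simp add: dist_norm norm_minus_commute)
  qed
  then show "\<exists>N0. \<forall>N\<ge>N0. norm (proj N v - v) < r" by blast
qed

lemma parseval_inner: "(\<lambda>n. inner u (e n) * inner v (e n)) sums inner u v"
proof -
  have "(\<lambda>N. inner u (proj N v)) \<longlonglongrightarrow> inner u v" by (intro tendsto_intros proj_tendsto)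
  then show ?thesis by (simp add: sums_def proj_def inner_sum_right mult.commute)
qed

lemma parseval: "(\<lambda>n. (inner v (e n))\<^sup>2) sums (norm v)\<^sup>2"
  using parseval_inner[of v v] by (simp add: power2_eq_square power2_norm_eq_inner[unfolded power2_eq_square])

section \<open>The Hilbert-Schmidt norm\<close>

lemma hs_norm_nonneg: "hilbert_schmidt e T \<Longrightarrow> hs_norm e T \<ge> 0"
  unfolding hs_norm_def hilbert_schmidt_def by (intro real_sqrt_ge_zero suminf_nonneg) auto

lemma hs_norm_power2:
  assumes "hilbert_schmidt e T"
  shows "(hs_norm e T)\<^sup>2 = (\<Sum>n. (norm (blinfun_apply T (e n)))\<^sup>2)"
  using assms unfolding hs_norm_def hilbert_schmidt_def by (intro real_sqrt_pow2 suminf_nonneg) auto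

lemma partial_le_hs_norm:
  assumes "hilbert_schmidt e T"
  shows "L2_set (\<lambda>n. norm (blinfun_apply T (e n))) {..<N} \<le> hs_norm e T"
  unfolding L2_set_def hs_norm_def
  using assms by (intro real_sqrt_le_mono sum_le_suminf) (auto simp: hilbert_schmidt_def)

lemma hs_norm_le:
  assumes T: "hilbert_schmidt e T" and le: "\<And>N. L2_set (\<lambda>n. norm (blinfun_apply T (e n))) {..<N} \<le> B"
  shows "hs_norm e T \<le> B"
proof -
  have "(\<lambda>N. \<Sum>n<N. (norm (blinfun_apply T (e n)))\<^sup>2) \<longlonglongrightarrow> (\<Sum>n. (norm (blinfun_apply T (e n)))\<^sup>2)"
    using T by (intro summable_LIMSEQ) (simp add: hilbert_schmidt_def)
  then have "(\<lambda>N. L2_set (\<lambda>n. norm (blinfun_apply T (e n))) {..<N}) \<longlonglongrightarrow> hs_norm e T"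
    unfolding L2_set_def hs_norm_def by (intro tendsto_intros)
  then show ?thesis using le by (intro LIMSEQ_le_const2) auto
qed

lemma hilbert_schmidt_diff:
  assumes "hilbert_schmidt e T" "hilbert_schmidt e S"
  shows "hilbert_schmidt e (T - S)"
  unfolding hilbert_schmidt_def
proof (rule summable_comparison_test')
  show "summable (\<lambda>n. 2 * (norm (blinfun_apply T (e n)))\<^sup>2 + 2 * (norm (blinfun_apply S (e n)))\<^sup>2)"
    using assms by (intro summable_add summable_mult) (auto simp: hilbert_schmidt_def)
  show "norm ((norm (blinfun_apply (T - S) (e n)))\<^sup>2) \<le> 2 * (norm (blinfun_apply T (e n)))\<^sup>2 + 2 * (norm (blinfun_apply S (e n)))\<^sup>2"
    if "n \<ge> 0" for n
  proof -
    have "norm (blinfun_apply (T - S) (e n)) \<le> norm (blinfun_apply T (e n)) + norm (blinfun_apply S (e n))"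
      by (simp add: blinfun.diff_left norm_triangle_ineq4)
    then have "(norm (blinfun_apply (T - S) (e n)))\<^sup>2 \<le> (norm (blinfun_apply T (e n)) + norm (blinfun_apply S (e n)))\<^sup>2"
      by (rule power_mono) simp
    also have "\<dots> \<le> 2 * (norm (blinfun_apply T (e n)))\<^sup>2 + 2 * (norm (blinfun_apply S (e n)))\<^sup>2"
      using sum_squares_bound[of "norm (blinfun_apply T (e n))" "norm (blinfun_apply S (e n))"] by (simp add: power2_sum)
    finally show ?thesis by simp
  qed
qed

text \<open>Minkowski's inequality for the finite partial sums, followed by the limit. The form with
  \<open>T - S\<close> fits the comparison of a limit with its approximants.\<close>

lemma hs_norm_triangle:
  assumes T: "hilbert_schmidt e T" and S: "hilbert_schmidt e S"
  shows "hs_norm e T \<le> hs_norm e S + hs_norm e (T - S)"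
proof (rule hs_norm_le[OF T])
  fix N
  have "L2_set (\<lambda>n. norm (blinfun_apply T (e n))) {..<N} \<le>
    L2_set (\<lambda>n. norm (blinfun_apply S (e n)) + norm (blinfun_apply (T - S) (e n))) {..<N}"
    by (intro L2_set_mono) (auto simp: blinfun.diff_left norm_triangle_sub)
  also have "\<dots> \<le> L2_set (\<lambda>n. norm (blinfun_apply S (e n))) {..<N} + L2_set (\<lambda>n. norm (blinfun_apply (T - S) (e n))) {..<N}"
    by (rule L2_set_triangle_ineq)
  also have "\<dots> \<le> hs_norm e S + hs_norm e (T - S)"
    by (intro add_mono partial_le_hs_norm S hilbert_schmidt_diff T)
  finally show "L2_set (\<lambda>n. norm (blinfun_apply T (e n))) {..<N} \<le> hs_norm e S + hs_norm e (T - S)" .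
qed

lemma hs_norm_diff_commute: "hs_norm e (T - S) = hs_norm e (S - T)"
  by (simp add: hs_norm_def blinfun.diff_left norm_minus_commute)

lemma abs_hs_norm_diff_le:
  assumes "hilbert_schmidt e T" "hilbert_schmidt e S"
  shows "\<bar>hs_norm e T - hs_norm e S\<bar> \<le> hs_norm e (T - S)"
  using hs_norm_triangle[OF assms] hs_norm_triangle[OF assms(2,1)] hs_norm_diff_commute[of T S] by linarith

text \<open>Cauchy-Schwarz on the coordinates of \<open>proj N h\<close>, then N tends to
  infinity.\<close>

lemma norm_apply_le_hs_norm:
  assumes T: "hilbert_schmidt e T"
  shows "norm (blinfun_apply T h) \<le> hs_norm e T * norm h"
proof (rule LIMSEQ_le_const2)
  show "(\<lambda>N. norm (blinfun_apply T (proj N h))) \<longlonglongrightarrow> norm (blinfun_apply T h)"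
    by (intro tendsto_intros proj_tendsto)
  have "norm (blinfun_apply T (proj N h)) \<le> hs_norm e T * norm h" for N
  proof -
    have "norm (blinfun_apply T (proj N h)) \<le> (\<Sum>n<N. \<bar>inner h (e n)\<bar> * \<bar>norm (blinfun_apply T (e n))\<bar>)"
      unfolding proj_def blinfun.sum_right blinfun.scaleR_right by (rule order_trans[OF norm_sum]) simp
    also have "\<dots> \<le> L2_set (\<lambda>n. inner h (e n)) {..<N} * L2_set (\<lambda>n. norm (blinfun_apply T (e n))) {..<N}"
      by (rule L2_set_mult_ineq)
    also have "\<dots> \<le> norm h * hs_norm e T"
    proof (intro mult_mono partial_le_hs_norm T)
      show "L2_set (\<lambda>n. inner h (e n)) {..<N} \<le> norm h"
        unfolding L2_set_def norm_proj[symmetric] by (simp add: norm_proj_le)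
    qed auto
    finally show ?thesis by (simp add: mult.commute)
  qed
  then show "\<exists>N. \<forall>n\<ge>N. norm (blinfun_apply T (proj n h)) \<le> hs_norm e T * norm h" by blast
qed

lemma abs_inner_apply_le:
  assumes "hilbert_schmidt e T"
  shows "\<bar>inner (blinfun_apply T h) k\<bar> \<le> (norm h * norm k) * hs_norm e T"
proof -
  have "\<bar>inner (blinfun_apply T h) k\<bar> \<le> norm (blinfun_apply T h) * norm k" by (rule Cauchy_Schwarz_ineq2)
  also have "\<dots> \<le> hs_norm e T * norm h * norm k" by (intro mult_right_mono norm_apply_le_hs_norm assms) simp
  finally show ?thesis by (simp add: ac_simps)
qed

text \<open>Weak measurability implies strong measurability because the field is the pointwise limit
  of its finite orthonormal expansions.\<close>

lemma measurable_of_inner: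
  fixes f :: "'b \<Rightarrow> 'h"
  assumes "\<And>k. (\<lambda>x. inner (f x) k) \<in> borel_measurable M"
  shows "f \<in> borel_measurable M"
proof (rule borel_measurable_LIMSEQ_metric)
  show "(\<lambda>x. proj N (f x)) \<in> borel_measurable M" for N
    unfolding proj_def using assms by (intro borel_measurable_sum borel_measurable_scaleR) auto
  show "(\<lambda>N. proj N (f x)) \<longlonglongrightarrow> f x" for x by (rule proj_tendsto)
qed

lemma hs_norm_measurable:
  assumes "\<And>h k. (\<lambda>x. inner (blinfun_apply (T x) h) k) \<in> borel_measurable M"
  shows "(\<lambda>x. hs_norm e (T x)) \<in> borel_measurable M"
proof -
  have "(\<lambda>x. blinfun_apply (T x) h) \<in> borel_measurable M" for h by (rule measurable_of_inner) (rule assms)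
  note [measurable] = this
  show ?thesis unfolding hs_norm_def by measurable
qed

text \<open>\<open>tr (T\<^sup>2) \<le> \<parallel>T\<parallel>\<^sup>2\<close> in the Hilbert--Schmidt norm, for the finite rank operator
  \<open>T = \<Sum> h\<^sub>i \<otimes> g\<^sub>i\<close>: expand \<open>0 \<le> \<parallel>T - T\<^sup>*\<parallel>\<^sup>2\<close>.\<close>

lemma finite_rank:
  fixes g h :: "nat \<Rightarrow> 'h"
  assumes T: "\<And>k. blinfun_apply T k = (\<Sum>i<n. inner (g i) k *\<^sub>R h i)"
  shows finite_rank_sums: "(\<lambda>m. (norm (blinfun_apply T (e m)))\<^sup>2) sums (\<Sum>i<n. \<Sum>j<n. inner (g i) (g j) * inner (h i) (h j))"
    and finite_rank_hilbert_schmidt: "hilbert_schmidt e T"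
    and finite_rank_trace_le: "(\<Sum>i<n. \<Sum>j<n. inner (g i) (h j) * inner (g j) (h i)) \<le> (hs_norm e T)\<^sup>2"
proof -
  \<comment> \<open>The Hilbert-Schmidt inner product of two finite rank operators by Parseval.
    Suitable choices of the four families give the norm of T, that of its adjoint, and their mixed
    product.\<close>
  have expand: "(\<lambda>m. inner (\<Sum>i<n. inner (a i) (e m) *\<^sub>R b i) (\<Sum>i<n. inner (c i) (e m) *\<^sub>R d i)) sums
      (\<Sum>i<n. \<Sum>j<n. inner (a i) (c j) * inner (b i) (d j))" for a b c d :: "nat \<Rightarrow> 'h"
  proof -
    have "(\<lambda>m. \<Sum>i<n. \<Sum>j<n. (inner (a i) (e m) * inner (c j) (e m)) * inner (b i) (d j)) sums
      (\<Sum>i<n. \<Sum>j<n. inner (a i) (c j) * inner (b i) (d j))"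
      by (intro sums_sum sums_mult2 parseval_inner)
    moreover have "inner (\<Sum>i<n. inner (a i) (e m) *\<^sub>R b i) (\<Sum>i<n. inner (c i) (e m) *\<^sub>R d i) =
      (\<Sum>i<n. \<Sum>j<n. (inner (a i) (e m) * inner (c j) (e m)) * inner (b i) (d j))" for m
      by (simp only: inner_sum_left) (simp add: inner_sum_right sum_distrib_left ac_simps)
    ultimately show ?thesis by simp
  qed
  have N: "(norm (blinfun_apply T (e m)))\<^sup>2 = inner (\<Sum>i<n. inner (g i) (e m) *\<^sub>R h i) (\<Sum>i<n. inner (g i) (e m) *\<^sub>R h i)" for m
    unfolding T power2_norm_eq_inner ..
  show s: "(\<lambda>m. (norm (blinfun_apply T (e m)))\<^sup>2) sums (\<Sum>i<n. \<Sum>j<n. inner (g i) (g j) * inner (h i) (h j))"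
    unfolding N by (rule expand)
  then show hs: "hilbert_schmidt e T" by (auto simp: hilbert_schmidt_def sums_iff)
  have A: "(\<lambda>m. (norm ((\<Sum>i<n. inner (g i) (e m) *\<^sub>R h i) - (\<Sum>i<n. inner (h i) (e m) *\<^sub>R g i)))\<^sup>2) sums
    ((\<Sum>i<n. \<Sum>j<n. inner (g i) (g j) * inner (h i) (h j)) - 2 * (\<Sum>i<n. \<Sum>j<n. inner (g i) (h j) * inner (h i) (g j))
      + (\<Sum>i<n. \<Sum>j<n. inner (h i) (h j) * inner (g i) (g j)))"
  proof -
    have "(norm (u - v))\<^sup>2 = inner u u - 2 * inner u v + inner v v" for u v :: 'h
      by (simp add: power2_norm_eq_inner inner_diff_left inner_diff_right inner_commute)
    then show ?thesis by (simp only:) (intro sums_add sums_diff sums_mult expand)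
  qed
  have "0 \<le> (\<Sum>i<n. \<Sum>j<n. inner (g i) (g j) * inner (h i) (h j)) - 2 * (\<Sum>i<n. \<Sum>j<n. inner (g i) (h j) * inner (h i) (g j))
      + (\<Sum>i<n. \<Sum>j<n. inner (h i) (h j) * inner (g i) (g j))"
    using sums_le[OF _ sums_zero A] by simp
  moreover have "(\<Sum>i<n. \<Sum>j<n. inner (h i) (h j) * inner (g i) (g j)) = (\<Sum>i<n. \<Sum>j<n. inner (g i) (g j) * inner (h i) (h j))"
    by (simp add: mult.commute)
  ultimately have "(\<Sum>i<n. \<Sum>j<n. inner (g i) (h j) * inner (h i) (g j)) \<le> (\<Sum>i<n. \<Sum>j<n. inner (g i) (g j) * inner (h i) (h j))"
    by linarith
  moreover have "(hs_norm e T)\<^sup>2 = (\<Sum>i<n. \<Sum>j<n. inner (g i) (g j) * inner (h i) (h j))"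
    using s hs_norm_power2[OF hs] by (simp add: sums_iff)
  moreover have "(\<Sum>i<n. \<Sum>j<n. inner (g i) (h j) * inner (g j) (h i)) = (\<Sum>i<n. \<Sum>j<n. inner (g i) (h j) * inner (h i) (g j))"
    by (simp add: inner_commute)
  ultimately show "(\<Sum>i<n. \<Sum>j<n. inner (g i) (h j) * inner (g j) (h i)) \<le> (hs_norm e T)\<^sup>2" by simp
qed

end

sublocale cameron_martin_space \<subseteq> orthonormal e
  by unfold_locales (rule onb)

context cameron_martin_space
begin

lemma FCb_vec_hilbert_schmidt:
  assumes "\<Phi> \<in> FCb_vec"
  shows "hilbert_schmidt e (H_deriv \<iota> \<Phi> x)"
proof -
  obtain n f a where f: "\<forall>i<(n::nat). f i \<in> FCb" "\<Phi> = (\<lambda>x. \<Sum>i<n. f i x *\<^sub>R a i)"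
    by (rule FCb_vecE[OF assms])
  have "blinfun_apply (H_deriv \<iota> \<Phi> x) k = (\<Sum>i<n. inner (H_grad \<iota> (f i) x) k *\<^sub>R a i)" for k
    using FCb_vec_H_deriv(2)[OF f(1)[rule_format] f(2)] by (simp add: dH_def)
  then show ?thesis by (rule finite_rank_hilbert_schmidt)
qed

end

section \<open>The second-order integration by parts formula\<close>

context weighted_space
begin

text \<open>One sequence serves the gradient and the Hessian at once, and t at least 2s' turns its
  L^t(\<mu>) limits into L^2(\<nu>) limits. Entries of the Hessian are controlled by the
  Hilbert-Schmidt norm.\<close>

lemma hess_L2_lim:
  obtains F where "\<And>m. F m \<in> FCb" "\<And>h. L2_lim \<nu> (\<lambda>m. dH h (F m)) (\<lambda>x. inner (grad_ln x) h)"
    "\<And>h k. L2_lim \<nu> (\<lambda>m. dH k (dH h (F m))) (\<lambda>x. inner (blinfun_apply (hess x) k) h)"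
proof -
  obtain F where F: "\<forall>k. F k \<in> FCb" "Lp_tendsto \<mu> t (\<lambda>k. H_grad \<iota> (F k)) grad_ln"
    "Lp_HS_tendsto e \<mu> t (\<lambda>k. H_hess \<iota> (F k)) hess" using ln_approx(4) by blast
  have t0: "t > 0" using t_gt by simp
  have hm: "(\<lambda>x. inner (blinfun_apply (hess x) h) k) \<in> borel_measurable \<mu>"
    and hs: "AE x in \<mu>. hilbert_schmidt e (hess x)" and hi: "integrable \<mu> (\<lambda>x. hs_norm e (hess x) powr t)" for h k
    using ln_approx(1) by (auto simp: Lp_HS_def)
  note [measurable] = hm Lp_space_measurable[OF ln_approx(3)]
  have fm: "(\<lambda>x. inner (blinfun_apply (H_hess \<iota> (F n) x) h) k) \<in> borel_measurable \<mu>" for n h k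
    using F(1) by (simp add: H_hess_inner FCb_measurable dH_FCb)
  have dm: "(\<lambda>x. inner (blinfun_apply (H_hess \<iota> (F n) x - hess x) h) k) \<in> borel_measurable \<mu>" for n h k
    using fm hm by (simp add: blinfun.diff_left inner_diff_left)
  note [measurable] = hs_norm_measurable[OF dm] hs_norm_measurable[OF hm]
  show ?thesis
  proof (rule that)
    show "F m \<in> FCb" for m using F by simp
    show "L2_lim \<nu> (\<lambda>m. dH h (F m)) (\<lambda>x. inner (grad_ln x) h)" for h
    proof (rule L2_lim_nu[OF t])
      show "dH h (F m) \<in> Lp_space \<mu> t" for m using F t0 by (intro FCb_Lp dH_FCb) auto
      show "(\<lambda>x. inner (grad_ln x) h) \<in> Lp_space \<mu> t" using t0 by (intro Lp_space_inner ln_approx)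
      show "Lp_tendsto \<mu> t (\<lambda>m. dH h (F m)) (\<lambda>x. inner (grad_ln x) h)"
        unfolding dH_def using F t0
        by (intro Lp_tendsto_inner FCb_vec_measurable H_grad_in_FCb_vec Lp_space_measurable[OF ln_approx(3)]) auto
    qed
    show "L2_lim \<nu> (\<lambda>m. dH k (dH h (F m))) (\<lambda>x. inner (blinfun_apply (hess x) k) h)" for h k
    proof (rule L2_lim_nu[OF t])
      show "dH k (dH h (F m)) \<in> Lp_space \<mu> t" for m using F t0 by (intro FCb_Lp dH_FCb) auto
      have "integrable \<mu> (\<lambda>x. norm (inner (blinfun_apply (hess x) k) h) powr t)"
      proof (rule Bochner_Integration.integrable_bound)
        show "integrable \<mu> (\<lambda>x. (norm k * norm h) powr t * hs_norm e (hess x) powr t)" using hi by simp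
        show "AE x in \<mu>. norm (norm (inner (blinfun_apply (hess x) k) h) powr t) \<le> norm ((norm k * norm h) powr t * hs_norm e (hess x) powr t)"
          using hs
        proof eventually_elim
          case (elim x)
          have "\<bar>inner (blinfun_apply (hess x) k) h\<bar> powr t \<le> ((norm k * norm h) * hs_norm e (hess x)) powr t"
            using t0 by (intro powr_mono2 abs_inner_apply_le elim) auto
          then show ?case by (simp add: powr_mult hs_norm_nonneg[OF elim])
        qed
      qed measurable
      then show "(\<lambda>x. inner (blinfun_apply (hess x) k) h) \<in> Lp_space \<mu> t" by (simp add: Lp_space_def)
      show "Lp_tendsto \<mu> t (\<lambda>m. dH k (dH h (F m))) (\<lambda>x. inner (blinfun_apply (hess x) k) h)"
      proof (rule Lp_tendsto_mono[OF F(3)[unfolded Lp_HS_tendsto_def] t0, where c="norm k * norm h"])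
        show "AE x in \<mu>. norm (dH k (dH h (F n)) x - inner (blinfun_apply (hess x) k) h)
          \<le> norm k * norm h * norm (hs_norm e (H_hess \<iota> (F n) x - hess x) - 0)" for n
          using hs
        proof eventually_elim
          case (elim x)
          have "hilbert_schmidt e (H_hess \<iota> (F n) x - hess x)"
            unfolding H_hess_def using F(1) elim
            by (intro hilbert_schmidt_diff FCb_vec_hilbert_schmidt H_grad_in_FCb_vec) auto
          from abs_inner_apply_le[OF this, of k h] hs_norm_nonneg[OF this] show ?case
            using F(1) by (simp add: H_hess_inner[symmetric] blinfun.diff_left inner_diff_left)
        qed
      qed auto
    qed
  qed
qed

section \<open>Directional derivatives in the sense of distributions\<close>

definition delta :: "'h \<Rightarrow> ('a \<Rightarrow> real) \<Rightarrow> 'a \<Rightarrow> real" where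
  "delta k g x = dH k g x + g x * \<beta> k x"

lemma FCb_sq_int: "f \<in> FCb \<Longrightarrow> sq_int \<nu> f"
  by (rule admissible_nu(1)[OF FCb_admissible])

lemma FCb_mult_sq_int:
  assumes f: "f \<in> FCb" and g: "sq_int \<nu> g"
  shows "sq_int \<nu> (\<lambda>x. f x * g x)"
proof -
  obtain B where "\<forall>x. \<bar>f x\<bar> \<le> B" using FCb_bounded[OF f] by blast
  then show ?thesis using FCb_measurable[OF f] by (intro sq_int_bounded_mult[OF g, where B=B]) (auto simp: measurable_nu_iff)
qed

lemma FCb_mult_L2_lim:
  assumes f: "f \<in> FCb" and g: "L2_lim \<nu> G g"
  shows "L2_lim \<nu> (\<lambda>n x. f x * G n x) (\<lambda>x. f x * g x)"
proof -
  obtain B where "\<forall>x. \<bar>f x\<bar> \<le> B" using FCb_bounded[OF f] by blast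
  then show ?thesis using FCb_measurable[OF f] by (intro L2_lim_mult[OF g, where B=B]) (auto simp: measurable_nu_iff)
qed

lemma delta_sq_int: "f \<in> FCb \<Longrightarrow> sq_int \<nu> (delta k f)"
  unfolding delta_def[abs_def] by (intro sq_int_add FCb_sq_int dH_FCb FCb_mult_sq_int beta_sq_int)

text \<open>\<open>weak_dH k \<psi> \<psi>'\<close>: \<open>\<psi>'\<close> is the derivative of \<open>\<psi>\<close> along \<open>k\<close> in the sense of distributions with
  respect to \<open>\<nu>\<close>. Unlike the classical relation it is closed in \<open>L\<^sup>2(\<nu>)\<close>.\<close>

definition weak_dH :: "'h \<Rightarrow> ('a \<Rightarrow> real) \<Rightarrow> ('a \<Rightarrow> real) \<Rightarrow> bool" where
  "weak_dH k \<psi> \<psi>' \<longleftrightarrow> sq_int \<nu> \<psi> \<and> sq_int \<nu> \<psi>' \<and> (\<forall>g\<in>FCb. (\<integral>x. \<psi>' x * g x \<partial>\<nu>) = - (\<integral>x. \<psi> x * delta k g x \<partial>\<nu>))"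

lemma weak_dH_admissible:
  assumes "admissible k \<psi> \<psi>'"
  shows "weak_dH k \<psi> \<psi>'"
  unfolding weak_dH_def
proof (intro conjI ballI admissible_nu(1,2)[OF assms])
  fix g :: "'a \<Rightarrow> real" assume g: "g \<in> FCb"
  note s = admissible_nu(1,2)[OF assms] FCb_sq_int[OF g] FCb_sq_int[OF dH_FCb[OF g]]
  have "(\<integral>x. \<psi>' x * g x + \<psi> x * dH k g x \<partial>\<nu>) = - (\<integral>x. \<psi> x * (g x * \<beta> k x) \<partial>\<nu>)"
    using weighted_integration_by_parts[OF admissible_mult[OF assms FCb_admissible[OF g]]] by (simp add: mult.assoc)
  then show "(\<integral>x. \<psi>' x * g x \<partial>\<nu>) = - (\<integral>x. \<psi> x * delta k g x \<partial>\<nu>)"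
    using sq_int_product[OF s(2) s(3)] sq_int_product[OF s(1) s(4), of k] sq_int_product[OF s(1) FCb_mult_sq_int[OF g beta_sq_int[of k]]]
    by (simp add: delta_def distrib_left)
qed

text \<open>Both sides of the defining identity are L^2 pairings with fixed square-integrable
  functions, so they pass to the limit.\<close>

lemma weak_dH_closed:
  assumes "\<And>n. weak_dH k (\<Psi> n) (\<Psi>' n)" and l: "L2_lim \<nu> \<Psi> \<psi>" "L2_lim \<nu> \<Psi>' \<psi>'"
  shows "weak_dH k \<psi> \<psi>'"
  unfolding weak_dH_def
proof (intro conjI ballI L2_limD(2)[OF l(1)] L2_limD(2)[OF l(2)])
  fix g :: "'a \<Rightarrow> real" assume g: "g \<in> FCb"
  have "(\<lambda>n. \<integral>x. \<Psi>' n x * g x \<partial>\<nu>) \<longlonglongrightarrow> (\<integral>x. \<psi>' x * g x \<partial>\<nu>)"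
    by (rule L2_lim_integral_product[OF l(2) FCb_sq_int[OF g]])
  moreover have "(\<lambda>n. - (\<integral>x. \<Psi> n x * delta k g x \<partial>\<nu>)) \<longlonglongrightarrow> - (\<integral>x. \<psi> x * delta k g x \<partial>\<nu>)"
    by (intro tendsto_minus L2_lim_integral_product[OF l(1) delta_sq_int[OF g]])
  moreover have "(\<integral>x. \<Psi>' n x * g x \<partial>\<nu>) = - (\<integral>x. \<Psi> n x * delta k g x \<partial>\<nu>)" for n
    using assms(1) g by (simp add: weak_dH_def)
  ultimately show "(\<integral>x. \<psi>' x * g x \<partial>\<nu>) = - (\<integral>x. \<psi> x * delta k g x \<partial>\<nu>)"
    using LIMSEQ_unique by simp
qed

lemma weak_dH_add:
  assumes "weak_dH k \<psi> \<psi>'" "weak_dH k \<phi> \<phi>'"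
  shows "weak_dH k (\<lambda>x. \<psi> x + \<phi> x) (\<lambda>x. \<psi>' x + \<phi>' x)"
  unfolding weak_dH_def
proof (intro conjI ballI sq_int_add)
  fix g :: "'a \<Rightarrow> real" assume g: "g \<in> FCb"
  have i: "integrable \<nu> (\<lambda>x. a x * g x)" "integrable \<nu> (\<lambda>x. a x * delta k g x)" if "sq_int \<nu> a" for a
    using that g by (auto intro: sq_int_product FCb_sq_int delta_sq_int)
  show "(\<integral>x. (\<psi>' x + \<phi>' x) * g x \<partial>\<nu>) = - (\<integral>x. (\<psi> x + \<phi> x) * delta k g x \<partial>\<nu>)"
    using assms g i by (simp add: weak_dH_def distrib_right)
qed (use assms in \<open>auto simp: weak_dH_def\<close>)

lemma weak_dH_minus:
  assumes "weak_dH k \<psi> \<psi>'" shows "weak_dH k (\<lambda>x. - \<psi> x) (\<lambda>x. - \<psi>' x)"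
  using assms sq_int_cmult[of \<nu> \<psi> "- 1"] sq_int_cmult[of \<nu> \<psi>' "- 1"] by (simp add: weak_dH_def)

text \<open>For cylindrical approximants of ln w this is the classical product rule; closedness
  carries it to the limit, where the second derivative becomes an entry of
  \<open>hess\<close>.\<close>

lemma weak_dH_grad_ln:
  assumes f: "f \<in> FCb"
  shows "weak_dH k (\<lambda>x. f x * inner (grad_ln x) h)
    (\<lambda>x. dH k f x * inner (grad_ln x) h + f x * inner (blinfun_apply (hess x) k) h)"
proof -
  obtain F where F: "\<And>m. F m \<in> FCb" "\<And>h. L2_lim \<nu> (\<lambda>m. dH h (F m)) (\<lambda>x. inner (grad_ln x) h)"
    "\<And>h k. L2_lim \<nu> (\<lambda>m. dH k (dH h (F m))) (\<lambda>x. inner (blinfun_apply (hess x) k) h)"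
    by (rule hess_L2_lim) blast
  show ?thesis
  proof (rule weak_dH_closed)
    show "weak_dH k (\<lambda>x. f x * dH h (F m) x) (\<lambda>x. dH k f x * dH h (F m) x + f x * dH k (dH h (F m)) x)" for m
      by (intro weak_dH_admissible admissible_mult FCb_admissible dH_FCb f F)
    show "L2_lim \<nu> (\<lambda>m x. f x * dH h (F m) x) (\<lambda>x. f x * inner (grad_ln x) h)"
      by (intro FCb_mult_L2_lim f F)
    show "L2_lim \<nu> (\<lambda>m x. dH k f x * dH h (F m) x + f x * dH k (dH h (F m)) x)
      (\<lambda>x. dH k f x * inner (grad_ln x) h + f x * inner (blinfun_apply (hess x) k) h)"
      by (intro L2_lim_add FCb_mult_L2_lim f dH_FCb F)
  qed
qed

lemma scaled_sin_tendsto: "(\<lambda>n. real (Suc n) * sin (a / real (Suc n))) \<longlonglongrightarrow> a"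
proof (cases "a = 0")
  case False
  have "((\<lambda>y. sin (a * y)) has_real_derivative a) (at 0)" by (auto intro!: derivative_eq_intros)
  then have "(\<lambda>y. sin (a * y) / y) \<midarrow>0\<rightarrow> a" by (simp add: has_field_derivative_iff)
  moreover have "(\<lambda>n. 1 / real (Suc n)) \<longlonglongrightarrow> 0" by (rule LIMSEQ_Suc[OF lim_1_over_n])
  then have "filterlim (\<lambda>n. 1 / real (Suc n)) (at 0) sequentially"
    by (simp add: filterlim_at)
  ultimately have "(\<lambda>n. sin (a * (1 / real (Suc n))) / (1 / real (Suc n))) \<longlonglongrightarrow> a"
    by (rule filterlim_compose)
  then show ?thesis by (simp add: mult.commute)
qed simp

lemma functional_sq_int: "sq_int \<nu> (blinfun_apply l)"
proof -
  obtain m0 :: nat where m0: "2 * (s / (s - 1)) \<le> real m0" using real_arch_simple by blast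
  define m where "m = max 1 m0"
  have m: "m \<ge> 1" "2 * (s / (s - 1)) \<le> real (2 * m)" using m0 by (auto simp: m_def)
  have pw: "\<bar>x\<bar> powr real (2 * m) = x ^ (2 * m)" for x :: real
  proof (cases "x = 0")
    case False
    then have "\<bar>x\<bar> powr real (2 * m) = \<bar>x\<bar> ^ (2 * m)" by (intro powr_realpow) auto
    then show ?thesis by (simp add: power_even_abs)
  qed (use m in simp)
  show ?thesis
    by (rule sq_int_nu[OF m(2)]) (unfold Lp_space_def real_norm_def pw, use integrable_power[of l "2 * m"] in auto)
qed

text \<open>A functional is unbounded and hence not admissible in general. It is approximated by c
  sin(l/c) with growing c: the values are dominated by the modulus of \<open>l\<close>, and the
  derivatives tend boundedly to the constant \<open>blinfun_apply l (\<iota> k)\<close>.\<close>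

lemma weak_dH_functional:
  assumes f: "f \<in> FCb"
  shows "weak_dH k (\<lambda>x. f x * blinfun_apply l x) (\<lambda>x. dH k f x * blinfun_apply l x + f x * blinfun_apply l (\<iota> k))"
proof (rule weak_dH_closed)
  define c where "c n = real (Suc n)" for n
  have c: "c n > 0" for n by (simp add: c_def)
  note l = functional_sq_int[of l]
  have [measurable]: "blinfun_apply l \<in> borel_measurable \<nu>" by (simp add: measurable_nu_iff)
  have "((\<lambda>r. c n * sin (blinfun_apply l (x + r *\<^sub>R \<iota> k) / c n)) has_real_derivative
      cos (blinfun_apply l x / c n) * blinfun_apply l (\<iota> k)) (at 0)" for n x
    using c[of n] by (auto simp: blinfun.add_right blinfun.scaleR_right intro!: derivative_eq_intros)
  moreover have "\<bar>c n * sin y\<bar> \<le> c n" "\<bar>cos y * b\<bar> \<le> \<bar>b\<bar>" for n y b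
    using c[of n] by (auto simp: abs_mult mult_left_le mult_left_le_one_le)
  moreover have "continuous_on UNIV (\<lambda>x. c n * sin (blinfun_apply l x / c n))"
    "continuous_on UNIV (\<lambda>x. cos (blinfun_apply l x / c n) * blinfun_apply l (\<iota> k))" for n
    using c[of n] by (auto intro!: continuous_intros)
  ultimately have adm: "admissible k (\<lambda>x. c n * sin (blinfun_apply l x / c n)) (\<lambda>x. cos (blinfun_apply l x / c n) * blinfun_apply l (\<iota> k))" for n
    unfolding admissible_def by blast
  show "weak_dH k (\<lambda>x. f x * (c n * sin (blinfun_apply l x / c n)))
    (\<lambda>x. dH k f x * (c n * sin (blinfun_apply l x / c n)) + f x * (cos (blinfun_apply l x / c n) * blinfun_apply l (\<iota> k)))" for n
    by (intro weak_dH_admissible admissible_mult FCb_admissible f adm)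
  have l1: "L2_lim \<nu> (\<lambda>n x. c n * sin (blinfun_apply l x / c n)) (blinfun_apply l)"
    unfolding L2_lim_def
  proof (intro conjI allI l admissible_nu(1)[OF adm])
    have "(\<lambda>n. \<integral>x. (c n * sin (blinfun_apply l x / c n) - blinfun_apply l x)\<^sup>2 \<partial>\<nu>) \<longlonglongrightarrow> (\<integral>x. 0 \<partial>\<nu>)"
    proof (rule integral_dominated_convergence[where w="\<lambda>x. 4 * (blinfun_apply l x)\<^sup>2"])
      show "integrable \<nu> (\<lambda>x. 4 * (blinfun_apply l x)\<^sup>2)" using l by (simp add: sq_int_def)
      show "AE x in \<nu>. (\<lambda>n. (c n * sin (blinfun_apply l x / c n) - blinfun_apply l x)\<^sup>2) \<longlonglongrightarrow> 0"
      proof (intro AE_I2)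
        fix x
        have "(\<lambda>n. (c n * sin (blinfun_apply l x / c n) - blinfun_apply l x)\<^sup>2) \<longlonglongrightarrow> (blinfun_apply l x - blinfun_apply l x)\<^sup>2"
          unfolding c_def by (intro tendsto_power tendsto_diff tendsto_const scaled_sin_tendsto)
        then show "(\<lambda>n. (c n * sin (blinfun_apply l x / c n) - blinfun_apply l x)\<^sup>2) \<longlonglongrightarrow> 0" by simp
      qed
      show "AE x in \<nu>. norm ((c n * sin (blinfun_apply l x / c n) - blinfun_apply l x)\<^sup>2) \<le> 4 * (blinfun_apply l x)\<^sup>2" for n
      proof (intro AE_I2)
        fix x
        have "\<bar>sin (blinfun_apply l x / c n)\<bar> \<le> \<bar>blinfun_apply l x / c n\<bar>" by (rule abs_sin_x_le_abs_x)
        then have "\<bar>c n * sin (blinfun_apply l x / c n)\<bar> \<le> \<bar>blinfun_apply l x\<bar>"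
          using c[of n] by (simp add: abs_mult abs_divide field_simps)
        then have "\<bar>c n * sin (blinfun_apply l x / c n) - blinfun_apply l x\<bar> \<le> 2 * \<bar>blinfun_apply l x\<bar>" by linarith
        then have "\<bar>c n * sin (blinfun_apply l x / c n) - blinfun_apply l x\<bar>\<^sup>2 \<le> (2 * \<bar>blinfun_apply l x\<bar>)\<^sup>2" by (rule power_mono) simp
        then show "norm ((c n * sin (blinfun_apply l x / c n) - blinfun_apply l x)\<^sup>2) \<le> 4 * (blinfun_apply l x)\<^sup>2"
          by (simp add: power_mult_distrib)
      qed
    qed measurable
    then show "(\<lambda>n. \<integral>x. (c n * sin (blinfun_apply l x / c n) - blinfun_apply l x)\<^sup>2 \<partial>\<nu>) \<longlonglongrightarrow> 0" by simp
  qed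
  interpret N: finite_measure \<nu> by (rule fin_nu)
  define b where "b = blinfun_apply l (\<iota> k)"
  have l2: "L2_lim \<nu> (\<lambda>n x. cos (blinfun_apply l x / c n) * b) (\<lambda>x. b)"
    unfolding L2_lim_def
  proof (intro conjI allI)
    show "sq_int \<nu> (\<lambda>x. cos (blinfun_apply l x / c n) * b)" for n
      using admissible_nu(2)[OF adm[of n]] by (simp add: b_def)
    show "sq_int \<nu> (\<lambda>x. b)" by (simp add: sq_int_def)
    have "(\<lambda>n. \<integral>x. (cos (blinfun_apply l x / c n) * b - b)\<^sup>2 \<partial>\<nu>) \<longlonglongrightarrow> (\<integral>x. 0 \<partial>\<nu>)"
    proof (rule integral_dominated_convergence[where w="\<lambda>x. (2 * \<bar>b\<bar>)\<^sup>2"])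
      show "AE x in \<nu>. (\<lambda>n. (cos (blinfun_apply l x / c n) * b - b)\<^sup>2) \<longlonglongrightarrow> 0"
      proof (intro AE_I2)
        fix x
        have "(\<lambda>n. blinfun_apply l x * (1 / real (Suc n))) \<longlonglongrightarrow> blinfun_apply l x * 0"
          by (intro tendsto_intros LIMSEQ_Suc[OF lim_1_over_n])
        then have "(\<lambda>n. blinfun_apply l x / c n) \<longlonglongrightarrow> 0" by (simp add: c_def)
        then have "(\<lambda>n. (cos (blinfun_apply l x / c n) * b - b)\<^sup>2) \<longlonglongrightarrow> (cos 0 * b - b)\<^sup>2"
          by (intro tendsto_intros)
        then show "(\<lambda>n. (cos (blinfun_apply l x / c n) * b - b)\<^sup>2) \<longlonglongrightarrow> 0" by simp
      qed
      show "AE x in \<nu>. norm ((cos (blinfun_apply l x / c n) * b - b)\<^sup>2) \<le> (2 * \<bar>b\<bar>)\<^sup>2" for n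
      proof (intro AE_I2)
        fix x
        have "\<bar>cos (blinfun_apply l x / c n) * b\<bar> \<le> 1 * \<bar>b\<bar>" unfolding abs_mult by (intro mult_right_mono) auto
        then have "\<bar>cos (blinfun_apply l x / c n) * b - b\<bar> \<le> 2 * \<bar>b\<bar>" by linarith
        then have "\<bar>cos (blinfun_apply l x / c n) * b - b\<bar>\<^sup>2 \<le> (2 * \<bar>b\<bar>)\<^sup>2" by (rule power_mono) simp
        then show "norm ((cos (blinfun_apply l x / c n) * b - b)\<^sup>2) \<le> (2 * \<bar>b\<bar>)\<^sup>2" by simp
      qed
    qed auto
    then show "(\<lambda>n. \<integral>x. (cos (blinfun_apply l x / c n) * b - b)\<^sup>2 \<partial>\<nu>) \<longlonglongrightarrow> 0" by simp
  qed
  show "L2_lim \<nu> (\<lambda>n x. f x * (c n * sin (blinfun_apply l x / c n))) (\<lambda>x. f x * blinfun_apply l x)"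
    by (rule FCb_mult_L2_lim[OF f l1])
  show "L2_lim \<nu> (\<lambda>n x. dH k f x * (c n * sin (blinfun_apply l x / c n)) + f x * (cos (blinfun_apply l x / c n) * blinfun_apply l (\<iota> k)))
    (\<lambda>x. dH k f x * blinfun_apply l x + f x * blinfun_apply l (\<iota> k))"
    using l2 unfolding b_def by (intro L2_lim_add FCb_mult_L2_lim[OF dH_FCb[OF f] l1] FCb_mult_L2_lim[OF f])
qed

text \<open>The constant derivative of \<open>hat h\<close> along \<open>k\<close> arises as the
  limit of the values of the approximating functionals at \<open>\<iota> k\<close>, which tend to
  the covariance of \<open>hat h\<close> and \<open>hat k\<close>.\<close>

lemma weak_dH_hat:
  assumes f: "f \<in> FCb"
  shows "weak_dH k (\<lambda>x. f x * hat h x) (\<lambda>x. dH k f x * hat h x + f x * inner h k)"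
proof -
  obtain L where L: "L2_lim \<nu> (\<lambda>n. blinfun_apply (L n)) (hat h)"
    "(\<lambda>n. \<integral>x. (hat h x - blinfun_apply (L n) x)\<^sup>2 \<partial>\<mu>) \<longlonglongrightarrow> 0"
    by (rule functional_L2_lim_hat)
  have "(\<lambda>n. \<integral>x. blinfun_apply (L n) x * hat k x \<partial>\<mu>) \<longlonglongrightarrow> (\<integral>x. hat h x * hat k x \<partial>\<mu>)"
    by (intro integral_product_tendsto L(2) hat_square integrable_square) auto
  then have c: "(\<lambda>n. blinfun_apply (L n) (\<iota> k)) \<longlonglongrightarrow> inner h k"
    by (simp add: apply_iota inner_hat mult.commute)
  have fL: "L2_lim \<nu> (\<lambda>n x. f x * blinfun_apply (L n) (\<iota> k)) (\<lambda>x. f x * inner h k)"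
    unfolding L2_lim_def
  proof (intro conjI allI)
    show "sq_int \<nu> (\<lambda>x. f x * b)" for b using sq_int_cmult[OF FCb_sq_int[OF f], of b] by (simp add: mult.commute)
    then show "sq_int \<nu> (\<lambda>x. f x * b)" for b .
    have "(\<integral>x. (f x * a - f x * b)\<^sup>2 \<partial>\<nu>) = (a - b)\<^sup>2 * (\<integral>x. (f x)\<^sup>2 \<partial>\<nu>)" for a b
    proof -
      have "(\<lambda>x. (f x * a - f x * b)\<^sup>2) = (\<lambda>x. (a - b)\<^sup>2 * (f x)\<^sup>2)"
        by (simp add: fun_eq_iff power2_eq_square algebra_simps)
      then show ?thesis by simp
    qed
    moreover have "(\<lambda>n. (blinfun_apply (L n) (\<iota> k) - inner h k)\<^sup>2 * (\<integral>x. (f x)\<^sup>2 \<partial>\<nu>)) \<longlonglongrightarrow> (inner h k - inner h k)\<^sup>2 * (\<integral>x. (f x)\<^sup>2 \<partial>\<nu>)"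
      by (intro tendsto_intros c)
    ultimately show "(\<lambda>n. \<integral>x. (f x * blinfun_apply (L n) (\<iota> k) - f x * inner h k)\<^sup>2 \<partial>\<nu>) \<longlonglongrightarrow> 0" by simp
  qed
  show ?thesis
  proof (rule weak_dH_closed[OF weak_dH_functional[OF f, of k "L n" for n]])
    show "L2_lim \<nu> (\<lambda>n x. f x * blinfun_apply (L n) x) (\<lambda>x. f x * hat h x)"
      by (rule FCb_mult_L2_lim[OF f L(1)])
    show "L2_lim \<nu> (\<lambda>n x. dH k f x * blinfun_apply (L n) x + f x * blinfun_apply (L n) (\<iota> k)) (\<lambda>x. dH k f x * hat h x + f x * inner h k)"
      by (rule L2_lim_add[OF FCb_mult_L2_lim[OF dH_FCb[OF f] L(1)] fL])
  qed
qed

text \<open>A commutation relation. Because second derivatives of \<open>f\<close> commute, the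
  terms differentiating \<open>f\<close> regroup into \<open>delta h (dH k f)\<close>, and
  differentiating the logarithmic derivative leaves a multiplication operator.\<close>

lemma weak_dH_delta:
  assumes f: "f \<in> FCb"
  shows "weak_dH k (delta h f) (\<lambda>x. delta h (dH k f) x + f x * (inner (blinfun_apply (hess x) k) h - inner h k))"
proof -
  have "weak_dH k (\<lambda>x. dH h f x + (f x * inner (grad_ln x) h + - (f x * hat h x)))
    (\<lambda>x. dH k (dH h f) x + ((dH k f x * inner (grad_ln x) h + f x * inner (blinfun_apply (hess x) k) h)
      + - (dH k f x * hat h x + f x * inner h k)))"
    by (intro weak_dH_add weak_dH_minus weak_dH_hat weak_dH_grad_ln f weak_dH_admissible FCb_admissible dH_FCb)
  moreover have "(\<lambda>x. dH h f x + (f x * inner (grad_ln x) h + - (f x * hat h x))) = delta h f"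
    by (simp add: fun_eq_iff delta_def \<beta>_def algebra_simps)
  moreover have "(\<lambda>x. dH k (dH h f) x + ((dH k f x * inner (grad_ln x) h + f x * inner (blinfun_apply (hess x) k) h)
      + - (dH k f x * hat h x + f x * inner h k)))
    = (\<lambda>x. delta h (dH k f) x + f x * (inner (blinfun_apply (hess x) k) h - inner h k))"
    by (simp add: fun_eq_iff delta_def \<beta>_def algebra_simps dH_commute[OF f, of h k])
  ultimately show ?thesis by simp
qed

lemma hess_sq_int: "sq_int \<nu> (\<lambda>x. inner (blinfun_apply (hess x) k) h)"
proof -
  obtain F where "\<And>m. F m \<in> FCb" "\<And>h. L2_lim \<nu> (\<lambda>m. dH h (F m)) (\<lambda>x. inner (grad_ln x) h)"
    "\<And>h k. L2_lim \<nu> (\<lambda>m. dH k (dH h (F m))) (\<lambda>x. inner (blinfun_apply (hess x) k) h)"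
    by (rule hess_L2_lim) blast
  then show ?thesis using L2_limD(2) by blast
qed

theorem second_order_integration_by_parts:
  assumes f: "f \<in> FCb" and g: "g \<in> FCb"
  shows "(\<integral>x. delta h f x * delta k g x \<partial>\<nu>) = (\<integral>x. dH k f x * dH h g x \<partial>\<nu>)
    + (\<integral>x. f x * g x * (inner h k - inner (blinfun_apply (hess x) k) h) \<partial>\<nu>)"
proof -
  interpret N: finite_measure \<nu> by (rule fin_nu)
  define q where "q x = inner (blinfun_apply (hess x) k) h - inner h k" for x
  have q: "sq_int \<nu> q" unfolding q_def by (intro sq_int_diff hess_sq_int) (simp add: sq_int_def)
  have i1: "integrable \<nu> (\<lambda>x. delta h (dH k f) x * g x)" by (intro sq_int_product delta_sq_int dH_FCb f FCb_sq_int g)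
  have i2: "integrable \<nu> (\<lambda>x. f x * q x * g x)" by (intro sq_int_product FCb_mult_sq_int f q FCb_sq_int g)
  have "(\<integral>x. (delta h (dH k f) x + f x * q x) * g x \<partial>\<nu>) = - (\<integral>x. delta h f x * delta k g x \<partial>\<nu>)"
    using weak_dH_delta[OF f, of k h] g unfolding q_def weak_dH_def by blast
  then have "(\<integral>x. delta h f x * delta k g x \<partial>\<nu>) = - (\<integral>x. delta h (dH k f) x * g x \<partial>\<nu>) - (\<integral>x. f x * q x * g x \<partial>\<nu>)"
    using i1 i2 by (simp add: distrib_right)
  \<comment> \<open>The second integration by parts: \<open>delta h\<close> is removed from
    \<open>dH k f\<close> and reappears as a derivative of \<open>g\<close>.\<close>
  moreover have "(\<integral>x. dH h g x * dH k f x \<partial>\<nu>) = - (\<integral>x. g x * delta h (dH k f) x \<partial>\<nu>)"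
    using weak_dH_admissible[OF FCb_admissible[OF g, of h]] dH_FCb[OF f, of k] unfolding weak_dH_def by blast
  moreover have "(\<integral>x. f x * g x * (inner h k - inner (blinfun_apply (hess x) k) h) \<partial>\<nu>) = - (\<integral>x. f x * q x * g x \<partial>\<nu>)"
    unfolding q_def by (subst Bochner_Integration.integral_minus[symmetric]) (simp add: algebra_simps)
  ultimately show ?thesis by (simp add: mult.commute)
qed

end

section \<open>The divergence estimate\<close>

lemma L2_lim_of_dominated_diff:
  assumes F: "\<And>n. sq_int M (F n)" "sq_int M f" and G: "L2_lim M G (\<lambda>_. 0)"
    and le: "\<And>n. AE x in M. \<bar>F n x - f x\<bar> \<le> \<bar>G n x\<bar>"
  shows "L2_lim M F f"
proof -
  have i: "(\<integral>x. (F n x - f x)\<^sup>2 \<partial>M) \<le> (\<integral>x. (G n x)\<^sup>2 \<partial>M)" for n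
  proof (rule integral_mono_AE)
    show "integrable M (\<lambda>x. (F n x - f x)\<^sup>2)" "integrable M (\<lambda>x. (G n x)\<^sup>2)"
      using sq_int_diff[OF F, of n] L2_limD(1)[OF G, of n] by (auto simp: sq_int_def)
    show "AE x in M. (F n x - f x)\<^sup>2 \<le> (G n x)\<^sup>2"
      using le[of n] by eventually_elim (simp add: abs_le_square_iff)
  qed
  have "(\<lambda>n. \<integral>x. (G n x)\<^sup>2 \<partial>M) \<longlonglongrightarrow> 0" using L2_limD(3)[OF G] by simp
  from tendsto_sandwich[OF always_eventually always_eventually tendsto_const this]
  have "(\<lambda>n. \<integral>x. (F n x - f x)\<^sup>2 \<partial>M) \<longlonglongrightarrow> 0" using i by simp
  then show ?thesis using F by (simp add: L2_lim_def)
qed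

lemma sq_int_of_AE_le:
  assumes [measurable]: "f \<in> borel_measurable M" and g: "sq_int M g" and le: "AE x in M. \<bar>f x\<bar> \<le> \<bar>g x\<bar>"
  shows "sq_int M f"
proof -
  have "integrable M (\<lambda>x. (f x)\<^sup>2)"
  proof (rule Bochner_Integration.integrable_bound)
    show "integrable M (\<lambda>x. (g x)\<^sup>2)" using g by (simp add: sq_int_def)
    show "AE x in M. norm ((f x)\<^sup>2) \<le> norm ((g x)\<^sup>2)"
      using le by eventually_elim (simp add: abs_le_square_iff)
  qed measurable
  then show ?thesis by (simp add: sq_int_def)
qed

lemma sq_int_norm:
  fixes f :: "'a \<Rightarrow> 'b::{banach,second_countable_topology}"
  shows "f \<in> Lp_space M 2 \<Longrightarrow> sq_int M (\<lambda>x. norm (f x))"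
  by (auto simp: Lp_space_def sq_int_def)

context orthonormal
begin

text \<open>Continuity of \<open>T\<close> sums the inner series and Parseval the outer one. The
  hypothesis for the coefficient sequence of \<open>v\<close> thereby becomes a bound on a quadratic
  form.\<close>

lemma quadratic_form_expansion:
  fixes T :: "'h \<Rightarrow>\<^sub>L 'h"
  shows "(\<Sum>i. \<Sum>j. ((if i = j then 1 else 0) - inner (blinfun_apply T (e j)) (e i)) * inner v (e i) * inner v (e j))
    = (norm v)\<^sup>2 - inner (blinfun_apply T v) v"
proof -
  have inner: "(\<lambda>j. ((if i = j then 1 else 0) - inner (blinfun_apply T (e j)) (e i)) * inner v (e i) * inner v (e j))
    sums (inner v (e i) * inner v (e i) - inner v (e i) * inner (blinfun_apply T v) (e i))" for i
  proof -
    have "(\<lambda>j. if j = i then inner v (e i) * inner v (e i) else 0) sums (inner v (e i) * inner v (e i))"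
      by (rule sums_single)
    moreover have "(\<lambda>N. inner (blinfun_apply T (proj N v)) (e i)) \<longlonglongrightarrow> inner (blinfun_apply T v) (e i)"
      by (intro tendsto_intros proj_tendsto)
    then have "(\<lambda>j. inner v (e j) * inner (blinfun_apply T (e j)) (e i)) sums inner (blinfun_apply T v) (e i)"
      by (simp add: sums_def proj_def blinfun.sum_right blinfun.scaleR_right inner_sum_left)
    then have "(\<lambda>j. inner v (e i) * (inner v (e j) * inner (blinfun_apply T (e j)) (e i))) sums (inner v (e i) * inner (blinfun_apply T v) (e i))"
      by (rule sums_mult)
    ultimately have "(\<lambda>j. (if j = i then inner v (e i) * inner v (e i) else 0) - inner v (e i) * (inner v (e j) * inner (blinfun_apply T (e j)) (e i)))
      sums (inner v (e i) * inner v (e i) - inner v (e i) * inner (blinfun_apply T v) (e i))"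
      by (rule sums_diff)
    moreover have "(if j = i then inner v (e i) * inner v (e i) else 0) - inner v (e i) * (inner v (e j) * inner (blinfun_apply T (e j)) (e i))
      = ((if i = j then 1 else 0) - inner (blinfun_apply T (e j)) (e i)) * inner v (e i) * inner v (e j)" for j
      by (auto simp: algebra_simps)
    ultimately show ?thesis by simp
  qed
  have "(\<lambda>i. inner v (e i) * inner v (e i) - inner v (e i) * inner (blinfun_apply T v) (e i)) sums (inner v v - inner v (blinfun_apply T v))"
    by (intro sums_diff parseval_inner)
  then show ?thesis using inner by (simp add: sums_iff power2_norm_eq_inner inner_commute)
qed

end

context cameron_martin_space
begin

lemma H_deriv_measurable:
  assumes "\<Phi> \<in> FCb_vec"
  shows "(\<lambda>x. inner (blinfun_apply (H_deriv \<iota> \<Phi> x) h) k) \<in> borel_measurable \<mu>"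
  using assms by (simp add: inner_H_deriv FCb_measurable dH_FCb FCb_vec_component)

text \<open>The finite rank formula for the Hilbert-Schmidt norm involves only gradients of
  cylindrical functions, which are bounded.\<close>

lemma H_deriv_hs_bounded:
  assumes "\<Phi> \<in> FCb_vec"
  shows "\<exists>B. \<forall>x. hs_norm e (H_deriv \<iota> \<Phi> x) \<le> B"
proof -
  obtain n f a where f: "\<forall>i<(n::nat). f i \<in> FCb" "\<Phi> = (\<lambda>x. \<Sum>i<n. f i x *\<^sub>R a i)"
    by (rule FCb_vecE[OF assms])
  have "\<forall>i\<in>{..<n}. \<exists>B. \<forall>x. norm (H_grad \<iota> (f i) x) \<le> B" using f(1) by (intro ballI FCb_vec_bounded H_grad_in_FCb_vec) simp
  from bchoice[OF this] obtain B where B: "\<And>i x. i < n \<Longrightarrow> norm (H_grad \<iota> (f i) x) \<le> B i" by auto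
  define C where "C = (\<Sum>i<n. \<Sum>j<n. (B i * B j) * (norm (a i) * norm (a j)))"
  have "hs_norm e (H_deriv \<iota> \<Phi> x) \<le> sqrt C" for x
  proof -
    have T: "blinfun_apply (H_deriv \<iota> \<Phi> x) k = (\<Sum>i<n. inner (H_grad \<iota> (f i) x) k *\<^sub>R a i)" for k
      using FCb_vec_H_deriv(2)[OF f(1)[rule_format] f(2)] by (simp add: dH_def)
    have "(\<Sum>m. (norm (blinfun_apply (H_deriv \<iota> \<Phi> x) (e m)))\<^sup>2) = (\<Sum>i<n. \<Sum>j<n. inner (H_grad \<iota> (f i) x) (H_grad \<iota> (f j) x) * inner (a i) (a j))"
      using finite_rank_sums[where T="H_deriv \<iota> \<Phi> x" and n=n and g="\<lambda>i. H_grad \<iota> (f i) x" and h=a] T by (simp add: sums_iff)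
    also have "\<dots> \<le> C" unfolding C_def
    proof (intro sum_mono)
      fix i j assume ij: "i \<in> {..<n}" "j \<in> {..<n}"
      have "\<bar>inner (H_grad \<iota> (f i) x) (H_grad \<iota> (f j) x)\<bar> \<le> B i * B j"
        using ij by (intro order_trans[OF Cauchy_Schwarz_ineq2] mult_mono B) (auto intro: order_trans[OF norm_ge_zero B])
      then have "\<bar>inner (H_grad \<iota> (f i) x) (H_grad \<iota> (f j) x)\<bar> * \<bar>inner (a i) (a j)\<bar> \<le> (B i * B j) * (norm (a i) * norm (a j))"
        by (intro mult_mono Cauchy_Schwarz_ineq2) (auto intro: order_trans[OF abs_ge_zero])
      then show "inner (H_grad \<iota> (f i) x) (H_grad \<iota> (f j) x) * inner (a i) (a j) \<le> (B i * B j) * (norm (a i) * norm (a j))"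
        by (simp add: abs_mult[symmetric] abs_le_iff)
    qed
    finally show ?thesis unfolding hs_norm_def by (rule real_sqrt_le_mono)
  qed
  then show ?thesis by blast
qed

end

locale log_concave_space = weighted_space +
  fixes C :: real
  assumes C: "C \<ge> 0" and hess_bound: "\<And>\<xi> :: nat \<Rightarrow> real. summable (\<lambda>i. (\<xi> i)\<^sup>2) \<Longrightarrow>
      AE x in \<mu>. (\<Sum>i. \<Sum>j. ((if i = j then 1 else 0)
          - inner (blinfun_apply (weak_hess \<iota> e \<mu> t (\<lambda>x. ln (w x)) x) (e j)) (e i)) * \<xi> i * \<xi> j)
        \<le> C * (\<Sum>i. (\<xi> i)\<^sup>2)"
begin

text \<open>The exceptional set of the hypothesis depends on the coefficient sequence. A countable
  dense set of vectors leaves one null set, outside of which continuity extends the bound: the set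
  of violating vectors is open and misses a dense set.\<close>

lemma hess_form_bound: "AE x in \<nu>. \<forall>v. (norm v)\<^sup>2 - inner (blinfun_apply (hess x) v) v \<le> C * (norm v)\<^sup>2"
proof -
  obtain D :: "'b set" where D: "countable D" "\<And>X. open X \<Longrightarrow> X \<noteq> {} \<Longrightarrow> \<exists>d\<in>D. d \<in> X"
    using countable_dense_exists by blast
  have "AE x in \<mu>. (norm v)\<^sup>2 - inner (blinfun_apply (hess x) v) v \<le> C * (norm v)\<^sup>2" for v
    using hess_bound[of "\<lambda>i. inner v (e i)"] parseval[of v]
    by (simp add: quadratic_form_expansion hess_def[symmetric] sums_iff)
  then have "AE x in \<mu>. \<forall>v\<in>D. (norm v)\<^sup>2 - inner (blinfun_apply (hess x) v) v \<le> C * (norm v)\<^sup>2"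
    using D(1) by (simp add: AE_ball_countable)
  then have "AE x in \<mu>. \<forall>v. (norm v)\<^sup>2 - inner (blinfun_apply (hess x) v) v \<le> C * (norm v)\<^sup>2"
  proof eventually_elim
    case (elim x)
    define X where "X = {v. C * (norm v)\<^sup>2 < (norm v)\<^sup>2 - inner (blinfun_apply (hess x) v) v}"
    have "open X" unfolding X_def by (intro open_Collect_less continuous_intros)
    then have "X = {}" using D(2)[of X] elim by (force simp: X_def)
    then show ?case by (auto simp: X_def not_less[symmetric])
  qed
  then show ?thesis by (simp add: AE_nu)
qed

text \<open>A relational form with square-integrable divergence and no choice involved, suited to
  limits and differences before the chosen \<open>divergence\<close> is identified with it.\<close>

definition is_div :: "('a \<Rightarrow> 'b) \<Rightarrow> ('a \<Rightarrow> real) \<Rightarrow> bool" where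
  "is_div \<Phi> g \<longleftrightarrow> sq_int \<nu> g \<and> (\<forall>f\<in>FCb. (\<integral>x. inner (H_grad \<iota> f x) (\<Phi> x) \<partial>\<nu>) = - (\<integral>x. f x * g x \<partial>\<nu>))"

text \<open>Plane waves are cylindrical, so agreement on \<open>FCb\<close> forces the Fourier
  transform of the difference to vanish.\<close>

lemma L1_unique:
  assumes g: "integrable \<nu> g" "integrable \<nu> g'"
    and eq: "\<And>f. f \<in> FCb \<Longrightarrow> (\<integral>x. f x * g x \<partial>\<nu>) = (\<integral>x. f x * g' x \<partial>\<nu>)"
  shows "AE x in \<nu>. g x = g' x"
proof -
  have "AE x in \<nu>. g x - g' x = 0"
  proof (rule AE_zero_of_trig[OF fin_nu])
    show "sets \<nu> = sets borel" by (simp add: sets_mu)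
    show "integrable \<nu> (\<lambda>x. g x - g' x)" using g by simp
    fix l b
    have [measurable]: "blinfun_apply (l :: 'a \<Rightarrow>\<^sub>L real) \<in> borel_measurable \<nu>" by (simp add: measurable_nu_iff)
    have i: "integrable \<nu> (\<lambda>x. cos (blinfun_apply l x + b) * u x)" if "integrable \<nu> u" for u
    proof (rule integrable_of_norm_le[where g="\<lambda>x. \<bar>u x\<bar>"])
      have [measurable]: "u \<in> borel_measurable \<nu>" using that by blast
      show "(\<lambda>x. cos (blinfun_apply l x + b) * u x) \<in> borel_measurable \<nu>" by measurable
      show "norm (cos (blinfun_apply l x + b) * u x) \<le> \<bar>u x\<bar>" for x
        by (simp add: abs_mult mult_left_le_one_le)
    qed (use that in simp)
    show "(\<integral>x. (g x - g' x) * cos (blinfun_apply l x + b) \<partial>\<nu>) = 0"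
      using eq[OF FCb_cos[of l b]] i[OF g(1)] i[OF g(2)]
      by (simp add: left_diff_distrib mult.commute)
  qed
  then show ?thesis by eventually_elim simp
qed

lemma is_div_unique: "is_div \<Phi> g \<Longrightarrow> is_div \<Phi> g' \<Longrightarrow> AE x in \<nu>. g x = g' x"
  by (rule L1_unique) (auto simp: is_div_def intro: sq_int_integrable[OF fin_nu])

lemma FCb_vec_norm_sq_int: "\<Phi> \<in> FCb_vec \<Longrightarrow> sq_int \<nu> (\<lambda>x. norm (\<Phi> x :: 'b))"
proof -
  assume \<Phi>: "\<Phi> \<in> FCb_vec"
  obtain B where "\<forall>x. norm (\<Phi> x) \<le> B" using FCb_vec_bounded[OF \<Phi>] by blast
  then show ?thesis using FCb_vec_measurable[OF \<Phi>]
    by (intro sq_int_bounded[OF fin_nu, where B=B]) (auto simp: measurable_nu_iff)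
qed

lemma FCb_vec_hs_sq_int: "\<Phi> \<in> FCb_vec \<Longrightarrow> sq_int \<nu> (\<lambda>x. hs_norm e (H_deriv \<iota> \<Phi> x))"
proof -
  assume \<Phi>: "\<Phi> \<in> FCb_vec"
  obtain B where B: "\<forall>x. hs_norm e (H_deriv \<iota> \<Phi> x) \<le> B" using H_deriv_hs_bounded[OF \<Phi>] by blast
  have "(\<lambda>x. hs_norm e (H_deriv \<iota> \<Phi> x)) \<in> borel_measurable \<mu>"
    by (rule hs_norm_measurable) (rule H_deriv_measurable[OF \<Phi>])
  then show ?thesis
    using B hs_norm_nonneg[OF FCb_vec_hilbert_schmidt[OF \<Phi>]]
    by (intro sq_int_bounded[OF fin_nu, where B=B]) (auto simp: measurable_nu_iff)
qed

text \<open>The constant is the larger of the two prices: 1 for the trace term, bounded pointwise by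
  the Hilbert-Schmidt norm, and \<open>C\<close> for the Hessian term, bounded almost everywhere by
  the form bound.\<close>

theorem divergence_estimate:
  assumes \<Phi>: "\<Phi> \<in> FCb_vec"
  obtains g where "is_div \<Phi> g"
    "(\<integral>x. (g x)\<^sup>2 \<partial>\<nu>) \<le> max C 1 * ((\<integral>x. (norm (\<Phi> x))\<^sup>2 \<partial>\<nu>) + (\<integral>x. (hs_norm e (H_deriv \<iota> \<Phi> x))\<^sup>2 \<partial>\<nu>))"
proof -
  obtain n f a where f: "\<forall>i<(n::nat). f i \<in> FCb" and \<Phi>_eq: "\<Phi> = (\<lambda>x. \<Sum>i<n. f i x *\<^sub>R a i)"
    by (rule FCb_vecE[OF \<Phi>])
  have fi: "f i \<in> FCb" if "i < n" for i using f that by simp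
  define g where "g x = (\<Sum>i<n. delta (a i) (f i) x)" for x
  have g: "sq_int \<nu> g" unfolding g_def by (intro sq_int_sum delta_sq_int fi) simp
  have div: "is_div \<Phi> g"
    unfolding is_div_def
  proof (intro conjI ballI g)
    fix \<psi> :: "'a \<Rightarrow> real" assume \<psi>: "\<psi> \<in> FCb"
    have "(\<integral>x. inner (H_grad \<iota> \<psi> x) (\<Phi> x) \<partial>\<nu>) = (\<integral>x. (\<Sum>i<n. dH (a i) \<psi> x * f i x) \<partial>\<nu>)"
      by (simp add: \<Phi>_eq inner_sum_right dH_def mult.commute)
    also have "\<dots> = (\<Sum>i<n. \<integral>x. dH (a i) \<psi> x * f i x \<partial>\<nu>)"
      by (rule Bochner_Integration.integral_sum) (auto intro!: sq_int_product FCb_sq_int dH_FCb \<psi> fi)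
    also have "\<dots> = (\<Sum>i<n. - (\<integral>x. \<psi> x * delta (a i) (f i) x \<partial>\<nu>))"
      using weak_dH_admissible[OF FCb_admissible[OF \<psi>]] fi by (intro sum.cong) (auto simp: weak_dH_def)
    also have "\<dots> = - (\<integral>x. (\<Sum>i<n. \<psi> x * delta (a i) (f i) x) \<partial>\<nu>)"
      by (subst Bochner_Integration.integral_sum) (auto intro!: sq_int_product FCb_sq_int delta_sq_int \<psi> fi simp: sum_negf)
    finally show "(\<integral>x. inner (H_grad \<iota> \<psi> x) (\<Phi> x) \<partial>\<nu>) = - (\<integral>x. \<psi> x * g x \<partial>\<nu>)"
      by (simp add: g_def sum_distrib_left)
  qed
  \<comment> \<open>Summed over i and j, \<open>p\<close> is the trace of the squared derivative of
    the field, and \<open>q\<close> is the quadratic form of the identity minus the Hessian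
    evaluated at the field.\<close>
  define p where "p i j x = inner (H_grad \<iota> (f i) x) (a j) * inner (H_grad \<iota> (f j) x) (a i)" for i j x
  define q where "q i j x = f i x * f j x * (inner (a i) (a j) - inner (blinfun_apply (hess x) (a j)) (a i))" for i j x
  interpret N: finite_measure \<nu> by (rule fin_nu)
  have ip: "integrable \<nu> (p i j)" if "i < n" "j < n" for i j
    unfolding p_def dH_def[symmetric] using that by (intro sq_int_product FCb_sq_int dH_FCb fi)
  have iq: "integrable \<nu> (q i j)" if "i < n" "j < n" for i j
  proof -
    have "sq_int \<nu> (\<lambda>x. inner (a i) (a j) - inner (blinfun_apply (hess x) (a j)) (a i))"
      by (intro sq_int_diff hess_sq_int) (simp add: sq_int_def)
    then show ?thesis unfolding q_def mult.assoc
      by (rule sq_int_product[OF FCb_sq_int[OF fi[OF that(1)]] FCb_mult_sq_int[OF fi[OF that(2)]]])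
  qed
  have "(\<integral>x. (g x)\<^sup>2 \<partial>\<nu>) = (\<integral>x. (\<Sum>i<n. \<Sum>j<n. delta (a i) (f i) x * delta (a j) (f j) x) \<partial>\<nu>)"
    by (simp add: g_def power2_eq_square sum_product)
  also have "\<dots> = (\<Sum>i<n. \<Sum>j<n. \<integral>x. delta (a i) (f i) x * delta (a j) (f j) x \<partial>\<nu>)"
    by (subst Bochner_Integration.integral_sum; (intro sum.cong refl)?; (subst Bochner_Integration.integral_sum)?)
      (auto intro!: Bochner_Integration.integrable_sum sq_int_product delta_sq_int fi)
  also have "\<dots> = (\<Sum>i<n. \<Sum>j<n. (\<integral>x. p i j x \<partial>\<nu>) + (\<integral>x. q i j x \<partial>\<nu>))"
    by (intro sum.cong refl) (simp add: second_order_integration_by_parts[OF fi fi] p_def q_def dH_def)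
  also have "\<dots> = (\<integral>x. (\<Sum>i<n. \<Sum>j<n. p i j x) \<partial>\<nu>) + (\<integral>x. (\<Sum>i<n. \<Sum>j<n. q i j x) \<partial>\<nu>)"
  proof -
    have dbl: "(\<integral>x. (\<Sum>i<n. \<Sum>j<n. u i j x) \<partial>\<nu>) = (\<Sum>i<n. \<Sum>j<n. \<integral>x. u i j x \<partial>\<nu>)"
      if u: "\<And>i j. i < n \<Longrightarrow> j < n \<Longrightarrow> integrable \<nu> (u i j)" for u :: "nat \<Rightarrow> nat \<Rightarrow> 'a \<Rightarrow> real"
    proof -
      have "(\<integral>x. (\<Sum>i<n. \<Sum>j<n. u i j x) \<partial>\<nu>) = (\<Sum>i<n. \<integral>x. (\<Sum>j<n. u i j x) \<partial>\<nu>)"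
        by (rule Bochner_Integration.integral_sum) (auto intro!: Bochner_Integration.integrable_sum u)
      also have "\<dots> = (\<Sum>i<n. \<Sum>j<n. \<integral>x. u i j x \<partial>\<nu>)"
        by (intro sum.cong refl Bochner_Integration.integral_sum) (auto intro: u)
      finally show ?thesis .
    qed
    show ?thesis using dbl[of p, OF ip] dbl[of q, OF iq] by (simp add: sum.distrib)
  qed
  also have "\<dots> \<le> (\<integral>x. (hs_norm e (H_deriv \<iota> \<Phi> x))\<^sup>2 \<partial>\<nu>) + (\<integral>x. C * (norm (\<Phi> x))\<^sup>2 \<partial>\<nu>)"
  proof (rule add_mono)
    show "(\<integral>x. (\<Sum>i<n. \<Sum>j<n. p i j x) \<partial>\<nu>) \<le> (\<integral>x. (hs_norm e (H_deriv \<iota> \<Phi> x))\<^sup>2 \<partial>\<nu>)"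
    proof (rule integral_mono)
      show "integrable \<nu> (\<lambda>x. \<Sum>i<n. \<Sum>j<n. p i j x)"
        by (intro Bochner_Integration.integrable_sum ip) auto
      show "integrable \<nu> (\<lambda>x. (hs_norm e (H_deriv \<iota> \<Phi> x))\<^sup>2)" using FCb_vec_hs_sq_int[OF \<Phi>] by (simp add: sq_int_def)
      show "(\<Sum>i<n. \<Sum>j<n. p i j x) \<le> (hs_norm e (H_deriv \<iota> \<Phi> x))\<^sup>2" for x
        unfolding p_def
        by (rule finite_rank_trace_le) (use FCb_vec_H_deriv(2)[OF fi \<Phi>_eq] in \<open>simp add: dH_def\<close>)
    qed
    show "(\<integral>x. (\<Sum>i<n. \<Sum>j<n. q i j x) \<partial>\<nu>) \<le> (\<integral>x. C * (norm (\<Phi> x))\<^sup>2 \<partial>\<nu>)"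
    proof (rule integral_mono_AE)
      show "integrable \<nu> (\<lambda>x. \<Sum>i<n. \<Sum>j<n. q i j x)"
        by (intro Bochner_Integration.integrable_sum iq) auto
      show "integrable \<nu> (\<lambda>x. C * (norm (\<Phi> x))\<^sup>2)" using FCb_vec_norm_sq_int[OF \<Phi>] by (simp add: sq_int_def)
      show "AE x in \<nu>. (\<Sum>i<n. \<Sum>j<n. q i j x) \<le> C * (norm (\<Phi> x))\<^sup>2"
        using hess_form_bound
      proof eventually_elim
        case (elim x)
        have "(norm (\<Phi> x))\<^sup>2 = (\<Sum>i<n. \<Sum>j<n. f i x * f j x * inner (a i) (a j))"
          by (simp only: power2_norm_eq_inner \<Phi>_eq inner_sum_left) (simp add: inner_sum_right sum_distrib_left ac_simps)
        moreover have "inner (blinfun_apply (hess x) (\<Phi> x)) (\<Phi> x) = (\<Sum>i<n. \<Sum>j<n. f i x * f j x * inner (blinfun_apply (hess x) (a j)) (a i))"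
          by (simp only: \<Phi>_eq blinfun.sum_right inner_sum_right) (simp add: blinfun.scaleR_right inner_sum_left sum_distrib_left ac_simps)
        ultimately have "(\<Sum>i<n. \<Sum>j<n. q i j x) = (norm (\<Phi> x))\<^sup>2 - inner (blinfun_apply (hess x) (\<Phi> x)) (\<Phi> x)"
          by (simp add: q_def right_diff_distrib sum_subtractf)
        then show ?case using elim by simp
      qed
    qed
  qed
  also have "\<dots> = (\<integral>x. (hs_norm e (H_deriv \<iota> \<Phi> x))\<^sup>2 \<partial>\<nu>) + C * (\<integral>x. (norm (\<Phi> x))\<^sup>2 \<partial>\<nu>)" by simp
  also have "\<dots> \<le> max C 1 * (\<integral>x. (hs_norm e (H_deriv \<iota> \<Phi> x))\<^sup>2 \<partial>\<nu>) + max C 1 * (\<integral>x. (norm (\<Phi> x))\<^sup>2 \<partial>\<nu>)"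
  proof (rule add_mono)
    have "1 * (\<integral>x. (hs_norm e (H_deriv \<iota> \<Phi> x))\<^sup>2 \<partial>\<nu>) \<le> max C 1 * (\<integral>x. (hs_norm e (H_deriv \<iota> \<Phi> x))\<^sup>2 \<partial>\<nu>)"
      by (rule mult_right_mono) auto
    then show "(\<integral>x. (hs_norm e (H_deriv \<iota> \<Phi> x))\<^sup>2 \<partial>\<nu>) \<le> max C 1 * (\<integral>x. (hs_norm e (H_deriv \<iota> \<Phi> x))\<^sup>2 \<partial>\<nu>)" by simp
    show "C * (\<integral>x. (norm (\<Phi> x))\<^sup>2 \<partial>\<nu>) \<le> max C 1 * (\<integral>x. (norm (\<Phi> x))\<^sup>2 \<partial>\<nu>)"
      by (rule mult_right_mono) auto
  qed
  finally have "(\<integral>x. (g x)\<^sup>2 \<partial>\<nu>) \<le> max C 1 * ((\<integral>x. (norm (\<Phi> x))\<^sup>2 \<partial>\<nu>) + (\<integral>x. (hs_norm e (H_deriv \<iota> \<Phi> x))\<^sup>2 \<partial>\<nu>))"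
    by (simp add: distrib_left add.commute)
  then show ?thesis using that div by blast
qed

lemma H_grad_inner_sq_int:
  assumes \<psi>: "\<psi> \<in> FCb" and [measurable]: "\<Phi> \<in> borel_measurable \<nu>" and \<Phi>: "sq_int \<nu> (\<lambda>x. norm (\<Phi> x))"
  shows "sq_int \<nu> (\<lambda>x. inner (H_grad \<iota> \<psi> x) (\<Phi> x))"
proof -
  obtain B where B: "\<forall>x. norm (H_grad \<iota> \<psi> x) \<le> B" using FCb_vec_bounded[OF H_grad_in_FCb_vec[OF \<psi>]] by blast
  have [measurable]: "H_grad \<iota> \<psi> \<in> borel_measurable \<nu>"
    by (intro measurable_nu FCb_vec_measurable H_grad_in_FCb_vec \<psi>)
  show ?thesis
  proof (rule sq_int_of_AE_le[OF _ sq_int_cmult[OF \<Phi>, of B]], measurable, intro AE_I2)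
    fix x
    have "\<bar>inner (H_grad \<iota> \<psi> x) (\<Phi> x)\<bar> \<le> B * norm (\<Phi> x)"
      using B by (intro order_trans[OF Cauchy_Schwarz_ineq2] mult_right_mono) auto
    then show "\<bar>inner (H_grad \<iota> \<psi> x) (\<Phi> x)\<bar> \<le> \<bar>B * norm (\<Phi> x)\<bar>" by linarith
  qed
qed

lemma is_div_diff:
  assumes "is_div \<Phi> g" "is_div \<Psi> h"
    and \<Phi>: "\<Phi> \<in> borel_measurable \<nu>" "sq_int \<nu> (\<lambda>x. norm (\<Phi> x))"
    and \<Psi>: "\<Psi> \<in> borel_measurable \<nu>" "sq_int \<nu> (\<lambda>x. norm (\<Psi> x))"
  shows "is_div (\<lambda>x. \<Phi> x - \<Psi> x) (\<lambda>x. g x - h x)"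
  unfolding is_div_def
proof (intro conjI ballI sq_int_diff)
  fix \<psi> :: "'a \<Rightarrow> real" assume \<psi>: "\<psi> \<in> FCb"
  note i = sq_int_integrable[OF fin_nu H_grad_inner_sq_int[OF \<psi> \<Phi>]] sq_int_integrable[OF fin_nu H_grad_inner_sq_int[OF \<psi> \<Psi>]]
  have "integrable \<nu> (\<lambda>x. \<psi> x * g x)" "integrable \<nu> (\<lambda>x. \<psi> x * h x)"
    using assms(1,2) by (auto simp: is_div_def intro!: sq_int_product FCb_sq_int \<psi>)
  then show "(\<integral>x. inner (H_grad \<iota> \<psi> x) (\<Phi> x - \<Psi> x) \<partial>\<nu>) = - (\<integral>x. \<psi> x * (g x - h x) \<partial>\<nu>)"
    using i assms(1,2) \<psi> by (simp add: inner_diff_right right_diff_distrib is_div_def)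
qed (use assms in \<open>auto simp: is_div_def\<close>)

lemma divergence_estimate_unique:
  assumes \<Phi>: "\<Phi> \<in> FCb_vec" and g: "is_div \<Phi> g"
  shows "(\<integral>x. (g x)\<^sup>2 \<partial>\<nu>) \<le> max C 1 * ((\<integral>x. (norm (\<Phi> x))\<^sup>2 \<partial>\<nu>) + (\<integral>x. (hs_norm e (H_deriv \<iota> \<Phi> x))\<^sup>2 \<partial>\<nu>))"
proof -
  obtain h where h: "is_div \<Phi> h"
    "(\<integral>x. (h x)\<^sup>2 \<partial>\<nu>) \<le> max C 1 * ((\<integral>x. (norm (\<Phi> x))\<^sup>2 \<partial>\<nu>) + (\<integral>x. (hs_norm e (H_deriv \<iota> \<Phi> x))\<^sup>2 \<partial>\<nu>))"
    by (rule divergence_estimate[OF \<Phi>])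
  have [measurable]: "g \<in> borel_measurable \<nu>" "h \<in> borel_measurable \<nu>"
    using g h(1) by (auto simp: is_div_def sq_int_def)
  have "(\<integral>x. (g x)\<^sup>2 \<partial>\<nu>) = (\<integral>x. (h x)\<^sup>2 \<partial>\<nu>)"
    using is_div_unique[OF g h(1)] by (intro integral_cong_AE) (auto elim: eventually_mono)
  then show ?thesis using h(2) by simp
qed

text \<open>Cylindrical approximants have divergences, and the estimate applied to differences of
  approximants makes these a Cauchy sequence in L^2. The limit inherits the divergence identity, and
  the bound follows from convergence of the norms.\<close>

theorem weak_deriv_divergence:
  assumes W: "has_weak_deriv \<iota> e \<nu> 2 \<Phi> S"
  obtains g where "is_div \<Phi> g"
    "(\<integral>x. (g x)\<^sup>2 \<partial>\<nu>) \<le> max C 1 * ((\<integral>x. (norm (\<Phi> x))\<^sup>2 \<partial>\<nu>) + (\<integral>x. (hs_norm e (S x))\<^sup>2 \<partial>\<nu>))"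
proof -
  obtain F where \<Phi>: "\<Phi> \<in> Lp_space \<nu> 2" and S: "S \<in> Lp_HS e \<nu> 2" and F: "\<And>k. F k \<in> FCb_vec"
    "Lp_tendsto \<nu> 2 F \<Phi>" "Lp_HS_tendsto e \<nu> 2 (\<lambda>k. H_deriv \<iota> (F k)) S"
    using W by (auto simp: has_weak_deriv_def)
  note \<Phi>s = sq_int_norm[OF \<Phi>]
  have \<Phi>m: "\<Phi> \<in> borel_measurable \<nu>" by (rule Lp_space_measurable[OF \<Phi>])
  have Fm: "F k \<in> borel_measurable \<nu>" for k by (intro measurable_nu FCb_vec_measurable F)
  note [measurable] = \<Phi>m Fm
  note Fs = FCb_vec_norm_sq_int[OF F(1)] FCb_vec_hs_sq_int[OF F(1)]
  have Sm: "\<And>h k. (\<lambda>x. inner (blinfun_apply (S x) h) k) \<in> borel_measurable \<nu>" and hs: "AE x in \<nu>. hilbert_schmidt e (S x)"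
    and Si: "integrable \<nu> (\<lambda>x. hs_norm e (S x) powr 2)" using S by (auto simp: Lp_HS_def)
  have hSm: "(\<lambda>x. hs_norm e (S x)) \<in> borel_measurable \<nu>" by (rule hs_norm_measurable[OF Sm])
  have "integrable \<nu> (\<lambda>x. (hs_norm e (S x))\<^sup>2)"
  proof (rule Bochner_Integration.integrable_bound[OF Si])
    show "(\<lambda>x. (hs_norm e (S x))\<^sup>2) \<in> borel_measurable \<nu>" using hSm by measurable
    show "AE x in \<nu>. norm ((hs_norm e (S x))\<^sup>2) \<le> norm (hs_norm e (S x) powr 2)"
      using hs by eventually_elim (simp add: hs_norm_nonneg)
  qed
  then have Ss: "sq_int \<nu> (\<lambda>x. hs_norm e (S x))" using hSm by (simp add: sq_int_def)
  define a where "a k x = norm (F k x - \<Phi> x)" for k x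
  define b where "b k x = hs_norm e (H_deriv \<iota> (F k) x - S x)" for k x
  have as: "sq_int \<nu> (a k)" for k
    unfolding a_def
    by (rule sq_int_of_AE_le[OF _ sq_int_add[OF Fs(1)[of k] \<Phi>s]]) (auto intro!: AE_I2 norm_triangle_ineq4)
  have bm: "b k \<in> borel_measurable \<nu>" for k
    unfolding b_def
  proof (rule hs_norm_measurable)
    fix h l
    have "(\<lambda>x. inner (blinfun_apply (H_deriv \<iota> (F k) x) h) l) \<in> borel_measurable \<nu>"
      by (intro measurable_nu H_deriv_measurable F)
    then show "(\<lambda>x. inner (blinfun_apply (H_deriv \<iota> (F k) x - S x) h) l) \<in> borel_measurable \<nu>"
      using Sm by (simp add: blinfun.diff_left inner_diff_left)
  qed
  have bs: "sq_int \<nu> (b k)" for k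
  proof (rule sq_int_of_AE_le[OF bm sq_int_add[OF Fs(2)[of k] Ss]])
    show "AE x in \<nu>. \<bar>b k x\<bar> \<le> \<bar>hs_norm e (H_deriv \<iota> (F k) x) + hs_norm e (S x)\<bar>"
      using hs
    proof eventually_elim
      case (elim x)
      note T = FCb_vec_hilbert_schmidt[OF F(1), of k x]
      have neg: "hilbert_schmidt e (- S x)" "hs_norm e (- S x) = hs_norm e (S x)"
        using elim by (auto simp: hilbert_schmidt_def hs_norm_def blinfun.minus_left)
      have "hs_norm e (H_deriv \<iota> (F k) x - S x) \<le> hs_norm e (- S x) + hs_norm e (H_deriv \<iota> (F k) x)"
        using hs_norm_triangle[OF hilbert_schmidt_diff[OF T elim] neg(1)] by simp
      then show ?case using hs_norm_nonneg[OF hilbert_schmidt_diff[OF T elim]] neg(2) by (simp add: b_def)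
    qed
  qed
  have zero: "sq_int \<nu> (\<lambda>_. 0)" by (rule sq_int_zero)
  have al: "L2_lim \<nu> a (\<lambda>_. 0)"
    using F(2) by (intro L2_lim_of_nn_integral[OF as zero]) (simp add: Lp_tendsto_def a_def)
  have bl: "L2_lim \<nu> b (\<lambda>_. 0)"
    using F(3) by (intro L2_lim_of_nn_integral[OF bs zero]) (simp add: Lp_HS_tendsto_def Lp_tendsto_def b_def)
  have nl: "L2_lim \<nu> (\<lambda>k x. norm (F k x)) (\<lambda>x. norm (\<Phi> x))"
    by (rule L2_lim_of_dominated_diff[OF Fs(1) \<Phi>s al]) (simp add: a_def norm_triangle_ineq3)
  have hl: "L2_lim \<nu> (\<lambda>k x. hs_norm e (H_deriv \<iota> (F k) x)) (\<lambda>x. hs_norm e (S x))"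
  proof (rule L2_lim_of_dominated_diff[OF Fs(2) Ss bl])
    show "AE x in \<nu>. \<bar>hs_norm e (H_deriv \<iota> (F k) x) - hs_norm e (S x)\<bar> \<le> \<bar>b k x\<bar>" for k
      using hs by eventually_elim
        (auto simp: b_def intro: order_trans[OF abs_hs_norm_diff_le[OF FCb_vec_hilbert_schmidt[OF F(1)]]])
  qed
  have "\<exists>g. is_div (F k) g" for k by (rule divergence_estimate[OF F(1)[of k]]) blast
  then obtain G where G: "\<And>k. is_div (F k) (G k)" by metis
  have Gs: "sq_int \<nu> (G k)" for k using G by (simp add: is_div_def)
  define A where "A k = (\<integral>x. (a k x)\<^sup>2 \<partial>\<nu>) + (\<integral>x. (b k x)\<^sup>2 \<partial>\<nu>)" for k
  have "(\<lambda>k. (\<integral>x. (a k x)\<^sup>2 \<partial>\<nu>) + (\<integral>x. (b k x)\<^sup>2 \<partial>\<nu>)) \<longlonglongrightarrow> (\<integral>x. 0\<^sup>2 \<partial>\<nu>) + (\<integral>x. 0\<^sup>2 \<partial>\<nu>)"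
    by (intro tendsto_add L2_lim_norm al bl)
  then have A: "A \<longlonglongrightarrow> 0" by (simp add: A_def[abs_def])
  have sq: "u\<^sup>2 \<le> 2 * v\<^sup>2 + 2 * z\<^sup>2" if "\<bar>u\<bar> \<le> \<bar>v\<bar> + \<bar>z\<bar>" for u v z :: real
  proof -
    have "\<bar>u\<bar>\<^sup>2 \<le> (\<bar>v\<bar> + \<bar>z\<bar>)\<^sup>2" using that by (intro power_mono) auto
    then show ?thesis using sum_squares_bound[of "\<bar>v\<bar>" "\<bar>z\<bar>"] by (simp add: power2_sum)
  qed
  \<comment> \<open>Each difference is compared through the limits \<open>\<Phi>\<close> and
    \<open>S\<close>; the factors 2 come from squaring a sum of two terms.\<close>
  have GG: "(\<integral>x. (G k x - G l x)\<^sup>2 \<partial>\<nu>) \<le> max C 1 * (2 * A k + 2 * A l)" for k l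
  proof -
    have sa: "integrable \<nu> (\<lambda>x. 2 * (a k x)\<^sup>2 + 2 * (a l x)\<^sup>2)" "integrable \<nu> (\<lambda>x. 2 * (b k x)\<^sup>2 + 2 * (b l x)\<^sup>2)"
      using as bs by (auto simp: sq_int_def)
    note FF = FCb_vec_diff[OF F(1) F(1), of k l]
    have "(\<integral>x. (G k x - G l x)\<^sup>2 \<partial>\<nu>) \<le> max C 1 * ((\<integral>x. (norm (F k x - F l x))\<^sup>2 \<partial>\<nu>)
      + (\<integral>x. (hs_norm e (H_deriv \<iota> (\<lambda>x. F k x - F l x) x))\<^sup>2 \<partial>\<nu>))"
      by (rule divergence_estimate_unique[OF FF(1) is_div_diff[OF G G Fm Fs(1) Fm Fs(1)]])
    also have "\<dots> \<le> max C 1 * ((\<integral>x. 2 * (a k x)\<^sup>2 + 2 * (a l x)\<^sup>2 \<partial>\<nu>) + (\<integral>x. 2 * (b k x)\<^sup>2 + 2 * (b l x)\<^sup>2 \<partial>\<nu>))"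
    proof (rule mult_left_mono[OF add_mono])
      show "(\<integral>x. (norm (F k x - F l x))\<^sup>2 \<partial>\<nu>) \<le> (\<integral>x. 2 * (a k x)\<^sup>2 + 2 * (a l x)\<^sup>2 \<partial>\<nu>)"
      proof (rule integral_mono[OF _ sa(1)])
        show "integrable \<nu> (\<lambda>x. (norm (F k x - F l x))\<^sup>2)" using FCb_vec_norm_sq_int[OF FF(1)] by (simp add: sq_int_def)
        show "(norm (F k x - F l x))\<^sup>2 \<le> 2 * (a k x)\<^sup>2 + 2 * (a l x)\<^sup>2" for x
          using norm_triangle_ineq4[of "F k x - \<Phi> x" "F l x - \<Phi> x"] by (intro sq) (simp add: a_def)
      qed
      show "(\<integral>x. (hs_norm e (H_deriv \<iota> (\<lambda>x. F k x - F l x) x))\<^sup>2 \<partial>\<nu>) \<le> (\<integral>x. 2 * (b k x)\<^sup>2 + 2 * (b l x)\<^sup>2 \<partial>\<nu>)"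
      proof (rule integral_mono_AE[OF _ sa(2)])
        show "integrable \<nu> (\<lambda>x. (hs_norm e (H_deriv \<iota> (\<lambda>x. F k x - F l x) x))\<^sup>2)"
          using FCb_vec_hs_sq_int[OF FF(1)] by (simp add: sq_int_def)
        show "AE x in \<nu>. (hs_norm e (H_deriv \<iota> (\<lambda>x. F k x - F l x) x))\<^sup>2 \<le> 2 * (b k x)\<^sup>2 + 2 * (b l x)\<^sup>2"
          using hs
        proof eventually_elim
          case (elim x)
          note T = FCb_vec_hilbert_schmidt[OF F(1), of _ x]
          have "hs_norm e (H_deriv \<iota> (F k) x - H_deriv \<iota> (F l) x) \<le> hs_norm e (S x - H_deriv \<iota> (F l) x) + hs_norm e (H_deriv \<iota> (F k) x - S x)"
            using hs_norm_triangle[OF hilbert_schmidt_diff[OF T T] hilbert_schmidt_diff[OF elim T], of k l l] by simp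
          then show ?case
            using hs_norm_nonneg[OF hilbert_schmidt_diff[OF T T], of k l] hs_norm_diff_commute[of "S x" "H_deriv \<iota> (F l) x"]
            unfolding FF(2) b_def by (intro sq) linarith
        qed
      qed
    qed auto
    also have "\<dots> = max C 1 * (2 * A k + 2 * A l)"
      using as bs by (simp add: A_def sq_int_def)
    finally show ?thesis .
  qed
  have "\<exists>N. \<forall>m\<ge>N. \<forall>n\<ge>N. (\<integral>x. (G m x - G n x)\<^sup>2 \<partial>\<nu>) < \<epsilon>" if \<epsilon>: "\<epsilon> > 0" for \<epsilon>
  proof -
    have M: "max C 1 > 0" by simp
    have "\<forall>\<^sub>F k in sequentially. A k < \<epsilon> / (4 * max C 1)" using \<epsilon> M by (intro order_tendstoD(2)[OF A]) simp
    then obtain N where N: "\<And>k. k \<ge> N \<Longrightarrow> A k < \<epsilon> / (4 * max C 1)" by (auto simp: eventually_sequentially)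
    have "(\<integral>x. (G m x - G n x)\<^sup>2 \<partial>\<nu>) < \<epsilon>" if "m \<ge> N" "n \<ge> N" for m n
    proof -
      \<comment> \<open>The divisor 4 chosen for \<open>A\<close> is the total of the two
        coefficients 2.\<close>
      have "max C 1 * (2 * A m + 2 * A n) < max C 1 * (\<epsilon> / max C 1)"
        using N[OF that(1)] N[OF that(2)] M by (intro mult_strict_left_mono) auto
      also have "\<dots> = \<epsilon>" using M by simp
      finally show ?thesis using GG[of m n] by linarith
    qed
    then show ?thesis by blast
  qed
  then obtain g where g: "L2_lim \<nu> G g" using L2_complete[of \<nu> G] Gs by blast
  have "is_div \<Phi> g"
    unfolding is_div_def
  proof (intro conjI ballI L2_limD(2)[OF g])
    fix \<psi> :: "'a \<Rightarrow> real" assume \<psi>: "\<psi> \<in> FCb"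
    obtain B where B: "\<forall>x. norm (H_grad \<iota> \<psi> x) \<le> B" using FCb_vec_bounded[OF H_grad_in_FCb_vec[OF \<psi>]] by blast
    have l: "L2_lim \<nu> (\<lambda>k x. inner (H_grad \<iota> \<psi> x) (F k x)) (\<lambda>x. inner (H_grad \<iota> \<psi> x) (\<Phi> x))"
    proof (rule L2_lim_of_dominated_diff[OF H_grad_inner_sq_int[OF \<psi> Fm Fs(1)] H_grad_inner_sq_int[OF \<psi> \<Phi>m \<Phi>s]])
      show "L2_lim \<nu> (\<lambda>k x. B * a k x) (\<lambda>_. 0)" using L2_lim_cmult[OF al, of B] by simp
      have "\<bar>inner (H_grad \<iota> \<psi> x) (F k x - \<Phi> x)\<bar> \<le> B * norm (F k x - \<Phi> x)" for k x
        using B by (intro order_trans[OF Cauchy_Schwarz_ineq2] mult_right_mono) auto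
      then show "AE x in \<nu>. \<bar>inner (H_grad \<iota> \<psi> x) (F k x) - inner (H_grad \<iota> \<psi> x) (\<Phi> x)\<bar> \<le> \<bar>B * a k x\<bar>" for k
        by (intro AE_I2) (auto simp: a_def inner_diff_right intro: order_trans[OF _ abs_ge_self])
    qed
    interpret N: finite_measure \<nu> by (rule fin_nu)
    have "(\<lambda>k. \<integral>x. inner (H_grad \<iota> \<psi> x) (F k x) * 1 \<partial>\<nu>) \<longlonglongrightarrow> (\<integral>x. inner (H_grad \<iota> \<psi> x) (\<Phi> x) * 1 \<partial>\<nu>)"
      by (rule L2_lim_integral_product[OF l]) (simp add: sq_int_def)
    moreover have "(\<lambda>k. - (\<integral>x. G k x * \<psi> x \<partial>\<nu>)) \<longlonglongrightarrow> - (\<integral>x. g x * \<psi> x \<partial>\<nu>)"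
      by (intro tendsto_minus L2_lim_integral_product[OF g FCb_sq_int[OF \<psi>]])
    ultimately show "(\<integral>x. inner (H_grad \<iota> \<psi> x) (\<Phi> x) \<partial>\<nu>) = - (\<integral>x. \<psi> x * g x \<partial>\<nu>)"
      using G \<psi> LIMSEQ_unique by (fastforce simp: is_div_def mult.commute)
  qed
  moreover have "(\<integral>x. (g x)\<^sup>2 \<partial>\<nu>) \<le> max C 1 * ((\<integral>x. (norm (\<Phi> x))\<^sup>2 \<partial>\<nu>) + (\<integral>x. (hs_norm e (S x))\<^sup>2 \<partial>\<nu>))"
  proof (rule LIMSEQ_le[OF L2_lim_norm[OF g]])
    show "(\<lambda>k. max C 1 * ((\<integral>x. (norm (F k x))\<^sup>2 \<partial>\<nu>) + (\<integral>x. (hs_norm e (H_deriv \<iota> (F k) x))\<^sup>2 \<partial>\<nu>))) \<longlonglongrightarrow>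
      max C 1 * ((\<integral>x. (norm (\<Phi> x))\<^sup>2 \<partial>\<nu>) + (\<integral>x. (hs_norm e (S x))\<^sup>2 \<partial>\<nu>))"
      by (intro tendsto_mult_left tendsto_add L2_lim_norm nl hl)
    show "\<exists>N. \<forall>k\<ge>N. (\<integral>x. (G k x)\<^sup>2 \<partial>\<nu>) \<le> max C 1 * ((\<integral>x. (norm (F k x))\<^sup>2 \<partial>\<nu>) + (\<integral>x. (hs_norm e (H_deriv \<iota> (F k) x))\<^sup>2 \<partial>\<nu>))"
      using divergence_estimate_unique[OF F(1) G] by blast
  qed
  ultimately show ?thesis by (rule that)
qed

end

section \<open>Components and truncations of vector fields\<close>

context orthonormal
begin

text \<open>Orthogonality makes the partial sums Cauchy, so square-summable coefficients define a
  vector. This is how the gradient of a component is assembled.\<close>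

lemma square_summable_series:
  fixes c :: "nat \<Rightarrow> real"
  assumes c: "summable (\<lambda>m. (c m)\<^sup>2)"
  shows "inner (\<Sum>m. c m *\<^sub>R e m) (e j) = c j"
    and "(norm (\<Sum>m. c m *\<^sub>R e m))\<^sup>2 = (\<Sum>m. (c m)\<^sup>2)"
proof -
  have sq: "(norm (\<Sum>i\<in>I. c i *\<^sub>R e i))\<^sup>2 = (\<Sum>i\<in>I. (c i)\<^sup>2)" if "finite I" for I
    unfolding power2_norm_eq_inner inner_sum_left inner_sum_right
    using that by (intro sum.cong refl) (simp add: inner_basis if_distrib power2_eq_square cong: if_cong)
  have "summable (\<lambda>m. c m *\<^sub>R e m)"
    unfolding summable_Cauchy
  proof (intro allI impI)
    fix r :: real assume r: "r > 0"
    then obtain N where N: "\<And>m n. m \<ge> N \<Longrightarrow> norm (\<Sum>i=m..<n. (c i)\<^sup>2) < r\<^sup>2"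
      using c unfolding summable_Cauchy by (meson zero_less_power)
    have "norm (\<Sum>i=m..<n. c i *\<^sub>R e i) < r" if "m \<ge> N" for m n
    proof -
      have "(norm (\<Sum>i=m..<n. c i *\<^sub>R e i))\<^sup>2 < r\<^sup>2" using N[OF that, of n] sq[of "{m..<n}"] by simp
      then show ?thesis using r by (simp add: power_less_imp_less_base)
    qed
    then show "\<exists>N. \<forall>m\<ge>N. \<forall>n. norm (\<Sum>i=m..<n. c i *\<^sub>R e i) < r" by blast
  qed
  then have s: "(\<lambda>m. c m *\<^sub>R e m) sums (\<Sum>m. c m *\<^sub>R e m)" by (rule summable_sums)
  show coeff: "inner (\<Sum>m. c m *\<^sub>R e m) (e j) = c j" for j
  proof -
    have "(\<lambda>m. inner (c m *\<^sub>R e m) (e j)) sums inner (\<Sum>m. c m *\<^sub>R e m) (e j)"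
      by (rule bounded_linear.sums[OF bounded_linear_inner_left s])
    moreover have "(\<lambda>m. inner (c m *\<^sub>R e m) (e j)) = (\<lambda>m. if m = j then c m else 0)"
      by (auto simp: inner_basis)
    moreover have "(\<lambda>m. if m = j then c m else 0) sums c j" by (rule sums_single)
    ultimately show ?thesis by (simp add: sums_iff)
  qed
  show "(norm (\<Sum>m. c m *\<^sub>R e m))\<^sup>2 = (\<Sum>m. (c m)\<^sup>2)"
    using parseval[of "\<Sum>m. c m *\<^sub>R e m"] by (simp add: coeff sums_iff)
qed

lemma proj_bounded_linear: "bounded_linear (proj N)"
  unfolding proj_def
  by (intro bounded_linear_sum bounded_linear_scaleR_const bounded_linear_inner_left)

definition projL :: "nat \<Rightarrow> 'h \<Rightarrow>\<^sub>L 'h" where "projL N = Blinfun (proj N)"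

lemma projL_apply [simp]: "blinfun_apply (projL N) v = proj N v"
  by (simp add: projL_def bounded_linear_Blinfun_apply[OF proj_bounded_linear])

lemma contraction_hilbert_schmidt:
  fixes Q T :: "'h \<Rightarrow>\<^sub>L 'h"
  assumes T: "hilbert_schmidt e T" and Q: "\<And>v. norm (blinfun_apply Q v) \<le> norm v"
  shows "hilbert_schmidt e (Q o\<^sub>L T)" "hs_norm e (Q o\<^sub>L T) \<le> hs_norm e T"
proof -
  have le: "(norm (blinfun_apply (Q o\<^sub>L T) (e n)))\<^sup>2 \<le> (norm (blinfun_apply T (e n)))\<^sup>2" for n
    by (intro power_mono) (auto simp: Q)
  show 1: "hilbert_schmidt e (Q o\<^sub>L T)"
    unfolding hilbert_schmidt_def
    by (rule summable_comparison_test'[OF T[unfolded hilbert_schmidt_def]]) (use le in auto)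
  show "hs_norm e (Q o\<^sub>L T) \<le> hs_norm e T"
    unfolding hs_norm_def using T 1 le
    by (intro real_sqrt_le_mono suminf_le) (auto simp: hilbert_schmidt_def)
qed

text \<open>Dominated convergence for series: every term tends to 0 because the projections converge
  strongly, and the summable terms of \<open>T\<close> dominate uniformly in
  \<open>N\<close>.\<close>

lemma hs_norm_tail_tendsto:
  fixes T :: "'h \<Rightarrow>\<^sub>L 'h"
  assumes T: "hilbert_schmidt e T"
  shows "(\<lambda>N. (hs_norm e ((id_blinfun - projL N) o\<^sub>L T))\<^sup>2) \<longlonglongrightarrow> 0"
proof -
  have Q: "norm (blinfun_apply (id_blinfun - projL N) v) \<le> norm v" for N v
    by (simp add: blinfun.diff_left norm_diff_proj_le)
  have lim: "(\<lambda>N. (norm (blinfun_apply ((id_blinfun - projL N) o\<^sub>L T) (e m)))\<^sup>2) \<longlonglongrightarrow> 0" for m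
  proof -
    have "(\<lambda>N. (norm (blinfun_apply T (e m) - proj N (blinfun_apply T (e m))))\<^sup>2) \<longlonglongrightarrow>
      (norm (blinfun_apply T (e m) - blinfun_apply T (e m)))\<^sup>2"
      by (intro tendsto_intros proj_tendsto)
    then show ?thesis by (simp add: blinfun.diff_left)
  qed
  have "(\<lambda>N. \<Sum>m. (norm (blinfun_apply ((id_blinfun - projL N) o\<^sub>L T) (e m)))\<^sup>2) \<longlonglongrightarrow> (\<Sum>m. 0)"
  proof (rule tannerys_theorem[THEN conjunct2, THEN conjunct2])
    show "\<forall>\<^sub>F (m, N) in sequentially \<times>\<^sub>F sequentially.
      norm ((norm (blinfun_apply ((id_blinfun - projL N) o\<^sub>L T) (e m)))\<^sup>2) \<le> (norm (blinfun_apply T (e m)))\<^sup>2"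
    proof (intro always_eventually allI, clarify)
      fix m N
      show "norm ((norm (blinfun_apply ((id_blinfun - projL N) o\<^sub>L T) (e m)))\<^sup>2) \<le> (norm (blinfun_apply T (e m)))\<^sup>2"
        using power_mono[OF Q[of N "blinfun_apply T (e m)"], of 2] by simp
    qed
    show "summable (\<lambda>m. (norm (blinfun_apply T (e m)))\<^sup>2)" using T by (simp add: hilbert_schmidt_def)
  qed (use lim in auto)
  then show ?thesis by (simp add: hs_norm_power2[OF contraction_hilbert_schmidt(1)[OF T Q]])
qed

end

section \<open>Contractions and components of Sobolev fields\<close>

context log_concave_space
begin

lemma weak_derivD:
  assumes "has_weak_deriv \<iota> e \<nu> 2 \<Phi> S"
  shows "\<Phi> \<in> borel_measurable \<nu>" "sq_int \<nu> (\<lambda>x. norm (\<Phi> x))"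
    "(\<lambda>x. inner (blinfun_apply (S x) h) k) \<in> borel_measurable \<nu>"
    "AE x in \<nu>. hilbert_schmidt e (S x)" "sq_int \<nu> (\<lambda>x. hs_norm e (S x))"
proof -
  have \<Phi>: "\<Phi> \<in> Lp_space \<nu> 2" and S: "S \<in> Lp_HS e \<nu> 2" using assms by (auto simp: has_weak_deriv_def)
  show "\<Phi> \<in> borel_measurable \<nu>" "sq_int \<nu> (\<lambda>x. norm (\<Phi> x))"
    using Lp_space_measurable[OF \<Phi>] sq_int_norm[OF \<Phi>] by auto
  show Sm: "(\<lambda>x. inner (blinfun_apply (S x) h) k) \<in> borel_measurable \<nu>"
    and hs: "AE x in \<nu>. hilbert_schmidt e (S x)" for h k using S by (auto simp: Lp_HS_def)
  have hSm: "(\<lambda>x. hs_norm e (S x)) \<in> borel_measurable \<nu>" by (rule hs_norm_measurable[OF Sm])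
  have "integrable \<nu> (\<lambda>x. (hs_norm e (S x))\<^sup>2)"
  proof (rule Bochner_Integration.integrable_bound)
    show "integrable \<nu> (\<lambda>x. hs_norm e (S x) powr 2)" using S by (auto simp: Lp_HS_def)
    show "(\<lambda>x. (hs_norm e (S x))\<^sup>2) \<in> borel_measurable \<nu>" using hSm by measurable
    show "AE x in \<nu>. norm ((hs_norm e (S x))\<^sup>2) \<le> norm (hs_norm e (S x) powr 2)"
      using hs by eventually_elim (simp add: hs_norm_nonneg)
  qed
  then show "sq_int \<nu> (\<lambda>x. hs_norm e (S x))" using hSm by (simp add: sq_int_def)
qed

lemma deriv_diff_measurable:
  assumes "F \<in> FCb_vec" and "\<And>h k. (\<lambda>x. inner (blinfun_apply (S x) h) k) \<in> borel_measurable \<nu>"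
  shows "(\<lambda>x. hs_norm e (H_deriv \<iota> F x - S x)) \<in> borel_measurable \<nu>"
proof (rule hs_norm_measurable)
  fix h l
  have "(\<lambda>x. inner (blinfun_apply (H_deriv \<iota> F x) h) l) \<in> borel_measurable \<nu>"
    by (intro measurable_nu H_deriv_measurable assms)
  then show "(\<lambda>x. inner (blinfun_apply (H_deriv \<iota> F x - S x) h) l) \<in> borel_measurable \<nu>"
    using assms(2) by (simp add: blinfun.diff_left inner_diff_left)
qed

text \<open>A constant contraction preserves cylindrical fields, commutes with differentiation and
  decreases both norms, so it carries approximating sequences along. It is used for the projections
  and for their complements.\<close>

lemma weak_deriv_contraction:
  fixes Q :: "'b \<Rightarrow>\<^sub>L 'b"
  assumes W: "has_weak_deriv \<iota> e \<nu> 2 \<Phi> S" and Q: "\<And>v. norm (blinfun_apply Q v) \<le> norm v"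
  shows "has_weak_deriv \<iota> e \<nu> 2 (\<lambda>x. blinfun_apply Q (\<Phi> x)) (\<lambda>x. Q o\<^sub>L S x)"
proof -
  obtain F where \<Phi>: "\<Phi> \<in> Lp_space \<nu> 2" and S: "S \<in> Lp_HS e \<nu> 2" and F: "\<And>k. F k \<in> FCb_vec"
    "Lp_tendsto \<nu> 2 F \<Phi>" "Lp_HS_tendsto e \<nu> 2 (\<lambda>k. H_deriv \<iota> (F k)) S"
    using W by (auto simp: has_weak_deriv_def)
  note D = weak_derivD[OF W]
  have Qm: "blinfun_apply Q \<in> borel_measurable borel"
    by (intro borel_measurable_continuous_onI continuous_intros)
  have Fm: "F k \<in> borel_measurable \<nu>" for k by (intro measurable_nu FCb_vec_measurable F)
  note [measurable] = Qm D(1) Fm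
  have "(\<lambda>x. blinfun_apply (S x) h) \<in> borel_measurable \<nu>" for h by (rule measurable_of_inner) (rule D(3))
  note [measurable] = this
  have QSm: "(\<lambda>x. inner (blinfun_apply (Q o\<^sub>L S x) h) k) \<in> borel_measurable \<nu>" for h k
  proof -
    have "(\<lambda>x. blinfun_apply Q (blinfun_apply (S x) h)) \<in> borel_measurable \<nu>" by measurable
    then show ?thesis by simp
  qed
  show ?thesis
    unfolding has_weak_deriv_def
  proof (intro conjI exI allI)
    show "(\<lambda>x. blinfun_apply Q (\<Phi> x)) \<in> Lp_space \<nu> 2"
    proof -
      have "sq_int \<nu> (\<lambda>x. norm (blinfun_apply Q (\<Phi> x)))"
        by (rule sq_int_of_AE_le[OF _ D(2)]) (auto simp: Q)
      then show ?thesis by (simp add: Lp_space_def sq_int_def)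
    qed
    show "(\<lambda>x. Q o\<^sub>L S x) \<in> Lp_HS e \<nu> 2"
      unfolding Lp_HS_def
    proof (intro CollectI conjI allI QSm)
      show "AE x in \<nu>. hilbert_schmidt e (Q o\<^sub>L S x)"
        using D(4) by eventually_elim (rule contraction_hilbert_schmidt(1)[OF _ Q])
      show "integrable \<nu> (\<lambda>x. hs_norm e (Q o\<^sub>L S x) powr 2)"
      proof (rule Bochner_Integration.integrable_bound)
        show "integrable \<nu> (\<lambda>x. hs_norm e (S x) powr 2)" using S by (auto simp: Lp_HS_def)
        show "(\<lambda>x. hs_norm e (Q o\<^sub>L S x) powr 2) \<in> borel_measurable \<nu>"
          using hs_norm_measurable[OF QSm] by measurable
        show "AE x in \<nu>. norm (hs_norm e (Q o\<^sub>L S x) powr 2) \<le> norm (hs_norm e (S x) powr 2)"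
          using D(4) by eventually_elim
            (auto intro!: powr_mono2 contraction_hilbert_schmidt(2)[OF _ Q] hs_norm_nonneg contraction_hilbert_schmidt(1)[OF _ Q])
      qed
    qed
    show "(\<lambda>x. blinfun_apply Q (F k x)) \<in> FCb_vec" for k by (rule FCb_vec_blinfun(1)[OF F(1)])
    show "Lp_tendsto \<nu> 2 (\<lambda>k x. blinfun_apply Q (F k x)) (\<lambda>x. blinfun_apply Q (\<Phi> x))"
    proof (rule Lp_tendsto_mono[OF F(2), where c=1])
      show "AE x in \<nu>. norm (blinfun_apply Q (F n x) - blinfun_apply Q (\<Phi> x)) \<le> 1 * norm (F n x - \<Phi> x)" for n
        using Q by (simp add: blinfun.diff_right[symmetric])
    qed auto
    show "Lp_HS_tendsto e \<nu> 2 (\<lambda>k. H_deriv \<iota> (\<lambda>x. blinfun_apply Q (F k x))) (\<lambda>x. Q o\<^sub>L S x)"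
      unfolding Lp_HS_tendsto_def
    proof (rule Lp_tendsto_mono[OF F(3)[unfolded Lp_HS_tendsto_def], where c=1])
      show "(\<lambda>x. norm (hs_norm e (H_deriv \<iota> (F n) x - S x) - 0)) \<in> borel_measurable \<nu>" for n
        using deriv_diff_measurable[OF F(1) D(3), of n] by measurable
      show "AE x in \<nu>. norm (hs_norm e (H_deriv \<iota> (\<lambda>x. blinfun_apply Q (F n x)) x - (Q o\<^sub>L S x)) - 0)
        \<le> 1 * norm (hs_norm e (H_deriv \<iota> (F n) x - S x) - 0)" for n
        using D(4)
      proof eventually_elim
        case (elim x)
        note d = hilbert_schmidt_diff[OF FCb_vec_hilbert_schmidt[OF F(1)] elim, of n]
        have "H_deriv \<iota> (\<lambda>x. blinfun_apply Q (F n x)) x - (Q o\<^sub>L S x) = Q o\<^sub>L (H_deriv \<iota> (F n) x - S x)"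
          unfolding FCb_vec_blinfun(2)[OF F(1)] by (rule blinfun_eqI) (simp add: blinfun.diff_left blinfun.diff_right)
        then show ?case
          using contraction_hilbert_schmidt[OF d Q] hs_norm_nonneg[OF d] hs_norm_nonneg[OF contraction_hilbert_schmidt(1)[OF d Q]] by simp
      qed
    qed auto
  qed
qed

lemma component_weak_grad:
  assumes W: "has_weak_deriv \<iota> e \<nu> 2 \<Phi> S"
  shows "\<exists>G. has_weak_grad \<iota> \<nu> 2 (\<lambda>x. inner (\<Phi> x) (e n)) G"
proof -
  obtain F where \<Phi>: "\<Phi> \<in> Lp_space \<nu> 2" and F: "\<And>k. F k \<in> FCb_vec"
    "Lp_tendsto \<nu> 2 F \<Phi>" "Lp_HS_tendsto e \<nu> 2 (\<lambda>k. H_deriv \<iota> (F k)) S"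
    using W by (auto simp: has_weak_deriv_def)
  note D = weak_derivD[OF W]
  have Fm: "F k \<in> borel_measurable \<nu>" for k by (intro measurable_nu FCb_vec_measurable F)
  note [measurable] = D(1,3) Fm
  define c where "c x m = inner (blinfun_apply (S x) (e m)) (e n)" for x m
  \<comment> \<open>The adjoint of \<open>S x\<close> applied to \<open>e n\<close>, written through
    its coefficients; it is the gradient of the n-th component, and its norm is at most the
    Hilbert-Schmidt norm of \<open>S x\<close>.\<close>
  define G where "G x = (\<Sum>m. c x m *\<^sub>R e m)" for x
  have cle: "(inner (blinfun_apply T (e m)) (e n))\<^sup>2 \<le> (norm (blinfun_apply T (e m)))\<^sup>2" for T m
  proof -
    have "norm (e n) = 1" using inner_basis[of n n] by (simp add: norm_eq_sqrt_inner)
    then have "\<bar>inner (blinfun_apply T (e m)) (e n)\<bar> \<le> \<bar>norm (blinfun_apply T (e m))\<bar>"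
      using Cauchy_Schwarz_ineq2[of "blinfun_apply T (e m)" "e n"] by simp
    then show ?thesis by (simp only: abs_le_square_iff)
  qed
  have sm: "summable (\<lambda>m. (inner (blinfun_apply T (e m)) (e n))\<^sup>2)" if "hilbert_schmidt e T" for T
    using that[unfolded hilbert_schmidt_def]
  proof (rule summable_comparison_test'[where N=0])
    show "norm ((inner (blinfun_apply T (e m)) (e n))\<^sup>2) \<le> (norm (blinfun_apply T (e m)))\<^sup>2" for m
      using cle[of T m] by (simp only: real_norm_def abs_of_nonneg zero_le_power2)
  qed
  have sle: "(\<Sum>m. (inner (blinfun_apply T (e m)) (e n))\<^sup>2) \<le> (hs_norm e T)\<^sup>2" if "hilbert_schmidt e T" for T
    unfolding hs_norm_power2[OF that] by (rule suminf_le[OF cle sm[OF that] that[unfolded hilbert_schmidt_def]])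
  have Gm [measurable]: "G \<in> borel_measurable \<nu>" unfolding G_def c_def by measurable
  have Gle: "AE x in \<nu>. \<bar>norm (G x)\<bar> \<le> \<bar>hs_norm e (S x)\<bar>"
    using D(4)
  proof eventually_elim
    case (elim x)
    have "(norm (G x))\<^sup>2 \<le> (hs_norm e (S x))\<^sup>2"
      unfolding G_def using square_summable_series(2)[of "c x"] sm[OF elim] sle[OF elim] by (simp add: c_def)
    then show ?case by (simp only: abs_le_square_iff)
  qed
  have "sq_int \<nu> (\<lambda>x. norm (G x))"
    by (rule sq_int_of_AE_le[OF measurable_compose[OF Gm borel_measurable_norm] D(5) Gle])
  then have GL: "G \<in> Lp_space \<nu> 2" using Gm by (simp add: Lp_space_def sq_int_def)
  have "has_weak_grad \<iota> \<nu> 2 (\<lambda>x. inner (\<Phi> x) (e n)) G"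
    unfolding has_weak_grad_def
  proof (intro conjI exI allI GL)
    show "(\<lambda>x. inner (\<Phi> x) (e n)) \<in> Lp_space \<nu> 2" by (intro Lp_space_inner \<Phi>) simp
    show "(\<lambda>x. inner (F k x) (e n)) \<in> FCb" for k by (intro FCb_vec_component F)
    show "Lp_tendsto \<nu> 2 (\<lambda>k x. inner (F k x) (e n)) (\<lambda>x. inner (\<Phi> x) (e n))"
      by (intro Lp_tendsto_inner F) auto
    show "Lp_tendsto \<nu> 2 (\<lambda>k. H_grad \<iota> (\<lambda>x. inner (F k x) (e n))) G"
    proof (rule Lp_tendsto_mono[OF F(3)[unfolded Lp_HS_tendsto_def], where c=1])
      show "(\<lambda>x. norm (hs_norm e (H_deriv \<iota> (F k) x - S x) - 0)) \<in> borel_measurable \<nu>" for k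
        using deriv_diff_measurable[OF F(1) D(3), of k] by measurable
      show "AE x in \<nu>. norm (H_grad \<iota> (\<lambda>x. inner (F k x) (e n)) x - G x) \<le> 1 * norm (hs_norm e (H_deriv \<iota> (F k) x - S x) - 0)" for k
        using D(4)
      proof eventually_elim
        case (elim x)
        have T: "hilbert_schmidt e (H_deriv \<iota> (F k) x - S x)"
          by (rule hilbert_schmidt_diff[OF FCb_vec_hilbert_schmidt[OF F(1)] elim])
        define d where "d = H_grad \<iota> (\<lambda>x. inner (F k x) (e n)) x - G x"
        have "inner d (e m) = inner (blinfun_apply (H_deriv \<iota> (F k) x - S x) (e m)) (e n)" for m
          using square_summable_series(1)[of "c x" m] sm[OF elim]
          by (simp add: d_def inner_diff_left blinfun.diff_left inner_H_deriv[OF F(1)] dH_def G_def c_def)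
        then have "(norm d)\<^sup>2 \<le> (hs_norm e (H_deriv \<iota> (F k) x - S x))\<^sup>2"
          using parseval[of d] sle[OF T] by (simp add: sums_iff)
        then show ?case unfolding d_def by (simp add: abs_le_square_iff[symmetric])
      qed
    qed auto
  qed
  then show ?thesis by blast
qed

section \<open>Identification of the chosen divergence and of its series\<close>

lemma is_div_has_divergence:
  assumes "\<Phi> \<in> borel_measurable \<nu>" "sq_int \<nu> (\<lambda>x. norm (\<Phi> x))" "is_div \<Phi> g"
  shows "has_divergence \<iota> \<nu> \<Phi> g"
proof -
  have g: "sq_int \<nu> g" using assms(3) by (simp add: is_div_def)
  have "\<Phi> \<in> Lp_space \<nu> 1" "g \<in> Lp_space \<nu> 1"
    using assms(1) g sq_int_integrable[OF fin_nu assms(2)] sq_int_integrable[OF fin_nu g]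
    by (simp_all add: Lp_space_def sq_int_def)
  then show ?thesis using assms(3) by (simp add: has_divergence_def is_div_def)
qed

text \<open>The choice behind \<open>divergence\<close> guarantees only an integrable function.
  Uniqueness in L^1 identifies it with \<open>g\<close>, from which it inherits square
  integrability.\<close>

lemma divergence_is_div:
  assumes "\<Phi> \<in> borel_measurable \<nu>" "sq_int \<nu> (\<lambda>x. norm (\<Phi> x))" "is_div \<Phi> g"
  shows "is_div \<Phi> (divergence \<iota> \<nu> \<Phi>)" "AE x in \<nu>. divergence \<iota> \<nu> \<Phi> x = g x"
proof -
  define d where "d = divergence \<iota> \<nu> \<Phi>"
  note g = is_div_has_divergence[OF assms]
  have d: "has_divergence \<iota> \<nu> \<Phi> d"
    unfolding d_def divergence_def by (rule someI[of "has_divergence \<iota> \<nu> \<Phi>", OF g])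
  have dm: "d \<in> borel_measurable \<nu>" and di: "integrable \<nu> d" "integrable \<nu> g"
    using d g by (auto simp: has_divergence_def Lp_space_def integrable_abs_iff)
  show eq: "AE x in \<nu>. divergence \<iota> \<nu> \<Phi> x = g x"
    unfolding d_def[symmetric] by (rule L1_unique[OF di]) (use d g in \<open>simp add: has_divergence_def\<close>)
  have "sq_int \<nu> d"
    using assms(3) eq by (intro sq_int_of_AE_le[OF dm]) (auto simp: is_div_def d_def elim: eventually_mono)
  then show "is_div \<Phi> (divergence \<iota> \<nu> \<Phi>)"
    using d unfolding d_def[symmetric] is_div_def by (simp add: has_divergence_def)
qed

text \<open>The identity holds for cylindrical approximants of \<open>f\<close> and passes to the
  limit because both pairings are between L^2 quantities.\<close>

lemma is_div_W1:
  assumes \<Phi>: "\<Phi> \<in> borel_measurable \<nu>" "sq_int \<nu> (\<lambda>x. norm (\<Phi> x))" and g: "is_div \<Phi> g"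
    and f: "has_weak_grad \<iota> \<nu> 2 f G"
  shows "(\<integral>x. inner (G x) (\<Phi> x) \<partial>\<nu>) = - (\<integral>x. f x * g x \<partial>\<nu>)"
proof -
  obtain F where fm: "f \<in> Lp_space \<nu> 2" "G \<in> Lp_space \<nu> 2" and F: "\<And>k. F k \<in> FCb" "Lp_tendsto \<nu> 2 F f"
    "Lp_tendsto \<nu> 2 (\<lambda>k. H_grad \<iota> (F k)) G"
    using f by (auto simp: has_weak_grad_def)
  have Hm: "H_grad \<iota> (F k) \<in> borel_measurable \<nu>" for k
    by (intro measurable_nu FCb_vec_measurable H_grad_in_FCb_vec F)
  note [measurable] = \<Phi>(1) Lp_space_measurable[OF fm(2)] Hm
  have fl: "L2_lim \<nu> F f" by (rule Lp_tendsto_imp_L2_lim[OF FCb_sq_int[OF F(1)] _ F(2)]) (use fm in \<open>simp add: sq_int_Lp_space\<close>)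
  have i1: "integrable \<nu> (\<lambda>x. inner (H_grad \<iota> (F k) x) (\<Phi> x))" for k
    by (rule sq_int_integrable[OF fin_nu H_grad_inner_sq_int[OF F(1) \<Phi>]])
  have i2: "integrable \<nu> (\<lambda>x. inner (G x) (\<Phi> x))"
  proof (rule integrable_of_norm_le)
    show "integrable \<nu> (\<lambda>x. norm (G x) * norm (\<Phi> x))" by (rule sq_int_product[OF sq_int_norm[OF fm(2)] \<Phi>(2)])
    show "norm (inner (G x) (\<Phi> x)) \<le> norm (G x) * norm (\<Phi> x)" for x using Cauchy_Schwarz_ineq2 by simp
  qed measurable
  have "(\<lambda>k. \<integral>\<^sup>+x. ennreal (norm (inner (H_grad \<iota> (F k) x) (\<Phi> x) - inner (G x) (\<Phi> x))) \<partial>\<nu>) \<longlonglongrightarrow> 0"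
  proof (rule nn_integral_tendsto_0_of_domination[where a="\<lambda>k x. (norm (H_grad \<iota> (F k) x - G x))\<^sup>2" and h="\<lambda>x. (norm (\<Phi> x))\<^sup>2"])
    show "integrable \<nu> (\<lambda>x. (norm (\<Phi> x))\<^sup>2)" using \<Phi>(2) by (simp add: sq_int_def)
    show "(\<lambda>k. \<integral>\<^sup>+x. ennreal ((norm (H_grad \<iota> (F k) x - G x))\<^sup>2) \<partial>\<nu>) \<longlonglongrightarrow> 0"
      using F(3) by (simp add: Lp_tendsto_def)
    fix \<delta> :: real assume \<delta>: "\<delta> > 0"
    have "norm (inner (H_grad \<iota> (F k) x) (\<Phi> x) - inner (G x) (\<Phi> x)) \<le> \<delta> * (norm (\<Phi> x))\<^sup>2 + 1 / \<delta> * (norm (H_grad \<iota> (F k) x - G x))\<^sup>2" for k x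
    proof -
      define u v where "u = norm (H_grad \<iota> (F k) x - G x)" and "v = norm (\<Phi> x)"
      have "norm (inner (H_grad \<iota> (F k) x) (\<Phi> x) - inner (G x) (\<Phi> x)) \<le> u * v"
        unfolding u_def v_def using Cauchy_Schwarz_ineq2[of "H_grad \<iota> (F k) x - G x" "\<Phi> x"] by (simp add: inner_diff_left)
      \<comment> \<open>The balanced split puts the small factor on the fixed field and the large
        one on the gradients' difference, which tends to 0 in L^2.\<close>
      also have "u * v = (u / sqrt \<delta>) * (sqrt \<delta> * v)" using \<delta> by simp
      also have "\<dots> \<le> (u / sqrt \<delta>)\<^sup>2 + (sqrt \<delta> * v)\<^sup>2" using abs_mult_le_squares by (rule order_trans[OF abs_ge_self])
      also have "\<dots> = \<delta> * v\<^sup>2 + 1 / \<delta> * u\<^sup>2" using \<delta> by (simp add: power_divide power_mult_distrib)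
      finally show ?thesis by (simp add: u_def v_def)
    qed
    then show "\<exists>c\<ge>0. \<forall>k. AE x in \<nu>. norm (inner (H_grad \<iota> (F k) x) (\<Phi> x) - inner (G x) (\<Phi> x)) \<le> \<delta> * (norm (\<Phi> x))\<^sup>2 + c * (norm (H_grad \<iota> (F k) x - G x))\<^sup>2"
      using \<delta> by (intro exI[of _ "1 / \<delta>"]) auto
  qed auto
  then have "(\<lambda>k. \<integral>x. inner (H_grad \<iota> (F k) x) (\<Phi> x) \<partial>\<nu>) \<longlonglongrightarrow> (\<integral>x. inner (G x) (\<Phi> x) \<partial>\<nu>)"
    using i1 i2 by (intro tendsto_L1_int)
  moreover have "(\<lambda>k. - (\<integral>x. F k x * g x \<partial>\<nu>)) \<longlonglongrightarrow> - (\<integral>x. f x * g x \<partial>\<nu>)"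
    using g by (intro tendsto_minus L2_lim_integral_product fl) (simp add: is_div_def)
  moreover have "(\<integral>x. inner (H_grad \<iota> (F k) x) (\<Phi> x) \<partial>\<nu>) = - (\<integral>x. F k x * g x \<partial>\<nu>)" for k
    using g F(1) by (simp add: is_div_def)
  ultimately show ?thesis using LIMSEQ_unique by simp
qed

text \<open>The projected field has finitely many components, each a W^(1,2) function to which the
  weighted formula applies; testing against \<open>FCb\<close> identifies the divergence with the
  partial sum. The auxiliary \<open>grad_ln\<close> is finally exchanged for the chosen weak
  gradient outside a countable union of null sets.\<close>

lemma projection_divergence:
  assumes W: "has_weak_deriv \<iota> e \<nu> 2 \<Phi> S" and D: "is_div (\<lambda>x. proj N (\<Phi> x)) D"
  shows "AE x in \<nu>. D x = (\<Sum>n<N. inner (weak_grad \<iota> \<nu> 2 (\<lambda>x. inner (\<Phi> x) (e n)) x) (e n)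
            + inner (\<Phi> x) (e n) * inner (weak_grad \<iota> \<mu> t (\<lambda>x. ln (w x)) x) (e n)
            - inner (\<Phi> x) (e n) * cm_hat \<mu> (\<iota> (e n)) x)"
proof -
  define \<phi> where "\<phi> n x = inner (\<Phi> x) (e n)" for n x
  define G where "G n = weak_grad \<iota> \<nu> 2 (\<phi> n)" for n
  have G: "has_weak_grad \<iota> \<nu> 2 (\<phi> n) (G n)" for n
    unfolding G_def weak_grad_def \<phi>_def by (rule someI_ex[OF component_weak_grad[OF W]])
  have \<phi>: "sq_int \<nu> (\<phi> n)" and Gn: "sq_int \<nu> (\<lambda>x. inner (G n x) (e n))" for n
    using weighted_W12_integration_by_parts(1,2)[OF G admissible_cos[of "e n" 0 0]] by auto
  define T where "T x = (\<Sum>n<N. inner (G n x) (e n) + \<phi> n x * \<beta> (e n) x)" for x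
  have i1: "integrable \<nu> (\<lambda>x. inner (G n x) (e n))" "integrable \<nu> (\<lambda>x. \<phi> n x * \<beta> (e n) x)" for n
    by (rule sq_int_integrable[OF fin_nu Gn]) (rule sq_int_product[OF \<phi> beta_sq_int])
  then have T: "integrable \<nu> T" unfolding T_def by (intro Bochner_Integration.integrable_sum Bochner_Integration.integrable_add)
  have "AE x in \<nu>. D x = T x"
  proof (rule L1_unique[OF _ T])
    show "integrable \<nu> D" using D by (intro sq_int_integrable[OF fin_nu]) (simp add: is_div_def)
    fix f :: "'a \<Rightarrow> real" assume f: "f \<in> FCb"
    have j1: "integrable \<nu> (\<lambda>x. f x * inner (G n x) (e n))" for n by (rule sq_int_product[OF FCb_sq_int[OF f] Gn])
    have j2: "integrable \<nu> (\<lambda>x. f x * (\<phi> n x * \<beta> (e n) x))" for n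
      using sq_int_product[OF \<phi> FCb_mult_sq_int[OF f beta_sq_int]] by (simp add: ac_simps)
    have j3: "integrable \<nu> (\<lambda>x. dH (e n) f x * \<phi> n x)" for n by (rule sq_int_product[OF FCb_sq_int[OF dH_FCb[OF f]] \<phi>])
    have "- (\<integral>x. f x * D x \<partial>\<nu>) = (\<integral>x. inner (H_grad \<iota> f x) (proj N (\<Phi> x)) \<partial>\<nu>)"
      using D f by (simp add: is_div_def)
    also have "\<dots> = (\<integral>x. (\<Sum>n<N. dH (e n) f x * \<phi> n x) \<partial>\<nu>)"
      by (simp add: proj_def inner_sum_right dH_def \<phi>_def mult.commute)
    also have "\<dots> = (\<Sum>n<N. \<integral>x. dH (e n) f x * \<phi> n x \<partial>\<nu>)"
      by (rule Bochner_Integration.integral_sum) (rule j3)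
    also have "\<dots> = (\<Sum>n<N. - (\<integral>x. f x * (inner (G n x) (e n) + \<phi> n x * \<beta> (e n) x) \<partial>\<nu>))"
    proof (intro sum.cong refl)
      fix n
      show "(\<integral>x. dH (e n) f x * \<phi> n x \<partial>\<nu>) = - (\<integral>x. f x * (inner (G n x) (e n) + \<phi> n x * \<beta> (e n) x) \<partial>\<nu>)"
        using weighted_W12_integration_by_parts(3)[OF G FCb_admissible[OF f], of n "e n"] j1[of n] j2[of n]
        by (simp add: distrib_left ac_simps)
    qed
    also have "\<dots> = - (\<integral>x. (\<Sum>n<N. f x * (inner (G n x) (e n) + \<phi> n x * \<beta> (e n) x)) \<partial>\<nu>)"
      using j1 j2 by (subst Bochner_Integration.integral_sum) (auto simp: sum_negf[symmetric] distrib_left intro!: sum.cong)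
    finally show "(\<integral>x. f x * D x \<partial>\<nu>) = (\<integral>x. f x * T x \<partial>\<nu>)" by (simp add: T_def sum_distrib_left)
  qed
  moreover have "AE x in \<nu>. \<forall>n. inner (weak_grad \<iota> \<mu> t (\<lambda>x. ln (w x)) x) (e n) = inner (grad_ln x) (e n)"
    unfolding AE_all_countable AE_nu using weak_grad_ln by blast
  ultimately show ?thesis
  proof eventually_elim
    case (elim x)
    then show ?case by (simp add: T_def G_def \<phi>_def[abs_def] \<beta>_def hat_def right_diff_distrib add_diff_eq)
  qed
qed

text \<open>For the series, the divergence minus its N-th partial sum is the divergence of the tail
  of the field; the estimate bounds it by the tail's Sobolev norm, which tends to 0.\<close>

theorem divergence_of_W1_field:
  assumes \<Phi>: "\<Phi> \<in> W1_vec \<iota> e \<nu> 2"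
  shows "\<exists>g. has_divergence \<iota> \<nu> \<Phi> g"
    and "divergence \<iota> \<nu> \<Phi> \<in> Lp_space \<nu> 2"
    and "f \<in> W1 \<iota> \<nu> 2 \<Longrightarrow>
      (\<integral>x. inner (weak_grad \<iota> \<nu> 2 f x) (\<Phi> x) \<partial>\<nu>) = - (\<integral>x. f x * divergence \<iota> \<nu> \<Phi> x \<partial>\<nu>)"
    and "Lp_tendsto \<nu> 2
        (\<lambda>N x. \<Sum>n<N. inner (weak_grad \<iota> \<nu> 2 (\<lambda>x. inner (\<Phi> x) (e n)) x) (e n)
            + inner (\<Phi> x) (e n) * inner (weak_grad \<iota> \<mu> t (\<lambda>x. ln (w x)) x) (e n)
            - inner (\<Phi> x) (e n) * cm_hat \<mu> (\<iota> (e n)) x)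
        (divergence \<iota> \<nu> \<Phi>)"
    and "Lp_norm \<nu> 2 (divergence \<iota> \<nu> \<Phi>) \<le> max (sqrt C) 1 * W1_vec_norm \<iota> e \<nu> 2 \<Phi>"
proof -
  define S where "S = weak_deriv \<iota> e \<nu> 2 \<Phi>"
  have "\<exists>S. has_weak_deriv \<iota> e \<nu> 2 \<Phi> S" using \<Phi> by (simp add: W1_vec_def)
  from someI_ex[OF this] have W: "has_weak_deriv \<iota> e \<nu> 2 \<Phi> S" by (simp add: S_def weak_deriv_def)
  note D = weak_derivD[OF W]
  obtain g where g: "is_div \<Phi> g"
    "(\<integral>x. (g x)\<^sup>2 \<partial>\<nu>) \<le> max C 1 * ((\<integral>x. (norm (\<Phi> x))\<^sup>2 \<partial>\<nu>) + (\<integral>x. (hs_norm e (S x))\<^sup>2 \<partial>\<nu>))"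
    by (rule weak_deriv_divergence[OF W])
  define d where "d = divergence \<iota> \<nu> \<Phi>"
  have d: "is_div \<Phi> d" "AE x in \<nu>. d x = g x"
    unfolding d_def by (rule divergence_is_div[OF D(1,2) g(1)])+
  have ds: "sq_int \<nu> d" using d by (simp add: is_div_def)
  show "\<exists>g. has_divergence \<iota> \<nu> \<Phi> g" using is_div_has_divergence[OF D(1,2) g(1)] by blast
  show "divergence \<iota> \<nu> \<Phi> \<in> Lp_space \<nu> 2" using ds by (simp add: sq_int_Lp_space d_def)
  show "(\<integral>x. inner (weak_grad \<iota> \<nu> 2 f x) (\<Phi> x) \<partial>\<nu>) = - (\<integral>x. f x * divergence \<iota> \<nu> \<Phi> x \<partial>\<nu>)" if "f \<in> W1 \<iota> \<nu> 2"
  proof -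
    have "\<exists>G. has_weak_grad \<iota> \<nu> 2 f G" using that by (simp add: W1_def)
    from someI_ex[OF this] have "has_weak_grad \<iota> \<nu> 2 f (weak_grad \<iota> \<nu> 2 f)" by (simp add: weak_grad_def)
    from is_div_W1[OF D(1,2) d(1) this] show ?thesis by (simp add: d_def)
  qed
  define A where "A = (\<integral>x. (norm (\<Phi> x))\<^sup>2 \<partial>\<nu>)"
  define B where "B = (\<integral>x. (hs_norm e (S x))\<^sup>2 \<partial>\<nu>)"
  have AB: "A \<ge> 0" "B \<ge> 0" by (simp_all add: A_def B_def)
  show "Lp_norm \<nu> 2 (divergence \<iota> \<nu> \<Phi>) \<le> max (sqrt C) 1 * W1_vec_norm \<iota> e \<nu> 2 \<Phi>"
  proof -
    have [measurable]: "d \<in> borel_measurable \<nu>" "g \<in> borel_measurable \<nu>" using ds g(1) by (auto simp: is_div_def sq_int_def)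
    have "(\<integral>x. (d x)\<^sup>2 \<partial>\<nu>) = (\<integral>x. (g x)\<^sup>2 \<partial>\<nu>)"
      using d(2) by (intro integral_cong_AE) (auto elim: eventually_mono)
    then have "(\<integral>x. (d x)\<^sup>2 \<partial>\<nu>) \<le> max C 1 * (A + B)" using g(2) by (simp add: A_def B_def)
    then have "sqrt (\<integral>x. (d x)\<^sup>2 \<partial>\<nu>) \<le> sqrt (max C 1 * (A + B))" by (rule real_sqrt_le_mono)
    \<comment> \<open>The square root is monotone and fixes 1, so it passes through the
      maximum.\<close>
    also have "\<dots> = max (sqrt C) 1 * sqrt (A + B)" by (simp add: real_sqrt_mult max_def)
    also have "\<dots> \<le> max (sqrt C) 1 * (sqrt A + sqrt B)"
      using AB by (intro mult_left_mono sqrt_add_le_add_sqrt) auto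
    finally show ?thesis
      by (simp add: Lp_norm_def W1_vec_norm_def Lp_HS_norm_def powr_half_sqrt A_def B_def d_def S_def)
  qed
  define T where "T N x = (\<Sum>n<N. inner (weak_grad \<iota> \<nu> 2 (\<lambda>x. inner (\<Phi> x) (e n)) x) (e n)
            + inner (\<Phi> x) (e n) * inner (weak_grad \<iota> \<mu> t (\<lambda>x. ln (w x)) x) (e n)
            - inner (\<Phi> x) (e n) * cm_hat \<mu> (\<iota> (e n)) x)" for N x
  define r where "r N = max C 1 * ((\<integral>x. (norm (\<Phi> x - proj N (\<Phi> x)))\<^sup>2 \<partial>\<nu>) + (\<integral>x. (hs_norm e ((id_blinfun - projL N) o\<^sub>L S x))\<^sup>2 \<partial>\<nu>))" for N
  have bound: "(\<integral>\<^sup>+x. ennreal ((T N x - d x)\<^sup>2) \<partial>\<nu>) \<le> ennreal (r N)" for N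
  proof -
    have Q: "norm (blinfun_apply (projL N) v) \<le> norm v" "norm (blinfun_apply (id_blinfun - projL N) v) \<le> norm v" for v
      by (auto simp: blinfun.diff_left norm_diff_proj_le norm_proj_le)
    note W1 = weak_deriv_contraction[OF W Q(1)] and W2 = weak_deriv_contraction[OF W Q(2)]
    obtain D1 where D1: "is_div (\<lambda>x. proj N (\<Phi> x)) D1"
      by (rule weak_deriv_divergence[OF W1]) simp
    obtain D2 where D2: "is_div (\<lambda>x. blinfun_apply (id_blinfun - projL N) (\<Phi> x)) D2"
      "(\<integral>x. (D2 x)\<^sup>2 \<partial>\<nu>) \<le> max C 1 * ((\<integral>x. (norm (blinfun_apply (id_blinfun - projL N) (\<Phi> x)))\<^sup>2 \<partial>\<nu>)
        + (\<integral>x. (hs_norm e ((id_blinfun - projL N) o\<^sub>L S x))\<^sup>2 \<partial>\<nu>))"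
      by (rule weak_deriv_divergence[OF W2])
    \<comment> \<open>The tail has two divergences, one by subtraction and one from the estimate.
      Uniqueness equates them, which transfers the bound on \<open>D2\<close> to the error of the
      partial sum.\<close>
    have "is_div (\<lambda>x. \<Phi> x - proj N (\<Phi> x)) (\<lambda>x. d x - D1 x)"
      using weak_derivD(1,2)[OF W1] by (intro is_div_diff d(1) D1 D(1,2)) simp_all
    then have eq: "AE x in \<nu>. d x - D1 x = D2 x"
      using D2(1) by (intro is_div_unique) (auto simp: blinfun.diff_left)
    have D2s: "sq_int \<nu> D2" using D2 by (simp add: is_div_def)
    have "(\<integral>\<^sup>+x. ennreal ((T N x - d x)\<^sup>2) \<partial>\<nu>) = (\<integral>\<^sup>+x. ennreal ((D2 x)\<^sup>2) \<partial>\<nu>)"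
    proof (rule nn_integral_cong_AE)
      show "AE x in \<nu>. ennreal ((T N x - d x)\<^sup>2) = ennreal ((D2 x)\<^sup>2)"
        using eq projection_divergence[OF W D1]
      proof eventually_elim
        case (elim x)
        then have "T N x - d x = - D2 x" by (simp add: T_def)
        then show ?case by simp
      qed
    qed
    also have "\<dots> = ennreal (\<integral>x. (D2 x)\<^sup>2 \<partial>\<nu>)"
      using D2s by (intro nn_integral_eq_integral) (auto simp: sq_int_def)
    also have "\<dots> \<le> ennreal (r N)"
      using D2(2) by (intro ennreal_leI) (simp add: r_def blinfun.diff_left)
    finally show ?thesis .
  qed
  have "(\<lambda>N. \<integral>x. (norm (\<Phi> x - proj N (\<Phi> x)))\<^sup>2 \<partial>\<nu>) \<longlonglongrightarrow> (\<integral>x. 0 \<partial>\<nu>)"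
  proof (rule integral_dominated_convergence[where w="\<lambda>x. (norm (\<Phi> x))\<^sup>2"])
    show "integrable \<nu> (\<lambda>x. (norm (\<Phi> x))\<^sup>2)" using D(2) by (simp add: sq_int_def)
    have "proj N \<in> borel_measurable borel" for N
      using linear_continuous_on[OF proj_bounded_linear] by (rule borel_measurable_continuous_onI)
    note [measurable] = this D(1)
    show "(\<lambda>x. (norm (\<Phi> x - proj N (\<Phi> x)))\<^sup>2) \<in> borel_measurable \<nu>" for N by measurable
    show "AE x in \<nu>. (\<lambda>N. (norm (\<Phi> x - proj N (\<Phi> x)))\<^sup>2) \<longlonglongrightarrow> 0"
    proof (intro AE_I2)
      fix x
      have "(\<lambda>N. (norm (\<Phi> x - proj N (\<Phi> x)))\<^sup>2) \<longlonglongrightarrow> (norm (\<Phi> x - \<Phi> x))\<^sup>2" by (intro tendsto_intros proj_tendsto)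
      then show "(\<lambda>N. (norm (\<Phi> x - proj N (\<Phi> x)))\<^sup>2) \<longlonglongrightarrow> 0" by simp
    qed
    show "AE x in \<nu>. norm ((norm (\<Phi> x - proj N (\<Phi> x)))\<^sup>2) \<le> (norm (\<Phi> x))\<^sup>2" for N
      by (intro AE_I2) (simp add: norm_diff_proj_le power_mono)
  qed simp
  \<comment> \<open>The tail of the derivative tends to 0 pointwise almost everywhere and stays
    below the norm of \<open>S\<close>, so dominated convergence applies as for the field
    itself.\<close>
  moreover have "(\<lambda>N. \<integral>x. (hs_norm e ((id_blinfun - projL N) o\<^sub>L S x))\<^sup>2 \<partial>\<nu>) \<longlonglongrightarrow> (\<integral>x. 0 \<partial>\<nu>)"
  proof (rule integral_dominated_convergence[where w="\<lambda>x. (hs_norm e (S x))\<^sup>2"])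
    have Q: "norm (blinfun_apply (id_blinfun - projL N) v) \<le> norm v" for N v
      by (simp add: blinfun.diff_left norm_diff_proj_le)
    show "integrable \<nu> (\<lambda>x. (hs_norm e (S x))\<^sup>2)" using D(5) by (simp add: sq_int_def)
    show "(\<lambda>x. (hs_norm e ((id_blinfun - projL N) o\<^sub>L S x))\<^sup>2) \<in> borel_measurable \<nu>" for N
      using weak_derivD(5)[OF weak_deriv_contraction[OF W Q], unfolded sq_int_def, THEN conjunct2]
      by (rule borel_measurable_integrable)
    show "AE x in \<nu>. (\<lambda>N. (hs_norm e ((id_blinfun - projL N) o\<^sub>L S x))\<^sup>2) \<longlonglongrightarrow> 0"
      using D(4) by eventually_elim (rule hs_norm_tail_tendsto)
    show "AE x in \<nu>. norm ((hs_norm e ((id_blinfun - projL N) o\<^sub>L S x))\<^sup>2) \<le> (hs_norm e (S x))\<^sup>2" for N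
      using D(4)
    proof eventually_elim
      case (elim x)
      then show ?case
        using contraction_hilbert_schmidt[OF elim Q] hs_norm_nonneg by (auto intro!: power_mono)
    qed
  qed simp
  ultimately have "r \<longlonglongrightarrow> max C 1 * ((\<integral>x. 0 \<partial>\<nu>) + (\<integral>x. 0 \<partial>\<nu>))"
    unfolding r_def by (intro tendsto_mult_left tendsto_add)
  then have "(\<lambda>N. ennreal (r N)) \<longlonglongrightarrow> ennreal 0" by (intro tendsto_ennrealI) simp
  then have r: "(\<lambda>N. ennreal (r N)) \<longlonglongrightarrow> 0" by simp
  have "(\<lambda>N. \<integral>\<^sup>+x. ennreal ((T N x - d x)\<^sup>2) \<partial>\<nu>) \<longlonglongrightarrow> 0"
    by (rule tendsto_sandwich[OF always_eventually always_eventually tendsto_const r]) (auto simp: bound)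
  then have "Lp_tendsto \<nu> 2 T d" by (simp add: Lp_tendsto_def)
  then show "Lp_tendsto \<nu> 2
        (\<lambda>N x. \<Sum>n<N. inner (weak_grad \<iota> \<nu> 2 (\<lambda>x. inner (\<Phi> x) (e n)) x) (e n)
            + inner (\<Phi> x) (e n) * inner (weak_grad \<iota> \<mu> t (\<lambda>x. ln (w x)) x) (e n)
            - inner (\<Phi> x) (e n) * cm_hat \<mu> (\<iota> (e n)) x)
        (divergence \<iota> \<nu> \<Phi>)"
    unfolding T_def[abs_def] d_def .
qed

end

theorem proposition4p3:
  fixes \<mu> \<nu> :: "'a::{banach,second_countable_topology} measure"
    and \<iota> :: "'h::{real_inner,banach,second_countable_topology} \<Rightarrow> 'a"
    and e :: "nat \<Rightarrow> 'h"
    and w :: "'a \<Rightarrow> real"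
    and s t C :: real
  assumes "nondegenerate_centered_gaussian \<mu>"
    and "cameron_martin \<mu> \<iota>"
    and "orthonormal_basis e"
    and "s > 1"
    and "AE x in \<mu>. w x > 0"
    and "w \<in> W1 \<iota> \<mu> s"
    and "precise \<mu> 1 s w"
    and "t \<ge> 2 * (s / (s - 1))"
    and "(\<lambda>x. ln (w x)) \<in> W2 \<iota> e \<mu> t"
    and "\<nu> = density \<mu> (\<lambda>x. ennreal (w x))"
    and "C \<ge> 0"
    and "\<And>\<xi> :: nat \<Rightarrow> real. summable (\<lambda>i. (\<xi> i)\<^sup>2) \<Longrightarrow>
      AE x in \<mu>. (\<Sum>i. \<Sum>j. ((if i = j then 1 else 0)
          - inner (blinfun_apply (weak_hess \<iota> e \<mu> t (\<lambda>x. ln (w x)) x) (e j)) (e i)) * \<xi> i * \<xi> j)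
        \<le> C * (\<Sum>i. (\<xi> i)\<^sup>2)"
  shows "\<forall>\<Phi> \<in> W1_vec \<iota> e \<nu> 2.
    (\<exists>g. has_divergence \<iota> \<nu> \<Phi> g) \<and>
    divergence \<iota> \<nu> \<Phi> \<in> Lp_space \<nu> 2 \<and>
    (\<forall>f \<in> W1 \<iota> \<nu> 2.
      (\<integral>x. inner (weak_grad \<iota> \<nu> 2 f x) (\<Phi> x) \<partial>\<nu>) = - (\<integral>x. f x * divergence \<iota> \<nu> \<Phi> x \<partial>\<nu>)) \<and>
    (let \<phi> = (\<lambda>n x. inner (\<Phi> x) (e n)) in
      Lp_tendsto \<nu> 2
        (\<lambda>N x. \<Sum>n<N. inner (weak_grad \<iota> \<nu> 2 (\<phi> n) x) (e n)
            + \<phi> n x * inner (weak_grad \<iota> \<mu> t (\<lambda>x. ln (w x)) x) (e n)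
            - \<phi> n x * cm_hat \<mu> (\<iota> (e n)) x)
        (divergence \<iota> \<nu> \<Phi>)) \<and>
    Lp_norm \<nu> 2 (divergence \<iota> \<nu> \<Phi>) \<le> max (sqrt C) 1 * W1_vec_norm \<iota> e \<nu> 2 \<Phi>"
proof -
  interpret L: log_concave_space \<mu> \<iota> e w s t C
    by unfold_locales (use assms in auto)
  have \<nu>: "\<nu> = L.\<nu>" by (simp add: assms(10) L.\<nu>_def)
  show ?thesis
    unfolding Let_def \<nu>
    by (intro ballI conjI L.divergence_of_W1_field)
qed

end
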